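(* For a non-degenerate uniform grid model, define for $\theta\in[0,\pi]$ \[ V(\theta)=\int_{\mathbb{R}}\operatorname{Var}\bigl(L\,|\ell(\theta,t)\cap S_1|\bigr)\,dt . \] Then $\lim_{n\to\infty}n\,\mathbb{E}|\operatorname{proj}_\theta S_n|=\frac{2}{V(\theta)}$ uniformly in $\theta$, and therefore \[ \lim_{n\to\infty}n\,\mathbb{E}[\operatorname{Fav}(S_n)]=\int_0^\pi\frac{2}{V(\theta)}\,d\theta . \] Consequently, almost surely $\lim_{n\to\infty}n\operatorname{Fav}(S_n)=Z\int_0^\pi\frac{2}{V(\theta)}\,d\theta$.
   Context: Fix an integer $L\ge2$; $\mathcal{D}_n$ is the set of closed squares obtained by dividing $[0,1]^2$ into an $L^n\times L^n$ grid. A grid model is a probability distribution $\mathfrak X$ on finite sets of distinct squares of $\mathcal{D}_1$ (random bounded number $\mathbf L$, $\mathbb{E}[\mathbf L]=L$). Random sets: $\mathcal{S}_0=\{[0,1]^2\}$; given $\mathcal{S}_n$, for each $R\in\mathcal{S}_n$ independently (and independently of $\mathcal{S}_n$) sample from $\mathfrak X$ and map the chosen squares into $R$ via the natural homothety; $\mathcal{S}_{n+1}$ is the resulting collection, $S_n=\bigcup\mathcal{S}_n$. $Z$ is the almost sure limit of the martingale $Z_n=L^{-n}\#\mathcal{S}_n$. Uniform: $\mathbb{P}[Q\in\mathcal{S}_1]=1/L$ for each $Q\in\mathcal{D}_1$. Non-degenerate: it is not the case that a.s. $\mathcal{S}_1$ contains exactly one square per column, and not the case that a.s. it contains exactly one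 square per row. $\operatorname{proj}_\theta(x)=\langle x,(-\sin\theta,\cos\theta)\rangle$, $\ell(\theta,t)=\operatorname{proj}_\theta^{-1}(t)$, $|\cdot|$ one-dimensional Lebesgue measure, $\operatorname{Fav}(A)=\int_0^\pi|\operatorname{proj}_\theta A|\,d\theta$. *)

theory Defs
  imports "HOL-Probability.Probability"
begin

text \<open>Squares of the level-n grid D_n are indexed by (i,j) with i,j < L^n;
  i is the column (x-direction) index, j the row (y-direction) index.\<close>

definition grid_square :: "nat \<Rightarrow> nat \<Rightarrow> nat \<times> nat \<Rightarrow> (real \<times> real) set" where
  "grid_square L n ij =
     {real (fst ij) / real L ^ n .. (real (fst ij) + 1) / real L ^ n} \<times>
     {real (snd ij) / real L ^ n .. (real (snd ij) + 1) / real L ^ n}"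

definition grid_model :: "nat \<Rightarrow> (nat \<times> nat) set pmf \<Rightarrow> bool" where
  "grid_model L X \<longleftrightarrow> (\<forall>F\<in>set_pmf X. F \<subseteq> {..<L} \<times> {..<L})"

definition uniform_grid_model :: "nat \<Rightarrow> (nat \<times> nat) set pmf \<Rightarrow> bool" where
  "uniform_grid_model L X \<longleftrightarrow>
     (\<forall>a<L. \<forall>b<L. measure_pmf.prob X {F. (a, b) \<in> F} = 1 / real L)"

definition non_degenerate :: "nat \<Rightarrow> (nat \<times> nat) set pmf \<Rightarrow> bool" where
  "non_degenerate L X \<longleftrightarrow>
     \<not> (\<forall>F\<in>set_pmf X. \<forall>a<L. card {b. (a, b) \<in> F} = 1) \<and>
     \<not> (\<forall>F\<in>set_pmf X. \<forall>b<L. card {a. (a, b) \<in> F} = 1)"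

text \<open>The randomness: for every potential square (n,i,j) of every level an independent
  sample from the grid model; only those of squares in S_n are used.\<close>
type_synonym omega = "nat \<times> nat \<times> nat \<Rightarrow> (nat \<times> nat) set"

definition sample_space :: "(nat \<times> nat) set pmf \<Rightarrow> omega measure" where
  "sample_space X = PiM UNIV (\<lambda>_. measure_pmf X)"

fun Sq :: "nat \<Rightarrow> omega \<Rightarrow> nat \<Rightarrow> (nat \<times> nat) set" where
  "Sq L \<omega> 0 = {(0, 0)}"
| "Sq L \<omega> (Suc n) =
     (\<Union>ij\<in>Sq L \<omega> n. (\<lambda>ab. (L * fst ij + fst ab, L * snd ij + snd ab)) ` \<omega> (n, fst ij, snd ij))"

definition Sset :: "nat \<Rightarrow> omega \<Rightarrow> nat \<Rightarrow> (real \<times> real) set" where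
  "Sset L \<omega> n = \<Union> (grid_square L n ` Sq L \<omega> n)"

definition Zn :: "nat \<Rightarrow> omega \<Rightarrow> nat \<Rightarrow> real" where
  "Zn L \<omega> n = real (card (Sq L \<omega> n)) / real L ^ n"

definition proj :: "real \<Rightarrow> real \<times> real \<Rightarrow> real" where
  "proj \<theta> x = - sin \<theta> * fst x + cos \<theta> * snd x"

text \<open>One-dimensional Lebesgue measure of l(theta,t) \<inter> A, using the arclength
  parametrisation s \<mapsto> t(-sin,cos) + s(cos,sin) of the line proj_theta^{-1}(t).\<close>
definition line_len :: "real \<Rightarrow> real \<Rightarrow> (real \<times> real) set \<Rightarrow> real" where
  "line_len \<theta> t A =
     measure lebesgue {s. (- t * sin \<theta> + s * cos \<theta>, t * cos \<theta> + s * sin \<theta>) \<in> A}"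

definition Fav :: "(real \<times> real) set \<Rightarrow> real" where
  "Fav A = integral {0..pi} (\<lambda>\<theta>. measure lebesgue (proj \<theta> ` A))"

definition Vfun :: "nat \<Rightarrow> (nat \<times> nat) set pmf \<Rightarrow> real \<Rightarrow> real" where
  "Vfun L X \<theta> = integral UNIV (\<lambda>t.
     measure_pmf.variance X (\<lambda>F. real L * line_len \<theta> t (\<Union> (grid_square L 1 ` F))))"

end

theory Submission
  imports Defs "HOL-Real_Asymp.Real_Asymp"
begin

text \<open>Fix a direction \<open>\<theta>\<close>. The probability \<open>p n t\<close> that the line \<open>\<ell>(\<theta>,t)\<close> meets
  \<open>S\<^sub>n\<close> satisfies a recursion of critical multitype branching type: a line meets \<open>S\<^sub>n\<^sub>+\<^sub>1\<close> iff
  it meets one of the independent copies of \<open>S\<^sub>n\<close> inside the squares of \<open>S\<^sub>1\<close>. By uniformity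
  the chord length \<open>h \<theta> t\<close> of the unit square is an eigenfunction of the linearised recursion, and
  Lebesgue measure is the left eigenvector. Writing \<open>p n = h u\<^sub>n\<close> and integrating against the
  probability measure \<open>h dt\<close>, the linear part preserves \<open>a\<^sub>n = \<integral> u\<^sub>n h dt\<close> and the quadratic part of
  Bonferroni's expansion gives \<open>a\<^sub>n\<^sub>+\<^sub>1 = a\<^sub>n - (V/2) a\<^sub>n\<^sup>2 + \<dots>\<close>, provided that \<open>u\<^sub>n\<close> is nearly
  constant. The latter follows from the second moments \<open>W\<^sub>n = \<integral> u\<^sub>n\<^sup>2 h dt\<close>: they decrease, the
  decrement controls the spread of \<open>u\<^sub>n\<close> over the children of a line, and the averages of the
  variance density over many generations are bounded below by almost \<open>V\<close>, so that
  \<open>W\<^sub>n = O(n\<^sup>-\<^sup>2)\<close>. Hence \<open>1/a\<^sub>n\<close> grows like \<open>V n / 2\<close>. All constants are uniform in \<open>\<theta>\<close>, since \<open>V\<close>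
  is bounded below in the non-degenerate case. The initial indicator function is not of the form
  \<open>h u\<^sub>0\<close> with bounded \<open>u\<^sub>0\<close>; truncating at \<open>K = n\<^sup>2\<close> only costs a logarithm.

  For the almost sure statement, at generation \<open>k\<close> the set \<open>S\<^sub>k\<^sub>+\<^sub>n\<close> is a union of independent scaled
  copies of \<open>S\<^sub>n\<close>, whose Favard lengths add up to \<open>Z\<^sub>k E Fav(S\<^sub>n)\<close> up to an error of order
  \<open>L\<^bsup>-k/2\<^esup>\<close> in mean; the loss by overlaps has mean \<open>E Fav(S\<^sub>n) - E Fav(S\<^sub>n\<^sub>+\<^sub>k) = O(k/n\<^sup>2)\<close>.
  With \<open>k = m\<close>, \<open>k + n = m\<^sup>4\<close> these errors are summable after multiplication by \<open>m\<^sup>4\<close>, and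
  monotonicity of \<open>Fav(S\<^sub>n)\<close> fills the gaps between fourth powers.\<close>

section \<open>Bonferroni inequalities\<close>

text \<open>The two bounds on \<open>1/a\<^sub>n\<close> are of different nature. Bounding it from
  below requires a genuine drop of \<open>a\<^sub>n\<close>, but the variance density can vanish on
  whole intervals of lines: near a corner of the square an oblique line meets a single cell. The
  density is therefore transported by the adjoint \<open>Ms\<close> over several generations, after
  which bounded variation makes it almost constant; the price is paid in decrements of
  \<open>W\<^sub>n\<close>. Bounding it from above goes through
  \<open>\<integral> h / u\<^sub>n dt\<close>: convexity shows that the linear part does not
  increase this integral, and the variance density enters it linearly. In both cases the errors look
  like \<open>n\<^sup>2 (W\<^sub>n - W\<^sub>n\<^sub>+\<^sub>k)\<close> and nearly telescope because
  \<open>W\<^sub>n = O(n\<^sup>-\<^sup>2)\<close>.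

  Bonferroni's quadratic term involves only pairs of distinct cells, while \<open>V\<close> is built
  from variances. The difference consists of a diagonal term and the square of the mean; by
  self-similarity the two cancel after integration over t.\<close>

lemma one_minus_prod_le_sum:
  fixes p :: "'a \<Rightarrow> real"
  assumes "finite F" "\<And>i. i \<in> F \<Longrightarrow> 0 \<le> p i \<and> p i \<le> 1"
  shows "1 - (\<Prod>i\<in>F. 1 - p i) \<le> sum p F"
  using assms
proof (induction F rule: finite_induct)
  case (insert a F)
  let ?P = "\<Prod>i\<in>F. 1 - p i"
  have "?P \<le> 1" using insert by (intro prod_le_1) auto
  then have "p a * ?P \<le> p a * 1" using insert by (intro mult_left_mono) auto
  with insert show ?case by (auto simp: algebra_simps)
qed auto

text \<open>\<open>((sum p F)\<^sup>2 - (\<Sum>i\<in>F. (p i)\<^sup>2)) / 2\<close> is the sum of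
  \<open>p i * p j\<close> over unordered pairs, written so that its expectation becomes a double
  sum over all cells. The induction step only needs the union bound for the smaller set.\<close>

lemma bonferroni_lower:
  fixes p :: "'a \<Rightarrow> real"
  assumes "finite F" "\<And>i. i \<in> F \<Longrightarrow> 0 \<le> p i \<and> p i \<le> 1"
  shows "sum p F - ((sum p F)\<^sup>2 - (\<Sum>i\<in>F. (p i)\<^sup>2)) / 2 \<le> 1 - (\<Prod>i\<in>F. 1 - p i)"
  using assms
proof (induction F rule: finite_induct)
  case (insert a F)
  let ?P = "\<Prod>i\<in>F. 1 - p i"
  have "1 - ?P \<le> sum p F" using insert by (intro one_minus_prod_le_sum) auto
  then have 1: "p a * (1 - ?P) \<le> p a * sum p F" using insert by (intro mult_left_mono) auto
  have e1: "1 - (\<Prod>i\<in>insert a F. 1 - p i) = (1 - ?P) + p a - p a * (1 - ?P)"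
    using insert.hyps by (simp add: algebra_simps)
  have e2: "sum p (insert a F) - ((sum p (insert a F))\<^sup>2 - (\<Sum>i\<in>insert a F. (p i)\<^sup>2)) / 2
     = sum p F - ((sum p F)\<^sup>2 - (\<Sum>i\<in>F. (p i)\<^sup>2)) / 2 + p a - p a * sum p F"
    using insert.hyps by (simp add: algebra_simps power2_eq_square add_divide_distrib diff_divide_distrib)
  show ?case unfolding e1 e2 using insert 1 by simp
qed auto

text \<open>The third term of inclusion-exclusion is at most a sixth of the cube. The generous
  factor 1 leaves room for an induction that rests on the preceding lower bound alone.\<close>

lemma bonferroni_upper_cubic:
  fixes p :: "'a \<Rightarrow> real"
  assumes "finite F" "\<And>i. i \<in> F \<Longrightarrow> 0 \<le> p i \<and> p i \<le> 1"
  shows "1 - (\<Prod>i\<in>F. 1 - p i) \<le> sum p F - ((sum p F)\<^sup>2 - (\<Sum>i\<in>F. (p i)\<^sup>2)) / 2 + (sum p F)^3"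
  using assms
proof (induction F rule: finite_induct)
  case (insert a F)
  let ?P = "\<Prod>i\<in>F. 1 - p i" and ?S = "sum p F" and ?T = "\<Sum>i\<in>F. (p i)\<^sup>2"
  have a: "0 \<le> p a" and S: "0 \<le> ?S" using insert by (auto intro: sum_nonneg)
  have T: "0 \<le> ?T" by (auto intro: sum_nonneg)
  have "?S - (?S\<^sup>2 - ?T)/2 \<le> 1 - ?P" using insert by (intro bonferroni_lower) auto
  then have 1: "p a * (?S - (?S\<^sup>2 - ?T)/2) \<le> p a * (1 - ?P)" using a by (intro mult_left_mono)
  have "p a * ?T \<ge> 0" using a T by simp
  then have 2: "p a * (?S\<^sup>2 - ?T)/2 \<le> p a * ?S\<^sup>2" using a by (simp add: algebra_simps add_increasing)
  have 3: "?S^3 + p a * ?S\<^sup>2 \<le> (p a + ?S)^3"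
    using a S by (simp add: power3_eq_cube power2_eq_square algebra_simps add_nonneg_nonneg)
  have ih: "1 - ?P \<le> ?S - (?S\<^sup>2 - ?T) / 2 + ?S^3" using insert by auto
  have e1: "1 - (\<Prod>i\<in>insert a F. 1 - p i) = (1 - ?P) + p a - p a * (1 - ?P)"
    using insert.hyps by (simp add: algebra_simps)
  have e2: "sum p (insert a F) - ((sum p (insert a F))\<^sup>2 - (\<Sum>i\<in>insert a F. (p i)\<^sup>2)) / 2
     = ?S - (?S\<^sup>2 - ?T)/2 + p a - p a * ?S"
    using insert.hyps by (simp add: algebra_simps power2_eq_square add_divide_distrib diff_divide_distrib)
  have e3: "p a * (?S - (?S\<^sup>2 - ?T)/2) = p a * ?S - p a * (?S\<^sup>2 - ?T)/2"
    by (simp add: algebra_simps add_divide_distrib diff_divide_distrib)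
  show ?case unfolding e1 e2 using 1 2 3 ih e3 insert.hyps by simp
qed auto

text \<open>There is no error term, at the price of a smaller quadratic coefficient: every
  \<open>p i\<close> lies below the probability of the union, hence so does
  \<open>sum p F / N\<close>. This serves where the \<open>p i\<close> are not small.\<close>

lemma bonferroni_upper_crude:
  fixes p :: "'a \<Rightarrow> real"
  assumes "finite F" "\<And>i. i \<in> F \<Longrightarrow> 0 \<le> p i \<and> p i \<le> 1" "real (card F) \<le> N" "0 < N"
  shows "1 - (\<Prod>i\<in>F. 1 - p i) \<le> sum p F - ((sum p F)\<^sup>2 - (\<Sum>i\<in>F. (p i)\<^sup>2)) / (2 * N)"
  using assms(1-3)
proof (induction F rule: finite_induct)
  case (insert a F)
  let ?P = "\<Prod>i\<in>F. 1 - p i" and ?S = "sum p F" and ?T = "\<Sum>i\<in>F. (p i)\<^sup>2"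
  have a: "0 \<le> p a" using insert by auto
  have "p i \<le> 1 - ?P" if "i \<in> F" for i
  proof -
    have "(\<Prod>j\<in>F. 1 - p j) = (1 - p i) * (\<Prod>j\<in>F - {i}. 1 - p j)"
      using that insert by (simp add: prod.remove)
    also have "\<dots> \<le> (1 - p i) * 1"
      using that insert by (intro mult_left_mono prod_le_1) auto
    finally show ?thesis by simp
  qed
  then have "?S \<le> real (card F) * (1 - ?P)" by (rule sum_bounded_above)
  also have "\<dots> \<le> N * (1 - ?P)"
  proof (rule mult_right_mono)
    have "?P \<le> 1" using insert by (intro prod_le_1) auto
    then show "0 \<le> 1 - ?P" by simp
  qed (use insert in auto)
  finally have "?S / N \<le> 1 - ?P" using \<open>0 < N\<close> by (simp add: divide_le_eq mult.commute)
  then have 1: "p a * (?S / N) \<le> p a * (1 - ?P)" using a by (intro mult_left_mono)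
  have ih: "1 - ?P \<le> ?S - (?S\<^sup>2 - ?T) / (2 * N)" using insert by auto
  have e1: "1 - (\<Prod>i\<in>insert a F. 1 - p i) = (1 - ?P) + p a - p a * (1 - ?P)"
    using insert.hyps by (simp add: algebra_simps)
  have e2: "sum p (insert a F) - ((sum p (insert a F))\<^sup>2 - (\<Sum>i\<in>insert a F. (p i)\<^sup>2)) / (2*N)
     = ?S - (?S\<^sup>2 - ?T)/(2*N) + p a - p a * (?S / N)"
    using insert.hyps \<open>0 < N\<close> by (simp add: field_simps power2_eq_square)
  show ?case unfolding e1 e2 using 1 ih by simp
qed auto

lemma prod_one_minus_antimono:
  fixes p :: "'a \<Rightarrow> real"
  assumes "\<And>i. i \<in> F \<Longrightarrow> p i \<le> r i \<and> r i \<le> 1"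
  shows "(\<Prod>i\<in>F. 1 - r i) \<le> (\<Prod>i\<in>F. 1 - p i)"
  by (rule prod_mono) (use assms in force)

text \<open>The bound is one-sided, so that under iteration only the excess of the first argument
  over the second has to be followed.\<close>

lemma prod_one_minus_diff:
  fixes p r :: "'a \<Rightarrow> real"
  assumes "finite F" "\<And>i. i \<in> F \<Longrightarrow> 0 \<le> p i \<and> p i \<le> 1 \<and> 0 \<le> r i \<and> r i \<le> 1"
  shows "(\<Prod>i\<in>F. 1 - r i) - (\<Prod>i\<in>F. 1 - p i) \<le> (\<Sum>i\<in>F. max 0 (p i - r i))"
  using assms
proof (induction F rule: finite_induct)
  case (insert a F)
  let ?R = "\<Prod>i\<in>F. 1 - r i" and ?P = "\<Prod>i\<in>F. 1 - p i"
  let ?s = "\<Sum>i\<in>F. max 0 (p i - r i)"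
  have R: "0 \<le> ?R" "?R \<le> 1" using insert by (auto intro!: prod_nonneg prod_le_1)
  have "(1 - r a) * ?R - (1 - p a) * ?P = (p a - r a) * ?R + (1 - p a) * (?R - ?P)"
    by (simp add: algebra_simps)
  also have "(p a - r a) * ?R \<le> max 0 (p a - r a) * 1"
    using R by (intro mult_mono) auto
  also have "(1 - p a) * (?R - ?P) \<le> (1 - p a) * ?s"
    using insert by (intro mult_left_mono) auto
  also have "(1 - p a) * ?s \<le> 1 * ?s"
    using insert by (intro mult_right_mono sum_nonneg) auto
  finally show ?case using insert.hyps by simp
qed auto

section \<open>Uniform grid models\<close>

definition cells :: "nat \<Rightarrow> (nat \<times> nat) set" where
  "cells L = {..<L} \<times> {..<L}"

lemma finite_cells[simp]: "finite (cells L)" and card_cells[simp]: "card (cells L) = L * L"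
  by (auto simp: cells_def)

text \<open>The zero diagonal lets double sums run over all of \<open>cells L\<close> and still
  count only pairs of distinct cells.\<close>

definition pair_prob :: "(nat \<times> nat) set pmf \<Rightarrow> nat \<times> nat \<Rightarrow> nat \<times> nat \<Rightarrow> real" where
  "pair_prob X Q Q' = (if Q = Q' then 0 else measure_pmf.prob X {F. Q \<in> F \<and> Q' \<in> F})"

text \<open>The probability that some chosen cell succeeds if, given the choice, cell
  \<open>Q\<close> succeeds independently with probability \<open>p Q\<close>.\<close>

definition hit_prob :: "(nat \<times> nat) set pmf \<Rightarrow> (nat \<times> nat \<Rightarrow> real) \<Rightarrow> real" where
  "hit_prob X p = 1 - measure_pmf.expectation X (\<lambda>F. \<Prod>Q\<in>F. 1 - p Q)"

definition memb :: "'a set \<Rightarrow> 'a \<Rightarrow> real" where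
  "memb F Q = (if Q \<in> F then 1 else 0)"

locale uniform_grid =
  fixes L :: nat and X :: "(nat \<times> nat) set pmf"
  assumes L2: "2 \<le> L" and gm: "grid_model L X" and un: "uniform_grid_model L X"
begin

abbreviation "G \<equiv> cells L"
abbreviation "EE \<equiv> measure_pmf.expectation X"

lemma L_pos[simp]: "0 < L" "0 < real L" "L \<noteq> 0" using L2 by auto

lemma support_sub: "F \<in> set_pmf X \<Longrightarrow> F \<subseteq> G"
  using gm by (auto simp: grid_model_def cells_def)

lemma finite_support[simp]: "finite (set_pmf X)"
  by (rule finite_subset[of _ "Pow G"]) (use support_sub in auto)

lemma finite_supp_elem: "F \<in> set_pmf X \<Longrightarrow> finite F"
  using support_sub finite_subset by fastforce

lemma integrable_X[simp]: "integrable (measure_pmf X) (f :: _ \<Rightarrow> real)"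
  by (rule integrable_measure_pmf_finite) simp

lemma EE_mono: "(\<And>F. F \<in> set_pmf X \<Longrightarrow> f F \<le> g F) \<Longrightarrow> EE f \<le> EE (g :: _ \<Rightarrow> real)"
  by (rule integral_mono_AE) (auto simp: AE_measure_pmf_iff)

lemma EE_cong: "(\<And>F. F \<in> set_pmf X \<Longrightarrow> f F = g F) \<Longrightarrow> EE f = EE (g :: _ \<Rightarrow> real)"
  by (rule integral_cong_AE) (auto simp: AE_measure_pmf_iff)

lemma EE_ind: "Q \<in> G \<Longrightarrow> EE (\<lambda>F. memb F Q) = 1 / real L"
proof -
  assume "Q \<in> G"
  have "EE (\<lambda>F. memb F Q) = EE (indicator {F. Q \<in> F})"
    by (rule EE_cong) (auto simp: indicator_def memb_def)
  also have "\<dots> = 1 / real L"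
    using un \<open>Q \<in> G\<close> by (cases Q) (auto simp: uniform_grid_model_def cells_def)
  finally show ?thesis .
qed

lemma sum_F_eq: "F \<in> set_pmf X \<Longrightarrow> sum p F = (\<Sum>Q\<in>G. memb F Q * (p Q :: real))"
  by (rule sum.mono_neutral_cong_left) (use support_sub in \<open>auto simp: memb_def\<close>)

lemma EE_sum: "EE (\<lambda>F. sum p F) = sum p G / real L"
proof -
  have "EE (\<lambda>F. sum p F) = EE (\<lambda>F. \<Sum>Q\<in>G. memb F Q * p Q)"
    by (rule EE_cong) (rule sum_F_eq)
  also have "\<dots> = (\<Sum>Q\<in>G. EE (\<lambda>F. memb F Q) * p Q)" by (simp add: Bochner_Integration.integral_sum)
  also have "\<dots> = sum p G / real L" by (simp add: EE_ind sum_divide_distrib)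
  finally show ?thesis .
qed

lemma pair_prob_nonneg: "0 \<le> pair_prob X Q Q'" by (simp add: pair_prob_def)

lemma pair_prob_le: "Q \<in> G \<Longrightarrow> pair_prob X Q Q' \<le> 1 / real L"
proof -
  assume "Q \<in> G"
  have "measure_pmf.prob X {F. Q \<in> F \<and> Q' \<in> F} \<le> measure_pmf.prob X {F. Q \<in> F}"
    by (intro measure_pmf.finite_measure_mono) auto
  also have "\<dots> = 1 / real L"
    using un \<open>Q \<in> G\<close> by (cases Q) (auto simp: uniform_grid_model_def cells_def)
  finally show ?thesis by (simp add: pair_prob_def)
qed

lemma pair_prob_sym: "pair_prob X Q Q' = pair_prob X Q' Q"
  by (auto simp: pair_prob_def conj_commute)

lemma EE_ind2: "Q \<noteq> Q' \<Longrightarrow> EE (\<lambda>F. memb F Q * memb F Q') = pair_prob X Q Q'"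
proof -
  assume "Q \<noteq> Q'"
  have "EE (\<lambda>F. memb F Q * memb F Q') = EE (indicator {F. Q \<in> F \<and> Q' \<in> F})"
    by (rule EE_cong) (auto simp: indicator_def memb_def)
  then show ?thesis using \<open>Q \<noteq> Q'\<close> by (simp add: pair_prob_def)
qed

lemma EE_pair:
  "EE (\<lambda>F. (sum p F)\<^sup>2 - (\<Sum>Q\<in>F. (p Q)\<^sup>2)) = (\<Sum>Q\<in>G. \<Sum>Q'\<in>G. pair_prob X Q Q' * p Q * p Q')"
proof -
  have "EE (\<lambda>F. (sum p F)\<^sup>2 - (\<Sum>Q\<in>F. (p Q)\<^sup>2))
     = EE (\<lambda>F. \<Sum>Q\<in>G. \<Sum>Q'\<in>G. (if Q = Q' then 0 else memb F Q * memb F Q') * p Q * p Q')"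
  proof (rule EE_cong)
    fix F assume F: "F \<in> set_pmf X"
    let ?o = "\<lambda>Q. memb F Q"
    have "(\<Sum>Q\<in>G. \<Sum>Q'\<in>G. (if Q = Q' then 0 else ?o Q * ?o Q') * p Q * p Q')
       = (\<Sum>Q\<in>G. \<Sum>Q'\<in>G. (?o Q * p Q) * (?o Q' * p Q') - (if Q = Q' then ?o Q * (p Q)\<^sup>2 else 0))"
      by (intro sum.cong) (auto simp: power2_eq_square memb_def)
    also have "\<dots> = (\<Sum>Q\<in>G. ?o Q * p Q)\<^sup>2 - (\<Sum>Q\<in>G. ?o Q * (p Q)\<^sup>2)"
      by (simp add: sum_subtractf sum_product power2_eq_square sum.delta)
    finally show "(sum p F)\<^sup>2 - (\<Sum>Q\<in>F. (p Q)\<^sup>2)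
       = (\<Sum>Q\<in>G. \<Sum>Q'\<in>G. (if Q = Q' then 0 else ?o Q * ?o Q') * p Q * p Q')"
      using F by (simp add: sum_F_eq)
  qed
  also have "\<dots> = (\<Sum>Q\<in>G. \<Sum>Q'\<in>G. EE (\<lambda>F. (if Q = Q' then 0 else memb F Q * memb F Q') * p Q * p Q'))"
    by (simp add: Bochner_Integration.integral_sum)
  also have "\<dots> = (\<Sum>Q\<in>G. \<Sum>Q'\<in>G. pair_prob X Q Q' * p Q * p Q')"
  proof (intro sum.cong refl)
    fix Q Q' assume "Q \<in> G" "Q' \<in> G"
    show "EE (\<lambda>F. (if Q = Q' then 0 else memb F Q * memb F Q') * p Q * p Q') = pair_prob X Q Q' * p Q * p Q'"
      by (cases "Q = Q'") (simp_all only: EE_ind2 integral_mult_left_zero if_True if_False pair_prob_def simp_thms, simp_all)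
  qed
  finally show ?thesis .
qed

section \<open>Bonferroni expansions of the hitting probability\<close>

lemma hit_prob_alt: "hit_prob X p = EE (\<lambda>F. 1 - (\<Prod>Q\<in>F. 1 - p Q))"
  by (simp add: hit_prob_def)

context
  fixes p :: "nat \<times> nat \<Rightarrow> real"
  assumes p: "\<And>Q. Q \<in> G \<Longrightarrow> 0 \<le> p Q \<and> p Q \<le> 1"
begin

lemma p_F: "F \<in> set_pmf X \<Longrightarrow> Q \<in> F \<Longrightarrow> 0 \<le> p Q \<and> p Q \<le> 1"
  using p support_sub by blast

lemma hit_prob_nonneg: "0 \<le> hit_prob X p" and hit_prob_le1: "hit_prob X p \<le> 1"
proof -
  have "0 \<le> (\<Prod>Q\<in>F. 1 - p Q) \<and> (\<Prod>Q\<in>F. 1 - p Q) \<le> 1" if "F \<in> set_pmf X" for F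
    using p_F[OF that] by (auto intro!: prod_nonneg prod_le_1)
  then have "EE (\<lambda>_. 0) \<le> EE (\<lambda>F. \<Prod>Q\<in>F. 1 - p Q)" "EE (\<lambda>F. \<Prod>Q\<in>F. 1 - p Q) \<le> EE (\<lambda>_. 1)"
    by (blast intro: EE_mono)+
  then show "0 \<le> hit_prob X p" "hit_prob X p \<le> 1" by (auto simp: hit_prob_def)
qed

lemma hit_prob_le: "hit_prob X p \<le> sum p G / L"
  unfolding hit_prob_alt EE_sum[symmetric]
  by (intro EE_mono one_minus_prod_le_sum) (use p_F finite_supp_elem in auto)

lemma hit_prob_ge: "sum p G / L - (\<Sum>Q\<in>G. \<Sum>Q'\<in>G. pair_prob X Q Q' * p Q * p Q') / 2 \<le> hit_prob X p"
proof -
  have "EE (\<lambda>F. sum p F - ((sum p F)\<^sup>2 - (\<Sum>Q\<in>F. (p Q)\<^sup>2)) / 2) \<le> hit_prob X p"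
    unfolding hit_prob_alt by (intro EE_mono bonferroni_lower) (use p_F finite_supp_elem in auto)
  moreover have "EE (\<lambda>F. sum p F - ((sum p F)\<^sup>2 - (\<Sum>Q\<in>F. (p Q)\<^sup>2)) / 2)
    = EE (\<lambda>F. sum p F) - EE (\<lambda>F. (sum p F)\<^sup>2 - (\<Sum>Q\<in>F. (p Q)\<^sup>2)) / 2"
    by (subst Bochner_Integration.integral_diff) (simp_all del: Bochner_Integration.integral_diff)
  ultimately show ?thesis by (simp only: EE_sum EE_pair)
qed

lemma hit_prob_le_crude:
  "hit_prob X p \<le> sum p G / L - (\<Sum>Q\<in>G. \<Sum>Q'\<in>G. pair_prob X Q Q' * p Q * p Q') / (2 * (real L)\<^sup>2)"
proof -
  have "hit_prob X p \<le> EE (\<lambda>F. sum p F - ((sum p F)\<^sup>2 - (\<Sum>Q\<in>F. (p Q)\<^sup>2)) / (2 * (real L)\<^sup>2))"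
    unfolding hit_prob_alt
  proof (intro EE_mono bonferroni_upper_crude)
    fix F assume "F \<in> set_pmf X"
    then have "card F \<le> card G" by (intro card_mono support_sub) auto
    then show "real (card F) \<le> (real L)\<^sup>2"
      by (simp add: power2_eq_square flip: of_nat_mult)
  qed (use p_F finite_supp_elem in auto)
  moreover have "EE (\<lambda>F. sum p F - ((sum p F)\<^sup>2 - (\<Sum>Q\<in>F. (p Q)\<^sup>2)) / (2 * (real L)\<^sup>2))
    = EE (\<lambda>F. sum p F) - EE (\<lambda>F. (sum p F)\<^sup>2 - (\<Sum>Q\<in>F. (p Q)\<^sup>2)) / (2 * (real L)\<^sup>2)"
    by (subst Bochner_Integration.integral_diff) (simp_all del: Bochner_Integration.integral_diff)
  ultimately show ?thesis by (simp only: EE_sum EE_pair)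
qed

text \<open>The cubic error is a sum over cells, so that uniformity evaluates its expectation. The
  factor \<open>real L ^ 6\<close> is the cube of the maximal number of chosen cells.\<close>

lemma hit_prob_le_cubic:
  "hit_prob X p \<le> sum p G / L - (\<Sum>Q\<in>G. \<Sum>Q'\<in>G. pair_prob X Q Q' * p Q * p Q') / 2
      + real L ^ 6 * ((\<Sum>Q\<in>G. (p Q)^3) / L)"
proof -
  have cube: "(sum p F)^3 \<le> real L ^ 6 * (\<Sum>Q\<in>F. (p Q)^3)" if F: "F \<in> set_pmf X" for F
  proof (cases "F = {}")
    case False
    have fin: "finite F" using finite_supp_elem F by simp
    have "Max (p ` F) \<in> p ` F" using False fin by (intro Max_in) auto
    then obtain Q where Q: "Q \<in> F" "p Q = Max (p ` F)" by auto
    have le: "p R \<le> p Q" if "R \<in> F" for R unfolding Q(2) using that fin by auto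
    have "sum p F \<le> real (card F) * p Q" by (rule sum_bounded_above) (rule le)
    also have "\<dots> \<le> (real L)\<^sup>2 * p Q"
    proof (intro mult_right_mono)
      have "card F \<le> card G" using F by (intro card_mono support_sub) auto
      then show "real (card F) \<le> (real L)\<^sup>2"
        by (simp add: power2_eq_square flip: of_nat_mult)
    qed (use p_F[OF F Q(1)] in auto)
    finally have "(sum p F)^3 \<le> ((real L)\<^sup>2 * p Q)^3"
      using p_F[OF F] by (intro power_mono sum_nonneg) auto
    also have "\<dots> = real L ^ 6 * (p Q)^3" by (simp add: power_mult_distrib flip: power_mult)
    also have "(p Q)^3 \<le> (\<Sum>Q\<in>F. (p Q)^3)"
      using p_F[OF F] fin by (intro member_le_sum Q) auto
    finally show ?thesis by simp
  qed auto
  have "hit_prob X p \<le> EE (\<lambda>F. sum p F - ((sum p F)\<^sup>2 - (\<Sum>Q\<in>F. (p Q)\<^sup>2)) / 2 + real L ^ 6 * (\<Sum>Q\<in>F. (p Q)^3))"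
    unfolding hit_prob_alt
  proof (rule EE_mono)
    fix F assume F: "F \<in> set_pmf X"
    have "1 - (\<Prod>i\<in>F. 1 - p i) \<le> sum p F - ((sum p F)\<^sup>2 - (\<Sum>i\<in>F. (p i)\<^sup>2)) / 2 + (sum p F)^3"
      using p_F[OF F] finite_supp_elem[OF F] by (intro bonferroni_upper_cubic) auto
    with cube[OF F] show "1 - (\<Prod>i\<in>F. 1 - p i) \<le> sum p F - ((sum p F)\<^sup>2 - (\<Sum>i\<in>F. (p i)\<^sup>2)) / 2 + real L ^ 6 * (\<Sum>Q\<in>F. (p Q)^3)"
      by simp
  qed
  moreover have "EE (\<lambda>F. sum p F - ((sum p F)\<^sup>2 - (\<Sum>Q\<in>F. (p Q)\<^sup>2)) / 2 + real L ^ 6 * (\<Sum>Q\<in>F. (p Q)^3))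
    = EE (\<lambda>F. sum p F) - EE (\<lambda>F. (sum p F)\<^sup>2 - (\<Sum>Q\<in>F. (p Q)\<^sup>2)) / 2
       + real L ^ 6 * EE (\<lambda>F. \<Sum>Q\<in>F. (p Q)^3)"
    by (subst Bochner_Integration.integral_add, simp, simp,
        subst Bochner_Integration.integral_diff) (simp_all del: Bochner_Integration.integral_diff)
  ultimately show ?thesis by (simp only: EE_sum EE_pair)
qed

end

lemma hit_prob_mono:
  assumes "\<And>Q. Q \<in> G \<Longrightarrow> p Q \<le> r Q \<and> r Q \<le> 1"
  shows "hit_prob X p \<le> hit_prob X r"
  unfolding hit_prob_def using assms support_sub
  by (intro diff_left_mono EE_mono prod_one_minus_antimono) blast

lemma hit_prob_diff:
  assumes "\<And>Q. Q \<in> G \<Longrightarrow> 0 \<le> p Q \<and> p Q \<le> 1 \<and> 0 \<le> r Q \<and> r Q \<le> 1"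
  shows "hit_prob X p - hit_prob X r \<le> (\<Sum>Q\<in>G. max 0 (p Q - r Q)) / L"
proof -
  have "hit_prob X p - hit_prob X r = EE (\<lambda>F. (\<Prod>Q\<in>F. 1 - r Q) - (\<Prod>Q\<in>F. 1 - p Q))"
    by (simp add: hit_prob_def)
  also have "\<dots> \<le> EE (\<lambda>F. \<Sum>Q\<in>F. max 0 (p Q - r Q))"
    using assms support_sub finite_supp_elem by (intro EE_mono prod_one_minus_diff) blast+
  also have "\<dots> = (\<Sum>Q\<in>G. max 0 (p Q - r Q)) / L" by (rule EE_sum)
  finally show ?thesis .
qed

end

section \<open>One generation of the weighted recursion\<close>

text \<open>Whenever \<open>sum w (cells L) = L * H\<close>, the numbers
  \<open>w Q / (L * H)\<close> form a probability vector. For \<open>H = 0\<close> the value is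
  0.\<close>

definition avg :: "nat \<Rightarrow> (nat \<times> nat \<Rightarrow> real) \<Rightarrow> real \<Rightarrow> (nat \<times> nat \<Rightarrow> real) \<Rightarrow> real" where
  "avg L w H x = (\<Sum>Q\<in>cells L. w Q * x Q) / (real L * H)"

text \<open>Half of this is the quadratic term of
  \<open>hit_prob X (\<lambda>Q. w Q * x Q) / H\<close>, of which \<open>avg\<close> is the linear
  term; hence the single division by \<open>H\<close>.\<close>

definition pairsum :: "nat \<Rightarrow> (nat \<times> nat) set pmf \<Rightarrow> (nat \<times> nat \<Rightarrow> real) \<Rightarrow> real \<Rightarrow> (nat \<times> nat \<Rightarrow> real) \<Rightarrow> real" where
  "pairsum L X w H x = (\<Sum>Q\<in>cells L. \<Sum>Q'\<in>cells L. pair_prob X Q Q' * (w Q * x Q) * (w Q' * x Q')) / H"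

text \<open>Being quadratic at infinity and cubic at the origin, \<open>phi\<close> is controlled by the decrement of
  the second moment whatever the size of its argument.\<close>
definition phi :: "real \<Rightarrow> real" where
  "phi x = x\<^sup>2 * min x 1"

lemma phi_nonneg: "0 \<le> x \<Longrightarrow> 0 \<le> phi x" by (simp add: phi_def)

lemma phi_le_sq: "phi x \<le> x\<^sup>2"
  by (simp add: phi_def mult_left_le)

lemma phi_scale: assumes "0 \<le> x" "x \<le> 2 * y" shows "phi x \<le> 8 * phi y"
proof -
  have "x\<^sup>2 \<le> (2*y)\<^sup>2" using assms by (intro power_mono) auto
  moreover have "min x 1 \<le> 2 * min y 1" using assms by auto
  ultimately have "x\<^sup>2 * min x 1 \<le> (2*y)\<^sup>2 * (2 * min y 1)"
    using assms by (intro mult_mono) auto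
  then show ?thesis by (simp add: phi_def power2_eq_square)
qed

text \<open>Either the arguments are comparable and the factor 8 of a cube under doubling applies,
  or the difference exceeds half of \<open>x\<close> and its square pays for the quadratic bound on
  \<open>phi\<close>.\<close>

lemma phi_le_near: assumes "0 \<le> x" "0 \<le> y" shows "phi x \<le> 8 * phi y + 4 * (x - y)\<^sup>2"
proof (cases "x \<le> 2 * y")
  case True
  then show ?thesis using phi_scale[of x y] assms by (simp add: add_increasing2)
next
  case False
  have "phi x \<le> x\<^sup>2" by (rule phi_le_sq)
  also have "\<dots> \<le> (2 * (x - y))\<^sup>2" using False assms by (intro power_mono) auto
  also have "\<dots> = 4 * (x - y)\<^sup>2" by (simp only: power_mult_distrib) simp
  finally show ?thesis using phi_nonneg[OF assms(2)] by linarith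
qed

lemma phi_le_drop: assumes "0 \<le> u" "u \<le> y" shows "phi y \<le> 8 * phi u + 2 * (y\<^sup>2 - u\<^sup>2)"
proof (cases "y \<le> 2 * u")
  case True
  have "u\<^sup>2 \<le> y\<^sup>2" using assms by (intro power_mono) auto
  moreover have "phi y \<le> 8 * phi u" using phi_scale[of y u] assms True by auto
  ultimately show ?thesis by argo
next
  case False
  have "phi y \<le> y\<^sup>2" by (rule phi_le_sq)
  moreover have "(2*u)\<^sup>2 \<le> y\<^sup>2" using False assms by (intro power_mono) auto
  then have "4 * u\<^sup>2 \<le> y\<^sup>2" by (simp add: power_mult_distrib)
  moreover have "0 \<le> u\<^sup>2" by simp
  ultimately show ?thesis using phi_nonneg[OF assms(1)] by argo
qed

text \<open>A family of minorants affine in \<open>x\<^sup>2\<close>. After integration the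
  parameter \<open>l\<close> can be fitted to the second moment, which gives a Jensen-type bound for
  \<open>phi\<close> as a function of \<open>x\<^sup>2\<close>.\<close>

lemma phi_ge_linear: assumes "0 \<le> x" "0 \<le> l" "l \<le> 1" shows "l * x\<^sup>2 - l^3 \<le> phi x"
proof (cases "l \<le> x")
  case True
  then have "l \<le> min x 1" using assms by auto
  then have "l * x\<^sup>2 \<le> min x 1 * x\<^sup>2" by (intro mult_right_mono) auto
  moreover have "0 \<le> l^3" using assms by simp
  ultimately have "l * x\<^sup>2 - l^3 \<le> min x 1 * x\<^sup>2" by linarith
  then show ?thesis by (simp add: phi_def mult.commute)
next
  case False
  then have "x\<^sup>2 \<le> l\<^sup>2" using assms by (intro power_mono) auto
  then have "l * x\<^sup>2 \<le> l * l\<^sup>2" using assms by (intro mult_left_mono)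
  then have "l * x\<^sup>2 \<le> l ^ 3" by (simp add: power2_eq_square power3_eq_cube)
  with phi_nonneg[OF assms(1)] show ?thesis by linarith
qed

text \<open>Either both \<open>x\<close> and \<open>x'\<close> are at least \<open>y / 2\<close>,
  and the product is of order \<open>y\<^sup>3\<close>, or one of them is at distance more than
  \<open>y / 2\<close> from \<open>y\<close>.\<close>

lemma prod_ge_phi:
  fixes x x' y :: real
  assumes "0 \<le> x" "0 \<le> x'" "0 \<le> y"
  shows "phi y / 4 - 1 * ((x - y)\<^sup>2 + (x' - y)\<^sup>2) \<le> y * (x * x')"
proof -
  define a b where "a = (x - y)\<^sup>2" and "b = (x' - y)\<^sup>2"
  have ab: "0 \<le> a" "0 \<le> b" by (auto simp: a_def b_def)
  have "phi y / 4 - 1 * (a + b) \<le> y * (x * x')"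
  proof (cases "y / 2 \<le> x \<and> y / 2 \<le> x'")
    case True
    then have "(y/2) * (y/2) \<le> x * x'" using assms by (intro mult_mono) auto
    then have "y * ((y/2) * (y/2)) \<le> y * (x * x')" using assms by (intro mult_left_mono)
    moreover have "phi y \<le> y\<^sup>2 * y" unfolding phi_def by (intro mult_left_mono) auto
    moreover have "y * ((y/2) * (y/2)) = y\<^sup>2 * y / 4" by (simp add: power2_eq_square)
    ultimately have "phi y / 4 \<le> y * (x * x')" by argo
    then show ?thesis using ab by argo
  next
    case False
    have "(y/2)\<^sup>2 \<le> a + b"
    proof (cases "y / 2 \<le> x")
      case True
      with False have "(y/2)\<^sup>2 \<le> (y - x')\<^sup>2" using assms by (intro power_mono) auto
      then have "(y/2)\<^sup>2 \<le> b" unfolding b_def by (subst power2_commute)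
      then show ?thesis using ab by argo
    next
      case False
      then have "(y/2)\<^sup>2 \<le> (y - x)\<^sup>2" using assms by (intro power_mono) auto
      then have "(y/2)\<^sup>2 \<le> a" unfolding a_def by (subst power2_commute)
      then show ?thesis using ab by argo
    qed
    moreover have "phi y / 4 \<le> (y/2)\<^sup>2" using phi_le_sq[of y] by (simp add: power_divide)
    moreover have "0 \<le> y * (x * x')" using assms by simp
    ultimately show ?thesis by argo
  qed
  then show ?thesis unfolding a_def b_def .
qed

text \<open>Expand around \<open>y\<close>; Young's inequality with weight \<open>e\<close> handles
  the cross terms.\<close>

lemma prod_near_square:
  fixes x x' y e :: real
  assumes "0 < e"
  shows "\<bar>x * x' - y\<^sup>2\<bar> \<le> e * y\<^sup>2 + (1 + 1/e) / 2 * ((x - y)\<^sup>2 + (x' - y)\<^sup>2)"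
proof -
  define a b where "a = x - y" and "b = x' - y"
  have e: "x * x' - y\<^sup>2 = y * a + y * b + a * b"
    by (simp add: a_def b_def algebra_simps power2_eq_square)
  have amgm: "\<bar>y * a\<bar> \<le> e * y\<^sup>2 / 2 + a\<^sup>2 / (2 * e)" for a
  proof -
    have "0 \<le> (e * \<bar>y\<bar> - \<bar>a\<bar>)\<^sup>2 / (2 * e)" using assms by simp
    also have "\<dots> = e * y\<^sup>2 / 2 + a\<^sup>2 / (2 * e) - \<bar>y * a\<bar>"
      using assms by (simp add: power2_eq_square field_simps abs_mult)
    finally show ?thesis by simp
  qed
  have ab: "\<bar>a * b\<bar> \<le> (a\<^sup>2 + b\<^sup>2) / 2"
  proof -
    have "0 \<le> (\<bar>a\<bar> - \<bar>b\<bar>)\<^sup>2 / 2" by simp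
    also have "\<dots> = (a\<^sup>2 + b\<^sup>2) / 2 - \<bar>a * b\<bar>"
      by (simp add: power2_eq_square field_simps abs_mult)
    finally show ?thesis by simp
  qed
  have "\<bar>x * x' - y\<^sup>2\<bar> \<le> \<bar>y * a\<bar> + \<bar>y * b\<bar> + \<bar>a * b\<bar>" unfolding e by linarith
  also have "\<dots> \<le> (e * y\<^sup>2 / 2 + a\<^sup>2 / (2 * e)) + (e * y\<^sup>2 / 2 + b\<^sup>2 / (2 * e)) + (a\<^sup>2 + b\<^sup>2) / 2"
    using amgm[of a] amgm[of b] ab by linarith
  also have "\<dots> = e * y\<^sup>2 + (1 + 1/e) / 2 * (a\<^sup>2 + b\<^sup>2)"
    using assms by (simp add: field_simps)
  finally show ?thesis by (simp add: a_def b_def)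
qed

section \<open>Weighted averages over the children of one line\<close>

lemma av_H0: "avg L w 0 x = 0" and pr_H0: "pairsum L X w 0 x = 0"
  by (simp_all add: avg_def pairsum_def)

lemma avg_mono:
  assumes "\<And>Q. Q \<in> cells L \<Longrightarrow> 0 \<le> w Q \<and> x Q \<le> x' Q" "0 \<le> H"
  shows "avg L w H x \<le> avg L w H x'"
  unfolding avg_def using assms by (intro divide_right_mono sum_mono mult_left_mono) auto

lemma avg_mono_weighted:
  assumes "\<And>Q. Q \<in> cells L \<Longrightarrow> w Q * x Q \<le> w Q * x' Q" "0 \<le> H"
  shows "avg L w H x \<le> avg L w H x'"
  unfolding avg_def using assms by (intro divide_right_mono sum_mono) auto

lemma avg_add: "avg L w H (\<lambda>Q. x Q + x' Q) = avg L w H x + avg L w H x'"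
  by (simp add: avg_def algebra_simps sum.distrib add_divide_distrib)

lemma avg_diff: "avg L w H (\<lambda>Q. x Q - x' Q) = avg L w H x - avg L w H x'"
  by (simp add: avg_def algebra_simps sum_subtractf diff_divide_distrib)

lemma avg_cmult: "avg L w H (\<lambda>Q. c * x Q) = c * avg L w H x"
  by (simp add: avg_def sum_distrib_left algebra_simps)

lemma avg_nonneg:
  assumes "\<And>Q. Q \<in> cells L \<Longrightarrow> 0 \<le> w Q \<and> 0 \<le> x Q" "0 \<le> H"
  shows "0 \<le> avg L w H x"
  unfolding avg_def using assms by (intro divide_nonneg_nonneg sum_nonneg) auto

text \<open>A single line is frozen: \<open>H\<close> stands for its chord in the unit square and
  \<open>w Q\<close> for the rescaled chord in the cell \<open>Q\<close>. Then \<open>sum_w\<close>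
  is additivity of length, and 2 is a convenient bound for the diagonal of the square.\<close>

locale weighted_cells = uniform_grid +
  fixes w :: "nat \<times> nat \<Rightarrow> real" and H :: real
  assumes w: "\<And>Q. Q \<in> G \<Longrightarrow> 0 \<le> w Q \<and> w Q \<le> 2" and H: "0 \<le> H" "H \<le> 2"
    and sum_w: "sum w G = real L * H"
begin

abbreviation "av \<equiv> avg L w H"
abbreviation "pr \<equiv> pairsum L X w H"
abbreviation "vv \<equiv> pr (\<lambda>_. 1)"
abbreviation "spread x \<equiv> av (\<lambda>Q. (x Q)\<^sup>2) - (av x)\<^sup>2"

lemma av_const: "0 < H \<Longrightarrow> av (\<lambda>_. c) = c"
  using sum_w by (simp add: avg_def sum_distrib_right[symmetric])

lemma av_le_const:
  assumes "\<And>Q. Q \<in> G \<Longrightarrow> x Q \<le> c" "0 \<le> c" shows "av x \<le> c"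
proof (cases "H = 0")
  case False
  have "av x \<le> av (\<lambda>_. c)" using assms w H by (intro avg_mono) auto
  then show ?thesis using av_const False H by simp
qed (use assms in \<open>simp add: av_H0\<close>)

lemma spread_eq: "0 < H \<Longrightarrow> spread x = av (\<lambda>Q. (x Q - av x)\<^sup>2)"
proof -
  assume "0 < H"
  have "av (\<lambda>Q. (x Q - av x)\<^sup>2) = av (\<lambda>Q. ((x Q)\<^sup>2 - (2 * av x) * x Q) + (av x)\<^sup>2)"
    by (intro arg_cong[where f=av] ext) (simp add: power2_eq_square algebra_simps)
  also have "\<dots> = av (\<lambda>Q. (x Q)\<^sup>2) - 2 * av x * av x + (av x)\<^sup>2"
    by (simp add: avg_add avg_diff avg_cmult av_const[OF \<open>0 < H\<close>])
  finally show ?thesis by (simp add: power2_eq_square)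
qed

lemma spread_nonneg: "0 \<le> spread x"
proof (cases "H = 0")
  case False
  then have "0 < H" using H by simp
  then show ?thesis unfolding spread_eq[OF \<open>0 < H\<close>] using w H by (intro avg_nonneg) auto
qed (simp add: av_H0)

lemma pr_nonneg: assumes "\<And>Q. Q \<in> G \<Longrightarrow> 0 \<le> x Q" shows "0 \<le> pr x"
  unfolding pairsum_def using assms w H pair_prob_nonneg
  by (intro divide_nonneg_nonneg sum_nonneg mult_nonneg_nonneg) auto

lemma pr_le: assumes x: "\<And>Q. Q \<in> G \<Longrightarrow> 0 \<le> x Q" shows "pr x \<le> 2 * real L * (av x)\<^sup>2"
proof (cases "H = 0")
  case False
  then have H0: "0 < H" using H by simp
  have S: "(\<Sum>Q\<in>G. w Q * x Q) = real L * H * av x" using H0 by (simp add: avg_def)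
  have "(\<Sum>Q\<in>G. \<Sum>Q'\<in>G. pair_prob X Q Q' * (w Q * x Q) * (w Q' * x Q'))
      \<le> (\<Sum>Q\<in>G. \<Sum>Q'\<in>G. (1 / real L) * (w Q * x Q) * (w Q' * x Q'))"
    using w x pair_prob_le by (intro sum_mono mult_right_mono) auto
  also have "\<dots> = (\<Sum>Q\<in>G. w Q * x Q)\<^sup>2 / real L"
    by (simp add: power2_eq_square sum_product sum_divide_distrib)
  also have "\<dots> = real L * H * (av x)\<^sup>2 * H" unfolding S by (simp add: power2_eq_square)
  finally have "pr x \<le> real L * H * (av x)\<^sup>2" using H0 by (simp add: pairsum_def divide_le_eq)
  also have "\<dots> \<le> real L * 2 * (av x)\<^sup>2" using H by (intro mult_right_mono mult_left_mono) auto
  finally show ?thesis by simp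
qed (simp add: pr_H0)

lemma vv_le: "vv \<le> 2 * real L"
proof (cases "H = 0")
  case False
  then show ?thesis using pr_le[of "\<lambda>_. 1"] av_const[of 1] H by simp
qed (simp add: pr_H0)

lemma vv_nonneg: "0 \<le> vv" by (rule pr_nonneg) simp

text \<open>The pair weights \<open>pair_prob * w * w' / H\<close> have total mass
  \<open>vv\<close>. Because \<open>pair_prob \<le> 1 / L\<close>, the marginal at \<open>Q\<close>
  is at most \<open>H * w Q / H\<close>, so each of the two error terms costs at most
  \<open>2 * L * c\<close> times the average of \<open>d\<close>.\<close>

lemma pair_lower:
  assumes H0: "0 < H" and t: "\<And>Q Q'. Q \<in> G \<Longrightarrow> Q' \<in> G \<Longrightarrow> \<alpha> - c * (d Q + d Q') \<le> t Q Q'"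
    and c: "0 \<le> c" and d: "\<And>Q. Q \<in> G \<Longrightarrow> 0 \<le> d Q"
  shows "vv * \<alpha> - 4 * real L * c * av d \<le> (\<Sum>Q\<in>G. \<Sum>Q'\<in>G. pair_prob X Q Q' * w Q * w Q' * t Q Q') / H"
proof -
  let ?D = "\<Sum>Q\<in>G. \<Sum>Q'\<in>G. pair_prob X Q Q' * w Q * w Q' * d Q"
  have D: "?D / H \<le> 2 * real L * av d"
  proof -
    have "?D \<le> (\<Sum>Q\<in>G. \<Sum>Q'\<in>G. (1 / real L) * w Q * w Q' * d Q)"
      using w d pair_prob_le by (intro sum_mono mult_right_mono) auto
    also have "\<dots> = (\<Sum>Q\<in>G. (w Q * d Q / real L) * (\<Sum>Q'\<in>G. w Q'))"
      unfolding sum_distrib_left by (intro sum.cong refl) simp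
    also have "\<dots> = (\<Sum>Q\<in>G. w Q * d Q) * H"
      unfolding sum_w sum_distrib_right by (intro sum.cong refl) simp
    also have "\<dots> = real L * H * av d * H" using H0 by (simp add: avg_def)
    finally have "?D / H \<le> real L * H * av d" using H0 by (simp add: divide_le_eq)
    also have "\<dots> \<le> real L * 2 * av d" using H w d
      by (intro mult_right_mono mult_left_mono avg_nonneg) auto
    finally show ?thesis by simp
  qed
  have D': "(\<Sum>Q\<in>G. \<Sum>Q'\<in>G. pair_prob X Q Q' * w Q * w Q' * d Q') = ?D"
    by (subst sum.swap, intro sum.cong refl, subst pair_prob_sym) simp
  have "vv * \<alpha> - c * (?D / H) - c * (?D / H)
     = ((\<Sum>Q\<in>G. \<Sum>Q'\<in>G. pair_prob X Q Q' * w Q * w Q') * \<alpha> - c * ?D - c * (\<Sum>Q\<in>G. \<Sum>Q'\<in>G. pair_prob X Q Q' * w Q * w Q' * d Q')) / H"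
    unfolding D' by (simp add: pairsum_def diff_divide_distrib)
  also have "\<dots> = (\<Sum>Q\<in>G. \<Sum>Q'\<in>G. pair_prob X Q Q' * w Q * w Q' * (\<alpha> - c * (d Q + d Q'))) / H"
    unfolding sum_distrib_left sum_distrib_right sum_subtractf[symmetric]
    by (intro arg_cong[where f="\<lambda>z. z / H"] sum.cong refl) (simp add: algebra_simps)
  also have "\<dots> \<le> (\<Sum>Q\<in>G. \<Sum>Q'\<in>G. pair_prob X Q Q' * w Q * w Q' * t Q Q') / H"
    using H w pair_prob_nonneg t by (intro divide_right_mono sum_mono mult_left_mono mult_nonneg_nonneg) auto
  finally have "vv * \<alpha> - c * (?D / H) - c * (?D / H) \<le> (\<Sum>Q\<in>G. \<Sum>Q'\<in>G. pair_prob X Q Q' * w Q * w Q' * t Q Q') / H" .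
  moreover have "c * (?D / H) \<le> c * (2 * real L * av d)" using D c by (intro mult_left_mono)
  ultimately show ?thesis by argo
qed

lemma av_pr_ge:
  assumes x: "\<And>Q. Q \<in> G \<Longrightarrow> 0 \<le> x Q"
  shows "vv * phi (av x) / 4 - 4 * real L * spread x \<le> av x * pr x"
proof (cases "H = 0")
  case False
  then have H0: "0 < H" using H by simp
  have y: "0 \<le> av x" using w x H by (intro avg_nonneg) auto
  have "vv * (phi (av x) / 4) - 4 * real L * 1 * av (\<lambda>Q. (x Q - av x)\<^sup>2)
     \<le> (\<Sum>Q\<in>G. \<Sum>Q'\<in>G. pair_prob X Q Q' * w Q * w Q' * (av x * (x Q * x Q'))) / H"
    by (intro pair_lower H0 prod_ge_phi) (use x y in auto)
  also have "\<dots> = av x * pr x"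
    unfolding pairsum_def times_divide_eq_right sum_distrib_left
    by (intro arg_cong[where f="\<lambda>z. z / H"] sum.cong refl) simp
  finally show ?thesis by (simp add: spread_eq[OF H0])
qed (simp add: av_H0 pr_H0)

lemma pr_near:
  assumes x: "\<And>Q. Q \<in> G \<Longrightarrow> 0 \<le> x Q" and e: "0 < e"
  shows "\<bar>pr x - vv * (av x)\<^sup>2\<bar> \<le> e * (vv * (av x)\<^sup>2) + 2 * real L * (1 + 1/e) * spread x"
proof (cases "H = 0")
  case False
  then have H0: "0 < H" using H by simp
  let ?c = "(1 + 1/e)/2" and ?d = "\<lambda>Q. (x Q - av x)\<^sup>2"
  have c: "0 \<le> ?c" using e by simp
  have eq: "(\<Sum>Q\<in>G. \<Sum>Q'\<in>G. pair_prob X Q Q' * w Q * w Q' * (x Q * x Q')) / H = pr x"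
    unfolding pairsum_def by (intro arg_cong[where f="\<lambda>z. z / H"] sum.cong refl) simp
  have "vv * ((1 - e) * (av x)\<^sup>2) - 4 * real L * ?c * av ?d
     \<le> (\<Sum>Q\<in>G. \<Sum>Q'\<in>G. pair_prob X Q Q' * w Q * w Q' * (x Q * x Q')) / H"
  proof (intro pair_lower H0 c)
    fix Q Q' show "(1 - e) * (av x)\<^sup>2 - ?c * (?d Q + ?d Q') \<le> x Q * x Q'"
      using prod_near_square[OF e, of "x Q" "x Q'" "av x"] by (simp add: algebra_simps)
  qed auto
  \<comment> \<open>The upper estimate is \<open>pair_lower\<close> applied to the negated
    products.\<close>
  moreover have "vv * (- (1 + e) * (av x)\<^sup>2) - 4 * real L * ?c * av ?d
     \<le> (\<Sum>Q\<in>G. \<Sum>Q'\<in>G. pair_prob X Q Q' * w Q * w Q' * (- (x Q * x Q'))) / H"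
  proof (intro pair_lower H0 c)
    fix Q Q' show "- (1 + e) * (av x)\<^sup>2 - ?c * (?d Q + ?d Q') \<le> - (x Q * x Q')"
      using prod_near_square[OF e, of "x Q" "x Q'" "av x"] by (simp add: algebra_simps)
  qed auto
  moreover have "4 * real L * ?c * av ?d = 2 * real L * (1 + 1/e) * spread x"
    unfolding spread_eq[OF H0] by simp
  moreover have "(\<Sum>Q\<in>G. \<Sum>Q'\<in>G. pair_prob X Q Q' * w Q * w Q' * (- (x Q * x Q'))) / H = - pr x"
    unfolding eq[symmetric] by (simp add: sum_negf)
  moreover have "vv * ((1 - e) * (av x)\<^sup>2) = vv * (av x)\<^sup>2 - e * (vv * (av x)\<^sup>2)"
    "vv * (- (1 + e) * (av x)\<^sup>2) = - (vv * (av x)\<^sup>2) - e * (vv * (av x)\<^sup>2)"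
    by (simp_all add: algebra_simps)
  ultimately show ?thesis unfolding abs_le_iff eq by argo
qed (simp add: av_H0 pr_H0)

lemma av_phi_le:
  assumes x: "\<And>Q. Q \<in> G \<Longrightarrow> 0 \<le> x Q"
  shows "av (\<lambda>Q. phi (x Q)) \<le> 8 * phi (av x) + 4 * spread x"
proof (cases "H = 0")
  case False
  then have H0: "0 < H" using H by simp
  have y: "0 \<le> av x" using w x H by (intro avg_nonneg) auto
  have "av (\<lambda>Q. phi (x Q)) \<le> av (\<lambda>Q. 8 * phi (av x) + 4 * (x Q - av x)\<^sup>2)"
    using w H x y by (intro avg_mono) (auto intro!: phi_le_near)
  then show ?thesis by (simp add: avg_add avg_cmult av_const[OF H0] spread_eq[OF H0])
qed (simp add: av_H0 phi_def)

text \<open>Jensen's inequality for the reciprocal, by its tangent at the mean. Positivity of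
  \<open>x\<close> is demanded only where the weight is positive, since elsewhere the recursion
  carries arbitrary values.\<close>

lemma inverse_av_le:
  assumes x: "\<And>Q. Q \<in> G \<Longrightarrow> 0 < w Q \<Longrightarrow> 0 < x Q" and H0: "0 < H" and y: "0 < av x"
  shows "1 / av x \<le> av (\<lambda>Q. 1 / x Q)"
proof -
  let ?y = "av x"
  have "av (\<lambda>Q. 2 / ?y - (1 / ?y\<^sup>2) * x Q) \<le> av (\<lambda>Q. 1 / x Q)"
  proof (rule avg_mono_weighted)
    fix Q assume Q: "Q \<in> G"
    show "w Q * (2 / ?y - (1 / ?y\<^sup>2) * x Q) \<le> w Q * (1 / x Q)"
    proof (cases "w Q = 0")
      case False
      then have "0 < x Q" using w[OF Q] x[OF Q] by auto
      have "0 \<le> (x Q - ?y)\<^sup>2 / (x Q * ?y\<^sup>2)" using \<open>0 < x Q\<close> by simp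
      also have "\<dots> = 1 / x Q - (2 / ?y - (1 / ?y\<^sup>2) * x Q)"
        using \<open>0 < x Q\<close> y by (simp add: field_simps power2_eq_square)
      finally show ?thesis using w[OF Q] by (intro mult_left_mono) auto
    qed simp
  qed (use H in simp)
  then have "2 / ?y - (1 / ?y\<^sup>2) * ?y \<le> av (\<lambda>Q. 1 / x Q)"
    unfolding avg_diff avg_cmult av_const[OF H0] .
  then show ?thesis using y by (simp add: power2_eq_square)
qed

context
  fixes x :: "nat \<times> nat \<Rightarrow> real"
  assumes x: "\<And>Q. Q \<in> G \<Longrightarrow> 0 \<le> x Q \<and> w Q * x Q \<le> 1"
begin

lemma wx: "Q \<in> G \<Longrightarrow> 0 \<le> w Q * x Q \<and> w Q * x Q \<le> 1"
  using x w by auto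

abbreviation "st \<equiv> hit_prob X (\<lambda>Q. w Q * x Q) / H"

lemma st_nonneg: "0 \<le> st"
  using hit_prob_nonneg[of "\<lambda>Q. w Q * x Q", OF wx] H by simp

lemma st_le: "st \<le> av x"
  using divide_right_mono[OF hit_prob_le[of "\<lambda>Q. w Q * x Q", OF wx] H(1)] by (simp add: avg_def)

lemma st_ge: "av x - pr x / 2 \<le> st"
  using divide_right_mono[OF hit_prob_ge[of "\<lambda>Q. w Q * x Q", OF wx] H(1)] by (simp add: avg_def pairsum_def diff_divide_distrib)

lemma st_le_crude: "st \<le> av x - pr x / (2 * (real L)\<^sup>2)"
  using divide_right_mono[OF hit_prob_le_crude[of "\<lambda>Q. w Q * x Q", OF wx] H(1)]
  by (simp add: avg_def pairsum_def diff_divide_distrib mult.commute mult.left_commute)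

lemma st_le_cubic: "st \<le> av x - pr x / 2 + 4 * real L ^ 6 * av (\<lambda>Q. phi (x Q))"
proof (cases "H = 0")
  case False
  then have H0: "0 < H" using H by simp
  have "(\<Sum>Q\<in>G. (w Q * x Q)^3) \<le> (\<Sum>Q\<in>G. w Q * (4 * phi (x Q)))"
  proof (rule sum_mono)
    fix Q assume Q: "Q \<in> G"
    have 1: "w Q * x Q \<le> 2 * x Q" using w[OF Q] x[OF Q] by (intro mult_right_mono) auto
    \<comment> \<open>The constraint \<open>w Q * x Q \<le> 1\<close> is what turns the cube into
      \<open>phi\<close>: one factor is at most \<open>2 * x Q\<close>, another at most
      \<open>2 * min (x Q) 1\<close>, and the third keeps the weight.\<close>
    have 2: "w Q * x Q \<le> 2 * min (x Q) 1" using 1 x[OF Q] by (auto simp: min_def)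
    have "(w Q * x Q)^3 = (w Q * x Q) * ((w Q * x Q) * (w Q * x Q))" by (simp add: power3_eq_cube)
    also have "\<dots> \<le> (w Q * x Q) * ((2 * x Q) * (2 * min (x Q) 1))"
      by (rule mult_left_mono[OF mult_mono[OF 1 2]]) (use wx[OF Q] x[OF Q] in auto)
    also have "\<dots> = w Q * (4 * phi (x Q))" by (simp add: phi_def power2_eq_square)
    finally show "(w Q * x Q)^3 \<le> w Q * (4 * phi (x Q))" .
  qed
  then have "real L ^ 6 * ((\<Sum>Q\<in>G. (w Q * x Q)^3) / L) / H \<le> real L ^ 6 * ((\<Sum>Q\<in>G. w Q * (4 * phi (x Q))) / L) / H"
    using H0 by (intro divide_right_mono mult_left_mono) auto
  also have "(\<Sum>Q\<in>G. w Q * (4 * phi (x Q))) = 4 * (\<Sum>Q\<in>G. w Q * phi (x Q))"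
    unfolding sum_distrib_left by (intro sum.cong refl) simp
  also have "real L ^ 6 * (4 * (\<Sum>Q\<in>G. w Q * phi (x Q)) / real L) / H = 4 * real L ^ 6 * av (\<lambda>Q. phi (x Q))"
    by (simp add: avg_def)
  finally have "real L ^ 6 * ((\<Sum>Q\<in>G. (w Q * x Q)^3) / L) / H \<le> 4 * real L ^ 6 * av (\<lambda>Q. phi (x Q))" .
  then show ?thesis
    using divide_right_mono[OF hit_prob_le_cubic[of "\<lambda>Q. w Q * x Q", OF wx] H(1)]
    by (simp add: avg_def pairsum_def diff_divide_distrib add_divide_distrib mult.commute mult.left_commute)
qed (simp add: av_H0 pr_H0)

end

end

section \<open>The chord-length transform\<close>

definition BM :: "(real \<Rightarrow> real) \<Rightarrow> bool" where
  "BM f \<longleftrightarrow> f \<in> borel_measurable borel \<and> (\<exists>B. \<forall>t. \<bar>f t\<bar> \<le> B)"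

lemma BM_I: "f \<in> borel_measurable borel \<Longrightarrow> (\<And>t. \<bar>f t\<bar> \<le> B) \<Longrightarrow> BM f"
  by (auto simp: BM_def)

lemma BM_meas[measurable_dest]: "BM f \<Longrightarrow> f \<in> borel_measurable borel"
  by (simp add: BM_def)

lemma BM_const[intro, simp]: "BM (\<lambda>_. c)"
  by (rule BM_I[of _ "\<bar>c\<bar>"]) auto

lemma BM_add[intro]: assumes "BM f" "BM g" shows "BM (\<lambda>t. f t + g t)"
proof -
  from assms obtain A B where "\<And>t. \<bar>f t\<bar> \<le> A" "\<And>t. \<bar>g t\<bar> \<le> B" by (auto simp: BM_def)
  then have "\<bar>f t + g t\<bar> \<le> A + B" for t using abs_triangle_ineq[of "f t" "g t"] by (smt (verit))
  with assms show ?thesis by (intro BM_I[of _ "A + B"]) (auto simp: BM_def)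
qed

lemma BM_mult[intro]: assumes "BM f" "BM g" shows "BM (\<lambda>t. f t * g t)"
proof -
  from assms obtain A B where AB: "\<And>t. \<bar>f t\<bar> \<le> A" "\<And>t. \<bar>g t\<bar> \<le> B" by (auto simp: BM_def)
  have "\<bar>f t * g t\<bar> \<le> A * B" for t
    unfolding abs_mult by (rule mult_mono) (use AB abs_ge_zero order_trans in blast)+
  with assms show ?thesis by (intro BM_I[of _ "A * B"]) (auto simp: BM_def)
qed

lemma BM_uminus[intro]: "BM f \<Longrightarrow> BM (\<lambda>t. - f t)"
  using BM_mult[of "\<lambda>_. -1" f] by simp

lemma BM_diff[intro]: "BM f \<Longrightarrow> BM g \<Longrightarrow> BM (\<lambda>t. f t - g t)"
  using BM_add[of f "\<lambda>t. - g t"] by auto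

lemma BM_divide_const[intro]: "BM f \<Longrightarrow> BM (\<lambda>t. f t / c)"
  using BM_mult[of f "\<lambda>_. 1 / c"] by simp

lemma BM_power[intro]: "BM f \<Longrightarrow> BM (\<lambda>t. f t ^ n)"
  by (induction n) auto

lemma BM_sum[intro]: "(\<And>i. i \<in> S \<Longrightarrow> BM (f i)) \<Longrightarrow> BM (\<lambda>t. \<Sum>i\<in>S. f i t)"
  by (induction S rule: infinite_finite_induct) auto

lemma BM_affine[intro]: "BM f \<Longrightarrow> BM (\<lambda>t. f (c * t - d))"
  unfolding BM_def by (auto intro: measurable_compose[where g=f])

lemma BM_bounded: "f \<in> borel_measurable borel \<Longrightarrow> (\<And>t. 0 \<le> f t \<and> f t \<le> g t) \<Longrightarrow> BM g \<Longrightarrow> BM f"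
  unfolding BM_def by (metis abs_le_D1 abs_of_nonneg order_trans)

lemma phi_meas[measurable]: "phi \<in> borel_measurable borel"
  unfolding phi_def[abs_def] by measurable

lemma BM_phi[intro]: assumes "BM f" "\<And>t. 0 \<le> f t" shows "BM (\<lambda>t. phi (f t))"
  by (rule BM_bounded[of _ "\<lambda>t. (f t)^2"])
     (use assms in \<open>auto intro: phi_nonneg phi_le_sq measurable_compose[OF BM_meas phi_meas]\<close>)

text \<open>\<open>h \<theta> t\<close> stands for the length of the chord that the line \<open>\<ell>(\<theta>,t)\<close> cuts out of the unit square;
  after rescaling a first level square \<open>Q\<close> to the unit square, the same line has the parameter
  \<open>L t - q \<theta> Q\<close>.\<close>
locale lines = uniform_grid +
  fixes h :: "real \<Rightarrow> real \<Rightarrow> real" and q :: "real \<Rightarrow> nat \<times> nat \<Rightarrow> real"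
  assumes h_bounds: "0 \<le> h \<theta> t \<and> h \<theta> t \<le> 2"
    and h_meas[measurable]: "h \<theta> \<in> borel_measurable borel"
    and h_nn: "(\<integral>\<^sup>+t. ennreal (h \<theta> t) \<partial>lborel) = 1"
    and h_self: "(\<Sum>Q\<in>cells L. h \<theta> (real L * t - q \<theta> Q)) = real L * h \<theta> t"
begin

definition mu :: "real \<Rightarrow> real measure" where
  "mu \<theta> = density lborel (\<lambda>t. ennreal (h \<theta> t))"

abbreviation ig :: "real \<Rightarrow> (real \<Rightarrow> real) \<Rightarrow> real" where
  "ig \<theta> f \<equiv> integral\<^sup>L (mu \<theta>) f"

text \<open>A Markov operator: from the line \<open>t\<close> pass to one of its first level cells,
  chosen with probability proportional to the chord there. Its stationary measure is
  \<open>mu\<close> (see \<open>ig_PP\<close>).\<close>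

definition PP :: "real \<Rightarrow> (real \<Rightarrow> real) \<Rightarrow> real \<Rightarrow> real" where
  "PP \<theta> f t = avg L (\<lambda>Q. h \<theta> (real L * t - q \<theta> Q)) (h \<theta> t) (\<lambda>Q. f (real L * t - q \<theta> Q))"

definition BB :: "real \<Rightarrow> (real \<Rightarrow> real) \<Rightarrow> real \<Rightarrow> real" where
  "BB \<theta> f t = pairsum L X (\<lambda>Q. h \<theta> (real L * t - q \<theta> Q)) (h \<theta> t) (\<lambda>Q. f (real L * t - q \<theta> Q))"

text \<open>Like every function obtained by division by \<open>h\<close>, \<open>step \<theta> f\<close> has the junk value \<open>0\<close> where \<open>h\<close>
  vanishes, a null set of \<open>mu\<close>.\<close>
definition step :: "real \<Rightarrow> (real \<Rightarrow> real) \<Rightarrow> real \<Rightarrow> real" where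
  "step \<theta> f t = hit_prob X (\<lambda>Q. h \<theta> (real L * t - q \<theta> Q) * f (real L * t - q \<theta> Q)) / h \<theta> t"

text \<open>The adjoint of \<open>PP\<close> with respect to \<open>mu\<close>.\<close>
definition Ms :: "real \<Rightarrow> (real \<Rightarrow> real) \<Rightarrow> real \<Rightarrow> real" where
  "Ms \<theta> g s = (\<Sum>Q\<in>G. g ((s + q \<theta> Q) / real L)) / (real L)\<^sup>2"

text \<open>The constant through which the variance enters the recursion; \<open>Vfun_eq\<close>
  identifies it with the function V of the theorem.\<close>

definition Vc :: "real \<Rightarrow> real" where
  "Vc \<theta> = ig \<theta> (BB \<theta> (\<lambda>_. 1))"

text \<open>The conditional variance of \<open>f\<close> under one step of the kernel
  \<open>PP\<close>.\<close>

definition Sp :: "real \<Rightarrow> (real \<Rightarrow> real) \<Rightarrow> real \<Rightarrow> real" where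
  "Sp \<theta> f t = PP \<theta> (\<lambda>t. (f t)\<^sup>2) t - (PP \<theta> f t)\<^sup>2"

text \<open>The condition says that \<open>h * f\<close> takes values in the unit interval, as a
  hitting probability must.\<close>

definition valid :: "real \<Rightarrow> (real \<Rightarrow> real) \<Rightarrow> bool" where
  "valid \<theta> f \<longleftrightarrow> BM f \<and> (\<forall>t. 0 \<le> f t \<and> h \<theta> t * f t \<le> 1)"

sublocale C: weighted_cells L X "\<lambda>Q. h \<theta> (real L * t - q \<theta> Q)" "h \<theta> t" for \<theta> t
  by unfold_locales (use h_bounds h_self in auto)

lemma h_nonneg[simp]: "0 \<le> h \<theta> t" and h_le2: "h \<theta> t \<le> 2" using h_bounds by auto

sublocale P: prob_space "mu \<theta>" for \<theta>
  by (rule prob_spaceI) (simp add: mu_def emeasure_density h_nn)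

lemma sets_mu[measurable_cong, simp]: "sets (mu \<theta>) = sets borel" by (simp add: mu_def)

lemma BM_int[intro]: assumes "BM f" shows "integrable (mu \<theta>) f"
proof -
  from assms obtain B where "\<forall>t. \<bar>f t\<bar> \<le> B" "f \<in> borel_measurable borel" by (auto simp: BM_def)
  then show ?thesis by (intro P.integrable_const_bound[of _ B]) auto
qed

lemma ig_eq: assumes [measurable]: "f \<in> borel_measurable borel"
  shows "ig \<theta> f = (\<integral>t. h \<theta> t * f t \<partial>lborel)"
  unfolding mu_def by (subst integral_real_density) auto

lemma AE_mu: "(\<And>t. 0 < h \<theta> t \<Longrightarrow> Q t) \<Longrightarrow> AE t in mu \<theta>. Q t"
  unfolding mu_def by (subst AE_density) (auto simp: less_le ennreal_eq_0_iff)

lemma ig_mono: "BM f \<Longrightarrow> BM g \<Longrightarrow> (\<And>t. 0 < h \<theta> t \<Longrightarrow> f t \<le> g t) \<Longrightarrow> ig \<theta> f \<le> ig \<theta> g"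
  by (intro integral_mono_AE AE_mu BM_int)

lemma ig_nonneg: "(\<And>t. 0 < h \<theta> t \<Longrightarrow> 0 \<le> f t) \<Longrightarrow> 0 \<le> ig \<theta> f"
  by (intro integral_nonneg_AE AE_mu)

lemma ig_cong: "BM f \<Longrightarrow> BM g \<Longrightarrow> (\<And>t. 0 < h \<theta> t \<Longrightarrow> f t = g t) \<Longrightarrow> ig \<theta> f = ig \<theta> g"
  by (intro integral_cong_AE AE_mu) (auto dest: BM_meas)

lemma ig_const[simp]: "ig \<theta> (\<lambda>_. c) = c"
  using P.prob_space by simp

lemma ig_add: "BM f \<Longrightarrow> BM g \<Longrightarrow> ig \<theta> (\<lambda>t. f t + g t) = ig \<theta> f + ig \<theta> g"
  by (intro Bochner_Integration.integral_add BM_int)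

lemma ig_diff: "BM f \<Longrightarrow> BM g \<Longrightarrow> ig \<theta> (\<lambda>t. f t - g t) = ig \<theta> f - ig \<theta> g"
  by (intro Bochner_Integration.integral_diff BM_int)

lemma ig_cmult: "ig \<theta> (\<lambda>t. c * f t) = c * ig \<theta> f"
  by simp

lemma PP_meas[measurable]: assumes [measurable]: "f \<in> borel_measurable borel"
  shows "PP \<theta> f \<in> borel_measurable borel"
  unfolding PP_def[abs_def] avg_def by measurable

lemma BM_PP[intro]: assumes "BM f" shows "BM (PP \<theta> f)"
proof -
  from assms obtain B where B: "\<And>t. \<bar>f t\<bar> \<le> B" and [measurable]: "f \<in> borel_measurable borel"
    by (auto simp: BM_def)
  have "0 \<le> B" using B[of 0] by linarith
  have "PP \<theta> f t \<le> B" for t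
    unfolding PP_def using B \<open>0 \<le> B\<close> abs_le_D1 by (intro C.av_le_const) blast+
  moreover have "PP \<theta> (\<lambda>t. - 1 * f t) t \<le> B" for t
    unfolding PP_def using B \<open>0 \<le> B\<close> abs_le_D2 by (intro C.av_le_const) force+
  moreover have "PP \<theta> (\<lambda>t. - 1 * f t) t = - PP \<theta> f t" for t
    unfolding PP_def avg_cmult by simp
  ultimately have "\<bar>PP \<theta> f t\<bar> \<le> B" for t by (smt (verit))
  then show ?thesis by (intro BM_I) auto
qed

lemma PP_nonneg: "(\<And>t. 0 \<le> f t) \<Longrightarrow> 0 \<le> PP \<theta> f t"
  unfolding PP_def using C.w C.H by (intro avg_nonneg) auto

lemma PP_le_const: "(\<And>t. f t \<le> c) \<Longrightarrow> 0 \<le> c \<Longrightarrow> PP \<theta> f t \<le> c"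
  unfolding PP_def by (intro C.av_le_const) auto

lemma PP_const: "0 < h \<theta> t \<Longrightarrow> PP \<theta> (\<lambda>_. c) t = c"
  unfolding PP_def by (rule C.av_const)

lemma BB_nonneg: "(\<And>t. 0 \<le> f t) \<Longrightarrow> 0 \<le> BB \<theta> f t"
  unfolding BB_def by (intro C.pr_nonneg) auto

lemma BB_le: "(\<And>t. 0 \<le> f t) \<Longrightarrow> BB \<theta> f t \<le> 2 * real L * (PP \<theta> f t)\<^sup>2"
  unfolding BB_def PP_def by (intro C.pr_le) auto

lemma BM_BB[intro]: assumes "BM f" "\<And>t. 0 \<le> f t" shows "BM (BB \<theta> f)"
proof (rule BM_bounded)
  have [measurable]: "f \<in> borel_measurable borel" using assms(1) by (rule BM_meas)
  show "BB \<theta> f \<in> borel_measurable borel"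
    unfolding BB_def[abs_def] pairsum_def by measurable
  show "BM (\<lambda>t. 2 * real L * (PP \<theta> f t)\<^sup>2)"
    by (intro BM_mult BM_const BM_power BM_PP assms)
qed (use assms BB_nonneg BB_le in auto)

lemma BM_vv[intro]: "BM (BB \<theta> (\<lambda>_. 1))" by auto

lemma vv_bounds: "0 \<le> BB \<theta> (\<lambda>_. 1) t" "BB \<theta> (\<lambda>_. 1) t \<le> 2 * real L"
  unfolding BB_def by (rule C.vv_nonneg C.vv_le)+

lemma Sp_nonneg: "0 \<le> Sp \<theta> f t"
  unfolding Sp_def PP_def by (rule C.spread_nonneg)

lemma BM_Sp[intro]: "BM f \<Longrightarrow> BM (Sp \<theta> f)"
  unfolding Sp_def[abs_def] by (intro BM_diff BM_PP BM_power)

lemma BM_Ms[intro]: assumes "BM g" shows "BM (Ms \<theta> g)"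
proof -
  have "(\<lambda>s. g ((s + q \<theta> Q) / real L)) = (\<lambda>s. g ((1 / real L) * s - (- q \<theta> Q / real L)))" for Q
    by (simp add: add_divide_distrib)
  then have "BM (\<lambda>s. g ((s + q \<theta> Q) / real L))" for Q using BM_affine[OF assms, of "1 / real L" "- q \<theta> Q / real L"] by simp
  then show ?thesis unfolding Ms_def[abs_def] by (intro BM_divide_const BM_sum)
qed

lemma Ms_bounds: assumes "\<And>t. 0 \<le> g t \<and> g t \<le> B" shows "0 \<le> Ms \<theta> g s \<and> Ms \<theta> g s \<le> B"
proof
  show "0 \<le> Ms \<theta> g s" unfolding Ms_def using assms by (auto intro!: sum_nonneg divide_nonneg_nonneg)
  have "(\<Sum>Q\<in>G. g ((s + q \<theta> Q) / real L)) \<le> real (card G) * B"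
    by (rule sum_bounded_above) (use assms in auto)
  then show "Ms \<theta> g s \<le> B" by (simp add: Ms_def power2_eq_square divide_le_eq mult.commute)
qed

text \<open>The density of \<open>mu\<close> cancels the normalisation of \<open>PP\<close>. In each
  summand substitute \<open>s = L * t - q \<theta> Q\<close>; the Jacobian supplies the second
  factor \<open>1 / L\<close> of \<open>Ms\<close>.\<close>

lemma PP_duality:
  assumes g: "BM g" and f: "BM f"
  shows "ig \<theta> (\<lambda>t. g t * PP \<theta> f t) = ig \<theta> (\<lambda>t. Ms \<theta> g t * f t)"
proof -
  have [measurable]: "g \<in> borel_measurable borel" "f \<in> borel_measurable borel"
    using f g by (auto dest: BM_meas)
  have hint: "integrable lborel (h \<theta>)"
    by (rule integrableI_nonneg) (auto simp: h_nn)
  have hbm: "integrable lborel (\<lambda>t. h \<theta> t * k t)" if "BM k" for k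
  proof -
    from that obtain B where B: "\<And>t. \<bar>k t\<bar> \<le> B" by (auto simp: BM_def)
    show ?thesis
    proof (rule Bochner_Integration.integrable_bound[of _ "\<lambda>t. B * h \<theta> t"])
      show "AE t in lborel. norm (h \<theta> t * k t) \<le> norm (B * h \<theta> t)"
      proof (rule AE_I2)
        fix t have "\<bar>h \<theta> t * k t\<bar> \<le> h \<theta> t * B"
          unfolding abs_mult using B by (intro mult_mono) auto
        then show "norm (h \<theta> t * k t) \<le> norm (B * h \<theta> t)" by (simp add: mult.commute)
      qed
    qed (use hint that in \<open>auto dest: BM_meas\<close>)
  qed
  define gq where "gq Q = (\<lambda>s. g ((s + q \<theta> Q) / real L))" for Q
  have gq: "BM (gq Q)" for Q
  proof -
    have "gq Q = (\<lambda>s. g ((1 / real L) * s - (- q \<theta> Q / real L)))"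
      by (simp add: gq_def add_divide_distrib)
    then show ?thesis using BM_affine[OF g, of "1 / real L" "- q \<theta> Q / real L"] by simp
  qed
  define F where "F Q t = g t * (h \<theta> (real L * t - q \<theta> Q) * f (real L * t - q \<theta> Q))" for Q t
  have F_aff: "F Q (q \<theta> Q / real L + (1 / real L) * x) = h \<theta> x * (gq Q x * f x)" for Q x
  proof -
    have "real L * (q \<theta> Q / real L + (1 / real L) * x) - q \<theta> Q = x" by (simp add: field_simps)
    moreover have "q \<theta> Q / real L + (1 / real L) * x = (x + q \<theta> Q) / real L" by (simp add: field_simps)
    ultimately show ?thesis unfolding F_def gq_def by simp
  qed
  have F_int: "(\<integral>t. F Q t \<partial>lborel) = (\<integral>x. h \<theta> x * (gq Q x * f x) \<partial>lborel) / real L" for Q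
    by (subst lborel_integral_real_affine[of "1 / real L" "F Q" "q \<theta> Q / real L"])
       (simp_all only: F_aff, simp_all)
  have F_integrable: "integrable lborel (F Q)" for Q
  proof -
    have "integrable lborel (\<lambda>x. h \<theta> x * (gq Q x * f x))" by (intro hbm BM_mult gq f)
    then have "integrable lborel (\<lambda>x. F Q (q \<theta> Q / real L + (1 / real L) * x))"
      unfolding F_aff .
    then show ?thesis by (subst (asm) lborel_integrable_real_affine_iff) auto
  qed
  have "ig \<theta> (\<lambda>t. g t * PP \<theta> f t) = (\<integral>t. h \<theta> t * (g t * PP \<theta> f t) \<partial>lborel)"
    by (rule ig_eq) measurable
  also have "\<dots> = (\<integral>t. (\<Sum>Q\<in>G. F Q t) / real L \<partial>lborel)"
  proof (intro Bochner_Integration.integral_cong refl)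
    fix t
    show "h \<theta> t * (g t * PP \<theta> f t) = (\<Sum>Q\<in>G. F Q t) / real L"
    \<comment> \<open>Where the chord vanishes \<open>PP\<close> has the default value 0, and by
      \<open>h_self\<close> all child chords vanish as well, so the identity survives.\<close>
    proof (cases "h \<theta> t = 0")
      case True
      then have "(\<Sum>Q\<in>G. h \<theta> (real L * t - q \<theta> Q)) = 0" by (simp add: h_self)
      then have "h \<theta> (real L * t - q \<theta> Q) = 0" if "Q \<in> G" for Q
        using that by (subst (asm) sum_nonneg_eq_0_iff) auto
      then show ?thesis using True by (simp add: F_def)
    next
      case False
      then show ?thesis by (simp add: F_def PP_def avg_def flip: sum_distrib_left)
    qed
  qed
  also have "\<dots> = (\<Sum>Q\<in>G. (\<integral>t. F Q t \<partial>lborel)) / real L"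
    using F_integrable by (simp add: Bochner_Integration.integral_sum)
  also have "\<dots> = (\<Sum>Q\<in>G. (\<integral>x. h \<theta> x * (gq Q x * f x) \<partial>lborel)) / (real L)\<^sup>2"
    unfolding F_int by (simp add: sum_divide_distrib power2_eq_square)
  also have "\<dots> = (\<integral>x. (\<Sum>Q\<in>G. h \<theta> x * (gq Q x * f x)) / (real L)\<^sup>2 \<partial>lborel)"
    by (subst Bochner_Integration.integral_divide_zero)
      (subst Bochner_Integration.integral_sum, auto intro!: hbm BM_mult gq f)
  also have "\<dots> = (\<integral>x. h \<theta> x * (Ms \<theta> g x * f x) \<partial>lborel)"
    by (intro Bochner_Integration.integral_cong refl)
       (simp add: Ms_def gq_def sum_distrib_left sum_distrib_right sum_divide_distrib mult.commute mult.left_commute)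
  also have "\<dots> = ig \<theta> (\<lambda>t. Ms \<theta> g t * f t)"
    by (intro ig_eq[symmetric] borel_measurable_times BM_meas[OF BM_Ms[OF g]] BM_meas[OF f])
  finally show ?thesis .
qed

text \<open>Stationarity of \<open>mu\<close>: the adjoint fixes constants, because there are
  \<open>L\<^sup>2\<close> cells.\<close>

lemma ig_PP: assumes "BM f" shows "ig \<theta> (PP \<theta> f) = ig \<theta> f"
proof -
  have "Ms \<theta> (\<lambda>_. 1) = (\<lambda>_. 1)" by (auto simp: Ms_def power2_eq_square)
  then show ?thesis using PP_duality[OF BM_const[of 1] assms] by simp
qed

lemma ig_Sp: assumes "BM f" shows "ig \<theta> (Sp \<theta> f) = ig \<theta> (\<lambda>t. (f t)\<^sup>2) - ig \<theta> (\<lambda>t. (PP \<theta> f t)\<^sup>2)"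
  unfolding Sp_def[abs_def] using assms by (subst ig_diff) (auto simp: ig_PP BM_power)

lemma Vc_nonneg: "0 \<le> Vc \<theta>" and Vc_le: "Vc \<theta> \<le> 2 * real L"
proof -
  show "0 \<le> Vc \<theta>" unfolding Vc_def by (rule ig_nonneg) (rule vv_bounds)
  have "Vc \<theta> \<le> ig \<theta> (\<lambda>_. 2 * real L)" unfolding Vc_def using vv_bounds by (intro ig_mono) auto
  then show "Vc \<theta> \<le> 2 * real L" unfolding ig_const .
qed

lemma hit_prob_meas[measurable]:
  assumes [measurable]: "\<And>Q. p Q \<in> borel_measurable M"
  shows "(\<lambda>t. hit_prob X (\<lambda>Q. p Q t)) \<in> borel_measurable M"
proof -
  have "(\<lambda>t. hit_prob X (\<lambda>Q. p Q t)) = (\<lambda>t. 1 - (\<Sum>F\<in>set_pmf X. (\<Prod>Q\<in>F. 1 - p Q t) * pmf X F))"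
    unfolding hit_prob_def by (subst integral_measure_pmf_real[of "set_pmf X"]) auto
  then show ?thesis by simp
qed

context
  fixes \<theta> f assumes f: "valid \<theta> f"
begin

lemma fBM: "BM f" and f0: "\<And>t. 0 \<le> f t" and f1: "\<And>t. h \<theta> t * f t \<le> 1"
  using f by (auto simp: valid_def)

lemma step_nonneg: "0 \<le> step \<theta> f t" and step_le: "step \<theta> f t \<le> PP \<theta> f t"
  and step_ge: "PP \<theta> f t - BB \<theta> f t / 2 \<le> step \<theta> f t"
  and step_le_crude: "step \<theta> f t \<le> PP \<theta> f t - BB \<theta> f t / (2 * (real L)\<^sup>2)"
  and step_le_cubic: "step \<theta> f t \<le> PP \<theta> f t - BB \<theta> f t / 2 + 4 * real L ^ 6 * PP \<theta> (\<lambda>t. phi (f t)) t"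
  unfolding step_def PP_def BB_def
  by (intro C.st_nonneg C.st_le C.st_ge C.st_le_crude C.st_le_cubic; use f0 f1 in auto)+

text \<open>Undoing the division at zeros of \<open>h\<close> uses that all child chords, and with
  them the hitting probability, vanish there.\<close>

lemma h_step: "h \<theta> t * step \<theta> f t = hit_prob X (\<lambda>Q. h \<theta> (real L * t - q \<theta> Q) * f (real L * t - q \<theta> Q))"
proof (cases "h \<theta> t = 0")
  case True
  have *: "(\<Sum>Q\<in>G. h \<theta> (real L * t - q \<theta> Q)) = 0" by (simp add: h_self True)
  have "h \<theta> (real L * t - q \<theta> Q) = 0" if "Q \<in> G" for Q
    using that * by (subst (asm) sum_nonneg_eq_0_iff) auto
  then have "hit_prob X (\<lambda>Q. h \<theta> (real L * t - q \<theta> Q) * f (real L * t - q \<theta> Q)) \<le> 0"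
    using hit_prob_le[of "\<lambda>Q. h \<theta> (real L * t - q \<theta> Q) * f (real L * t - q \<theta> Q)"] by simp
  moreover have "0 \<le> hit_prob X (\<lambda>Q. h \<theta> (real L * t - q \<theta> Q) * f (real L * t - q \<theta> Q))"
    using f0 f1 by (intro hit_prob_nonneg) auto
  ultimately show ?thesis using True by simp
qed (simp add: step_def)

lemma valid_step: "valid \<theta> (step \<theta> f)"
  unfolding valid_def
proof (intro conjI allI)
  show "BM (step \<theta> f)"
  proof (rule BM_bounded[where g="PP \<theta> f"])
    have [measurable]: "f \<in> borel_measurable borel" using fBM by (rule BM_meas)
    show "step \<theta> f \<in> borel_measurable borel" unfolding step_def[abs_def] by measurable
  qed (use fBM step_nonneg step_le in auto)
  fix t
  show "0 \<le> step \<theta> f t" by (rule step_nonneg)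
  show "h \<theta> t * step \<theta> f t \<le> 1" unfolding h_step
    using f0 f1 by (intro hit_prob_le1) auto
qed

lemma PP_BB_ge: "BB \<theta> (\<lambda>_. 1) t * phi (PP \<theta> f t) / 4 - 4 * real L * Sp \<theta> f t \<le> PP \<theta> f t * BB \<theta> f t"
  unfolding PP_def BB_def Sp_def by (intro C.av_pr_ge f0)

lemma BB_near: "0 < e \<Longrightarrow> \<bar>BB \<theta> f t - BB \<theta> (\<lambda>_. 1) t * (PP \<theta> f t)\<^sup>2\<bar>
    \<le> e * (BB \<theta> (\<lambda>_. 1) t * (PP \<theta> f t)\<^sup>2) + 2 * real L * (1 + 1/e) * Sp \<theta> f t"
  unfolding PP_def BB_def Sp_def by (intro C.pr_near f0)

lemma PP_phi_le: "PP \<theta> (\<lambda>t. phi (f t)) t \<le> 8 * phi (PP \<theta> f t) + 4 * Sp \<theta> f t"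
  unfolding PP_def Sp_def by (intro C.av_phi_le f0)

end

lemma step_mono:
  assumes "valid \<theta> f" "valid \<theta> g" "\<And>t. 0 < h \<theta> t \<Longrightarrow> f t \<le> g t"
  shows "step \<theta> f t \<le> step \<theta> g t"
  unfolding step_def
proof (intro divide_right_mono hit_prob_mono conjI)
  fix Q
  show "h \<theta> (real L * t - q \<theta> Q) * f (real L * t - q \<theta> Q) \<le> h \<theta> (real L * t - q \<theta> Q) * g (real L * t - q \<theta> Q)"
    using assms(3)[of "real L * t - q \<theta> Q"] h_nonneg[of \<theta> "real L * t - q \<theta> Q"]
    by (cases "h \<theta> (real L * t - q \<theta> Q) = 0") (auto intro!: mult_left_mono simp: less_le)
qed (use f1[OF assms(2)] in auto)

end

section \<open>Decay of the second moment\<close>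

context lines
begin

declare P.prob_space [simp]

abbreviation W :: "real \<Rightarrow> (real \<Rightarrow> real) \<Rightarrow> real" where
  "W \<theta> f \<equiv> ig \<theta> (\<lambda>t. (f t)\<^sup>2)"

abbreviation it :: "real \<Rightarrow> (real \<Rightarrow> real) \<Rightarrow> nat \<Rightarrow> real \<Rightarrow> real" where
  "it \<theta> f n \<equiv> (step \<theta> ^^ n) f"

lemma valid_it: "valid \<theta> f \<Longrightarrow> valid \<theta> (it \<theta> f n)"
  by (induction n) (auto intro: valid_step)

lemma it_Suc_left: "it \<theta> f (Suc n) = it \<theta> (step \<theta> f) n"
  by (simp add: funpow_swap1)

lemma it_add: "it \<theta> f (m + n) = it \<theta> (it \<theta> f m) n"
  by (subst add.commute) (simp add: funpow_add)

context
  fixes \<theta> f assumes f: "valid \<theta> f"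
begin

lemma W_PP_le: "ig \<theta> (\<lambda>t. (PP \<theta> f t)\<^sup>2) \<le> W \<theta> f"
proof -
  have "0 \<le> ig \<theta> (Sp \<theta> f)" by (intro ig_nonneg Sp_nonneg)
  then show ?thesis unfolding ig_Sp[OF fBM[OF f]] by simp
qed

lemma W_step_le_PP: "W \<theta> (step \<theta> f) \<le> ig \<theta> (\<lambda>t. (PP \<theta> f t)\<^sup>2)"
proof (rule ig_mono)
  show "BM (\<lambda>t. (step \<theta> f t)\<^sup>2)" "BM (\<lambda>t. (PP \<theta> f t)\<^sup>2)"
    using fBM[OF f] fBM[OF valid_step[OF f]] by (auto intro: BM_power)
  show "(step \<theta> f t)\<^sup>2 \<le> (PP \<theta> f t)\<^sup>2" for t
    using step_nonneg[OF f] step_le[OF f] by (intro power_mono) auto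
qed

lemma W_step_le: "W \<theta> (step \<theta> f) \<le> W \<theta> f"
  using W_PP_le W_step_le_PP by (rule order_trans[rotated])

lemma W_nonneg: "0 \<le> W \<theta> f"
  by (rule ig_nonneg) simp

text \<open>The decrement of \<open>W\<close> has two nonnegative parts. The part lost in averaging
  is the integral of \<open>Sp\<close>. The nonlinear part controls the integral of
  \<open>?y * ?b\<close>: in the square of \<open>step\<close> one factor is bounded by the average,
  the other by the crude Bonferroni bound. By \<open>PP_BB_ge\<close> the two together dominate the
  variance density times \<open>phi\<close>.\<close>

lemma vv_phi_le: "ig \<theta> (\<lambda>t. BB \<theta> (\<lambda>_. 1) t * phi (PP \<theta> f t))
    \<le> (8 * (real L)\<^sup>2 + 16 * real L) * (W \<theta> f - W \<theta> (step \<theta> f))"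
proof -
  let ?y = "PP \<theta> f" and ?b = "BB \<theta> f" and ?v = "BB \<theta> (\<lambda>_. 1)"
  have y0: "0 \<le> ?y t" for t by (rule PP_nonneg) (rule f0[OF f])
  have b0: "0 \<le> ?b t" for t by (rule BB_nonneg) (rule f0[OF f])
  have bms: "BM f" "BM ?y" "BM ?b" "BM ?v" "BM (step \<theta> f)" "BM (\<lambda>t. phi (?y t))" "BM (Sp \<theta> f)"
    using fBM[OF f] f0[OF f] fBM[OF valid_step[OF f]] y0 by (auto intro!: BM_phi)
  have 1: "(step \<theta> f t)\<^sup>2 \<le> (?y t)\<^sup>2 - (?y t * ?b t) / (2 * (real L)\<^sup>2)" for t
  proof -
    have "step \<theta> f t * step \<theta> f t \<le> ?y t * (?y t - ?b t / (2 * (real L)\<^sup>2))"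
      using step_nonneg[OF f] step_le[OF f] step_le_crude[OF f] y0 by (intro mult_mono) auto
    then show ?thesis by (simp add: power2_eq_square algebra_simps)
  qed
  have "W \<theta> (step \<theta> f) \<le> ig \<theta> (\<lambda>t. (?y t)\<^sup>2 - (?y t * ?b t) / (2 * (real L)\<^sup>2))"
    by (intro ig_mono 1 BM_power BM_diff BM_divide_const BM_mult bms)
  also have "\<dots> = ig \<theta> (\<lambda>t. (?y t)\<^sup>2) - ig \<theta> (\<lambda>t. ?y t * ?b t) / (2 * (real L)\<^sup>2)"
    by (subst ig_diff) (auto intro!: BM_power BM_divide_const BM_mult bms)
  finally have A: "ig \<theta> (\<lambda>t. ?y t * ?b t) \<le> 2 * (real L)\<^sup>2 * (ig \<theta> (\<lambda>t. (?y t)\<^sup>2) - W \<theta> (step \<theta> f))"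
    by (simp add: field_simps)
  have "ig \<theta> (\<lambda>t. ?v t * phi (?y t) / 4 - 4 * real L * Sp \<theta> f t) \<le> ig \<theta> (\<lambda>t. ?y t * ?b t)"
    by (intro ig_mono PP_BB_ge f BM_diff BM_divide_const BM_mult BM_const bms)
  also have "ig \<theta> (\<lambda>t. ?v t * phi (?y t) / 4 - 4 * real L * Sp \<theta> f t)
     = ig \<theta> (\<lambda>t. ?v t * phi (?y t)) / 4 - 4 * real L * ig \<theta> (Sp \<theta> f)"
    by (subst ig_diff) (auto intro!: BM_divide_const BM_mult bms)
  finally have B: "ig \<theta> (\<lambda>t. ?v t * phi (?y t))
    \<le> 4 * ig \<theta> (\<lambda>t. ?y t * ?b t) + 16 * real L * ig \<theta> (Sp \<theta> f)" by argo
  define e k where "e = ig \<theta> (Sp \<theta> f)" and "k = ig \<theta> (\<lambda>t. (?y t)\<^sup>2) - W \<theta> (step \<theta> f)"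
  have e: "0 \<le> e" "e = W \<theta> f - ig \<theta> (\<lambda>t. (?y t)\<^sup>2)"
    unfolding e_def by (rule ig_nonneg[OF Sp_nonneg], rule ig_Sp[OF fBM[OF f]])
  have k: "0 \<le> k" unfolding k_def using W_step_le_PP by simp
  have "ig \<theta> (\<lambda>t. ?v t * phi (?y t)) \<le> 8 * (real L)\<^sup>2 * k + 16 * real L * e"
    using A B unfolding e_def k_def by argo
  also have "\<dots> \<le> (8 * (real L)\<^sup>2 + 16 * real L) * k + (8 * (real L)\<^sup>2 + 16 * real L) * e"
    using e k by (intro add_mono mult_right_mono) auto
  also have "\<dots> = (8 * (real L)\<^sup>2 + 16 * real L) * (W \<theta> f - W \<theta> (step \<theta> f))"
    unfolding k_def e(2) by (simp add: algebra_simps)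
  finally show ?thesis .
qed

text \<open>Together with \<open>phi_PP_le\<close> this trades one application of \<open>Ms\<close>
  to the weight for one generation of the recursion on \<open>f\<close>, at the price of a multiple
  of the decrement of \<open>W\<close>.\<close>

lemma Ms_phi_le:
  assumes G: "BM g" "\<And>t. 0 \<le> g t \<and> g t \<le> 2 * real L"
  shows "ig \<theta> (\<lambda>t. Ms \<theta> g t * phi (f t)) \<le>
    8 * ig \<theta> (\<lambda>t. g t * phi (PP \<theta> f t)) + 8 * real L * (W \<theta> f - W \<theta> (step \<theta> f))"
proof -
  let ?y = "PP \<theta> f"
  have y0: "0 \<le> ?y t" for t by (rule PP_nonneg) (rule f0[OF f])
  have bms: "BM f" "BM (\<lambda>t. phi (f t))" "BM ?y" "BM (\<lambda>t. phi (?y t))" "BM (Sp \<theta> f)"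
    using fBM[OF f] f0[OF f] y0 by (auto intro!: BM_phi)
  have "ig \<theta> (\<lambda>t. Ms \<theta> g t * phi (f t)) = ig \<theta> (\<lambda>t. g t * PP \<theta> (\<lambda>t. phi (f t)) t)"
    using G bms by (intro PP_duality[symmetric])
  also have "\<dots> \<le> ig \<theta> (\<lambda>t. 8 * (g t * phi (?y t)) + 8 * real L * Sp \<theta> f t)"
  proof (intro ig_mono BM_add BM_mult BM_const BM_PP bms G(1))
    fix t
    have "g t * PP \<theta> (\<lambda>t. phi (f t)) t \<le> g t * (8 * phi (?y t) + 4 * Sp \<theta> f t)"
      using PP_phi_le[OF f] G by (intro mult_left_mono) auto
    moreover have "g t * (4 * Sp \<theta> f t) \<le> 2 * real L * (4 * Sp \<theta> f t)"
      using G Sp_nonneg by (intro mult_right_mono) auto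
    ultimately show "g t * PP \<theta> (\<lambda>t. phi (f t)) t \<le> 8 * (g t * phi (?y t)) + 8 * real L * Sp \<theta> f t"
      by (simp add: algebra_simps)
  qed
  also have "\<dots> = 8 * ig \<theta> (\<lambda>t. g t * phi (?y t)) + 8 * real L * ig \<theta> (Sp \<theta> f)"
    by (subst ig_add) (auto intro!: BM_mult bms G)
  also have "ig \<theta> (Sp \<theta> f) \<le> W \<theta> f - W \<theta> (step \<theta> f)"
    using ig_Sp[OF bms(1)] W_step_le_PP by simp
  finally show ?thesis by simp
qed

lemma phi_PP_le:
  assumes G: "BM g" "\<And>t. 0 \<le> g t \<and> g t \<le> 2 * real L"
  shows "ig \<theta> (\<lambda>t. g t * phi (PP \<theta> f t)) \<le>
    8 * ig \<theta> (\<lambda>t. g t * phi (step \<theta> f t)) + 4 * real L * (W \<theta> f - W \<theta> (step \<theta> f))"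
proof -
  let ?y = "PP \<theta> f" and ?s = "step \<theta> f"
  have y0: "0 \<le> ?y t" for t by (rule PP_nonneg) (rule f0[OF f])
  have bms: "BM f" "BM ?y" "BM (\<lambda>t. phi (?y t))" "BM ?s" "BM (\<lambda>t. phi (?s t))"
    using fBM[OF f] fBM[OF valid_step[OF f]] step_nonneg[OF f] y0 by (auto intro!: BM_phi)
  have "ig \<theta> (\<lambda>t. g t * phi (?y t)) \<le> ig \<theta> (\<lambda>t. 8 * (g t * phi (?s t)) + 4 * real L * ((?y t)\<^sup>2 - (?s t)\<^sup>2))"
  proof (intro ig_mono BM_add BM_mult BM_const BM_diff BM_power bms G(1))
    fix t
    have "?s t ^ 2 \<le> ?y t ^ 2" using step_nonneg[OF f] step_le[OF f] by (intro power_mono) auto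
    then have "g t * (2 * ((?y t)\<^sup>2 - (?s t)\<^sup>2)) \<le> 2 * real L * (2 * ((?y t)\<^sup>2 - (?s t)\<^sup>2))"
      using G by (intro mult_right_mono) auto
    moreover have "g t * phi (?y t) \<le> g t * (8 * phi (?s t) + 2 * ((?y t)\<^sup>2 - (?s t)\<^sup>2))"
      using phi_le_drop[OF step_nonneg[OF f] step_le[OF f]] G by (intro mult_left_mono) auto
    ultimately show "g t * phi (?y t) \<le> 8 * (g t * phi (?s t)) + 4 * real L * ((?y t)\<^sup>2 - (?s t)\<^sup>2)"
      by (simp add: algebra_simps)
  qed
  also have "\<dots> = 8 * ig \<theta> (\<lambda>t. g t * phi (?s t)) + 4 * real L * (ig \<theta> (\<lambda>t. (?y t)\<^sup>2) - W \<theta> ?s)"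
    by (subst ig_add) (auto intro!: BM_mult BM_diff BM_power bms G simp: ig_diff BM_power bms)
  also have "ig \<theta> (\<lambda>t. (?y t)\<^sup>2) - W \<theta> ?s \<le> W \<theta> f - W \<theta> ?s"
    using W_PP_le by simp
  finally show ?thesis by simp
qed

end

lemma W_it_antimono:
  assumes f: "valid \<theta> f" and mn: "m \<le> n"
  shows "W \<theta> (it \<theta> f n) \<le> W \<theta> (it \<theta> f m)"
  using mn
proof (induction n rule: dec_induct)
  case (step n)
  then show ?case using W_step_le[OF valid_it[OF f, of n]] by simp
qed simp

text \<open>One trade multiplies the constant by 8 * 8, once for \<open>Ms_phi_le\<close> and once
  for \<open>phi_PP_le\<close>, and adds \<open>8 * 4 * L + 8 * L\<close> decrements. The initial
  value combines \<open>Ms_phi_le\<close> with \<open>vv_phi_le\<close>.\<close>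

fun chainC :: "nat \<Rightarrow> real" where
  "chainC 0 = 8 * (8 * (real L)\<^sup>2 + 16 * real L) + 8 * real L"
| "chainC (Suc j) = 64 * chainC j + 40 * real L"

lemma chainC_pos: "0 < chainC j"
  by (induction j) (auto intro!: add_pos_pos)

lemma Ms_pow_bounds:
  assumes "BM g" "\<And>t. 0 \<le> g t \<and> g t \<le> B"
  shows "BM ((Ms \<theta> ^^ j) g) \<and> (\<forall>t. 0 \<le> (Ms \<theta> ^^ j) g t \<and> (Ms \<theta> ^^ j) g t \<le> B)"
proof (induction j)
  case (Suc j)
  have "BM (Ms \<theta> ((Ms \<theta> ^^ j) g))" using Suc by auto
  moreover have "0 \<le> Ms \<theta> ((Ms \<theta> ^^ j) g) t \<and> Ms \<theta> ((Ms \<theta> ^^ j) g) t \<le> B" for t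
    using Suc by (intro Ms_bounds) auto
  ultimately show ?case by simp
qed (use assms in auto)

text \<open>The weight is pushed forward along the orbit of \<open>f\<close> until it is
  \<open>g\<close> itself, where it is compared with the variance density; the decrements of
  \<open>W\<close> collected on the way telescope. The gain is that the powers of \<open>Ms\<close>
  applied to \<open>g\<close> can be nearly constant although \<open>g\<close> has zeros.\<close>

lemma chain:
  assumes g: "BM g" "\<And>t. 0 \<le> g t \<and> g t \<le> 2 * real L" "\<And>t. 0 < h \<theta> t \<Longrightarrow> g t \<le> BB \<theta> (\<lambda>_. 1) t"
  shows "valid \<theta> f \<Longrightarrow> ig \<theta> (\<lambda>t. (Ms \<theta> ^^ Suc j) g t * phi (f t)) \<le> chainC j * (W \<theta> f - W \<theta> (it \<theta> f (Suc j)))"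
proof (induction j arbitrary: f)
  case (0 f)
  have y0: "0 \<le> PP \<theta> f t" for t by (rule PP_nonneg) (rule f0[OF 0])
  have bms: "BM (\<lambda>t. phi (PP \<theta> f t))" using fBM[OF 0] y0 by (auto intro!: BM_phi)
  have "ig \<theta> (\<lambda>t. g t * phi (PP \<theta> f t)) \<le> ig \<theta> (\<lambda>t. BB \<theta> (\<lambda>_. 1) t * phi (PP \<theta> f t))"
    using g phi_nonneg[OF y0] by (intro ig_mono BM_mult bms BM_vv mult_right_mono) auto
  also have "\<dots> \<le> (8 * (real L)\<^sup>2 + 16 * real L) * (W \<theta> f - W \<theta> (step \<theta> f))"
    by (rule vv_phi_le[OF 0])
  finally show ?case using Ms_phi_le[OF 0 g(1,2)] by (simp add: algebra_simps)
next
  case (Suc j f)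
  let ?G = "(Ms \<theta> ^^ Suc j) g" and ?s = "step \<theta> f"
  have G: "BM ?G" "\<And>t. 0 \<le> ?G t \<and> ?G t \<le> 2 * real L"
    using Ms_pow_bounds[OF g(1,2), where j="Suc j" and \<theta>=\<theta>] by blast+
  have d: "0 \<le> W \<theta> f - W \<theta> ?s" using W_step_le[OF Suc.prems] by simp
  have "ig \<theta> (\<lambda>t. (Ms \<theta> ^^ Suc (Suc j)) g t * phi (f t)) = ig \<theta> (\<lambda>t. Ms \<theta> ?G t * phi (f t))"
    by simp
  also have "\<dots> \<le> 8 * (8 * ig \<theta> (\<lambda>t. ?G t * phi (?s t)) + 4 * real L * (W \<theta> f - W \<theta> ?s)) + 8 * real L * (W \<theta> f - W \<theta> ?s)"
    using Ms_phi_le[OF Suc.prems G] phi_PP_le[OF Suc.prems G] by argo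
  also have "\<dots> = 64 * ig \<theta> (\<lambda>t. ?G t * phi (?s t)) + 40 * real L * (W \<theta> f - W \<theta> ?s)"
    by (simp add: algebra_simps)
  also have "ig \<theta> (\<lambda>t. ?G t * phi (?s t)) \<le> chainC j * (W \<theta> ?s - W \<theta> (it \<theta> f (Suc (Suc j))))"
    using Suc.IH[OF valid_step[OF Suc.prems]] unfolding it_Suc_left[where \<theta>=\<theta> and f=f] .
  also have "64 * (chainC j * (W \<theta> ?s - W \<theta> (it \<theta> f (Suc (Suc j))))) + 40 * real L * (W \<theta> f - W \<theta> ?s)
     \<le> chainC (Suc j) * (W \<theta> ?s - W \<theta> (it \<theta> f (Suc (Suc j)))) + chainC (Suc j) * (W \<theta> f - W \<theta> ?s)"
  proof -
    have "W \<theta> (it \<theta> f (Suc (Suc j))) \<le> W \<theta> ?s"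
      using W_it_antimono[OF Suc.prems, of 1 "Suc (Suc j)"] by simp
    then have "64 * chainC j * (W \<theta> ?s - W \<theta> (it \<theta> f (Suc (Suc j)))) \<le> chainC (Suc j) * (W \<theta> ?s - W \<theta> (it \<theta> f (Suc (Suc j))))"
      by (intro mult_right_mono) auto
    moreover have "40 * real L * (W \<theta> f - W \<theta> ?s) \<le> chainC (Suc j) * (W \<theta> f - W \<theta> ?s)"
      using d chainC_pos[of j] by (intro mult_right_mono) auto
    ultimately show ?thesis by simp
  qed
  also have "\<dots> = chainC (Suc j) * (W \<theta> f - W \<theta> (it \<theta> f (Suc (Suc j))))" by (simp add: algebra_simps)
  finally show ?case by simp
qed

text \<open>For the linear recursion duality would give equality with the iterated adjoint. The
  nonlinear one loses mass, and the weight is at most \<open>2 * L\<close> on the lost mass.\<close>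

lemma ig_step_ge:
  assumes G: "BM g" "\<And>t. 0 \<le> g t \<and> g t \<le> 2 * real L" and f: "valid \<theta> f"
  shows "ig \<theta> (\<lambda>t. (Ms \<theta> ^^ j) g t * f t) - 2 * real L * (ig \<theta> f - ig \<theta> (it \<theta> f j))
     \<le> ig \<theta> (\<lambda>t. g t * it \<theta> f j t)"
  using G
proof (induction j arbitrary: g)
  case (Suc j g)
  let ?f = "it \<theta> f j"
  have v: "valid \<theta> ?f" by (rule valid_it[OF f])
  have bms: "BM ?f" "BM (PP \<theta> ?f)" "BM (step \<theta> ?f)"
    using fBM[OF v] fBM[OF valid_step[OF v]] by auto
  have "ig \<theta> (\<lambda>t. g t * PP \<theta> ?f t - 2 * real L * (PP \<theta> ?f t - step \<theta> ?f t)) \<le> ig \<theta> (\<lambda>t. g t * step \<theta> ?f t)"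
  proof (intro ig_mono BM_diff BM_mult BM_const bms Suc.prems(1))
    fix t
    have "g t * (PP \<theta> ?f t - step \<theta> ?f t) \<le> 2 * real L * (PP \<theta> ?f t - step \<theta> ?f t)"
      using Suc.prems step_le[OF v] by (intro mult_right_mono) auto
    then show "g t * PP \<theta> ?f t - 2 * real L * (PP \<theta> ?f t - step \<theta> ?f t) \<le> g t * step \<theta> ?f t"
      by (simp add: algebra_simps)
  qed
  also have "ig \<theta> (\<lambda>t. g t * PP \<theta> ?f t - 2 * real L * (PP \<theta> ?f t - step \<theta> ?f t))
     = ig \<theta> (\<lambda>t. Ms \<theta> g t * ?f t) - 2 * real L * (ig \<theta> ?f - ig \<theta> (step \<theta> ?f))"
    using bms Suc.prems(1) by (simp add: ig_diff BM_mult BM_diff PP_duality ig_PP)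
  finally have 1: "ig \<theta> (\<lambda>t. Ms \<theta> g t * ?f t) - 2 * real L * (ig \<theta> ?f - ig \<theta> (step \<theta> ?f)) \<le> ig \<theta> (\<lambda>t. g t * step \<theta> ?f t)" .
  have 2: "ig \<theta> (\<lambda>t. (Ms \<theta> ^^ j) (Ms \<theta> g) t * f t) - 2 * real L * (ig \<theta> f - ig \<theta> ?f) \<le> ig \<theta> (\<lambda>t. Ms \<theta> g t * ?f t)"
    by (intro Suc.IH BM_Ms Ms_bounds Suc.prems)
  have 3: "(Ms \<theta> ^^ Suc j) g = (Ms \<theta> ^^ j) (Ms \<theta> g)" by (simp add: funpow_swap1)
  show ?case unfolding 3 using 1 2 by (simp add: algebra_simps)
qed simp

lemma ig_drop_le: assumes f: "valid \<theta> f" shows "ig \<theta> f - ig \<theta> (step \<theta> f) \<le> real L * W \<theta> f"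
proof -
  have bms: "BM f" "BM (PP \<theta> f)" "BM (step \<theta> f)" using fBM[OF f] fBM[OF valid_step[OF f]] by auto
  have "ig \<theta> f - ig \<theta> (step \<theta> f) = ig \<theta> (\<lambda>t. PP \<theta> f t - step \<theta> f t)"
    using bms by (simp add: ig_diff ig_PP)
  also have "\<dots> \<le> ig \<theta> (\<lambda>t. real L * (PP \<theta> f t)\<^sup>2)"
  proof (intro ig_mono BM_diff BM_mult BM_const BM_power bms)
    fix t show "PP \<theta> f t - step \<theta> f t \<le> real L * (PP \<theta> f t)\<^sup>2"
      using step_ge[OF f, of t] BB_le[of f \<theta> t, OF f0[OF f]] by simp
  qed
  also have "\<dots> = real L * ig \<theta> (\<lambda>t. (PP \<theta> f t)\<^sup>2)" by simp
  also have "\<dots> \<le> real L * W \<theta> f" using W_PP_le[OF f] by (intro mult_left_mono) auto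
  finally show ?thesis .
qed

lemma ig_step_mono: assumes f: "valid \<theta> f" shows "ig \<theta> (step \<theta> f) \<le> ig \<theta> f"
proof -
  have bms: "BM f" "BM (PP \<theta> f)" "BM (step \<theta> f)" using fBM[OF f] fBM[OF valid_step[OF f]] by auto
  have "ig \<theta> (step \<theta> f) \<le> ig \<theta> (PP \<theta> f)" using step_le[OF f] bms by (intro ig_mono) auto
  then show ?thesis using bms by (simp add: ig_PP)
qed

lemma ig_it_drop_le: assumes f: "valid \<theta> f"
  shows "ig \<theta> f - ig \<theta> (it \<theta> f j) \<le> real j * (real L * W \<theta> f)"
proof (induction j)
  case (Suc j)
  have "ig \<theta> (it \<theta> f j) - ig \<theta> (step \<theta> (it \<theta> f j)) \<le> real L * W \<theta> (it \<theta> f j)"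
    by (rule ig_drop_le[OF valid_it[OF f]])
  also have "\<dots> \<le> real L * W \<theta> f" using W_it_antimono[OF f, of 0 j] by (intro mult_left_mono) auto
  finally show ?case using Suc by (simp add: algebra_simps)
qed simp

lemma ig_sq_le: assumes "BM f" shows "(ig \<theta> f)\<^sup>2 \<le> W \<theta> f"
proof -
  define a where "a = ig \<theta> f"
  have "0 \<le> ig \<theta> (\<lambda>t. (f t - a)\<^sup>2)" by (rule ig_nonneg) simp
  also have "\<dots> = ig \<theta> (\<lambda>t. ((f t)\<^sup>2 - (2 * a) * f t) + a\<^sup>2)"
    by (intro arg_cong[where f="ig \<theta>"] ext) (simp add: power2_eq_square algebra_simps)
  also have "\<dots> = W \<theta> f - 2 * a * a + a\<^sup>2"
    using assms by (subst ig_add; (subst ig_diff)?) (auto intro!: BM_diff BM_power BM_mult BM_const simp: a_def)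
  finally show ?thesis unfolding a_def[symmetric] by (simp add: power2_eq_square)
qed

lemma W_le_bound: assumes f: "valid \<theta> f" "\<And>t. f t \<le> K" shows "W \<theta> f \<le> K\<^sup>2"
proof -
  have "W \<theta> f \<le> ig \<theta> (\<lambda>_. K\<^sup>2)"
    using f0[OF f(1)] fBM[OF f(1)] f(2) by (intro ig_mono BM_power BM_const power_mono) auto
  then show ?thesis by simp
qed

lemma const_valid: "0 \<le> c \<Longrightarrow> c \<le> 1/2 \<Longrightarrow> valid \<theta> (\<lambda>_. c)"
  unfolding valid_def
proof (intro conjI allI)
  fix t assume "0 \<le> c" "c \<le> 1/2"
  then have "h \<theta> t * c \<le> 2 * (1/2)" by (intro mult_mono) (auto simp: h_le2)
  then show "h \<theta> t * c \<le> 1" by simp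
qed auto

text \<open>A constant \<open>s\<close> is mapped to at least \<open>s - L * s\<^sup>2\<close>, and
  the harmonic sequence with constant \<open>1 / (2 * L)\<close> is a subsolution of this map. The
  pointwise bound is what allows reciprocals of the iterates with only linear growth.\<close>

lemma it_lower:
  assumes f: "valid \<theta> f" and c: "\<And>t. 0 < h \<theta> t \<Longrightarrow> 1 / (2 * real L) \<le> f t" and t: "0 < h \<theta> t"
  shows "1 / (2 * real L * (real n + 1)) \<le> it \<theta> f n t"
  using t
proof (induction n arbitrary: t)
  case 0 then show ?case using c by simp
next
  case (Suc n)
  define s where "s = 1 / (2 * real L * (real n + 1))"
  have "2 * 1 \<le> real L * (real n + 1)" using L2 by (intro mult_mono) auto
  then have "s \<le> 1/2" and s0: "0 < s" by (auto simp: s_def divide_le_eq)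
  then have vs: "valid \<theta> (\<lambda>_. s)" by (intro const_valid) auto
  have P: "PP \<theta> (\<lambda>_. s) t = s" by (rule PP_const[OF Suc.prems])
  have "s - real L * s\<^sup>2 \<le> step \<theta> (\<lambda>_. s) t"
    using step_ge[OF vs, of t] BB_le[of "\<lambda>_. s" \<theta> t] s0 P by simp
  also have "\<dots> \<le> step \<theta> (it \<theta> f n) t"
    using Suc.IH by (intro step_mono vs valid_it f) (auto simp: s_def)
  also have "1 / (2 * real L * (real (Suc n) + 1)) \<le> s - real L * s\<^sup>2"
  proof -
    define N where "N = real n + 1"
    have N: "1 \<le> N" by (simp add: N_def)
    have "0 \<le> (N - 1) / (4 * real L * N\<^sup>2 * (N + 1))" using N by simp
    also have "\<dots> = (s - real L * s\<^sup>2) - 1 / (2 * real L * (N + 1))"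
    proof -
      have nz: "N \<noteq> 0" "N + 1 \<noteq> 0" "1 + N \<noteq> 0" using N by auto
      have "real L * s\<^sup>2 = 1 / (4 * real L * N\<^sup>2)"
        by (simp add: s_def N_def[symmetric] power_mult_distrib power_divide power2_eq_square)
      then show ?thesis using nz unfolding s_def N_def[symmetric]
        by (simp add: divide_simps power2_eq_square) (simp add: algebra_simps)
    qed
    finally show ?thesis by (simp add: N_def algebra_simps)
  qed
  finally show ?case by simp
qed

end

text \<open>There are two regimes. Above 1 the recursion contracts by the factor
  \<open>1 - c\<close>, so that about \<open>2 * ln K / c\<close> steps suffice to come down from
  \<open>K\<^sup>2\<close>. Below 1 the square root \<open>x\<close> satisfies
  \<open>x' \<le> x * (1 - c * x / 2)\<close> and is compared with the reciprocal of a linear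
  function.\<close>

lemma sqrt_recursion_decay:
  fixes w :: "nat \<Rightarrow> real"
  assumes c: "0 < c" "c \<le> 1/2" and w0: "\<And>j. 0 \<le> w j" and K: "w 0 \<le> K\<^sup>2" "1 \<le> K"
    and rec: "\<And>j. w (Suc j) \<le> w j - c * w j * min 1 (sqrt (w j))"
    and j0: "2 * ln K / c \<le> real j0"
  shows "w (j0 + i) \<le> 1 / (1 + c * real i / 2)\<^sup>2"
proof (induction i)
  case 0
  have "w j \<le> max 1 (exp (- c * real j) * K\<^sup>2)" for j
  proof (induction j)
    case (Suc j)
    show ?case
    proof (cases "w j \<le> 1")
      case True
      have "0 \<le> c * w j * min 1 (sqrt (w j))" using c w0[of j] by auto
      with True rec[of j] show ?thesis by simp
    next
      case False
      then have "w (Suc j) \<le> (1 - c) * w j" using rec[of j] by (simp add: min_def algebra_simps)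
      also have "\<dots> \<le> exp (- c) * w j"
        using exp_ge_add_one_self[of "- c"] w0 by (intro mult_right_mono) auto
      also have "w j \<le> exp (- c * real j) * K\<^sup>2" using Suc False by auto
      also have "exp (- c) * (exp (- c * real j) * K\<^sup>2) = exp (- c * real (Suc j)) * K\<^sup>2"
        by (simp add: algebra_simps flip: exp_add)
      finally show ?thesis by simp
    qed
  qed (use K in simp)
  then have "w j0 \<le> max 1 (exp (- c * real j0) * K\<^sup>2)" .
  also have "exp (- c * real j0) * K\<^sup>2 \<le> 1"
  proof -
    have "2 * ln K \<le> c * real j0" using j0 c by (simp add: divide_le_eq mult.commute)
    then have "exp (- c * real j0) \<le> exp (- (2 * ln K))" by simp
    also have "\<dots> = 1 / K\<^sup>2"
    proof -
      have "exp (2 * ln K) = K\<^sup>2" using K by (simp add: exp_double)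
      then show ?thesis by (simp only: exp_minus inverse_eq_divide)
    qed
    finally have "exp (- c * real j0) * K\<^sup>2 \<le> 1 / K\<^sup>2 * K\<^sup>2" by (rule mult_right_mono) auto
    then show ?thesis using K by simp
  qed
  finally show ?case by simp
next
  case (Suc i)
  define s x where "s = 1 + c * real i / 2" and "x = sqrt (w (j0 + i))"
  have s: "1 \<le> s" using c by (simp add: s_def)
  have x0: "0 \<le> x" and wx: "w (j0 + i) = x\<^sup>2" using w0 by (auto simp: x_def)
  have "x \<le> sqrt (1 / s\<^sup>2)" unfolding x_def s_def by (rule real_sqrt_le_mono[OF Suc])
  then have xs: "x \<le> 1 / s" using s by (simp add: real_sqrt_divide)
  also have "1 / s \<le> 1" using s by simp
  finally have x1: "x \<le> 1" .
  \<comment> \<open>As \<open>c \<le> 1/2\<close>, the map is increasing on the unit interval, so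
    the induction bound \<open>1 / s\<close> may be inserted.\<close>
  have mono: "x * (1 - c * x / 2) \<le> 1 / s * (1 - c * (1 / s) / 2)"
  proof -
    have "0 \<le> (1 / s - x) * (1 - c / 2 * (1 / s + x))"
    proof (rule mult_nonneg_nonneg)
      have "c / 2 * (1 / s + x) \<le> c / 2 * 2" using c x1 \<open>1 / s \<le> 1\<close> by (intro mult_left_mono) auto
      then show "0 \<le> 1 - c / 2 * (1 / s + x)" using c by argo
    qed (use xs in simp)
    then show ?thesis by (simp add: algebra_simps diff_divide_distrib)
  qed
  also have "\<dots> \<le> 1 / (s + c / 2)"
  proof -
    have "1 / s * (1 - c * (1 / s) / 2) = (2 * s - c) / (2 * s\<^sup>2)"
      using s by (simp add: field_simps power2_eq_square)
    also have "\<dots> \<le> 1 / (s + c / 2)"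
    proof -
      have "(2 * s - c) * (s + c / 2) \<le> 1 * (2 * s\<^sup>2)" by (simp add: algebra_simps power2_eq_square)
      then show ?thesis using s c by (intro frac_le_eq[THEN iffD2] | simp add: divide_simps)+
    qed
    finally show ?thesis .
  qed
  finally have 1: "x * (1 - c * x / 2) \<le> 1 / (s + c / 2)" .
  have cx: "c * x \<le> 1" using mult_mono[of c "1/2" x 1] c x0 x1 by simp
  have "w (Suc (j0 + i)) \<le> x\<^sup>2 - c * x\<^sup>2 * x" using rec[of "j0 + i"] x1 x0 by (simp add: wx min_def)
  also have "\<dots> \<le> (x * (1 - c * x / 2))\<^sup>2"
  proof -
    have "(x * (1 - c * x / 2))\<^sup>2 = (x\<^sup>2 - c * x\<^sup>2 * x) + (c * x\<^sup>2 / 2)\<^sup>2"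
      by (simp add: power2_eq_square algebra_simps)
    then show ?thesis by simp
  qed
  also have "\<dots> \<le> (1 / (s + c / 2))\<^sup>2" using 1 x0 cx by (intro power_mono mult_nonneg_nonneg) auto
  finally show ?case by (simp add: s_def power_divide add_divide_distrib algebra_simps)
qed

text \<open>Second-order expansion of the reciprocal: the smallness condition gives
  \<open>b \<le> y\<close>, so the denominator of the remainder stays above
  \<open>y / 2\<close>.\<close>

lemma inverse_step_bound:
  fixes y b l :: real
  assumes y: "0 < y" and b: "0 \<le> b" "b \<le> 2 * l * y\<^sup>2" and l: "0 < l" "2 * l * y \<le> 1"
  shows "0 < y - b / 2 \<and> 1 / (y - b / 2) \<le> 1 / y + b / (2 * y\<^sup>2) + 2 * l\<^sup>2 * y"
proof
  have "2 * l * y\<^sup>2 \<le> 1 * y" using mult_right_mono[OF l(2), of y] y by (simp add: power2_eq_square mult.assoc)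
  then have bley: "b \<le> y" using b by simp
  then show pos: "0 < y - b / 2" using y by simp
  have "1 / (y - b / 2) = 1 / y + b / (2 * y\<^sup>2) + b\<^sup>2 / (4 * y\<^sup>2 * (y - b / 2))"
    using y pos by (simp add: divide_simps power2_eq_square) (simp add: algebra_simps)
  also have "b\<^sup>2 / (4 * y\<^sup>2 * (y - b / 2)) \<le> (2 * l * y\<^sup>2)\<^sup>2 / (4 * y\<^sup>2 * (y / 2))"
    using b bley y pos by (intro frac_le power_mono mult_left_mono mult_pos_pos) auto
  also have "\<dots> = 2 * l\<^sup>2 * y" using y by (simp add: power2_eq_square)
  finally show "1 / (y - b / 2) \<le> 1 / y + b / (2 * y\<^sup>2) + 2 * l\<^sup>2 * y" by simp
qed

text \<open>Summation by parts: a decrement weighted by \<open>m\<^sup>2\<close> is a decrement of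
  the weighted sequence up to the change of the weight, which the quadratic decay makes
  \<open>O(1/m)\<close>.\<close>

lemma weighted_drop_le:
  fixes w :: "nat \<Rightarrow> real"
  assumes w: "w (m + k) \<le> C / (real (m + k))\<^sup>2" and C: "0 \<le> C" and m: "0 < m"
  shows "(real m)\<^sup>2 * (w m - w (m + k)) \<le> (real m)\<^sup>2 * w m - (real (m + k))\<^sup>2 * w (m + k) + 2 * real k * C / real m"
proof -
  let ?n = "real (m + k)"
  have n: "0 < ?n" using m by simp
  have "(?n\<^sup>2 - (real m)\<^sup>2) * w (m + k) \<le> (?n\<^sup>2 - (real m)\<^sup>2) * (C / ?n\<^sup>2)"
    by (intro mult_left_mono w) (simp add: power_mono)
  also have "\<dots> \<le> (2 * real k * ?n) * (C / ?n\<^sup>2)"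
    using C by (intro mult_right_mono) (auto simp: power2_eq_square algebra_simps)
  also have "\<dots> = 2 * real k * C / ?n" using n by (simp add: power2_eq_square)
  also have "\<dots> \<le> 2 * real k * C / real m" using m C by (intro divide_left_mono) auto
  finally show ?thesis by (simp add: algebra_simps)
qed

section \<open>Asymptotics of the recursion\<close>

text \<open>The variance density \<open>BB \<theta> (\<lambda>_. 1)\<close> may oscillate where \<open>h\<close> is small; a more regular minorant \<open>g\<close>
  replaces it in the mixing argument.\<close>
locale crit = lines +
  fixes V0 :: real
  assumes V0: "0 < V0" and Vc_ge: "V0 \<le> Vc \<theta>"
    and minor: "0 < \<delta> \<Longrightarrow> \<exists>k. \<forall>\<theta>. \<exists>g. BM g \<and> (\<forall>t. 0 \<le> g t \<and> g t \<le> 2 * real L) \<and>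
      (\<forall>t. 0 < h \<theta> t \<longrightarrow> g t \<le> BB \<theta> (\<lambda>_. 1) t) \<and> (\<forall>s. 0 < h \<theta> s \<longrightarrow> Vc \<theta> - \<delta> \<le> (Ms \<theta> ^^ Suc k) g s)"
begin

lemma phi_drop:
  obtains k C where "0 < k" "0 < C"
    "\<And>\<theta> f. valid \<theta> f \<Longrightarrow> ig \<theta> (\<lambda>t. phi (f t)) \<le> C * (W \<theta> f - W \<theta> (it \<theta> f k))"
proof -
  from minor[of "V0 / 2"] V0 obtain j where j: "\<And>\<theta>. \<exists>g. BM g \<and> (\<forall>t. 0 \<le> g t \<and> g t \<le> 2 * real L) \<and>
      (\<forall>t. 0 < h \<theta> t \<longrightarrow> g t \<le> BB \<theta> (\<lambda>_. 1) t) \<and> (\<forall>s. 0 < h \<theta> s \<longrightarrow> Vc \<theta> - V0/2 \<le> (Ms \<theta> ^^ Suc j) g s)"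
    by auto
  show ?thesis
  proof (rule that[of "Suc j" "2 * chainC j / V0"])
    fix \<theta> f assume f: "valid \<theta> f"
    obtain g where g: "BM g" "\<And>t. 0 \<le> g t \<and> g t \<le> 2 * real L" "\<And>t. 0 < h \<theta> t \<Longrightarrow> g t \<le> BB \<theta> (\<lambda>_. 1) t"
      and gV: "\<And>s. 0 < h \<theta> s \<Longrightarrow> Vc \<theta> - V0/2 \<le> (Ms \<theta> ^^ Suc j) g s" using j[of \<theta>] by blast
    have bm: "BM (\<lambda>t. phi (f t))" using fBM[OF f] f0[OF f] by auto
    have G: "BM ((Ms \<theta> ^^ Suc j) g)" using Ms_pow_bounds[OF g(1,2)] by blast
    have "V0 / 2 * ig \<theta> (\<lambda>t. phi (f t)) = ig \<theta> (\<lambda>t. V0 / 2 * phi (f t))" by simp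
    also have "\<dots> \<le> ig \<theta> (\<lambda>t. (Ms \<theta> ^^ Suc j) g t * phi (f t))"
    proof (intro ig_mono BM_mult BM_const bm G)
      fix t assume "0 < h \<theta> t"
      then have "V0/2 \<le> (Ms \<theta> ^^ Suc j) g t" using gV[of t] Vc_ge[of \<theta>] by argo
      then show "V0 / 2 * phi (f t) \<le> (Ms \<theta> ^^ Suc j) g t * phi (f t)"
        using phi_nonneg[OF f0[OF f]] by (rule mult_right_mono)
    qed
    also have "\<dots> \<le> chainC j * (W \<theta> f - W \<theta> (it \<theta> f (Suc j)))" by (rule chain[OF g f])
    finally show "ig \<theta> (\<lambda>t. phi (f t)) \<le> 2 * chainC j / V0 * (W \<theta> f - W \<theta> (it \<theta> f (Suc j)))"
      using V0 by (simp add: field_simps)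
  qed (use chainC_pos V0 in auto)
qed

text \<open>Along blocks of \<open>k\<close> generations \<open>phi_drop\<close> yields the
  recursion of \<open>sqrt_recursion_decay\<close>. The constant depends neither on the direction
  nor on the start; the size \<open>K\<close> of the start only delays the decay.\<close>

lemma W_decay:
  obtains C where "0 < C"
    "\<And>\<theta> f K n. valid \<theta> f \<Longrightarrow> (\<And>t. f t \<le> K) \<Longrightarrow> 1 \<le> K \<Longrightarrow> C * (1 + ln K) \<le> real n \<Longrightarrow>
       W \<theta> (it \<theta> f n) \<le> C / (real n)\<^sup>2"
proof -
  obtain k C1 where k: "0 < k" and C1: "0 < C1"
    and dr: "\<And>\<theta> f. valid \<theta> f \<Longrightarrow> ig \<theta> (\<lambda>t. phi (f t)) \<le> C1 * (W \<theta> f - W \<theta> (it \<theta> f k))"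
    by (rule phi_drop) blast
  define c where "c = min (1/2) (3 / (8 * C1))"
  have c: "0 < c" "c \<le> 1/2" using C1 by (auto simp: c_def)
  have cC: "C1 * c \<le> 3 / 8" using C1 by (simp add: c_def min_def field_simps)
  have rec: "W \<theta> (it \<theta> f k) \<le> W \<theta> f - c * W \<theta> f * min 1 (sqrt (W \<theta> f))" if f: "valid \<theta> f" for \<theta> f
  proof -
    \<comment> \<open>The minorant of \<open>phi\<close> is taken with \<open>l = m / 2\<close>.
      Since \<open>m\<^sup>2 \<le> w\<close>, it integrates to at least
      \<open>(1/2 - 1/8) * w * m\<close>, the origin of the constant 3/8.\<close>
    define w m where "w = W \<theta> f" and "m = min 1 (sqrt w)"
    have w: "0 \<le> w" unfolding w_def by (rule W_nonneg[OF f])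
    have m: "0 \<le> m" "m \<le> 1" "m\<^sup>2 \<le> w" using w by (auto simp: m_def min_def power_le_one)
    have bms: "BM f" "BM (\<lambda>t. phi (f t))" using fBM[OF f] f0[OF f] by auto
    have "ig \<theta> (\<lambda>t. (m/2) * (f t)\<^sup>2 - (m/2)^3) \<le> ig \<theta> (\<lambda>t. phi (f t))"
      using m f0[OF f] by (intro ig_mono phi_ge_linear BM_diff BM_mult BM_const BM_power bms) auto
    also have "ig \<theta> (\<lambda>t. (m/2) * (f t)\<^sup>2 - (m/2)^3) = (m/2) * w - (m/2)^3"
      using bms by (subst ig_diff) (auto intro!: BM_mult BM_power simp: w_def)
    finally have 1: "(m/2) * w - (m/2)^3 \<le> ig \<theta> (\<lambda>t. phi (f t))" .
    have "(m/2)^3 = (m/8) * m\<^sup>2" by (simp add: power2_eq_square power3_eq_cube)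
    also have "\<dots> \<le> (m/8) * w" using m by (intro mult_left_mono) auto
    finally have "3/8 * (w * m) \<le> ig \<theta> (\<lambda>t. phi (f t))" using 1 by (simp add: algebra_simps)
    also have "\<dots> \<le> C1 * (w - W \<theta> (it \<theta> f k))" unfolding w_def by (rule dr[OF f])
    finally have "3/8 * (w * m) \<le> C1 * (w - W \<theta> (it \<theta> f k))" .
    moreover have "C1 * c * (w * m) \<le> 3/8 * (w * m)" using cC w m by (intro mult_right_mono) auto
    ultimately have "C1 * c * (w * m) \<le> C1 * (w - W \<theta> (it \<theta> f k))" by (rule order_trans[rotated])
    then have "C1 * (c * (w * m)) \<le> C1 * (w - W \<theta> (it \<theta> f k))" by (simp only: mult.assoc)
    then have "c * (w * m) \<le> w - W \<theta> (it \<theta> f k)" using C1 by simp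
    then show ?thesis by (simp add: w_def m_def)
  qed
  \<comment> \<open>The first two terms let the \<open>j0\<close> blocks spent above 1 leave at
    least \<open>n / (2 * k)\<close> blocks for the quadratic regime; the last term is the constant
    of that regime.\<close>
  define C where "C = 4 * real k + 4 * real k / c + 16 * (real k)\<^sup>2 / c\<^sup>2"
  show ?thesis
  proof (rule that[of C])
    show "0 < C" using k c by (auto simp: C_def intro!: add_pos_pos)
    fix \<theta> f K n
    assume f: "valid \<theta> f" and fK: "\<And>t. f t \<le> K" and K: "1 \<le> K" and n: "C * (1 + ln K) \<le> real n"
    have lnK: "0 \<le> ln K" using K by simp
    define j0 j where "j0 = nat \<lceil>2 * ln K / c\<rceil>" and "j = n div k"
    have j0: "2 * ln K / c \<le> real j0" "real j0 \<le> 2 * ln K / c + 1"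
      using lnK c by (auto simp: j0_def intro: real_nat_ceiling_ge) (simp add: of_nat_nat)?
    have jn: "real n / real k - 1 \<le> real j"
    proof -
      have "n < k * (j + 1)" unfolding j_def using k
        by (metis add.commute dividend_less_times_div mult.commute mult_Suc plus_1_eq_Suc mult_Suc_right)
      then have "real n < real k * (real j + 1)" by (metis of_nat_less_iff of_nat_mult of_nat_add of_nat_1)
      then show ?thesis using k by (simp add: field_simps)
    qed
    have "(4 * real k + 4 * real k / c) * (1 + ln K) \<le> C * (1 + ln K)"
      using lnK by (intro mult_right_mono) (auto simp: C_def)
    moreover have "4 * real k + 4 * real k / c * ln K \<le> (4 * real k + 4 * real k / c) * (1 + ln K)"
    proof -
      have "0 \<le> 4 * real k * ln K" "0 \<le> 4 * real k / c" using lnK c by auto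
      then show ?thesis by (simp only: distrib_left distrib_right mult_1_right)
    qed
    ultimately have n': "4 * real k + 4 * real k / c * ln K \<le> real n" using n by linarith
    have "(4 * real k + 4 * real k / c * ln K) / (2 * real k) \<le> real n / (2 * real k)"
      using n' k by (intro divide_right_mono) auto
    moreover have "(4 * real k + 4 * real k / c * ln K) / (2 * real k) = 2 + 2 * ln K / c"
      using k by (simp add: add_divide_distrib)
    ultimately have n2: "2 + 2 * ln K / c \<le> real n / (2 * real k)" by simp
    have half: "real n / real k = real n / (2 * real k) + real n / (2 * real k)" by simp
    have ji: "real n / (2 * real k) \<le> real j - real j0" using jn j0 n2 half by linarith
    have npos: "0 < real n" using n' k lnK c
      by (smt (verit) divide_nonneg_pos mult_nonneg_nonneg of_nat_0_le_iff of_nat_0_less_iff)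
    have jj: "j0 \<le> j" using ji npos k by (smt (verit) divide_nonneg_nonneg of_nat_0_le_iff of_nat_le_iff)
    define i where "i = j - j0"
    have i: "real n / (2 * real k) \<le> real i" "j = j0 + i" using ji jj by (auto simp: i_def of_nat_diff)
    have "W \<theta> (it \<theta> f (k * (j0 + i))) \<le> 1 / (1 + c * real i / 2)\<^sup>2"
    proof (rule sqrt_recursion_decay[OF c _ _ K _ j0(1)])
      show "0 \<le> W \<theta> (it \<theta> f (k * j))" for j by (rule W_nonneg[OF valid_it[OF f]])
      show "W \<theta> (it \<theta> f (k * 0)) \<le> K\<^sup>2" using W_le_bound[OF f fK] by simp
      show "W \<theta> (it \<theta> f (k * Suc j)) \<le> W \<theta> (it \<theta> f (k * j)) - c * W \<theta> (it \<theta> f (k * j)) * min 1 (sqrt (W \<theta> (it \<theta> f (k * j))))" for j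
      proof -
        have e: "k * Suc j = k * j + k" by simp
        show ?thesis unfolding e it_add by (rule rec[OF valid_it[OF f]])
      qed
    qed
    also have "\<dots> \<le> 1 / (c * (real n / (2 * real k)) / 2)\<^sup>2"
    proof -
      have p: "0 < 1 + c * real i / 2" using c by (intro add_pos_nonneg) auto
      show ?thesis
    proof (intro divide_left_mono power_mono)
      have "c * (real n / (2 * real k)) \<le> c * real i" using c i by (intro mult_left_mono) auto
      then show "c * (real n / (2 * real k)) / 2 \<le> 1 + c * real i / 2" by simp
    qed (use c k npos p in auto)
    qed
    also have "\<dots> = 16 * (real k)\<^sup>2 / c\<^sup>2 / (real n)\<^sup>2"
      by (simp add: power_mult_distrib power_divide)
    also have "\<dots> \<le> C / (real n)\<^sup>2"
      using c k by (intro divide_right_mono) (auto simp: C_def)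
    finally have "W \<theta> (it \<theta> f (k * (j0 + i))) \<le> C / (real n)\<^sup>2" .
    moreover have "W \<theta> (it \<theta> f n) \<le> W \<theta> (it \<theta> f (k * j))"
      by (rule W_it_antimono[OF f]) (simp add: j_def)
    ultimately show "W \<theta> (it \<theta> f n) \<le> C / (real n)\<^sup>2" using i by simp
  qed
qed

text \<open>The drop is measured at generation \<open>j\<close> but tested against the start:
  between the two, \<open>j\<close> adjoint steps smooth the weight. The subtracted terms are the
  mass lost during these steps and a decrement of \<open>W\<close>, which pays for spread and cubic
  errors.\<close>

lemma drop_ge:
  assumes d: "0 < \<delta>" "\<delta> \<le> 1" "\<delta> \<le> V0 / 2"
  obtains j k E where "0 < k" "0 < E"
    "\<And>\<theta> f. valid \<theta> f \<Longrightarrow>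
      (ig \<theta> (it \<theta> f j))\<^sup>2 * (Vc \<theta> / 2 - (1 + real L) * \<delta>)
       - 2 * real L * ig \<theta> (it \<theta> f j) * (ig \<theta> f - ig \<theta> (it \<theta> f j))
       - E * (W \<theta> (it \<theta> f j) - W \<theta> (it \<theta> f (j + k)))
      \<le> ig \<theta> (it \<theta> f j) - ig \<theta> (it \<theta> f (Suc j))"
proof -
  obtain k C1 where k: "0 < k" and C1: "0 < C1"
    and dr: "\<And>\<theta> f. valid \<theta> f \<Longrightarrow> ig \<theta> (\<lambda>t. phi (f t)) \<le> C1 * (W \<theta> f - W \<theta> (it \<theta> f k))"
    by (rule phi_drop) blast
  from minor[of \<delta>] d obtain j where j: "\<And>\<theta>. \<exists>g. BM g \<and> (\<forall>t. 0 \<le> g t \<and> g t \<le> 2 * real L) \<and>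
      (\<forall>t. 0 < h \<theta> t \<longrightarrow> g t \<le> BB \<theta> (\<lambda>_. 1) t) \<and> (\<forall>s. 0 < h \<theta> s \<longrightarrow> Vc \<theta> - \<delta> \<le> (Ms \<theta> ^^ Suc j) g s)"
    by auto
  define E where "E = real L * (1 + 1 / \<delta>) + 4 * real L ^ 6 * C1"
  show ?thesis
  proof (rule that[of k E j])
    show "0 < E" using d C1 by (auto simp: E_def intro!: add_pos_pos mult_pos_pos)
    fix \<theta> f0 assume f0v: "valid \<theta> f0"
    define f where "f = it \<theta> f0 j"
    have f: "valid \<theta> f" unfolding f_def by (rule valid_it[OF f0v])
    let ?y = "PP \<theta> f" and ?v = "BB \<theta> (\<lambda>_. 1)"
    obtain g where g: "BM g" "\<And>t. 0 \<le> g t \<and> g t \<le> 2 * real L" "\<And>t. 0 < h \<theta> t \<Longrightarrow> g t \<le> BB \<theta> (\<lambda>_. 1) t"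
      and gV: "\<And>s. 0 < h \<theta> s \<Longrightarrow> Vc \<theta> - \<delta> \<le> (Ms \<theta> ^^ Suc j) g s" using j[of \<theta>] by blast
    have y0: "0 \<le> ?y t" for t by (rule PP_nonneg) (rule f0[OF f])
    have bms: "BM f0" "BM f" "BM ?y" "BM ?v" "BM (BB \<theta> f)" "BM (Sp \<theta> f)" "BM (step \<theta> f)" "BM (\<lambda>t. phi (f t))"
      "BM ((Ms \<theta> ^^ Suc j) g)"
      using fBM[OF f] fBM[OF f0v] f0[OF f] fBM[OF valid_step[OF f]] Ms_pow_bounds[OF g(1,2)] by auto
    define a b V Wd where "a = ig \<theta> f" and "b = ig \<theta> f0" and "V = Vc \<theta>"
      and "Wd = W \<theta> f - W \<theta> (it \<theta> f k)"
    have a0: "0 \<le> a" unfolding a_def by (intro ig_nonneg f0[OF f])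
    have ab: "a \<le> b" unfolding a_def b_def f_def
      using ig_step_mono[OF valid_it[OF f0v]] by (induction j) (auto intro: order_trans)
    have V: "V0 \<le> V" "V \<le> 2 * real L" unfolding V_def by (rule Vc_ge Vc_le)+
    have Wk: "W \<theta> (it \<theta> f k) \<le> W \<theta> (step \<theta> f)"
      using W_it_antimono[OF f, of 1 k] k by simp
    have eta: "ig \<theta> (Sp \<theta> f) \<le> Wd"
      using ig_Sp[OF bms(2)] W_step_le_PP[OF f] Wk unfolding Wd_def by simp
    have phi: "ig \<theta> (\<lambda>t. phi (f t)) \<le> C1 * Wd" unfolding Wd_def by (rule dr[OF f])
    \<comment> \<open>First order: duality carries the weight back to \<open>f0\<close>, where it is
      at least \<open>V - \<delta>\<close>.\<close>
    have gy: "(V - \<delta>) * a - 2 * real L * (b - a) \<le> ig \<theta> (\<lambda>t. g t * ?y t)"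
    proof -
      have "(V - \<delta>) * a \<le> (V - \<delta>) * b" using ab V d by (intro mult_left_mono) auto
      also have "\<dots> = ig \<theta> (\<lambda>t. (V - \<delta>) * f0 t)" by (simp add: b_def)
      also have "\<dots> \<le> ig \<theta> (\<lambda>t. (Ms \<theta> ^^ Suc j) g t * f0 t)"
        using gV f0[OF f0v] by (intro ig_mono BM_mult BM_const bms mult_right_mono) (auto simp: V_def)
      also have "\<dots> - 2 * real L * (b - a) \<le> ig \<theta> (\<lambda>t. Ms \<theta> g t * f t)"
        using ig_step_ge[OF BM_Ms[OF g(1), of \<theta>] Ms_bounds[OF g(2), of \<theta>] f0v, of j]
        unfolding a_def b_def f_def by (simp add: funpow_swap1)
      also have "\<dots> = ig \<theta> (\<lambda>t. g t * ?y t)" by (rule PP_duality[symmetric]) (rule g bms)+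
      finally show ?thesis by simp
    qed
    \<comment> \<open>Second order from first order:
      \<open>y\<^sup>2 \<ge> 2 * a * y - a\<^sup>2\<close>, integrated against \<open>g\<close>,
      whose total mass is at most \<open>V\<close>.\<close>
    have gyy: "a\<^sup>2 * (V - 2 * \<delta>) - 4 * real L * a * (b - a) \<le> ig \<theta> (\<lambda>t. g t * (?y t)\<^sup>2)"
    proof -
      have "ig \<theta> g \<le> V" unfolding V_def Vc_def by (intro ig_mono g(1) bms g(3))
      then have 1: "a\<^sup>2 * ig \<theta> g \<le> a\<^sup>2 * V" by (intro mult_left_mono) auto
      have 2: "2 * a * ((V - \<delta>) * a - 2 * real L * (b - a)) \<le> 2 * a * ig \<theta> (\<lambda>t. g t * ?y t)"
        using a0 by (intro mult_left_mono gy) auto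
      have "ig \<theta> (\<lambda>t. 2 * a * (g t * ?y t) - a\<^sup>2 * g t) \<le> ig \<theta> (\<lambda>t. g t * (?y t)\<^sup>2)"
      proof (intro ig_mono BM_diff BM_mult BM_const BM_power bms g(1))
        fix t
        have "0 \<le> g t * (?y t - a)\<^sup>2" using g(2) by simp
        then show "2 * a * (g t * ?y t) - a\<^sup>2 * g t \<le> g t * (?y t)\<^sup>2"
          by (simp add: power2_eq_square algebra_simps)
      qed
      also have "ig \<theta> (\<lambda>t. 2 * a * (g t * ?y t) - a\<^sup>2 * g t) = 2 * a * ig \<theta> (\<lambda>t. g t * ?y t) - a\<^sup>2 * ig \<theta> g"
        by (subst ig_diff) (auto intro!: BM_mult bms g(1))
      finally show ?thesis using 1 2 by (simp add: algebra_simps power2_eq_square)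
    qed
    have bb: "(1 - \<delta>) * ig \<theta> (\<lambda>t. g t * (?y t)\<^sup>2) - 2 * real L * (1 + 1/\<delta>) * ig \<theta> (Sp \<theta> f) \<le> ig \<theta> (BB \<theta> f)"
    proof -
      have "ig \<theta> (\<lambda>t. (1 - \<delta>) * (g t * (?y t)\<^sup>2) - 2 * real L * (1 + 1/\<delta>) * Sp \<theta> f t) \<le> ig \<theta> (BB \<theta> f)"
      proof (intro ig_mono BM_diff BM_mult BM_const BM_power bms g(1))
        fix t assume t: "0 < h \<theta> t"
        have "(1 - \<delta>) * (g t * (?y t)\<^sup>2) \<le> (1 - \<delta>) * (?v t * (?y t)\<^sup>2)"
          using d g(3)[OF t] by (intro mult_left_mono mult_right_mono) auto
        also have "\<dots> = ?v t * (?y t)\<^sup>2 - \<delta> * (?v t * (?y t)\<^sup>2)" by (simp add: algebra_simps)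
        finally show "(1 - \<delta>) * (g t * (?y t)\<^sup>2) - 2 * real L * (1 + 1/\<delta>) * Sp \<theta> f t \<le> BB \<theta> f t"
          using BB_near[OF f d(1), of t] unfolding abs_le_iff by argo
      qed
      then show ?thesis by (subst (asm) ig_diff) (auto intro!: BM_mult BM_power bms g(1))
    qed
    have step: "ig \<theta> (BB \<theta> f) / 2 - 4 * real L ^ 6 * ig \<theta> (\<lambda>t. phi (f t)) \<le> a - ig \<theta> (step \<theta> f)"
    proof -
      have "ig \<theta> (step \<theta> f) \<le> ig \<theta> (\<lambda>t. ?y t - BB \<theta> f t / 2 + 4 * real L ^ 6 * PP \<theta> (\<lambda>t. phi (f t)) t)"
        by (intro ig_mono BM_diff BM_add BM_divide_const BM_mult BM_const BM_PP bms step_le_cubic f)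
      also have "\<dots> = a - ig \<theta> (BB \<theta> f) / 2 + 4 * real L ^ 6 * ig \<theta> (\<lambda>t. phi (f t))"
        using bms by (subst ig_add; (subst ig_diff)?)
          (auto intro!: BM_diff BM_divide_const BM_mult BM_PP simp: ig_PP a_def)
      finally show ?thesis by simp
    qed
    have Wd0: "0 \<le> Wd" unfolding Wd_def using W_it_antimono[OF f, of 0 k] by simp
    \<comment> \<open>The factor \<open>1 - \<delta>\<close> costs
      \<open>V * \<delta> \<le> 2 * L * \<delta>\<close>; adding the earlier
      \<open>2 * \<delta>\<close> gives the coefficient \<open>2 + 2 * L\<close>.\<close>
    have "a\<^sup>2 * (V - (2 + 2 * real L) * \<delta>) - 4 * real L * a * (b - a)
       \<le> (1 - \<delta>) * (a\<^sup>2 * (V - 2 * \<delta>) - 4 * real L * a * (b - a))"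
    proof -
      have "V * \<delta> \<le> 2 * real L * \<delta>" using V d by (intro mult_right_mono) auto
      moreover have "0 \<le> \<delta> * \<delta>" by simp
      moreover have "(1 - \<delta>) * (V - 2 * \<delta>) = V - 2 * \<delta> - V * \<delta> + 2 * (\<delta> * \<delta>)"
        "(2 + 2 * real L) * \<delta> = 2 * \<delta> + 2 * real L * \<delta>" by (simp_all add: algebra_simps)
      ultimately have "V - (2 + 2 * real L) * \<delta> \<le> (1 - \<delta>) * (V - 2 * \<delta>)" by argo
      then have "a\<^sup>2 * (V - (2 + 2 * real L) * \<delta>) \<le> a\<^sup>2 * ((1 - \<delta>) * (V - 2 * \<delta>))" by (intro mult_left_mono) auto
      moreover have "(1 - \<delta>) * (4 * real L * a * (b - a)) \<le> 1 * (4 * real L * a * (b - a))"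
        using d a0 ab by (intro mult_right_mono) auto
      ultimately show ?thesis by (simp add: algebra_simps)
    qed
    also have "\<dots> \<le> (1 - \<delta>) * ig \<theta> (\<lambda>t. g t * (?y t)\<^sup>2)"
      using d by (intro mult_left_mono gyy) auto
    finally have A: "a\<^sup>2 * (V - (2 + 2 * real L) * \<delta>) - 4 * real L * a * (b - a) \<le> (1 - \<delta>) * ig \<theta> (\<lambda>t. g t * (?y t)\<^sup>2)" .
    have B: "2 * real L * (1 + 1/\<delta>) * ig \<theta> (Sp \<theta> f) \<le> 2 * real L * (1 + 1/\<delta>) * Wd"
      using d by (intro mult_left_mono eta) auto
    have D: "4 * real L ^ 6 * ig \<theta> (\<lambda>t. phi (f t)) \<le> 4 * real L ^ 6 * (C1 * Wd)"
      by (intro mult_left_mono phi) auto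
    have EW: "E * Wd = real L * (1 + 1 / \<delta>) * Wd + 4 * real L ^ 6 * (C1 * Wd)" by (simp add: E_def algebra_simps)
    have "a\<^sup>2 * (V / 2 - (1 + real L) * \<delta>) - 2 * real L * a * (b - a) - E * Wd
       = (a\<^sup>2 * (V - (2 + 2 * real L) * \<delta>) - 4 * real L * a * (b - a)) / 2 - E * Wd"
      by (simp add: algebra_simps add_divide_distrib diff_divide_distrib)
    also have "\<dots> \<le> a - ig \<theta> (step \<theta> f)" using A B D EW bb step by argo
    finally show "(ig \<theta> (it \<theta> f0 j))\<^sup>2 * (Vc \<theta> / 2 - (1 + real L) * \<delta>)
       - 2 * real L * ig \<theta> (it \<theta> f0 j) * (ig \<theta> f0 - ig \<theta> (it \<theta> f0 j))
       - E * (W \<theta> (it \<theta> f0 j) - W \<theta> (it \<theta> f0 (j + k)))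
      \<le> ig \<theta> (it \<theta> f0 j) - ig \<theta> (it \<theta> f0 (Suc j))"
      unfolding a_def b_def V_def Wd_def f_def it_add by simp
  qed (rule k)
qed

text \<open>This bounds the mean from above. Dividing \<open>drop_ge\<close> by the squared mean
  gives an increment of its reciprocal. Since the reciprocal grows at most linearly, the lost mass
  contributes \<open>O(1/m)\<close>, and the decrements of \<open>W\<close>, now weighted by
  \<open>m\<^sup>2\<close>, nearly telescope.\<close>

lemma upper_asymptotics:
  assumes e: "0 < \<epsilon>"
  obtains D where "0 < D"
    "\<And>\<theta> f K n. valid \<theta> f \<Longrightarrow> (\<And>t. 0 < h \<theta> t \<Longrightarrow> 1 / (2 * real L) \<le> f t) \<Longrightarrow> (\<And>t. f t \<le> K) \<Longrightarrow> 1 \<le> K \<Longrightarrow>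
       real n * (Vc \<theta> / 2 - \<epsilon>) - D * (1 + ln K) \<le> 1 / ig \<theta> (it \<theta> f n)"
proof -
  define \<delta> where "\<delta> = min (min 1 (V0 / 2)) (\<epsilon> / (2 + real L))"
  have d: "0 < \<delta>" "\<delta> \<le> 1" "\<delta> \<le> V0 / 2" "(2 + real L) * \<delta> \<le> \<epsilon>"
  proof -
    have "\<delta> \<le> \<epsilon> / (2 + real L)" by (simp add: \<delta>_def)
    then show "(2 + real L) * \<delta> \<le> \<epsilon>" by (simp add: field_simps add_pos_pos)
    show "\<delta> \<le> V0 / 2" unfolding \<delta>_def by (rule min.coboundedI1) (rule min.cobounded2)
  qed (use V0 e in \<open>auto simp: \<delta>_def add_pos_pos\<close>)
  obtain j k E where k: "0 < k" and E: "0 < E" and drop: "\<And>\<theta> f. valid \<theta> f \<Longrightarrow>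
      (ig \<theta> (it \<theta> f j))\<^sup>2 * (Vc \<theta> / 2 - (1 + real L) * \<delta>)
       - 2 * real L * ig \<theta> (it \<theta> f j) * (ig \<theta> f - ig \<theta> (it \<theta> f j))
       - E * (W \<theta> (it \<theta> f j) - W \<theta> (it \<theta> f (j + k)))
      \<le> ig \<theta> (it \<theta> f j) - ig \<theta> (it \<theta> f (Suc j))"
    by (rule drop_ge[OF d(1-3)]) blast
  obtain C where C: "0 < C" and dec: "\<And>\<theta> f K n. valid \<theta> f \<Longrightarrow> (\<And>t. f t \<le> K) \<Longrightarrow> 1 \<le> K \<Longrightarrow> C * (1 + ln K) \<le> real n \<Longrightarrow>
       W \<theta> (it \<theta> f n) \<le> C / (real n)\<^sup>2" by (rule W_decay) blast
  define D0 where "D0 = 32 * (real L)^3 * real j * C + 32 * (real L)\<^sup>2 * E * real k * C"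
  define E1 where "E1 = 16 * (real L)\<^sup>2 * E"
  have D0: "0 \<le> D0" and E1: "0 < E1" using C E by (auto simp: D0_def E1_def)
  define D where "D = real L * (2 * real j + 2 * C + D0 / \<delta> + 2) + E1 * real k * C"
  show ?thesis
  proof (rule that[of D])
    show "0 < D" unfolding D_def using C D0 E1 d by (intro add_pos_nonneg mult_pos_pos add_nonneg_pos) auto
    fix \<theta> f K n
    assume f: "valid \<theta> f" and fl: "\<And>t. 0 < h \<theta> t \<Longrightarrow> 1 / (2 * real L) \<le> f t"
      and fK: "\<And>t. f t \<le> K" and K: "1 \<le> K"
    have lnK: "0 \<le> ln K" using K by simp
    define V where "V = Vc \<theta>"
    have V: "0 \<le> V" "V \<le> 2 * real L" unfolding V_def by (rule Vc_nonneg Vc_le)+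
    define a w where "a m = ig \<theta> (it \<theta> f m)" and "w m = W \<theta> (it \<theta> f m)" for m
    have vit: "valid \<theta> (it \<theta> f m)" for m by (rule valid_it[OF f])
    have alow: "1 / (2 * real L * (real m + 1)) \<le> a m" for m
    proof -
      have "ig \<theta> (\<lambda>_. 1 / (2 * real L * (real m + 1))) \<le> a m"
        unfolding a_def by (intro ig_mono BM_const fBM[OF vit] it_lower f fl)
      then show ?thesis unfolding ig_const .
    qed
    have apos: "0 < a m" for m
      using alow[of m] by (rule less_le_trans[rotated]) (simp add: add_pos_pos)
    have amono: "a (Suc m) \<le> a m" for m unfolding a_def using ig_step_mono[OF vit, of m] by simp
    \<comment> \<open>From \<open>M\<close> on, the decay of \<open>W\<close> is already available
      at \<open>m - j\<close>, and errors of the form \<open>D0 / m\<close> are at most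
      \<open>\<delta>\<close>.\<close>
    define M where "M = nat \<lceil>2 * real j + 2 * C * (1 + ln K) + D0 / \<delta> + 1\<rceil>"
    have arg0: "0 \<le> 2 * real j + 2 * C * (1 + ln K) + D0 / \<delta> + 1" using C lnK D0 d by (auto intro!: add_nonneg_nonneg)
    have M: "2 * real j + 2 * C * (1 + ln K) + D0 / \<delta> + 1 \<le> real M"
      unfolding M_def by (rule real_nat_ceiling_ge)
    have M2: "real M \<le> 2 * real j + 2 * C * (1 + ln K) + D0 / \<delta> + 2"
      unfolding M_def using arg0 by linarith
    have CK: "0 \<le> C * (1 + ln K)" and Dd: "0 \<le> D0 / \<delta>" using C lnK D0 d by auto
    have wM: "w m \<le> C / (real m)\<^sup>2" if "M \<le> m" for m
    proof -
      have "C * (1 + ln K) \<le> real m" using that M CK Dd by linarith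
      then show ?thesis unfolding w_def by (rule dec[OF f fK K])
    qed
    have inc: "V / 2 - (2 + real L) * \<delta> - E1 * ((real m)\<^sup>2 * w m - (real (m + k))\<^sup>2 * w (m + k)) \<le> 1 / a (Suc m) - 1 / a m"
      if m: "M \<le> m" for m
    proof -
      have mr: "2 * real j + 2 * C * (1 + ln K) + D0 / \<delta> + 1 \<le> real m" using m M by linarith
      then have m1: "1 \<le> real m" "2 * real j \<le> real m" "2 * (C * (1 + ln K)) \<le> real m" "D0 / \<delta> \<le> real m"
        using CK Dd by linarith+
      \<comment> \<open>\<open>drop_ge\<close> starts \<open>j\<close> generations before the one
        whose drop it estimates.\<close>
      define m' where "m' = m - j"
      have mm': "m = m' + j" and m'2: "real m \<le> 2 * real m'" using m1 by (auto simp: m'_def of_nat_diff)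
      have "C * (1 + ln K) \<le> real m'" using m1(3) m'2 by linarith
      then have wm': "w m' \<le> C / (real m')\<^sup>2" unfolding w_def by (rule dec[OF f fK K])
      have "C / (real m')\<^sup>2 \<le> C / (real m / 2)\<^sup>2"
        using C m'2 m1 by (intro divide_left_mono power_mono mult_pos_pos) (auto simp: zero_less_power)
      with wm' have wm'4: "w m' \<le> 4 * C / (real m)\<^sup>2" by (simp add: power_divide mult.commute)
      have w0: "0 \<le> w m" for m unfolding w_def by (rule W_nonneg[OF vit])
      define d where "d = a m' - a m"
      have itm': "it \<theta> (it \<theta> f m') i = it \<theta> f (m' + i)" for i by (rule it_add[symmetric])
      have d1: "d \<le> real j * (real L * w m')"
        using ig_it_drop_le[OF vit[of m'], of j] unfolding d_def a_def w_def mm' itm' .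
      also have "\<dots> \<le> real j * (real L * (4 * C / (real m)\<^sup>2))" by (intro mult_left_mono wm'4) auto
      finally have d2: "d \<le> 4 * real j * real L * C / (real m)\<^sup>2" by (simp add: algebra_simps)
      have inva: "1 / a m \<le> 4 * real L * real m"
      proof -
        have "1 / a m \<le> 1 / (1 / (2 * real L * (real m + 1)))"
          using alow[of m] apos[of m] by (intro divide_left_mono mult_pos_pos divide_pos_pos add_nonneg_pos) auto
        also have "\<dots> = 2 * real L * (real m + 1)" by simp
        also have "\<dots> \<le> 2 * real L * (2 * real m)" using m1 by (intro mult_left_mono) auto
        finally show ?thesis by simp
      qed
      have key: "(a m)\<^sup>2 * (V / 2 - (1 + real L) * \<delta>) - 2 * real L * a m * d - E * (w m - w (m + k)) \<le> a m - a (Suc m)"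
        using drop[OF vit[of m']] unfolding itm' a_def w_def d_def V_def mm'
        by (simp add: add.assoc)
      have "(a m - a (Suc m)) / (a m * a m) \<le> (a m - a (Suc m)) / (a m * a (Suc m))"
        using amono[of m] apos[of m] apos[of "Suc m"] by (intro divide_left_mono mult_left_mono mult_pos_pos) auto
      also have "\<dots> = 1 / a (Suc m) - 1 / a m"
        using apos[of m] apos[of "Suc m"] by (simp add: field_simps)
      finally have 1: "(a m - a (Suc m)) / (a m)\<^sup>2 \<le> 1 / a (Suc m) - 1 / a m" by (simp add: power2_eq_square)
      have "((a m)\<^sup>2 * (V / 2 - (1 + real L) * \<delta>) - 2 * real L * a m * d - E * (w m - w (m + k))) / (a m)\<^sup>2
          \<le> (a m - a (Suc m)) / (a m)\<^sup>2" by (intro divide_right_mono key) auto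
      then have 2: "V / 2 - (1 + real L) * \<delta> - 2 * real L * d * (1 / a m) - E * (w m - w (m + k)) * (1 / a m)\<^sup>2
          \<le> 1 / a (Suc m) - 1 / a m"
        using 1 apos[of m] by (simp add: diff_divide_distrib power2_eq_square)
      have 3: "2 * real L * d * (1 / a m) \<le> 32 * (real L)^3 * real j * C / real m"
      proof -
        have "2 * real L * d * (1 / a m) \<le> 2 * real L * (4 * real j * real L * C / (real m)\<^sup>2) * (4 * real L * real m)"
          using d2 inva apos[of m] C by (intro mult_mono mult_left_mono) (auto intro!: divide_nonneg_nonneg)
        also have "\<dots> = 32 * (real L)^3 * real j * C / real m"
          using m1 by (simp add: power2_eq_square power3_eq_cube)
        finally show ?thesis .
      qed
      have wd: "0 \<le> w m - w (m + k)" unfolding w_def using W_it_antimono[OF f, of m "m + k"] by simp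
      have 4: "E * (w m - w (m + k)) * (1 / a m)\<^sup>2
         \<le> E1 * ((real m)\<^sup>2 * w m - (real (m + k))\<^sup>2 * w (m + k)) + 32 * (real L)\<^sup>2 * E * real k * C / real m"
      proof -
        have "(1 / a m)\<^sup>2 \<le> (4 * real L * real m)\<^sup>2" using inva apos[of m] by (intro power_mono) auto
        then have "E * (w m - w (m + k)) * (1 / a m)\<^sup>2 \<le> E * (w m - w (m + k)) * (4 * real L * real m)\<^sup>2"
          using E wd by (intro mult_left_mono) auto
        also have "\<dots> = E1 * ((real m)\<^sup>2 * (w m - w (m + k)))" by (simp add: E1_def power_mult_distrib)
        also have "\<dots> \<le> E1 * ((real m)\<^sup>2 * w m - (real (m + k))\<^sup>2 * w (m + k) + 2 * real k * C / real m)"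
          using E1 C m1 m by (intro mult_left_mono weighted_drop_le wM) auto
        also have "\<dots> = E1 * ((real m)\<^sup>2 * w m - (real (m + k))\<^sup>2 * w (m + k)) + 32 * (real L)\<^sup>2 * E * real k * C / real m"
          unfolding distrib_left by (simp add: E1_def)
        finally show ?thesis .
      qed
      have "D0 / real m \<le> \<delta>" using m1 d by (simp add: divide_le_eq field_simps)
      then have 5: "32 * (real L)^3 * real j * C / real m + 32 * (real L)\<^sup>2 * E * real k * C / real m \<le> \<delta>"
        unfolding D0_def by (simp add: add_divide_distrib)
      have "(2 + real L) * \<delta> = (1 + real L) * \<delta> + \<delta>" by (simp add: algebra_simps)
      with 2 3 4 5 show ?thesis by argo
    qed
    \<comment> \<open>A window of length \<open>k\<close> turns a difference between the indices
      \<open>m\<close> and \<open>m + k\<close> into a difference of consecutive terms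
      (\<open>Psi_Suc\<close>).\<close>
    define \<Psi> where "\<Psi> m = (\<Sum>i<k. (real (m + i))\<^sup>2 * w (m + i))" for m
    have Psi_Suc: "\<Psi> m - \<Psi> (Suc m) = (real m)\<^sup>2 * w m - (real (m + k))\<^sup>2 * w (m + k)" for m
    proof -
      have "\<Psi> m + (real (m + k))\<^sup>2 * w (m + k) = (\<Sum>i<Suc k. (real (m + i))\<^sup>2 * w (m + i))"
        by (simp add: \<Psi>_def)
      also have "\<dots> = (real m)\<^sup>2 * w m + \<Psi> (Suc m)"
        by (subst sum.lessThan_Suc_shift) (simp add: \<Psi>_def)
      finally show ?thesis by simp
    qed
    have Psi_M: "\<Psi> M \<le> real k * C"
    proof -
      have "\<Psi> M \<le> real (card {..<k}) * C" unfolding \<Psi>_def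
      proof (rule sum_bounded_above)
        fix i
        have "real (M + i) > 0" using M CK Dd by simp
        then show "(real (M + i))\<^sup>2 * w (M + i) \<le> C" using wM[of "M + i"] by (simp add: field_simps)
      qed
      then show ?thesis by simp
    qed
    have Psi0: "0 \<le> \<Psi> m" for m unfolding \<Psi>_def w_def by (intro sum_nonneg mult_nonneg_nonneg W_nonneg[OF vit]) auto
    define c where "c = V / 2 - (2 + real L) * \<delta>"
    have "0 \<le> (2 + real L) * \<delta>" using d by (intro mult_nonneg_nonneg) auto
    then have c: "V / 2 - \<epsilon> \<le> c" "c \<le> real L" using d(4) V unfolding c_def by linarith+
    have tel: "1 / a M - E1 * \<Psi> M + real i * c \<le> 1 / a (M + i) - E1 * \<Psi> (M + i)" for i
    proof (induction i)
      case (Suc i)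
      have "c - E1 * (\<Psi> (M + i) - \<Psi> (Suc (M + i))) \<le> 1 / a (Suc (M + i)) - 1 / a (M + i)"
        unfolding Psi_Suc c_def by (rule inc) simp
      with Suc show ?case by (simp add: algebra_simps)
    qed simp
    have DM: "real L * real M + E1 * (real k * C) \<le> D * (1 + ln K)"
    proof -
      have mm: "x \<le> x * (1 + ln K)" if "0 \<le> x" for x using mult_nonneg_nonneg[OF that lnK] by (simp add: distrib_left)
      have "real L * real M \<le> real L * (2 * real j + 2 * C * (1 + ln K) + D0 / \<delta> + 2)" by (intro mult_left_mono M2) auto
      also have "\<dots> \<le> real L * ((2 * real j + 2 * C + D0 / \<delta> + 2) * (1 + ln K))"
      proof (rule mult_left_mono)
        have "(2 * real j + 2 * C + D0 / \<delta> + 2) * (1 + ln K)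
          = 2 * real j * (1 + ln K) + 2 * C * (1 + ln K) + D0 / \<delta> * (1 + ln K) + 2 * (1 + ln K)"
          by (simp only: distrib_right)
        then show "2 * real j + 2 * C * (1 + ln K) + D0 / \<delta> + 2 \<le> (2 * real j + 2 * C + D0 / \<delta> + 2) * (1 + ln K)"
          using mm[of "2 * real j"] mm[of "D0 / \<delta>"] mm[of 2] Dd by linarith
      qed simp
      finally have "real L * real M \<le> real L * (2 * real j + 2 * C + D0 / \<delta> + 2) * (1 + ln K)" by simp
      moreover have "E1 * (real k * C) \<le> E1 * real k * C * (1 + ln K)"
        using mm[of "E1 * real k * C"] E1 C by (simp add: mult.assoc)
      ultimately show ?thesis unfolding D_def distrib_right[of _ "E1 * real k * C" "1 + ln K"] by (rule add_mono)
    qed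
    show "real n * (Vc \<theta> / 2 - \<epsilon>) - D * (1 + ln K) \<le> 1 / ig \<theta> (it \<theta> f n)"
    proof (cases "M \<le> n")
      case True
      define i where "i = n - M"
      have n: "n = M + i" using True by (simp add: i_def)
      have "real i * c - E1 * \<Psi> M \<le> 1 / a n"
      proof -
        have "0 \<le> 1 / a M" "0 \<le> E1 * \<Psi> (M + i)" using apos[of M] E1 Psi0 by auto
        then show ?thesis using tel[of i] unfolding n by argo
      qed
      moreover have "E1 * \<Psi> M \<le> E1 * (real k * C)" using E1 Psi_M by (intro mult_left_mono) auto
      moreover have "real n * (V / 2 - \<epsilon>) - real L * real M \<le> real i * c"
      proof -
        have "real n * (V / 2 - \<epsilon>) \<le> real n * c" using c by (intro mult_left_mono) auto
        moreover have "real M * c \<le> real M * real L" using c by (intro mult_left_mono) auto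
        ultimately show ?thesis by (simp add: n algebra_simps)
      qed
      ultimately show ?thesis using DM unfolding a_def V_def by argo
    next
      case False
      \<comment> \<open>Below \<open>M\<close> the left-hand side is nonpositive, as
        \<open>D\<close> was chosen with \<open>L * M \<le> D * (1 + ln K)\<close>.\<close>
      have "real n * (V / 2 - \<epsilon>) \<le> real n * real L" using V e by (intro mult_left_mono) auto
      also have "\<dots> \<le> real M * real L" using False by (intro mult_right_mono) auto
      also have "\<dots> \<le> D * (1 + ln K)"
      proof -
        have "0 \<le> E1 * (real k * C)" using E1 C by simp
        then show ?thesis using DM by (simp add: mult.commute)
      qed
      finally have "real n * (Vc \<theta> / 2 - \<epsilon>) - D * (1 + ln K) \<le> 0" unfolding V_def by simp
      also have "0 \<le> 1 / ig \<theta> (it \<theta> f n)" using apos[of n] unfolding a_def by simp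
      finally show ?thesis .
    qed
  qed
qed

text \<open>Convexity gives \<open>1 / PP f \<le> PP (1 / f)\<close>, and \<open>PP\<close>
  preserves the integral, so the increase comes from \<open>BB\<close> and a second-order remainder.
  Divided by the squared average, the main part of \<open>BB\<close> is the variance density, with
  integral \<open>Vc\<close>. The maxima with \<open>c\<close> and \<open>c'\<close> keep the
  reciprocals bounded where \<open>h\<close> vanishes.\<close>

lemma inverse_drop:
  assumes f: "valid \<theta> f" and fu: "\<And>t. f t \<le> 1 / (2 * real L)"
    and c: "0 < c" "\<And>t. 0 < h \<theta> t \<Longrightarrow> c \<le> f t" and c': "0 < c'" "\<And>t. 0 < h \<theta> t \<Longrightarrow> c' \<le> step \<theta> f t"
    and d: "0 < \<delta>"
  shows "ig \<theta> (\<lambda>t. 1 / max (step \<theta> f t) c') \<le> ig \<theta> (\<lambda>t. 1 / max (f t) c) + (1 + \<delta>) * Vc \<theta> / 2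
      + real L * (1 + 1/\<delta>) / c\<^sup>2 * ig \<theta> (Sp \<theta> f) + 2 * (real L)\<^sup>2 * ig \<theta> f"
proof -
  let ?y = "PP \<theta> f" and ?v = "BB \<theta> (\<lambda>_. 1)" and ?r = "\<lambda>t. 1 / max (f t) c"
  have BM_inv: "BM (\<lambda>t. 1 / max (k t) e)" if "BM k" "0 < e" for k and e :: real
  proof (rule BM_I[of _ "1 / e"])
    have [measurable]: "k \<in> borel_measurable borel" using that by (auto dest: BM_meas)
    show "(\<lambda>t. 1 / max (k t) e) \<in> borel_measurable borel" by measurable
    show "\<bar>1 / max (k t) e\<bar> \<le> 1 / e" for t using that by (auto simp: abs_if max_def intro!: divide_left_mono)
  qed
  have bms: "BM f" "BM ?y" "BM ?v" "BM (Sp \<theta> f)" "BM (step \<theta> f)" "BM ?r" "BM (PP \<theta> ?r)"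
    using fBM[OF f] fBM[OF valid_step[OF f]] c(1) by (auto intro!: BM_inv)
  have "ig \<theta> (\<lambda>t. 1 / max (step \<theta> f t) c')
     \<le> ig \<theta> (\<lambda>t. PP \<theta> ?r t + ((1 + \<delta>) / 2 * ?v t + (real L * (1 + 1/\<delta>) / c\<^sup>2 * Sp \<theta> f t + 2 * (real L)\<^sup>2 * ?y t)))"
  proof (intro ig_mono BM_add BM_mult BM_const bms BM_inv c'(1))
    fix t assume t: "0 < h \<theta> t"
    have cy: "c \<le> ?y t"
    proof -
      have "PP \<theta> (\<lambda>_. c) t \<le> ?y t" unfolding PP_def
      proof (rule avg_mono_weighted)
        fix Q
        show "h \<theta> (real L * t - q \<theta> Q) * c \<le> h \<theta> (real L * t - q \<theta> Q) * f (real L * t - q \<theta> Q)"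
          using c(2)[of "real L * t - q \<theta> Q"] h_nonneg[of \<theta> "real L * t - q \<theta> Q"]
          by (cases "h \<theta> (real L * t - q \<theta> Q) = 0") (auto intro!: mult_left_mono simp: less_le)
      qed simp
      then show ?thesis by (simp add: PP_const[OF t])
    qed
    then have y: "0 < ?y t" using c by simp
    have yu: "?y t \<le> 1 / (2 * real L)" by (rule PP_le_const) (use fu in auto)
    then have Ly: "2 * real L * ?y t \<le> 1" by (simp add: field_simps)
    have b: "0 \<le> BB \<theta> f t" "BB \<theta> f t \<le> 2 * real L * (?y t)\<^sup>2"
      using BB_nonneg BB_le f0[OF f] by auto
    note ib = inverse_step_bound[OF y b _ Ly]
    have "1 / max (step \<theta> f t) c' = 1 / step \<theta> f t" using c'(2)[OF t] by (simp add: max_def)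
    also have "\<dots> \<le> 1 / (?y t - BB \<theta> f t / 2)"
      using step_ge[OF f, of t] ib by (intro divide_left_mono mult_pos_pos) (auto intro: less_le_trans)
    also have "\<dots> \<le> 1 / ?y t + BB \<theta> f t / (2 * (?y t)\<^sup>2) + 2 * (real L)\<^sup>2 * ?y t" using ib by simp
    also have "1 / ?y t \<le> PP \<theta> ?r t"
    proof -
      let ?w = "\<lambda>Q. h \<theta> (real L * t - q \<theta> Q)" and ?x = "\<lambda>Q. max (f (real L * t - q \<theta> Q)) c"
      have wx: "?w Q * f (real L * t - q \<theta> Q) = ?w Q * ?x Q" for Q
        using c(2)[of "real L * t - q \<theta> Q"] h_nonneg[of \<theta> "real L * t - q \<theta> Q"]
        by (cases "?w Q = 0") (auto simp: less_le max_def)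
      have e: "?y t = avg L ?w (h \<theta> t) ?x" unfolding PP_def avg_def wx ..
      have "1 / avg L ?w (h \<theta> t) ?x \<le> avg L ?w (h \<theta> t) (\<lambda>Q. 1 / ?x Q)"
        by (rule C.inverse_av_le[where x="?x"]) (use t c(1) y e in \<open>auto simp: less_max_iff_disj\<close>)
      then show ?thesis unfolding e by (simp add: PP_def)
    qed
    also have "BB \<theta> f t / (2 * (?y t)\<^sup>2) \<le> (1 + \<delta>) / 2 * ?v t + real L * (1 + 1/\<delta>) / c\<^sup>2 * Sp \<theta> f t"
    proof -
      have "BB \<theta> f t \<le> (1 + \<delta>) * ?v t * (?y t)\<^sup>2 + 2 * real L * (1 + 1/\<delta>) * Sp \<theta> f t"
        using BB_near[OF f d, of t] unfolding abs_le_iff by (simp add: algebra_simps)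
      then have "BB \<theta> f t / (2 * (?y t)\<^sup>2) \<le> ((1 + \<delta>) * ?v t * (?y t)\<^sup>2 + 2 * real L * (1 + 1/\<delta>) * Sp \<theta> f t) / (2 * (?y t)\<^sup>2)"
        by (rule divide_right_mono) simp
      also have "\<dots> = (1 + \<delta>) / 2 * ?v t + real L * (1 + 1/\<delta>) * Sp \<theta> f t / (?y t)\<^sup>2"
        using y by (simp add: field_simps)
      also have "real L * (1 + 1/\<delta>) * Sp \<theta> f t / (?y t)\<^sup>2 \<le> real L * (1 + 1/\<delta>) * Sp \<theta> f t / c\<^sup>2"
        using cy c d Sp_nonneg y by (intro divide_left_mono power_mono mult_nonneg_nonneg mult_pos_pos) auto
      finally show ?thesis by simp
    qed
    finally show "1 / max (step \<theta> f t) c' \<le> PP \<theta> ?r t + ((1 + \<delta>) / 2 * ?v t + (real L * (1 + 1/\<delta>) / c\<^sup>2 * Sp \<theta> f t + 2 * (real L)\<^sup>2 * ?y t))"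
      by simp
  qed
  also have "\<dots> = ig \<theta> ?r + ((1 + \<delta>) / 2 * Vc \<theta> + (real L * (1 + 1/\<delta>) / c\<^sup>2 * ig \<theta> (Sp \<theta> f) + 2 * (real L)\<^sup>2 * ig \<theta> f))"
    by (simp only: ig_add BM_add BM_mult BM_const bms ig_cmult ig_PP Vc_def)
  finally show ?thesis by simp
qed

lemma inverse_ig_le:
  assumes f: "BM f" and c: "0 < c" "\<And>t. 0 < h \<theta> t \<Longrightarrow> c \<le> f t"
  shows "1 / ig \<theta> f \<le> ig \<theta> (\<lambda>t. 1 / max (f t) c)"
proof -
  define a where "a = ig \<theta> f"
  have "ig \<theta> (\<lambda>_. c) \<le> a" unfolding a_def by (intro ig_mono f c BM_const)
  then have a: "0 < a" using c by (simp only: ig_const)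
  have [measurable]: "f \<in> borel_measurable borel" using f by (rule BM_meas)
  have bm: "BM (\<lambda>t. 1 / max (f t) c)"
    by (rule BM_I[of _ "1 / c"]) (use c in \<open>auto simp: abs_if max_def intro!: divide_left_mono\<close>)
  have "ig \<theta> (\<lambda>t. 2 / a - (1 / a\<^sup>2) * f t) \<le> ig \<theta> (\<lambda>t. 1 / max (f t) c)"
  proof (intro ig_mono BM_diff BM_mult BM_const f bm)
    fix t assume t: "0 < h \<theta> t"
    then have x: "0 < f t" "max (f t) c = f t" using c(1) c(2)[OF t] by (auto simp: max_def)
    have "0 \<le> (f t - a)\<^sup>2 / (f t * a\<^sup>2)" using x by simp
    also have "\<dots> = 1 / f t - (2 / a - (1 / a\<^sup>2) * f t)"
      using x a by (simp add: field_simps power2_eq_square)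
    finally show "2 / a - (1 / a\<^sup>2) * f t \<le> 1 / max (f t) c" using x by simp
  qed
  also have "ig \<theta> (\<lambda>t. 2 / a - (1 / a\<^sup>2) * f t) = 2 / a - (1 / a\<^sup>2) * a"
    by (simp only: ig_diff BM_const BM_mult f ig_cmult ig_const a_def)
  also have "\<dots> = 1 / a" using a by (simp add: power2_eq_square)
  finally show ?thesis by (simp add: a_def)
qed

text \<open>By Jensen \<open>1 / ig f\<close> is at most the integral of the reciprocal, which is
  followed here. The constant start \<open>1 / (2 * L)\<close> keeps all averages in the range of
  \<open>inverse_step_bound\<close> and has the harmonic lower bound, so the factor
  \<open>1 / c\<^sup>2\<close> in front of the spread is \<open>O(m\<^sup>2)\<close> and
  \<open>weighted_drop_le\<close> applies.\<close>

lemma lower_asymptotics: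
  assumes e: "0 < \<epsilon>"
  obtains D where "0 < D"
    "\<And>\<theta> n. 1 / ig \<theta> (it \<theta> (\<lambda>_. 1 / (2 * real L)) n) \<le> real n * (Vc \<theta> / 2 + \<epsilon>) + D"
proof -
  define \<delta> where "\<delta> = \<epsilon> / (1 + real L)"
  have d: "0 < \<delta>" "(1 + real L) * \<delta> = \<epsilon>" using e by (auto simp: \<delta>_def add_pos_pos add_nonneg_eq_0_iff)
  obtain C where C: "0 < C" and dec: "\<And>\<theta> f K n. valid \<theta> f \<Longrightarrow> (\<And>t. f t \<le> K) \<Longrightarrow> 1 \<le> K \<Longrightarrow> C * (1 + ln K) \<le> real n \<Longrightarrow>
       W \<theta> (it \<theta> f n) \<le> C / (real n)\<^sup>2" by (rule W_decay) blast
  define E where "E = 16 * (real L)^3 * (1 + 1/\<delta>)"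
  have E: "0 < E" using d by (auto simp: E_def intro!: mult_pos_pos add_pos_pos)
  define D0 where "D0 = E * 2 * C + 2 * (real L)\<^sup>2 * sqrt C"
  have D0: "0 \<le> D0" using E C by (simp add: D0_def)
  define M where "M = nat \<lceil>C + D0 / \<delta> + 1\<rceil>"
  have M: "C + D0 / \<delta> + 1 \<le> real M" unfolding M_def by (rule real_nat_ceiling_ge)
  define D where "D = 2 * real L * (real M + 1) + E * C"
  show ?thesis
  proof (rule that[of D])
    have "0 < 2 * real L * (real M + 1)" by (intro mult_pos_pos) auto
    then show "0 < D" unfolding D_def using E C by (intro add_pos_nonneg) auto
    fix \<theta> n
    define f :: "real \<Rightarrow> real" where "f = (\<lambda>_. 1 / (2 * real L))"
    have l2: "1 / (2 * real L) \<le> 1 / 2" using L2 by (simp add: field_simps)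
    have f: "valid \<theta> f" unfolding f_def by (rule const_valid) (use l2 in auto)
    define V where "V = Vc \<theta>"
    have V: "0 \<le> V" "V \<le> 2 * real L" unfolding V_def by (rule Vc_nonneg Vc_le)+
    have vit: "valid \<theta> (it \<theta> f m)" for m by (rule valid_it[OF f])
    have fu: "it \<theta> f m t \<le> 1 / (2 * real L)" for m t
    proof (induction m arbitrary: t)
      case (Suc m)
      have "it \<theta> f (Suc m) t \<le> PP \<theta> (it \<theta> f m) t" using step_le[OF vit] by simp
      also have "\<dots> \<le> 1 / (2 * real L)" by (rule PP_le_const) (use Suc in auto)
      finally show ?case .
    qed (simp add: f_def)
    define c where "c m = 1 / (2 * real L * (real m + 1))" for m
    have c: "0 < c m" "0 < h \<theta> t \<Longrightarrow> c m \<le> it \<theta> f m t" for m t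
      unfolding c_def by (simp add: add_pos_pos, rule it_lower[OF f]) (auto simp: f_def)
    define J a w where "J m = ig \<theta> (\<lambda>t. 1 / max (it \<theta> f m t) (c m))" and "a m = ig \<theta> (it \<theta> f m)"
      and "w m = W \<theta> (it \<theta> f m)" for m
    have wM: "w m \<le> C / (real m)\<^sup>2" if "M \<le> m" for m
    proof -
      have "C \<le> real M" using M D0 d by (smt (verit) divide_nonneg_pos)
      then have "C * (1 + ln 1) \<le> real m" using that by simp
      moreover have "f t \<le> 1" for t using l2 by (simp add: f_def)
      ultimately show ?thesis unfolding w_def by (intro dec[OF f, of 1]) auto
    qed
    have w0: "0 \<le> w m" for m unfolding w_def by (rule W_nonneg[OF vit])
    have Jb: "J m \<le> 2 * real L * (real m + 1)" for m
    proof -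
      have [measurable]: "it \<theta> f m \<in> borel_measurable borel" using fBM[OF vit] by (rule BM_meas)
      have "BM (\<lambda>t. 1 / max (it \<theta> f m t) (c m))"
        by (rule BM_I[of _ "1 / c m"]) (use c(1)[of m] in \<open>auto simp: abs_if max_def intro!: divide_left_mono\<close>)
      then have "J m \<le> ig \<theta> (\<lambda>_. 1 / c m)" unfolding J_def
        using c(1)[of m] by (intro ig_mono BM_const divide_left_mono) auto
      then show ?thesis unfolding ig_const by (simp add: c_def)
    qed
    have inc: "J (Suc m) \<le> J m + V / 2 + \<epsilon> + E * ((real m)\<^sup>2 * w m - (real (m + 1))\<^sup>2 * w (m + 1))"
      if m: "M \<le> m" for m
    proof -
      have Md: "C + D0 / \<delta> + 1 \<le> real m" using m M by linarith
      have m1: "1 \<le> real m" "D0 / \<delta> \<le> real m"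
        using Md C D0 d by (smt (verit) divide_nonneg_pos)+
      have sp: "ig \<theta> (Sp \<theta> (it \<theta> f m)) \<le> w m - w (m + 1)"
        using ig_Sp[OF fBM[OF vit]] W_step_le_PP[OF vit, of m] by (simp add: w_def)
      have "J (Suc m) \<le> J m + (1 + \<delta>) * V / 2
        + real L * (1 + 1/\<delta>) / (c m)\<^sup>2 * ig \<theta> (Sp \<theta> (it \<theta> f m)) + 2 * (real L)\<^sup>2 * a m"
        using inverse_drop[OF vit[of m] fu[of m] c(1)[of m] c(2)[of _ m], where c'="c (Suc m)" and \<delta>=\<delta>] c(1)[of "Suc m"] c(2)[of _ "Suc m"] d
        unfolding J_def V_def a_def by simp
      moreover have "real L * (1 + 1/\<delta>) / (c m)\<^sup>2 * ig \<theta> (Sp \<theta> (it \<theta> f m))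
         \<le> E * ((real m)\<^sup>2 * w m - (real (m + 1))\<^sup>2 * w (m + 1)) + E * 2 * C / real m"
      proof -
        have "(1 / c m)\<^sup>2 \<le> (4 * real L * real m)\<^sup>2"
        proof (rule power_mono)
          have "1 / c m = 2 * real L * (real m + 1)" by (simp add: c_def)
          also have "\<dots> \<le> 2 * real L * (2 * real m)" using m1 by (intro mult_left_mono) auto
          finally show "1 / c m \<le> 4 * real L * real m" by simp
        qed (use c(1)[of m] in simp)
        then have "real L * (1 + 1/\<delta>) * (1 / c m)\<^sup>2 \<le> real L * (1 + 1/\<delta>) * (4 * real L * real m)\<^sup>2"
          using d by (intro mult_left_mono) auto
        also have "\<dots> = E * (real m)\<^sup>2" by (simp add: E_def power2_eq_square power3_eq_cube)
        finally have "real L * (1 + 1/\<delta>) / (c m)\<^sup>2 \<le> E * (real m)\<^sup>2" by (simp add: power_divide)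
        then have "real L * (1 + 1/\<delta>) / (c m)\<^sup>2 * ig \<theta> (Sp \<theta> (it \<theta> f m)) \<le> E * (real m)\<^sup>2 * (w m - w (m + 1))"
          using E sp by (intro mult_mono ig_nonneg Sp_nonneg) auto
        also have "\<dots> = E * ((real m)\<^sup>2 * (w m - w (m + 1)))" by simp
        also have "\<dots> \<le> E * ((real m)\<^sup>2 * w m - (real (m + 1))\<^sup>2 * w (m + 1) + 2 * real 1 * C / real m)"
          using E C m1 m by (intro mult_left_mono weighted_drop_le wM) auto
        finally show ?thesis by (simp add: distrib_left)
      qed
      moreover have "2 * (real L)\<^sup>2 * a m \<le> 2 * (real L)\<^sup>2 * sqrt C / real m"
      proof -
        have "(a m)\<^sup>2 \<le> C / (real m)\<^sup>2" using ig_sq_le[OF fBM[OF vit]] wM[OF m] unfolding a_def w_def by (rule order_trans)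
        then have "a m \<le> sqrt (C / (real m)\<^sup>2)" by (rule real_le_rsqrt)
        also have "\<dots> = sqrt C / real m" by (simp add: real_sqrt_divide)
        finally have "2 * (real L)\<^sup>2 * a m \<le> 2 * (real L)\<^sup>2 * (sqrt C / real m)" by (intro mult_left_mono) auto
        then show ?thesis by simp
      qed
      moreover have "E * 2 * C / real m + 2 * (real L)\<^sup>2 * sqrt C / real m \<le> \<delta>"
      proof -
        have "D0 / real m \<le> \<delta>" using m1 d by (simp add: divide_le_eq field_simps)
        then show ?thesis unfolding D0_def by (simp add: add_divide_distrib)
      qed
      moreover have "\<delta> * V / 2 + \<delta> \<le> \<epsilon>"
      proof -
        have "\<delta> * V \<le> \<delta> * (2 * real L)" using V d by (intro mult_left_mono) auto
        then show ?thesis using d(2) by (simp add: algebra_simps)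
      qed
      moreover have "(1 + \<delta>) * V / 2 = V / 2 + \<delta> * V / 2" by (simp add: algebra_simps add_divide_distrib)
      ultimately show ?thesis by argo
    qed
    have "1 / a n \<le> J n" unfolding a_def J_def by (rule inverse_ig_le[OF fBM[OF vit] c(1) c(2)])
    also have "J n \<le> real n * (V / 2 + \<epsilon>) + D"
    proof (cases "M \<le> n")
      case True
      have "J (M + i) + E * ((real (M + i))\<^sup>2 * w (M + i)) \<le> J M + E * ((real M)\<^sup>2 * w M) + real i * (V / 2 + \<epsilon>)" for i
      proof (induction i)
        case (Suc i)
        then show ?case using inc[of "M + i"] by (simp add: algebra_simps add_divide_distrib)
      qed simp
      from this[of "n - M"] have "J n + E * ((real n)\<^sup>2 * w n) \<le> J M + E * ((real M)\<^sup>2 * w M) + real (n - M) * (V / 2 + \<epsilon>)"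
        using True by simp
      moreover have "0 \<le> E * ((real n)\<^sup>2 * w n)" using E w0 by simp
      moreover have "E * ((real M)\<^sup>2 * w M) \<le> E * C"
      proof -
        have "0 < real M" using M C D0 d by (smt (verit) divide_nonneg_pos)
        then have "(real M)\<^sup>2 * w M \<le> C" using wM[of M] by (simp add: field_simps)
        then show ?thesis using E by (intro mult_left_mono) auto
      qed
      moreover have "real (n - M) * (V / 2 + \<epsilon>) \<le> real n * (V / 2 + \<epsilon>)"
        using V e by (intro mult_right_mono) auto
      ultimately show ?thesis using Jb[of M] unfolding D_def by linarith
    next
      case False
      have "J n \<le> 2 * real L * (real n + 1)" by (rule Jb)
      also have "\<dots> \<le> 2 * real L * (real M + 1)" using False by (intro mult_left_mono) auto
      also have "\<dots> \<le> D" unfolding D_def using E C by simp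
      also have "\<dots> \<le> real n * (V / 2 + \<epsilon>) + D" using V e by simp
      finally show ?thesis .
    qed
    finally show "1 / ig \<theta> (it \<theta> (\<lambda>_. 1 / (2 * real L)) n) \<le> real n * (Vc \<theta> / 2 + \<epsilon>) + D"
      unfolding a_def V_def f_def .
  qed
qed

end

section \<open>Hitting probabilities\<close>

context lines
begin

text \<open>Multiplication by \<open>h\<close> conjugates \<open>step\<close> to this map
  (\<open>h_it\<close>); unlike \<open>step\<close> it also acts on functions that are not dominated
  by a multiple of \<open>h\<close>.\<close>

definition hit :: "real \<Rightarrow> (real \<Rightarrow> real) \<Rightarrow> real \<Rightarrow> real" where
  "hit \<theta> p t = hit_prob X (\<lambda>Q. p (real L * t - q \<theta> Q))"

definition prob_fun :: "(real \<Rightarrow> real) \<Rightarrow> bool" where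
  "prob_fun p \<longleftrightarrow> p \<in> borel_measurable borel \<and> (\<forall>t. 0 \<le> p t \<and> p t \<le> 1) \<and> integrable lborel p"

lemma integrable_affine:
  assumes "integrable lborel (f :: real \<Rightarrow> real)" shows "integrable lborel (\<lambda>t. f (real L * t - d))"
  using lborel_integrable_real_affine[OF assms, of "real L" "- d"] by (simp add: add.commute)

lemma integral_affine:
  "(\<integral>t. f (real L * t - d) \<partial>lborel) = (\<integral>t. f t \<partial>lborel :: real) / real L"
  using lborel_integral_real_affine[of "real L" f "- d"] by (simp add: add.commute)

lemma integral_children:
  assumes "integrable lborel f"
  shows "integrable lborel (\<lambda>t. (\<Sum>Q\<in>G. f (real L * t - q \<theta> Q)) / real L)"
    and "(\<integral>t. (\<Sum>Q\<in>G. f (real L * t - q \<theta> Q)) / real L \<partial>lborel) = (\<integral>t. f t \<partial>lborel :: real)"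
  using integrable_affine[OF assms] by (auto simp: integral_affine Bochner_Integration.integral_sum)

lemma prob_fun_hit: assumes p: "prob_fun p" shows "prob_fun (hit \<theta> p)"
proof -
  have [measurable]: "p \<in> borel_measurable borel" using p by (simp add: prob_fun_def)
  have m[measurable]: "hit \<theta> p \<in> borel_measurable borel" unfolding hit_def[abs_def] by measurable
  have b: "0 \<le> hit \<theta> p t" "hit \<theta> p t \<le> 1" "hit \<theta> p t \<le> (\<Sum>Q\<in>G. p (real L * t - q \<theta> Q)) / real L" for t
    unfolding hit_def using p by (auto simp: prob_fun_def intro!: hit_prob_nonneg hit_prob_le1 hit_prob_le)
  have "integrable lborel (hit \<theta> p)"
    by (rule Bochner_Integration.integrable_bound[OF integral_children(1)[of p \<theta>]])
       (use p order_trans[OF b(3) abs_ge_self] b(1) in \<open>auto simp: prob_fun_def\<close>)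
  then show ?thesis using b m by (auto simp: prob_fun_def)
qed

lemma prob_fun_pow: "prob_fun p \<Longrightarrow> prob_fun ((hit \<theta> ^^ n) p)"
  by (induction n) (auto intro: prob_fun_hit)

lemma h_it:
  assumes "valid \<theta> f" shows "h \<theta> t * it \<theta> f n t = (hit \<theta> ^^ n) (\<lambda>t. h \<theta> t * f t) t"
proof (induction n arbitrary: t)
  case (Suc n)
  then show ?case by (simp add: h_step[OF valid_it[OF assms]] hit_def)
qed simp

lemma h_integrable: "integrable lborel (h \<theta>)"
  by (rule integrableI_nonneg) (auto simp: h_nn)

lemma prob_fun_valid: assumes f: "valid \<theta> f" shows "prob_fun (\<lambda>t. h \<theta> t * f t)"
proof -
  have [measurable]: "f \<in> borel_measurable borel" using fBM[OF f] by (rule BM_meas)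
  from fBM[OF f] obtain B where B: "\<And>t. \<bar>f t\<bar> \<le> B" by (auto simp: BM_def)
  have "integrable lborel (\<lambda>t. h \<theta> t * f t)"
  proof (rule Bochner_Integration.integrable_bound[of _ "\<lambda>t. B * h \<theta> t"])
    show "AE t in lborel. norm (h \<theta> t * f t) \<le> norm (B * h \<theta> t)"
    proof (rule AE_I2)
      fix t have "\<bar>h \<theta> t * f t\<bar> \<le> h \<theta> t * B"
        unfolding abs_mult using B by (intro mult_mono) auto
      then show "norm (h \<theta> t * f t) \<le> norm (B * h \<theta> t)" by (simp add: mult.commute)
    qed
  qed (use h_integrable in auto)
  then show ?thesis using f by (auto simp: prob_fun_def valid_def)
qed

lemma hit_mono:
  assumes "\<And>t. p t \<le> r t" "\<And>t. r t \<le> 1" shows "hit \<theta> p t \<le> hit \<theta> r t"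
  unfolding hit_def using assms by (intro hit_prob_mono) auto

lemma hit_pow_mono:
  assumes "\<And>t. p t \<le> r t" "prob_fun r" "prob_fun p"
  shows "(hit \<theta> ^^ n) p t \<le> (hit \<theta> ^^ n) r t"
proof (induction n arbitrary: t)
  case (Suc n)
  have "hit \<theta> ((hit \<theta> ^^ n) p) t \<le> hit \<theta> ((hit \<theta> ^^ n) r) t"
    using Suc prob_fun_pow[OF assms(2), where n=n and \<theta>=\<theta>] by (intro hit_mono) (auto simp: prob_fun_def)
  then show ?case by simp
qed (use assms in simp)

text \<open>One generation bounds the new excess by an average over children of the old one, and
  that average preserves Lebesgue integrals.\<close>

lemma hit_pow_excess:
  assumes p: "prob_fun p" and r: "prob_fun r"
  shows "(\<integral>t. max 0 ((hit \<theta> ^^ n) p t - (hit \<theta> ^^ n) r t) \<partial>lborel) \<le> (\<integral>t. max 0 (p t - r t) \<partial>lborel)"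
proof (induction n)
  case (Suc n)
  let ?p = "(hit \<theta> ^^ n) p" and ?r = "(hit \<theta> ^^ n) r"
  note pn = prob_fun_pow[OF p, where n=n and \<theta>=\<theta>] and rn = prob_fun_pow[OF r, where n=n and \<theta>=\<theta>]
  have i: "integrable lborel (\<lambda>t. max 0 (?p t - ?r t))"
    using pn rn by (auto simp: prob_fun_def intro!: integrable_max)
  have i2: "integrable lborel (\<lambda>t. max 0 (hit \<theta> ?p t - hit \<theta> ?r t))"
    using prob_fun_hit[OF pn, of \<theta>] prob_fun_hit[OF rn, of \<theta>] by (auto simp: prob_fun_def intro!: integrable_max)
  have "(\<integral>t. max 0 (hit \<theta> ?p t - hit \<theta> ?r t) \<partial>lborel)
      \<le> (\<integral>t. (\<Sum>Q\<in>G. max 0 (?p (real L * t - q \<theta> Q) - ?r (real L * t - q \<theta> Q))) / real L \<partial>lborel)"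
  proof (rule integral_mono[OF i2])
    show "integrable lborel (\<lambda>t. (\<Sum>Q\<in>G. max 0 (?p (real L * t - q \<theta> Q) - ?r (real L * t - q \<theta> Q))) / real L)"
      by (rule integral_children(1)[OF i])
    fix t
    have "hit \<theta> ?p t - hit \<theta> ?r t \<le> (\<Sum>Q\<in>G. max 0 (?p (real L * t - q \<theta> Q) - ?r (real L * t - q \<theta> Q))) / real L"
      unfolding hit_def[of \<theta> ?p t] hit_def[of \<theta> ?r t] using pn rn by (intro hit_prob_diff) (auto simp: prob_fun_def)
    moreover have "0 \<le> (\<Sum>Q\<in>G. max 0 (?p (real L * t - q \<theta> Q) - ?r (real L * t - q \<theta> Q))) / real L"
      by (intro divide_nonneg_nonneg sum_nonneg) auto
    ultimately show "max 0 (hit \<theta> ?p t - hit \<theta> ?r t) \<le> (\<Sum>Q\<in>G. max 0 (?p (real L * t - q \<theta> Q) - ?r (real L * t - q \<theta> Q))) / real L"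
      by simp
  qed
  also have "\<dots> = (\<integral>t. max 0 (?p t - ?r t) \<partial>lborel)" by (rule integral_children(2)[OF i])
  also have "\<dots> \<le> (\<integral>t. max 0 (p t - r t) \<partial>lborel)" by (rule Suc)
  finally show ?case by simp
qed simp

lemma prob_fun_sq_integrable: "prob_fun p \<Longrightarrow> integrable lborel (\<lambda>t. (p t)\<^sup>2)"
  by (rule Bochner_Integration.integrable_bound[of _ p])
     (auto simp: prob_fun_def power2_eq_square mult_left_le abs_mult)

text \<open>The loss is measured in unweighted Lebesgue integrals without dividing by
  \<open>h\<close>, so the estimate applies to the iterates of an indicator function.\<close>

lemma hit_drop_le:
  assumes p: "prob_fun p"
  shows "(\<integral>t. p t \<partial>lborel) - (\<integral>t. hit \<theta> p t \<partial>lborel) \<le> (real L)\<^sup>2 / 2 * (\<integral>t. (p t)\<^sup>2 \<partial>lborel)"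
proof -
  let ?c = "\<lambda>t Q. real L * t - q \<theta> Q"
  have pi: "integrable lborel p" using p by (simp add: prob_fun_def)
  note hi = prob_fun_hit[OF p, of \<theta>]
  have "(\<integral>t. p t \<partial>lborel) - (\<integral>t. hit \<theta> p t \<partial>lborel)
     = (\<integral>t. (\<Sum>Q\<in>G. p (?c t Q)) / real L - hit \<theta> p t \<partial>lborel)"
    using hi integral_children[OF pi, of \<theta>] by (simp add: Bochner_Integration.integral_diff prob_fun_def)
  also have "\<dots> \<le> (\<integral>t. (real L)\<^sup>2 / 2 * ((\<Sum>Q\<in>G. (p (?c t Q))\<^sup>2) / real L) \<partial>lborel)"
  proof (rule integral_mono)
    show "integrable lborel (\<lambda>t. (\<Sum>Q\<in>G. p (?c t Q)) / real L - hit \<theta> p t)"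
      using integral_children(1)[OF pi, of \<theta>] hi by (auto simp: prob_fun_def)
    show "integrable lborel (\<lambda>t. (real L)\<^sup>2 / 2 * ((\<Sum>Q\<in>G. (p (?c t Q))\<^sup>2) / real L))"
      using integral_children(1)[OF prob_fun_sq_integrable[OF p], of \<theta>] by (intro integrable_mult_right)
    fix t
    let ?p = "\<lambda>Q. p (?c t Q)"
    have p01: "0 \<le> ?p Q" "?p Q \<le> 1" for Q using p by (auto simp: prob_fun_def)
    have "(\<Sum>Q\<in>G. \<Sum>Q'\<in>G. pair_prob X Q Q' * ?p Q * ?p Q') \<le> (\<Sum>Q\<in>G. \<Sum>Q'\<in>G. (1 / real L) * (((?p Q)\<^sup>2 + (?p Q')\<^sup>2) / 2))"
    proof (intro sum_mono)
      fix Q Q' assume Q: "Q \<in> G" "Q' \<in> G"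
      have "0 \<le> (?p Q - ?p Q')\<^sup>2 / 2" by simp
      also have "\<dots> = ((?p Q)\<^sup>2 + (?p Q')\<^sup>2) / 2 - ?p Q * ?p Q'" by (simp add: power2_eq_square algebra_simps add_divide_distrib diff_divide_distrib)
      finally have "?p Q * ?p Q' \<le> ((?p Q)\<^sup>2 + (?p Q')\<^sup>2) / 2" by simp
      then have "pair_prob X Q Q' * (?p Q * ?p Q') \<le> (1 / real L) * (((?p Q)\<^sup>2 + (?p Q')\<^sup>2) / 2)"
        using pair_prob_le[OF Q(1)] p01 by (intro mult_mono) auto
      then show "pair_prob X Q Q' * ?p Q * ?p Q' \<le> (1 / real L) * (((?p Q)\<^sup>2 + (?p Q')\<^sup>2) / 2)" by (simp only: mult.assoc)
    qed
    also have "\<dots> = (1 / real L) * (((real L)\<^sup>2 * (\<Sum>Q\<in>G. (?p Q)\<^sup>2) + (real L)\<^sup>2 * (\<Sum>Q\<in>G. (?p Q)\<^sup>2)) / 2)"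
    proof -
      have "(\<Sum>Q\<in>G. \<Sum>Q'\<in>G. a Q + a Q') = (real L)\<^sup>2 * (\<Sum>Q\<in>G. a Q) + (real L)\<^sup>2 * (\<Sum>Q\<in>G. a Q)" for a :: "nat \<times> nat \<Rightarrow> real"
        by (simp add: sum.distrib power2_eq_square flip: sum_distrib_left)
      then show ?thesis by (simp only: sum_distrib_left[symmetric] sum_divide_distrib[symmetric])
    qed
    also have "\<dots> / 2 = (real L)\<^sup>2 / 2 * ((\<Sum>Q\<in>G. (?p Q)\<^sup>2) / real L)" by simp
    finally have "(\<Sum>Q\<in>G. \<Sum>Q'\<in>G. pair_prob X Q Q' * ?p Q * ?p Q') / 2 \<le> (real L)\<^sup>2 / 2 * ((\<Sum>Q\<in>G. (?p Q)\<^sup>2) / real L)" by simp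
    moreover have "(\<Sum>Q\<in>G. ?p Q) / real L - (\<Sum>Q\<in>G. \<Sum>Q'\<in>G. pair_prob X Q Q' * ?p Q * ?p Q') / 2 \<le> hit \<theta> p t"
      unfolding hit_def by (rule hit_prob_ge) (use p01 in auto)
    ultimately show "(\<Sum>Q\<in>G. ?p Q) / real L - hit \<theta> p t \<le> (real L)\<^sup>2 / 2 * ((\<Sum>Q\<in>G. (?p Q)\<^sup>2) / real L)" by simp
  qed
  also have "\<dots> = (real L)\<^sup>2 / 2 * (\<integral>t. (p t)\<^sup>2 \<partial>lborel)"
    using integral_children(2)[OF prob_fun_sq_integrable[OF p], of \<theta>] by (simp only: integral_mult_right_zero)
  finally show ?thesis .
qed

end

text \<open>\<open>I \<theta>\<close> is the projection of the unit square; its chord lengths \<open>h \<theta>\<close> are small only near its ends.\<close>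
locale crit_shadow = crit +
  fixes I :: "real \<Rightarrow> real set"
  assumes I_meas[measurable]: "I \<theta> \<in> sets borel" and I_finite: "emeasure lborel (I \<theta>) < \<infinity>"
    and I_supp: "0 < h \<theta> t \<Longrightarrow> t \<in> I \<theta>"
    and tip: "0 < \<delta> \<Longrightarrow> \<delta> \<le> 1 \<Longrightarrow> emeasure lborel {t \<in> I \<theta>. h \<theta> t < \<delta>} \<le> ennreal (4 * \<delta>)"
begin

abbreviation pp :: "real \<Rightarrow> nat \<Rightarrow> real \<Rightarrow> real" where
  "pp \<theta> n \<equiv> (hit \<theta> ^^ n) (indicator (I \<theta>))"

definition AA :: "real \<Rightarrow> nat \<Rightarrow> real" where
  "AA \<theta> n = (\<integral>t. pp \<theta> n t \<partial>lborel)"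

text \<open>For positive \<open>K\<close> the product \<open>h * trunc\<close> is
  \<open>min 1 (K * h)\<close>: the indicator of the shadow, cut down only near its ends.\<close>

definition trunc :: "real \<Rightarrow> real \<Rightarrow> real \<Rightarrow> real" where
  "trunc \<theta> K t = 1 / max (h \<theta> t) (1 / K)"

lemma prob_fun_I: "prob_fun (indicator (I \<theta>))"
  using I_finite by (auto simp: prob_fun_def indicator_def less_top)

lemma trunc_props:
  assumes K: "1 \<le> K"
  shows "valid \<theta> (trunc \<theta> K)" "trunc \<theta> K t \<le> K" "1 / (2 * real L) \<le> trunc \<theta> K t"
proof -
  have K0: "0 < 1 / K" using K by simp
  have b: "0 < max (h \<theta> t) (1 / K)" for t using K0 by (simp add: less_max_iff_disj)
  show le: "trunc \<theta> K t \<le> K" for t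
  proof -
    have "trunc \<theta> K t \<le> 1 / (1 / K)" unfolding trunc_def
      using b[of t] K0 by (intro divide_left_mono mult_pos_pos) auto
    then show ?thesis using K by simp
  qed
  have ge0: "0 \<le> trunc \<theta> K t" for t unfolding trunc_def using b[of t] by simp
  show "valid \<theta> (trunc \<theta> K)" unfolding valid_def
  proof (intro conjI allI ge0)
    show "BM (trunc \<theta> K)"
      by (rule BM_I[of _ K]) (use le ge0 in \<open>auto simp: trunc_def[abs_def]\<close>)
    fix t
    have "h \<theta> t * trunc \<theta> K t \<le> max (h \<theta> t) (1 / K) * trunc \<theta> K t"
      using ge0 by (intro mult_right_mono) auto
    then show "h \<theta> t * trunc \<theta> K t \<le> 1" using b[of t] by (simp add: trunc_def)
  qed
  have "max (h \<theta> t) (1 / K) \<le> 2" using K h_le2[of \<theta> t] by (auto simp: divide_le_eq)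
  then have "1 / 2 \<le> trunc \<theta> K t" unfolding trunc_def using b[of t] by (intro divide_left_mono) auto
  moreover have "1 / (2 * real L) \<le> 1 / 2" using L2 by (simp add: field_simps)
  ultimately show "1 / (2 * real L) \<le> trunc \<theta> K t" by linarith
qed

text \<open>The excess never grows, and initially it lives where \<open>h < 1 / K\<close>, a set
  that \<open>tip\<close> bounds by \<open>4 / K\<close>.\<close>

lemma trunc_excess:
  assumes K: "1 \<le> K"
  shows "(\<integral>t. max 0 (pp \<theta> n t - h \<theta> t * it \<theta> (trunc \<theta> K) n t) \<partial>lborel) \<le> 4 / K"
proof -
  note v = trunc_props(1)[OF K, of \<theta>]
  have "(\<integral>t. max 0 (pp \<theta> n t - h \<theta> t * it \<theta> (trunc \<theta> K) n t) \<partial>lborel)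
     \<le> (\<integral>t. max 0 (indicator (I \<theta>) t - h \<theta> t * trunc \<theta> K t) \<partial>lborel)"
    unfolding h_it[OF v] by (rule hit_pow_excess[OF prob_fun_I prob_fun_valid[OF v]])
  also have "\<dots> \<le> (\<integral>t. indicator {t \<in> I \<theta>. h \<theta> t < 1 / K} t \<partial>lborel)"
  proof (rule integral_mono)
    show "integrable lborel (\<lambda>t. max 0 (indicator (I \<theta>) t - h \<theta> t * trunc \<theta> K t))"
      using prob_fun_I[of \<theta>] prob_fun_valid[OF v] by (intro integrable_max) (auto simp: prob_fun_def)
    have "emeasure lborel {t \<in> I \<theta>. h \<theta> t < 1 / K} < \<infinity>"
      by (rule le_less_trans[OF tip]) (use K in auto)
    then show "integrable lborel (indicator {t \<in> I \<theta>. h \<theta> t < 1 / K} :: real \<Rightarrow> real)" by (simp add: less_top)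
    fix t
    have "0 \<le> h \<theta> t * trunc \<theta> K t" using v by (simp add: valid_def)
    moreover have "h \<theta> t * trunc \<theta> K t = 1" if "1 / K \<le> h \<theta> t"
    proof -
      have "0 < h \<theta> t" using that K by (smt (verit) divide_pos_pos)
      then show ?thesis using that by (simp add: trunc_def max_def)
    qed
    ultimately show "max 0 (indicator (I \<theta>) t - h \<theta> t * trunc \<theta> K t) \<le> (indicator {t \<in> I \<theta>. h \<theta> t < 1 / K} t :: real)"
      by (auto simp: indicator_def not_less)
  qed
  also have "\<dots> = measure lborel {t \<in> I \<theta>. h \<theta> t < 1 / K}" by simp
  also have "\<dots> \<le> 4 * (1 / K)"
    using tip[of "1 / K" \<theta>] K unfolding measure_def by (intro enn2real_leI) auto
  finally show ?thesis by simp
qed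

lemma ig_it_eq: assumes v: "valid \<theta> f" shows "ig \<theta> (it \<theta> f n) = (\<integral>t. h \<theta> t * it \<theta> f n t \<partial>lborel)"
  by (rule ig_eq[OF BM_meas[OF fBM[OF valid_it[OF v]]]])

lemma AA_le:
  assumes K: "1 \<le> K" shows "AA \<theta> n \<le> ig \<theta> (it \<theta> (trunc \<theta> K) n) + 4 / K"
proof -
  note v = trunc_props(1)[OF K, of \<theta>]
  have i: "integrable lborel (\<lambda>t. h \<theta> t * it \<theta> (trunc \<theta> K) n t)" "integrable lborel (pp \<theta> n)"
    using prob_fun_valid[OF valid_it[OF v]] prob_fun_pow[OF prob_fun_I] by (auto simp: prob_fun_def)
  have "AA \<theta> n \<le> (\<integral>t. h \<theta> t * it \<theta> (trunc \<theta> K) n t + max 0 (pp \<theta> n t - h \<theta> t * it \<theta> (trunc \<theta> K) n t) \<partial>lborel)"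
    unfolding AA_def using i by (intro integral_mono Bochner_Integration.integrable_add integrable_max Bochner_Integration.integrable_diff) auto
  also have "\<dots> = ig \<theta> (it \<theta> (trunc \<theta> K) n) + (\<integral>t. max 0 (pp \<theta> n t - h \<theta> t * it \<theta> (trunc \<theta> K) n t) \<partial>lborel)"
    unfolding ig_it_eq[OF v]
    using i by (intro Bochner_Integration.integral_add integrable_max Bochner_Integration.integrable_diff) auto
  finally show ?thesis using trunc_excess[OF K, where n=n and \<theta>=\<theta>] by simp
qed

lemma AA_ge: "ig \<theta> (it \<theta> (\<lambda>_. 1 / (2 * real L)) n) \<le> AA \<theta> n"
proof -
  have l2: "1 / (2 * real L) \<le> 1 / 2" using L2 by (simp add: field_simps)
  have v: "valid \<theta> (\<lambda>_. 1 / (2 * real L))" by (rule const_valid) (use l2 in auto)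
  have "h \<theta> t * (1 / (2 * real L)) \<le> indicator (I \<theta>) t" for t
  proof (cases "h \<theta> t = 0")
    case False
    then have "t \<in> I \<theta>" by (intro I_supp) (simp add: less_le)
    then show ?thesis using v by (simp add: valid_def)
  qed simp
  then have "h \<theta> t * it \<theta> (\<lambda>_. 1 / (2 * real L)) n t \<le> pp \<theta> n t" for t
    unfolding h_it[OF v] by (intro hit_pow_mono prob_fun_I prob_fun_valid v)
  then show ?thesis unfolding ig_it_eq[OF v] AA_def
    using prob_fun_valid[OF valid_it[OF v]] prob_fun_pow[OF prob_fun_I]
    by (intro integral_mono) (auto simp: prob_fun_def)
qed

text \<open>With \<open>x\<close> the hitting probability, \<open>y\<close> its truncated version
  and \<open>e\<close> the excess, \<open>x \<le> 1\<close> gives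
  \<open>x\<^sup>2 \<le> x * y + e\<close>, so the excess enters linearly. One of the two factors
  \<open>h\<close> in \<open>y\<^sup>2\<close> is absorbed by the density of \<open>mu\<close>, the
  other is at most 2.\<close>

lemma pp_sq_le:
  assumes K: "1 \<le> K"
  shows "(\<integral>t. (pp \<theta> n t)\<^sup>2 \<partial>lborel) \<le> 2 * W \<theta> (it \<theta> (trunc \<theta> K) n) + 8 / K"
proof -
  note v = trunc_props(1)[OF K, of \<theta>]
  let ?u = "it \<theta> (trunc \<theta> K) n"
  let ?e = "\<lambda>t. max 0 (pp \<theta> n t - h \<theta> t * ?u t)"
  have pf: "prob_fun (\<lambda>t. h \<theta> t * ?u t)" "prob_fun (pp \<theta> n)"
    using prob_fun_valid[OF valid_it[OF v]] prob_fun_pow[OF prob_fun_I] by auto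
  have ei: "integrable lborel ?e" using pf by (auto simp: prob_fun_def intro!: integrable_max)
  have ui: "integrable lborel (\<lambda>t. h \<theta> t * (?u t)\<^sup>2)"
  proof -
    have "integrable (mu \<theta>) (\<lambda>t. (?u t)\<^sup>2)" by (intro BM_int BM_power fBM[OF valid_it[OF v]])
    moreover have "(\<lambda>t. (?u t)\<^sup>2) \<in> borel_measurable lborel"
      using BM_meas[OF BM_power[OF fBM[OF valid_it[OF v, of n]], of 2]] by simp
    ultimately show ?thesis unfolding mu_def by (subst (asm) integrable_real_density) auto
  qed
  have "(\<integral>t. (pp \<theta> n t)\<^sup>2 \<partial>lborel) \<le> (\<integral>t. 2 * (h \<theta> t * (?u t)\<^sup>2) + 2 * ?e t \<partial>lborel)"
  proof (rule integral_mono)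
    show "integrable lborel (\<lambda>t. (pp \<theta> n t)\<^sup>2)" by (rule prob_fun_sq_integrable[OF pf(2)])
    show "integrable lborel (\<lambda>t. 2 * (h \<theta> t * (?u t)\<^sup>2) + 2 * ?e t)"
      using ui ei by auto
    fix t
    define x y where "x = pp \<theta> n t" and "y = h \<theta> t * ?u t"
    have x: "0 \<le> x" "x \<le> 1" using pf(2) by (auto simp: x_def prob_fun_def)
    have "x * x \<le> x * (y + max 0 (x - y))" using x by (intro mult_left_mono) auto
    also have "\<dots> = x * y + x * max 0 (x - y)" by (simp add: distrib_left)
    also have "x * max 0 (x - y) \<le> 1 * max 0 (x - y)" using x by (intro mult_right_mono) auto
    also have "x * y \<le> x * x / 2 + y * y / 2"
    proof -
      have "0 \<le> (x - y)\<^sup>2 / 2" by simp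
      also have "\<dots> = x * x / 2 + y * y / 2 - x * y" by (simp add: power2_eq_square algebra_simps add_divide_distrib diff_divide_distrib)
      finally show ?thesis by simp
    qed
    finally have "x\<^sup>2 \<le> y * y + 2 * max 0 (x - y)" by (simp add: power2_eq_square)
    moreover have "y * y \<le> 2 * (h \<theta> t * (?u t)\<^sup>2)"
    proof -
      have "h \<theta> t * (h \<theta> t * (?u t)\<^sup>2) \<le> 2 * (h \<theta> t * (?u t)\<^sup>2)"
        using h_le2 by (intro mult_right_mono) auto
      then show ?thesis by (simp add: y_def power2_eq_square mult.left_commute mult.assoc)
    qed
    ultimately show "(pp \<theta> n t)\<^sup>2 \<le> 2 * (h \<theta> t * (?u t)\<^sup>2) + 2 * ?e t" unfolding x_def y_def by linarith
  qed
  also have "\<dots> = 2 * (\<integral>t. h \<theta> t * (?u t)\<^sup>2 \<partial>lborel) + 2 * (\<integral>t. ?e t \<partial>lborel)"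
    using ui ei by simp
  also have "(\<integral>t. h \<theta> t * (?u t)\<^sup>2 \<partial>lborel) = W \<theta> ?u"
    by (rule ig_eq[symmetric]) (rule BM_meas[OF BM_power[OF fBM[OF valid_it[OF v]]]])
  finally show ?thesis using trunc_excess[OF K, where n=n and \<theta>=\<theta>] by simp
qed

text \<open>The limit of \<open>n * AA\<close> says nothing about single decrements, yet these
  measure the overlaps in the almost sure statement. The choice \<open>K = n\<^sup>2\<close> makes
  the truncation error comparable with the second moment.\<close>

lemma AA_drop:
  obtains C N where "0 < C" "\<And>\<theta> n. N \<le> n \<Longrightarrow> 0 < n \<Longrightarrow> AA \<theta> n - AA \<theta> (Suc n) \<le> C / (real n)\<^sup>2"
proof -
  obtain C where C: "0 < C" and dec: "\<And>\<theta> f K n. valid \<theta> f \<Longrightarrow> (\<And>t. f t \<le> K) \<Longrightarrow> 1 \<le> K \<Longrightarrow> C * (1 + ln K) \<le> real n \<Longrightarrow>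
       W \<theta> (it \<theta> f n) \<le> C / (real n)\<^sup>2" by (rule W_decay) blast
  have "eventually (\<lambda>n. C * (1 + 2 * ln (real n)) \<le> real n) sequentially" by real_asymp
  then obtain N where N: "\<And>n. N \<le> n \<Longrightarrow> C * (1 + 2 * ln (real n)) \<le> real n"
    by (auto simp: eventually_sequentially)
  show ?thesis
  proof (rule that[of "(real L)\<^sup>2 / 2 * (2 * C + 8)" N])
    fix \<theta> n assume n: "N \<le> n" "0 < n"
    define K where "K = (real n)\<^sup>2"
    have K: "1 \<le> K" using n by (simp add: K_def)
    have "C * (1 + ln K) \<le> real n" using N[OF n(1)] n by (simp add: K_def ln_realpow)
    then have "W \<theta> (it \<theta> (trunc \<theta> K) n) \<le> C / K"
      using dec[OF trunc_props(1)[OF K, of \<theta>] trunc_props(2)[OF K] K] by (simp add: K_def)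
    then have "(\<integral>t. (pp \<theta> n t)\<^sup>2 \<partial>lborel) \<le> 2 * (C / K) + 8 / K"
      using pp_sq_le[OF K, where n=n and \<theta>=\<theta>] by linarith
    also have "\<dots> = (2 * C + 8) / K" by (simp add: add_divide_distrib)
    finally have "(real L)\<^sup>2 / 2 * (\<integral>t. (pp \<theta> n t)\<^sup>2 \<partial>lborel) \<le> (real L)\<^sup>2 / 2 * ((2 * C + 8) / K)"
      by (intro mult_left_mono) auto
    moreover have "AA \<theta> n - AA \<theta> (Suc n) \<le> (real L)\<^sup>2 / 2 * (\<integral>t. (pp \<theta> n t)\<^sup>2 \<partial>lborel)"
      using hit_drop_le[OF prob_fun_pow[OF prob_fun_I, where n=n and \<theta>=\<theta>], of \<theta>] by (simp add: AA_def)
    ultimately have "AA \<theta> n - AA \<theta> (Suc n) \<le> (real L)\<^sup>2 / 2 * ((2 * C + 8) / K)" by (rule order_trans[rotated])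
    then show "AA \<theta> n - AA \<theta> (Suc n) \<le> (real L)\<^sup>2 / 2 * (2 * C + 8) / (real n)\<^sup>2"
      by (simp only: K_def times_divide_eq_right)
  qed (use C in auto)
qed

lemma AA_limit:
  assumes e: "0 < \<epsilon>"
  shows "eventually (\<lambda>n. \<forall>\<theta>. \<bar>real n * AA \<theta> n - 2 / Vc \<theta>\<bar> \<le> \<epsilon>) sequentially"
proof -
  \<comment> \<open>The first bound keeps \<open>V / 2 - 2 * \<delta>\<close> above
    \<open>V / 4\<close>; the second makes the resulting error
    \<open>16 * \<delta> / V0\<^sup>2\<close> at most \<open>\<epsilon> / 2\<close>. One
    \<open>\<delta>\<close> comes from the asymptotics, the other absorbs their lower order
    terms.\<close>
  define \<delta> where "\<delta> = min (V0 / 8) (\<epsilon> * V0\<^sup>2 / 32)"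
  have d: "0 < \<delta>" "8 * \<delta> \<le> V0" "32 * \<delta> \<le> \<epsilon> * V0\<^sup>2" using V0 e by (auto simp: \<delta>_def min_def)
  obtain D1 where D1: "0 < D1" and up: "\<And>\<theta> f K n. valid \<theta> f \<Longrightarrow> (\<And>t. 0 < h \<theta> t \<Longrightarrow> 1 / (2 * real L) \<le> f t) \<Longrightarrow> (\<And>t. f t \<le> K) \<Longrightarrow> 1 \<le> K \<Longrightarrow>
       real n * (Vc \<theta> / 2 - \<delta>) - D1 * (1 + ln K) \<le> 1 / ig \<theta> (it \<theta> f n)"
    by (rule upper_asymptotics[OF d(1)]) blast
  obtain D2 where D2: "0 < D2" and lo: "\<And>\<theta> n. 1 / ig \<theta> (it \<theta> (\<lambda>_. 1 / (2 * real L)) n) \<le> real n * (Vc \<theta> / 2 + \<delta>) + D2"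
    by (rule lower_asymptotics[OF d(1)]) blast
  have ev: "eventually (\<lambda>n. D1 * (1 + 2 * ln (real n)) \<le> \<delta> * real n) sequentially"
    "eventually (\<lambda>n. D2 \<le> \<delta> * real n) sequentially"
    "eventually (\<lambda>n. 4 / real n \<le> \<epsilon> / 2) sequentially"
    using d e D1 D2 by real_asymp+
  show ?thesis
    using ev eventually_gt_at_top[of 0]
  proof eventually_elim
    case (elim n)
    show ?case
    proof
      fix \<theta>
      define V where "V = Vc \<theta>"
      have V: "V0 \<le> V" "0 < V" using V0 Vc_ge[of \<theta>] by (auto simp: V_def)
      have n: "0 < real n" using elim by simp
      have VV: "V0\<^sup>2 \<le> V * V" unfolding power2_eq_square using V V0 by (intro mult_mono) auto
      define K where "K = (real n)\<^sup>2"
      have K: "1 \<le> K" using n by (simp add: K_def)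
      note tp = trunc_props[OF K, of \<theta>]
      define a where "a = ig \<theta> (it \<theta> (trunc \<theta> K) n)"
      have "real n * (V / 2 - \<delta>) - D1 * (1 + ln K) \<le> 1 / a"
        unfolding a_def V_def by (rule up[OF tp(1) tp(3) tp(2) K])
      then have a1: "real n * (V / 2 - 2 * \<delta>) \<le> 1 / a"
        using elim(1) by (simp add: K_def ln_realpow n algebra_simps)
      have Vd: "0 < V / 2 - 2 * \<delta>" "V / 4 \<le> V / 2 - 2 * \<delta>" using d V by linarith+
      then have "0 < 1 / a" using a1 n by (smt (verit) mult_pos_pos)
      then have "0 < a" by simp
      have "real n * a \<le> 1 / (V / 2 - 2 * \<delta>)"
        using a1 \<open>0 < a\<close> Vd(1) by (simp add: field_simps)
      also have "\<dots> = 2 / V + 2 * \<delta> / ((V / 2 - 2 * \<delta>) * (V / 2))" using Vd V by (simp add: field_simps)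
      also have "2 * \<delta> / ((V / 2 - 2 * \<delta>) * (V / 2)) \<le> 2 * \<delta> / ((V / 4) * (V / 2))"
        using Vd V d by (intro divide_left_mono mult_right_mono mult_pos_pos) auto
      also have "\<dots> = 16 * \<delta> / (V * V)" by simp
      also have "\<dots> \<le> 16 * \<delta> / V0\<^sup>2" using VV V0 V d by (intro divide_left_mono) auto
      also have "\<dots> \<le> \<epsilon> / 2" using d V0 by (simp add: field_simps)
      finally have A: "real n * a \<le> 2 / V + \<epsilon> / 2" by simp
      have "real n * AA \<theta> n \<le> real n * (a + 4 / K)"
        unfolding a_def by (intro mult_left_mono AA_le K) auto
      also have "\<dots> = real n * a + 4 / real n" using n by (simp add: K_def field_simps power2_eq_square)
      finally have hi: "real n * AA \<theta> n \<le> 2 / V + \<epsilon>" using A elim(3) by linarith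
      define b where "b = ig \<theta> (it \<theta> (\<lambda>_. 1 / (2 * real L)) n)"
      have l2: "1 / (2 * real L) \<le> 1 / 2" using L2 by (simp add: field_simps)
      have vc: "valid \<theta> (\<lambda>_. 1 / (2 * real L))" by (rule const_valid) (use l2 in auto)
      have "ig \<theta> (\<lambda>_. 1 / (2 * real L * (real n + 1))) \<le> b" unfolding b_def
        by (intro ig_mono BM_const fBM[OF valid_it[OF vc]] it_lower vc) auto
      then have b0: "0 < b" unfolding ig_const
        by (rule less_le_trans[rotated]) (auto intro!: divide_pos_pos mult_pos_pos add_nonneg_pos)
      have "1 / b \<le> real n * (V / 2 + \<delta>) + D2" unfolding b_def V_def by (rule lo)
      then have "1 / b \<le> real n * (V / 2 + 2 * \<delta>)" using elim(2) by (simp add: algebra_simps)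
      then have "1 / (V / 2 + 2 * \<delta>) \<le> real n * b"
        using b0 V d n by (simp add: field_simps add_pos_pos)
      also have "\<dots> \<le> real n * AA \<theta> n" unfolding b_def by (intro mult_left_mono AA_ge) auto
      finally have 1: "1 / (V / 2 + 2 * \<delta>) \<le> real n * AA \<theta> n" .
      have pos: "0 < V / 2 + 2 * \<delta>" using V d by simp
      have "2 / V - 1 / (V / 2 + 2 * \<delta>) = 2 * \<delta> / ((V / 2 + 2 * \<delta>) * (V / 2))"
        using pos V d by (simp add: divide_simps) (simp add: algebra_simps)?
      also have "\<dots> \<le> 2 * \<delta> / ((V / 4) * (V / 2))"
        using V d by (intro divide_left_mono mult_right_mono mult_pos_pos) auto
      also have "\<dots> = 16 * \<delta> / (V * V)" by simp
      also have "\<dots> \<le> 16 * \<delta> / V0\<^sup>2" using VV V0 V d by (intro divide_left_mono) auto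
      also have "\<dots> \<le> \<epsilon>" using d V0 e by (simp add: field_simps)
      finally have "2 / V - \<epsilon> \<le> real n * AA \<theta> n" using 1 by linarith
      then show "\<bar>real n * AA \<theta> n - 2 / Vc \<theta>\<bar> \<le> \<epsilon>" using hi unfolding V_def by (simp add: abs_le_iff)
    qed
  qed
qed

end

section \<open>Chords of the unit square\<close>

definition chord_set :: "real \<Rightarrow> real \<Rightarrow> real \<Rightarrow> real set" where
  "chord_set c s t = {\<sigma>. 0 \<le> - t * s + \<sigma> * c \<and> - t * s + \<sigma> * c < 1 \<and> 0 \<le> t * c + \<sigma> * s \<and> t * c + \<sigma> * s < 1}"

text \<open>Length of the intersection of a line with the half-open unit square: half-open squares tile exactly.\<close>
definition chord :: "real \<Rightarrow> real \<Rightarrow> real \<Rightarrow> real" where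
  "chord c s t = measure lborel (chord_set c s t)"

text \<open>For \<open>c > 0\<close> the line is parametrised by its abscissa \<open>x\<close>; its
  ordinate is then \<open>(t + x * s) / c\<close>, and arclength is \<open>1 / c\<close> times the
  measure in \<open>x\<close>.\<close>

definition slice :: "real \<Rightarrow> real \<Rightarrow> real \<Rightarrow> real set" where
  "slice c s t = {x. 0 \<le> x \<and> x < 1 \<and> 0 \<le> t + x * s \<and> t + x * s < c}"

lemma chord_set_borel[measurable]: "chord_set c s t \<in> sets borel"
  unfolding chord_set_def by measurable

lemma slice_borel[measurable]: "slice c s t \<in> sets borel"
  unfolding slice_def by measurable

lemma emeasure_affine_preimage:
  assumes A: "A \<in> sets borel" and c: "c \<noteq> 0"
  shows "emeasure lborel {x. c * x - d \<in> A} = emeasure lborel A / ennreal \<bar>c\<bar>"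
proof -
  have 1: "(\<lambda>x. c * x - d) \<in> borel_measurable borel" by measurable
  have "emeasure lborel A = (\<integral>\<^sup>+x. indicator A x \<partial>lborel)" using A by simp
  also have "\<dots> = ennreal \<bar>c\<bar> * (\<integral>\<^sup>+x. indicator A (- d + c * x) \<partial>lborel)"
    using A c by (intro nn_integral_real_affine) auto
  also have "(\<lambda>x. indicator A (- d + c * x) :: ennreal) = indicator {x. c * x - d \<in> A}"
    by (auto simp: indicator_def fun_eq_iff add.commute)
  also have "(\<integral>\<^sup>+x. indicator {x. c * x - d \<in> A} x \<partial>lborel) = emeasure lborel {x. c * x - d \<in> A}"
    using measurable_sets[OF 1 A] by (intro nn_integral_indicator) (simp add: vimage_def)
  finally have "emeasure lborel A = emeasure lborel {x. c * x - d \<in> A} * ennreal \<bar>c\<bar>" by (simp only: mult.commute)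
  then show ?thesis using c by (simp add: mult_divide_eq_ennreal)
qed

lemma measure_affine_preimage:
  assumes A: "A \<in> sets borel" and c: "c \<noteq> 0"
  shows "measure lborel {x. c * x - d \<in> A} = measure lborel A / \<bar>c\<bar>"
proof (cases "emeasure lborel A = \<infinity>")
  case True
  then have "emeasure lborel {x. c * x - d \<in> A} = \<infinity>"
    using emeasure_affine_preimage[OF assms, of d] by (simp add: ennreal_top_divide)
  with True show ?thesis by (simp only: measure_def) simp
next
  case False
  have e: "emeasure lborel A = ennreal (measure lborel A)"
    by (rule emeasure_eq_ennreal_measure) (use False in auto)
  have "emeasure lborel {x. c * x - d \<in> A} = ennreal (measure lborel A / \<bar>c\<bar>)"
    unfolding emeasure_affine_preimage[OF assms] e using c by (intro divide_ennreal) auto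
  then show ?thesis by (rule measure_eq_emeasure_eq_ennreal[rotated]) simp
qed

lemma chord_swap: "chord s c (- t) = chord c s t"
proof -
  have "chord_set s c (- t) = chord_set c s t" by (auto simp: chord_set_def)
  then show ?thesis by (simp add: chord_def)
qed

lemma chord_neg: "chord (- c) (- s) (- t) = chord c s t"
proof -
  have "chord_set (- c) (- s) (- t) = {x. (- 1) * x - 0 \<in> chord_set c s t}" by (auto simp: chord_set_def)
  then show ?thesis
    using measure_affine_preimage[OF chord_set_borel, of "-1" 0 c s t] by (simp add: chord_def)
qed

text \<open>Reversing the direction and exchanging the coordinates reduce every direction to one
  closer to the horizontal axis and pointing to the right.\<close>

lemma direction_cases:
  fixes c s :: real
  assumes base: "\<And>c s. c\<^sup>2 + s\<^sup>2 = 1 \<Longrightarrow> \<bar>s\<bar> \<le> c \<Longrightarrow> P c s"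
    and neg: "\<And>c s. P (- c) (- s) \<Longrightarrow> P c s" and swap: "\<And>c s. P s c \<Longrightarrow> P c s"
    and cs: "c\<^sup>2 + s\<^sup>2 = 1"
  shows "P c s"
proof -
  have cs': "s\<^sup>2 + c\<^sup>2 = 1" using cs by simp
  consider "\<bar>s\<bar> \<le> c" | "\<bar>s\<bar> \<le> - c" | "\<bar>c\<bar> \<le> s" | "\<bar>c\<bar> \<le> - s" by linarith
  then show ?thesis
  proof cases
    case 1 then show ?thesis using base cs by blast
  next
    case 2 then show ?thesis using base[of "- c" "- s"] cs neg by simp
  next
    case 3 then show ?thesis using base[of s c] cs' swap by blast
  next
    case 4 then show ?thesis using base[of "- s" "- c"] cs' neg[of s c] swap by simp
  qed
qed

lemma major_ge_half: assumes "c\<^sup>2 + s\<^sup>2 = 1" "\<bar>s\<bar> \<le> c" shows "1/2 \<le> (c::real)" "c \<le> 1" "\<bar>s\<bar> \<le> 1"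
proof -
  have "s\<^sup>2 \<le> c\<^sup>2" using assms(2) by (intro abs_le_square_iff[THEN iffD1]) auto
  then have "(1/2)\<^sup>2 \<le> c\<^sup>2" using assms(1) by (simp add: power2_eq_square)
  then show "1/2 \<le> c" by (rule power2_le_imp_le) (use assms(2) in auto)
  have "0 \<le> s\<^sup>2" "0 \<le> c\<^sup>2" by auto
  then have "c\<^sup>2 \<le> 1" "s\<^sup>2 \<le> 1" using assms(1) by argo+
  then have "c\<^sup>2 \<le> 1\<^sup>2" "s\<^sup>2 \<le> 1\<^sup>2" by simp_all
  then show "c \<le> 1" "\<bar>s\<bar> \<le> 1" using power2_le_imp_le[of c 1] abs_le_square_iff[of s 1] by auto
qed

lemma chord_slice:
  assumes cs: "c\<^sup>2 + s\<^sup>2 = 1" and c: "0 < c"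
  shows "chord c s t = measure lborel (slice c s t) / c"
proof -
  have "chord_set c s t = {x. c * x - t * s \<in> slice c s t}"
  proof -
    have "t * c + \<sigma> * s = (t + (c * \<sigma> - t * s) * s) / c" for \<sigma>
    proof -
      have "(t + (c * \<sigma> - t * s) * s) = t * (1 - s\<^sup>2) + c * \<sigma> * s" by (simp add: algebra_simps power2_eq_square)
      also have "1 - s\<^sup>2 = c\<^sup>2" using cs by simp
      finally show ?thesis using c by (simp add: field_simps power2_eq_square)
    qed
    then show ?thesis using c by (auto simp: chord_set_def slice_def algebra_simps divide_le_eq zero_le_divide_iff less_divide_eq divide_less_eq)
  qed
  then show ?thesis
    using measure_affine_preimage[OF slice_borel, of c "t * s" c s t] c by (simp add: chord_def)
qed

lemma unit_fmeasurable: "{0..<1::real} \<in> fmeasurable lborel"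
  by (rule fmeasurableI) auto

lemma measure_subset_unit: "A \<in> sets borel \<Longrightarrow> A \<subseteq> {0..<1::real} \<Longrightarrow> measure lborel A \<le> 1"
  using measure_mono_fmeasurable[OF _ _ unit_fmeasurable, of A] by simp

lemma chord_nonneg: "0 \<le> chord c s t" by (simp add: chord_def)

lemma chord_le2: "c\<^sup>2 + s\<^sup>2 = 1 \<Longrightarrow> chord c s t \<le> 2"
proof -
  assume cs: "c\<^sup>2 + s\<^sup>2 = 1"
  have "\<forall>t. chord c s t \<le> 2"
  proof (rule direction_cases[OF _ _ _ cs])
    fix c s :: real assume cs: "c\<^sup>2 + s\<^sup>2 = 1" "\<bar>s\<bar> \<le> c"
    note ch = major_ge_half[OF cs]
    have "measure lborel (slice c s t) / c \<le> 1 / (1/2)" for t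
      using ch by (intro frac_le measure_subset_unit slice_borel) (auto simp: slice_def)
    then show "\<forall>t. chord c s t \<le> 2" using chord_slice[OF cs(1)] ch by simp
  qed (metis chord_neg minus_minus, metis chord_swap minus_minus)
  then show ?thesis by simp
qed

lemma chord_meas[measurable]: "chord c s \<in> borel_measurable borel"
proof -
  have "{p \<in> space (borel \<Otimes>\<^sub>M lborel). 0 \<le> - fst p * s + snd p * c \<and> - fst p * s + snd p * c < 1 \<and>
      0 \<le> fst p * c + snd p * s \<and> fst p * c + snd p * s < 1} \<in> sets (borel \<Otimes>\<^sub>M lborel)" (is "?A \<in> _")
    by measurable
  then have "(\<lambda>t. emeasure lborel (Pair t -` ?A)) \<in> borel_measurable borel"
    by (rule lborel.measurable_emeasure_Pair)
  moreover have "Pair t -` ?A = chord_set c s t" for t by (auto simp: chord_set_def space_pair_measure)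
  ultimately have "(\<lambda>t. emeasure lborel (chord_set c s t)) \<in> borel_measurable borel" by (simp only:)
  then show ?thesis unfolding chord_def[abs_def] measure_def by measurable
qed

text \<open>By Fubini this is the area of the unit square, computed in the coordinates of
  \<open>slice\<close>.\<close>

lemma chord_total: "c\<^sup>2 + s\<^sup>2 = 1 \<Longrightarrow> (\<integral>\<^sup>+t. ennreal (chord c s t) \<partial>lborel) = 1"
proof (rule direction_cases[of "\<lambda>c s. (\<integral>\<^sup>+t. ennreal (chord c s t) \<partial>lborel) = 1"])
  have flip: "(\<integral>\<^sup>+t. ennreal (chord c s (- t)) \<partial>lborel) = (\<integral>\<^sup>+t. ennreal (chord c s t) \<partial>lborel)" for c s
    using nn_integral_real_affine[of "\<lambda>t. ennreal (chord c s t)" "-1" 0] by simp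
  show "(\<integral>\<^sup>+t. ennreal (chord c s t) \<partial>lborel) = 1" if "(\<integral>\<^sup>+t. ennreal (chord (- c) (- s) t) \<partial>lborel) = 1" for c s
    using that flip[of "- c" "- s"] by (simp add: chord_neg)
  show "(\<integral>\<^sup>+t. ennreal (chord c s t) \<partial>lborel) = 1" if "(\<integral>\<^sup>+t. ennreal (chord s c t) \<partial>lborel) = 1" for c s
    using that flip[of s c] by (simp add: chord_swap)
  fix c s :: real assume cs: "c\<^sup>2 + s\<^sup>2 = 1" "\<bar>s\<bar> \<le> c"
  note ch = major_ge_half[OF cs]
  then have c: "0 < c" by simp
  define ind where "ind x t = (indicator {0..<1} x * indicator {- x * s..<c - x * s} t :: ennreal)" for x t :: real
  have sl: "ennreal (chord c s t) = ennreal (1 / c) * (\<integral>\<^sup>+x. ind x t \<partial>lborel)" for t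
  proof -
    have fin: "emeasure lborel (slice c s t) \<noteq> \<infinity>"
    proof -
      have "emeasure lborel (slice c s t) \<le> emeasure lborel {0..<1::real}" by (intro emeasure_mono) (auto simp: slice_def)
      then show ?thesis by (auto simp: top_unique)
    qed
    have "(\<lambda>x. ind x t) = indicator (slice c s t)" by (auto simp: ind_def indicator_def slice_def fun_eq_iff)
    then have "(\<integral>\<^sup>+x. ind x t \<partial>lborel) = ennreal (measure lborel (slice c s t))"
      using fin by (simp add: emeasure_eq_ennreal_measure)
    then show ?thesis using chord_slice[OF cs(1) c, of t] c by (simp flip: ennreal_mult')
  qed
  have [measurable]: "(\<lambda>(x, t). ind x t) \<in> borel_measurable (lborel \<Otimes>\<^sub>M lborel)"
    unfolding ind_def indicator_def atLeastLessThan_iff by measurable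
  have "(\<integral>\<^sup>+t. ennreal (chord c s t) \<partial>lborel) = ennreal (1 / c) * (\<integral>\<^sup>+t. (\<integral>\<^sup>+x. ind x t \<partial>lborel) \<partial>lborel)"
    unfolding sl by (rule nn_integral_cmult) measurable
  also have "(\<integral>\<^sup>+t. (\<integral>\<^sup>+x. ind x t \<partial>lborel) \<partial>lborel) = (\<integral>\<^sup>+x. (\<integral>\<^sup>+t. ind x t \<partial>lborel) \<partial>lborel)"
    by (rule lborel_pair.Fubini') measurable
  also have "\<dots> = (\<integral>\<^sup>+x. ennreal c * indicator {0..<1::real} x \<partial>lborel)"
    unfolding ind_def using c by (intro nn_integral_cong) (simp add: nn_integral_cmult mult.commute)
  also have "\<dots> = ennreal c" by (simp add: nn_integral_cmult)
  finally show "(\<integral>\<^sup>+t. ennreal (chord c s t) \<partial>lborel) = 1" using c by (simp flip: ennreal_mult')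
qed

text \<open>Bounded variation with total at most \<open>R\<close>, expressed through a monotone
  majorant of the increments. Positive averaging operators such as \<open>Ms\<close> can be applied
  to \<open>f\<close> and to the majorant simultaneously.\<close>

definition bv_dom :: "real \<Rightarrow> (real \<Rightarrow> real) \<Rightarrow> bool" where
  "bv_dom R f \<longleftrightarrow> (\<exists>\<tau>. mono \<tau> \<and> (\<forall>t. 0 \<le> \<tau> t \<and> \<tau> t \<le> R) \<and> (\<forall>t t'. t \<le> t' \<longrightarrow> \<bar>f t - f t'\<bar> \<le> \<tau> t' - \<tau> t))"

lemma bv_dom_flip: "bv_dom R f \<Longrightarrow> bv_dom R (\<lambda>t. f (- t))"
  unfolding bv_dom_def
proof (elim exE conjE)
  fix \<tau> assume t: "mono \<tau>" "\<forall>t. 0 \<le> \<tau> t \<and> \<tau> t \<le> R" "\<forall>t t'. t \<le> t' \<longrightarrow> \<bar>f t - f t'\<bar> \<le> \<tau> t' - \<tau> t"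
  show "\<exists>\<tau>. mono \<tau> \<and> (\<forall>t. 0 \<le> \<tau> t \<and> \<tau> t \<le> R) \<and> (\<forall>t t'. t \<le> t' \<longrightarrow> \<bar>f (- t) - f (- t')\<bar> \<le> \<tau> t' - \<tau> t)"
  proof (intro exI[of _ "\<lambda>t. R - \<tau> (- t)"] conjI allI impI)
    show "mono (\<lambda>t. R - \<tau> (- t))" using t(1) by (auto simp: mono_def)
    fix v w :: real assume "v \<le> w"
    then have "- w \<le> - v" by simp
    then have "\<bar>f (- w) - f (- v)\<bar> \<le> \<tau> (- v) - \<tau> (- w)" using t(3) by blast
    then show "\<bar>f (- v) - f (- w)\<bar> \<le> R - \<tau> (- w) - (R - \<tau> (- v))" by (simp add: abs_minus_commute)
  qed (use t(2) in auto)
qed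

lemma bv_dom_affine: "bv_dom R f \<Longrightarrow> 0 < l \<Longrightarrow> bv_dom R (\<lambda>t. f (l * t - d))"
  unfolding bv_dom_def
proof (elim exE conjE)
  fix \<tau> assume t: "mono \<tau>" "\<forall>t. 0 \<le> \<tau> t \<and> \<tau> t \<le> R" "\<forall>t t'. t \<le> t' \<longrightarrow> \<bar>f t - f t'\<bar> \<le> \<tau> t' - \<tau> t" and l: "0 < l"
  then show "\<exists>\<tau>. mono \<tau> \<and> (\<forall>t. 0 \<le> \<tau> t \<and> \<tau> t \<le> R) \<and> (\<forall>t t'. t \<le> t' \<longrightarrow> \<bar>f (l * t - d) - f (l * t' - d)\<bar> \<le> \<tau> t' - \<tau> t)"
    by (intro exI[of _ "\<lambda>t. \<tau> (l * t - d)"]) (auto simp: mono_def)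
qed

lemma bv_dom_combine:
  assumes f: "bv_dom R f" and g: "bv_dom S g" and A: "0 \<le> A" and B: "0 \<le> B"
    and k: "\<And>t t'. \<bar>k t - k t'\<bar> \<le> A * \<bar>f t - f t'\<bar> + B * \<bar>g t - g t'\<bar>"
  shows "bv_dom (A * R + B * S) k"
proof -
  from f obtain \<tau> where t: "mono \<tau>" "\<And>t. 0 \<le> \<tau> t \<and> \<tau> t \<le> R" "\<And>t t'. t \<le> t' \<Longrightarrow> \<bar>f t - f t'\<bar> \<le> \<tau> t' - \<tau> t"
    by (auto simp: bv_dom_def)
  from g obtain \<rho> where r: "mono \<rho>" "\<And>t. 0 \<le> \<rho> t \<and> \<rho> t \<le> S" "\<And>t t'. t \<le> t' \<Longrightarrow> \<bar>g t - g t'\<bar> \<le> \<rho> t' - \<rho> t"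
    by (auto simp: bv_dom_def)
  show ?thesis unfolding bv_dom_def
  proof (intro exI[of _ "\<lambda>t. A * \<tau> t + B * \<rho> t"] conjI allI impI)
    show "mono (\<lambda>t. A * \<tau> t + B * \<rho> t)" using t(1) r(1) A B
      by (auto simp: mono_def intro!: add_mono mult_left_mono)
    show "0 \<le> A * \<tau> t + B * \<rho> t" "A * \<tau> t + B * \<rho> t \<le> A * R + B * S" for t
      using t(2) r(2) A B by (auto intro!: add_nonneg_nonneg add_mono mult_left_mono)
    fix v w :: real assume vw: "v \<le> w"
    have "A * \<bar>f v - f w\<bar> \<le> A * (\<tau> w - \<tau> v)" "B * \<bar>g v - g w\<bar> \<le> B * (\<rho> w - \<rho> v)"
      using t(3)[OF vw] r(3)[OF vw] A B by (auto intro: mult_left_mono)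
    then show "\<bar>k v - k w\<bar> \<le> A * \<tau> w + B * \<rho> w - (A * \<tau> v + B * \<rho> v)"
      using k[of v w] by (simp add: algebra_simps)
  qed
qed

lemma bv_dom_const: "bv_dom 0 (\<lambda>_. c)"
  unfolding bv_dom_def by (intro exI[of _ "\<lambda>_. 0"]) (auto simp: mono_def)

lemma bv_dom_mult:
  assumes "bv_dom R f" "bv_dom S g" "\<And>t. \<bar>f t\<bar> \<le> A" "\<And>t. \<bar>g t\<bar> \<le> B"
  shows "bv_dom (B * R + A * S) (\<lambda>t. f t * g t)"
proof (rule bv_dom_combine[OF assms(1,2)])
  show "0 \<le> B" "0 \<le> A" using assms(3)[of 0] assms(4)[of 0] by linarith+
  fix t t'
  have "f t * g t - f t' * g t' = g t * (f t - f t') + f t' * (g t - g t')" by (simp add: algebra_simps)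
  then have "\<bar>f t * g t - f t' * g t'\<bar> \<le> \<bar>g t\<bar> * \<bar>f t - f t'\<bar> + \<bar>f t'\<bar> * \<bar>g t - g t'\<bar>"
    using abs_triangle_ineq[of "g t * (f t - f t')" "f t' * (g t - g t')"] by (simp add: abs_mult)
  also have "\<dots> \<le> B * \<bar>f t - f t'\<bar> + A * \<bar>g t - g t'\<bar>"
    using assms(3,4) by (intro add_mono mult_right_mono) auto
  finally show "\<bar>f t * g t - f t' * g t'\<bar> \<le> B * \<bar>f t - f t'\<bar> + A * \<bar>g t - g t'\<bar>" .
qed

lemma bv_dom_sum:
  assumes "finite S" "\<And>i. i \<in> S \<Longrightarrow> bv_dom R (f i)"
  shows "bv_dom (real (card S) * R) (\<lambda>t. \<Sum>i\<in>S. f i t)"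
  using assms
proof (induction S rule: finite_induct)
  case (insert a S)
  have "bv_dom (1 * R + 1 * (real (card S) * R)) (\<lambda>t. f a t + (\<Sum>i\<in>S. f i t))"
    by (rule bv_dom_combine[of _ "f a" _ "\<lambda>t. \<Sum>i\<in>S. f i t"]) (use insert in auto)
  then show ?case using insert by (simp add: algebra_simps)
qed (use bv_dom_const in simp)

lemma bv_dom_inverse:
  assumes f: "bv_dom R f" and d: "0 < \<delta>"
  shows "bv_dom (R / \<delta>\<^sup>2) (\<lambda>t. 1 / max (f t) \<delta>)"
proof -
  have "bv_dom ((1 / \<delta>\<^sup>2) * R + 0 * 0) (\<lambda>t. 1 / max (f t) \<delta>)"
  proof (rule bv_dom_combine[OF f bv_dom_const])
    fix t t'
    define a b where "a = max (f t) \<delta>" and "b = max (f t') \<delta>"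
    have ab: "\<delta> \<le> a" "\<delta> \<le> b" by (auto simp: a_def b_def)
    have "\<bar>1 / a - 1 / b\<bar> = \<bar>a - b\<bar> / (a * b)"
    proof -
      have "1 / a - 1 / b = (b - a) / (a * b)" using ab d by (simp add: field_simps)
      then show ?thesis using ab d by (simp add: abs_divide abs_mult abs_minus_commute)
    qed
    also have "\<dots> \<le> \<bar>a - b\<bar> / \<delta>\<^sup>2" unfolding power2_eq_square
      using ab d by (intro divide_left_mono mult_mono mult_pos_pos) auto
    also have "\<dots> \<le> \<bar>f t - f t'\<bar> / \<delta>\<^sup>2" by (rule divide_right_mono) (auto simp: a_def b_def)
    finally show "\<bar>1 / max (f t) \<delta> - 1 / max (f t') \<delta>\<bar> \<le> 1 / \<delta>\<^sup>2 * \<bar>f t - f t'\<bar> + 0 * \<bar>0 - 0\<bar>"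
      by (simp add: a_def b_def)
  qed auto
  then show ?thesis by simp
qed

text \<open>The slice is a difference of two sets \<open>U d t\<close>, each increasing in
  \<open>t\<close>. Both measures are at most 1 and \<open>c \<ge> 1/2\<close>, hence the bound
  4.\<close>

lemma chord_bv: "c\<^sup>2 + s\<^sup>2 = 1 \<Longrightarrow> bv_dom 4 (chord c s)"
proof (rule direction_cases[of "\<lambda>c s. bv_dom 4 (chord c s)"])
  show "bv_dom 4 (chord c s)" if "bv_dom 4 (chord (- c) (- s))" for c s
    using bv_dom_flip[OF that] by (simp add: chord_neg)
  show "bv_dom 4 (chord c s)" if "bv_dom 4 (chord s c)" for c s
    using bv_dom_flip[OF that] by (simp add: chord_swap)
  fix c s :: real assume cs: "c\<^sup>2 + s\<^sup>2 = 1" "\<bar>s\<bar> \<le> c"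
  note ch = major_ge_half[OF cs]
  then have c: "0 < c" by simp
  define U where "U d t = {x. 0 \<le> x \<and> x < 1 \<and> d \<le> t + x * s}" for d t :: real
  have Um[measurable]: "U d t \<in> sets borel" for d t unfolding U_def by measurable
  have Uf: "U d t \<in> fmeasurable lborel" for d t
    by (rule fmeasurableI2[OF unit_fmeasurable]) (auto simp: U_def[abs_def])
  have Ub: "0 \<le> measure lborel (U d t)" "measure lborel (U d t) \<le> 1" for d t
    by (auto intro!: measure_subset_unit simp: U_def)
  have Umono: "measure lborel (U d t) \<le> measure lborel (U d t')" if "t \<le> t'" for d t t'
    using that Uf by (intro measure_mono_fmeasurable) (auto simp: U_def)
  have ceq: "chord c s t = (measure lborel (U 0 t) - measure lborel (U c t)) / c" for t
  proof -
    have "slice c s t = U 0 t - U c t" using c by (auto simp: slice_def U_def)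
    moreover have "measure lborel (U 0 t - U c t) = measure lborel (U 0 t) - measure lborel (U c t)"
      using Uf c by (intro measure_Diff) (auto simp: U_def dest: fmeasurableD2)
    ultimately show ?thesis using chord_slice[OF cs(1) c] by simp
  qed
  show "bv_dom 4 (chord c s)" unfolding bv_dom_def
  proof (intro exI[of _ "\<lambda>t. (measure lborel (U 0 t) + measure lborel (U c t)) / c"] conjI allI impI)
    show "mono (\<lambda>t. (measure lborel (U 0 t) + measure lborel (U c t)) / c)"
      using c Umono by (auto simp: mono_def intro!: divide_right_mono add_mono)
    show "0 \<le> (measure lborel (U 0 t) + measure lborel (U c t)) / c" for t using c by simp
    show "(measure lborel (U 0 t) + measure lborel (U c t)) / c \<le> 4" for t
    proof -
      have "(measure lborel (U 0 t) + measure lborel (U c t)) / c \<le> 2 / (1/2)"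
        using Ub[of 0 t] Ub[of c t] ch by (intro frac_le) auto
      then show ?thesis by simp
    qed
    fix v w :: real assume vw: "v \<le> w"
    have "\<bar>(measure lborel (U 0 v) - measure lborel (U c v)) - (measure lborel (U 0 w) - measure lborel (U c w))\<bar>
      \<le> (measure lborel (U 0 w) + measure lborel (U c w)) - (measure lborel (U 0 v) + measure lborel (U c v))"
      using Umono[OF vw, of 0] Umono[OF vw, of c] by linarith
    then have "\<bar>(measure lborel (U 0 v) - measure lborel (U c v)) - (measure lborel (U 0 w) - measure lborel (U c w))\<bar> / c
      \<le> ((measure lborel (U 0 w) + measure lborel (U c w)) - (measure lborel (U 0 v) + measure lborel (U c v))) / c"
      using c by (intro divide_right_mono) auto
    then show "\<bar>chord c s v - chord c s w\<bar> \<le> (measure lborel (U 0 w) + measure lborel (U c w)) / c - (measure lborel (U 0 v) + measure lborel (U c v)) / c"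
      unfolding ceq using c by (simp add: abs_divide flip: diff_divide_distrib)
  qed
qed

text \<open>The projection of the closed unit square, as \<open>shadow_iff\<close> confirms.\<close>

definition shadow :: "real \<Rightarrow> real \<Rightarrow> real set" where
  "shadow c s = {min 0 c + min 0 (- s) .. max 0 c + max 0 (- s)}"

lemma chord_set_shadow: "c\<^sup>2 + s\<^sup>2 = 1 \<Longrightarrow> \<sigma> \<in> chord_set c s t \<Longrightarrow> t \<in> shadow c s"
proof -
  assume cs: "c\<^sup>2 + s\<^sup>2 = 1" and m: "\<sigma> \<in> chord_set c s t"
  define x y where "x = - t * s + \<sigma> * c" and "y = t * c + \<sigma> * s"
  have xy: "0 \<le> x" "x \<le> 1" "0 \<le> y" "y \<le> 1" using m by (auto simp: x_def y_def chord_set_def)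
  have "y * c + x * (- s) = t * (c\<^sup>2 + s\<^sup>2)" by (simp add: x_def y_def algebra_simps power2_eq_square)
  then have t: "t = y * c + x * (- s)" using cs by simp
  have "min 0 z \<le> w * z \<and> w * z \<le> max 0 z" if "0 \<le> w" "w \<le> 1" for w z :: real
  proof (cases "0 \<le> z")
    case True then show ?thesis using that mult_right_mono[of w 1 z] by simp
  next
    case False then show ?thesis using that mult_right_mono_neg[of w 1 z] by (simp add: mult_nonneg_nonpos)
  qed
  from this[OF xy(3,4), of c] this[OF xy(1,2), of "- s"] show ?thesis unfolding t shadow_def by auto
qed

lemma chord_shadow: "c\<^sup>2 + s\<^sup>2 = 1 \<Longrightarrow> 0 < chord c s t \<Longrightarrow> t \<in> shadow c s"
  using chord_set_shadow[of c s _ t] by (cases "chord_set c s t = {}") (auto simp: chord_def)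

text \<open>As a function of \<open>t\<close> the chord length is a trapezoid over the shadow,
  degenerating to a rectangle for axis-parallel lines. Its plateau is at least 1 and its flanks have
  slope at least 2 in absolute value, so distance \<open>2 * \<delta>\<close> from both ends ensures
  the value \<open>\<delta>\<close>.\<close>

lemma chord_tip:
  "c\<^sup>2 + s\<^sup>2 = 1 \<Longrightarrow> 0 < \<delta> \<Longrightarrow> \<delta> \<le> 1 \<Longrightarrow> emeasure lborel {t \<in> shadow c s. chord c s t < \<delta>} \<le> ennreal (4 * \<delta>)"
proof -
  assume cs: "c\<^sup>2 + s\<^sup>2 = 1" and d: "0 < \<delta>" "\<delta> \<le> 1"
  let ?P = "\<lambda>c s. \<forall>t. min 0 c + min 0 (- s) + 2 * \<delta> \<le> t \<longrightarrow> t \<le> max 0 c + max 0 (- s) - 2 * \<delta> \<longrightarrow> \<delta> \<le> chord c s t"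
  have "?P c s"
  proof (rule direction_cases[of ?P, OF _ _ _ cs])
    fix c s :: real assume P: "?P (- c) (- s)"
    show "?P c s"
    proof (intro allI impI)
      fix t assume "min 0 c + min 0 (- s) + 2 * \<delta> \<le> t" "t \<le> max 0 c + max 0 (- s) - 2 * \<delta>"
      then have "\<delta> \<le> chord (- c) (- s) (- t)" by (intro P[rule_format]) (auto simp: min_def max_def split: if_splits)
      then show "\<delta> \<le> chord c s t" by (simp add: chord_neg)
    qed
  next
    fix c s :: real assume P: "?P s c"
    show "?P c s"
    proof (intro allI impI)
      fix t assume "min 0 c + min 0 (- s) + 2 * \<delta> \<le> t" "t \<le> max 0 c + max 0 (- s) - 2 * \<delta>"
      then have "\<delta> \<le> chord s c (- t)" by (intro P[rule_format]) (auto simp: min_def max_def split: if_splits)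
      then show "\<delta> \<le> chord c s t" by (simp add: chord_swap)
    qed
  next
    fix c s :: real assume cs: "c\<^sup>2 + s\<^sup>2 = 1" "\<bar>s\<bar> \<le> c"
    note ch = major_ge_half[OF cs]
    then have c: "0 < c" by simp
    show "?P c s"
    proof (intro allI impI)
      fix t assume t: "min 0 c + min 0 (- s) + 2 * \<delta> \<le> t" "t \<le> max 0 c + max 0 (- s) - 2 * \<delta>"
      have "\<exists>l u. {l<..<u} \<subseteq> slice c s t \<and> \<delta> \<le> u - l"
      proof (cases s "0 :: real" rule: linorder_cases)
        case equal
        then have "{0<..<1} \<subseteq> slice c s t" using t c d by (auto simp: slice_def)
        then show ?thesis using d by force
      next
        case greater
        have td: "- s + 2 * \<delta> \<le> t" "t \<le> c - 2 * \<delta>" using t c greater by auto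
        have sc: "s \<le> c" "s \<le> 1" using cs(2) ch greater by auto
        have sub: "{max 0 (- t / s)<..<min 1 ((c - t) / s)} \<subseteq> slice c s t"
          using greater by (auto simp: slice_def field_simps)
        have ds1: "\<delta> * s \<le> 1 * s" by (rule mult_right_mono) (use d greater in auto)
        have ds2: "\<delta> * s \<le> \<delta> * 1" by (rule mult_left_mono) (use d sc in auto)
        have "\<delta> * s \<le> s + t" "\<delta> * s \<le> c - t" "\<delta> * s \<le> c" using ds1 ds2 td d sc by linarith+
        then have 1: "\<delta> \<le> 1 - (- t / s)" "\<delta> \<le> (c - t) / s" "\<delta> \<le> (c - t) / s - (- t / s)"
          using greater by (simp_all add: field_simps)
        have "\<delta> \<le> min 1 ((c - t) / s) - max 0 (- t / s)" using 1 d unfolding min_def max_def by auto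
        then show ?thesis using sub by blast
      next
        case less
        have td: "2 * \<delta> \<le> t" "t \<le> c - s - 2 * \<delta>" using t c less by auto
        have sc: "- s \<le> c" "- s \<le> 1" using cs(2) ch less by auto
        have sub: "{max 0 ((c - t) / s)<..<min 1 (- t / s)} \<subseteq> slice c s t"
          using less by (auto simp: slice_def field_simps)
        have ds1: "\<delta> * (- s) \<le> 1 * (- s)" by (rule mult_right_mono) (use d less in auto)
        have ds2: "\<delta> * (- s) \<le> \<delta> * 1" by (rule mult_left_mono) (use d sc in auto)
        have "\<delta> * (- s) \<le> c - s - t" "\<delta> * (- s) \<le> t" "\<delta> * (- s) \<le> c" using ds1 ds2 td d sc by linarith+
        then have 1: "\<delta> \<le> 1 - (c - t) / s" "\<delta> \<le> - t / s" "\<delta> \<le> - t / s - (c - t) / s"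
          using less by (simp_all add: field_simps)
        have "\<delta> \<le> min 1 (- t / s) - max 0 ((c - t) / s)" using 1 d unfolding min_def max_def by auto
        then show ?thesis using sub by blast
      qed
      then obtain l u where lu: "{l<..<u} \<subseteq> slice c s t" "\<delta> \<le> u - l" by blast
      have "slice c s t \<in> fmeasurable lborel"
        by (rule fmeasurableI2[OF unit_fmeasurable]) (auto simp: slice_def[abs_def])
      then have "measure lborel {l<..<u} \<le> measure lborel (slice c s t)"
        using lu by (intro measure_mono_fmeasurable) auto
      then have m: "\<delta> \<le> measure lborel (slice c s t)" using lu d by simp
      also have "\<dots> \<le> measure lborel (slice c s t) / c"
        using ch c by (simp add: le_divide_eq mult_left_le)
      finally show "\<delta> \<le> chord c s t" using chord_slice[OF cs(1) c] by simp
    qed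
  qed
  then have sub: "{t \<in> shadow c s. chord c s t < \<delta>} \<subseteq>
     {min 0 c + min 0 (- s) .. min 0 c + min 0 (- s) + 2 * \<delta>} \<union> {max 0 c + max 0 (- s) - 2 * \<delta> .. max 0 c + max 0 (- s)}"
    (is "_ \<subseteq> ?A \<union> ?B")
  proof (intro subsetI)
    fix t assume P: "?P c s" and t: "t \<in> {t \<in> shadow c s. chord c s t < \<delta>}"
    then have "\<not> (min 0 c + min 0 (- s) + 2 * \<delta> \<le> t \<and> t \<le> max 0 c + max 0 (- s) - 2 * \<delta>)"
      by (metis mem_Collect_eq not_le)
    with t show "t \<in> ?A \<union> ?B" unfolding shadow_def by auto
  qed
  have "emeasure lborel {t \<in> shadow c s. chord c s t < \<delta>} \<le> emeasure lborel (?A \<union> ?B)"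
    by (intro emeasure_mono sub) auto
  also have "\<dots> \<le> emeasure lborel ?A + emeasure lborel ?B" by (intro emeasure_subadditive) auto
  also have "\<dots> = ennreal (4 * \<delta>)" using d by (simp flip: ennreal_plus)
  finally show ?thesis .
qed

section \<open>Decomposition of a chord along the first level cells\<close>

definition sub_chord :: "nat \<Rightarrow> real \<Rightarrow> real \<Rightarrow> real \<Rightarrow> nat \<times> nat \<Rightarrow> real set" where
  "sub_chord L c s t Q = {\<sigma>. real (fst Q) \<le> real L * (- t * s + \<sigma> * c) \<and> real L * (- t * s + \<sigma> * c) < real (fst Q) + 1 \<and>
      real (snd Q) \<le> real L * (t * c + \<sigma> * s) \<and> real L * (t * c + \<sigma> * s) < real (snd Q) + 1}"

lemma sub_chord_borel[measurable]: "sub_chord L c s t Q \<in> sets borel"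
  unfolding sub_chord_def by measurable

lemma measure_sub_chord:
  assumes cs: "c\<^sup>2 + s\<^sup>2 = 1" and L: "0 < L"
  shows "measure lborel (sub_chord L c s t Q) = chord c s (real L * t - (- s * real (fst Q) + c * real (snd Q))) / real L"
proof -
  define qq dd where "qq = - s * real (fst Q) + c * real (snd Q)" and "dd = c * real (fst Q) + s * real (snd Q)"
  have 1: "- (real L * t - qq) * s + (real L * \<sigma> - dd) * c = real L * (- t * s + \<sigma> * c) - real (fst Q)" for \<sigma>
  proof -
    have "- (real L * t - qq) * s + (real L * \<sigma> - dd) * c
      = real L * (- t * s + \<sigma> * c) - real (fst Q) * (c\<^sup>2 + s\<^sup>2)"
      by (simp add: qq_def dd_def algebra_simps power2_eq_square)
    then show ?thesis using cs by simp
  qed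
  have 2: "(real L * t - qq) * c + (real L * \<sigma> - dd) * s = real L * (t * c + \<sigma> * s) - real (snd Q)" for \<sigma>
  proof -
    have "(real L * t - qq) * c + (real L * \<sigma> - dd) * s
      = real L * (t * c + \<sigma> * s) - real (snd Q) * (c\<^sup>2 + s\<^sup>2)"
      by (simp add: qq_def dd_def algebra_simps power2_eq_square)
    then show ?thesis using cs by simp
  qed
  have "sub_chord L c s t Q = {\<sigma>. real L * \<sigma> - dd \<in> chord_set c s (real L * t - qq)}"
    unfolding sub_chord_def chord_set_def mem_Collect_eq 1 2 by auto
  then show ?thesis
    using measure_affine_preimage[OF chord_set_borel, of "real L" dd] L by (simp add: chord_def qq_def)
qed

lemma nat_floor_unique: "real a \<le> z \<and> z < real a + 1 \<longleftrightarrow> 0 \<le> z \<and> a = nat \<lfloor>z\<rfloor>"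
  by (auto simp: le_nat_floor) linarith+

lemma sub_chord_disjoint: "disjoint_family (sub_chord L c s t)"
  unfolding disjoint_family_on_def
proof (intro ballI impI)
  fix Q Q' :: "nat \<times> nat" assume "Q \<noteq> Q'"
  show "sub_chord L c s t Q \<inter> sub_chord L c s t Q' = {}"
  proof (rule ccontr)
    assume "sub_chord L c s t Q \<inter> sub_chord L c s t Q' \<noteq> {}"
    then obtain \<sigma> where "\<sigma> \<in> sub_chord L c s t Q" "\<sigma> \<in> sub_chord L c s t Q'" by blast
    then have "fst Q = fst Q' \<and> snd Q = snd Q'"
      unfolding sub_chord_def mem_Collect_eq by (metis nat_floor_unique)
    with \<open>Q \<noteq> Q'\<close> show False by (simp add: prod_eq_iff)
  qed
qed

lemma chord_set_Union: assumes L: "0 < L" shows "chord_set c s t = (\<Union>Q\<in>cells L. sub_chord L c s t Q)"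
proof (intro set_eqI iffI)
  fix \<sigma> assume a: "\<sigma> \<in> chord_set c s t"
  define x y where "x = - t * s + \<sigma> * c" and "y = t * c + \<sigma> * s"
  have xy: "0 \<le> x" "x < 1" "0 \<le> y" "y < 1" using a by (auto simp: chord_set_def x_def y_def)
  have "real L * x < real L" "real L * y < real L" using xy L by auto
  then have "nat \<lfloor>real L * x\<rfloor> < L" "nat \<lfloor>real L * y\<rfloor> < L" using xy L by (auto simp: nat_less_iff floor_less_iff)
  moreover have "\<sigma> \<in> sub_chord L c s t (nat \<lfloor>real L * x\<rfloor>, nat \<lfloor>real L * y\<rfloor>)"
    unfolding sub_chord_def mem_Collect_eq fst_conv snd_conv x_def[symmetric] y_def[symmetric] conj_assoc[symmetric]
    using nat_floor_unique[of "nat \<lfloor>real L * x\<rfloor>" "real L * x"] nat_floor_unique[of "nat \<lfloor>real L * y\<rfloor>" "real L * y"] xy by auto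
  ultimately show "\<sigma> \<in> (\<Union>Q\<in>cells L. sub_chord L c s t Q)" by (force simp: cells_def)
next
  fix \<sigma> assume "\<sigma> \<in> (\<Union>Q\<in>cells L. sub_chord L c s t Q)"
  then obtain a b where ab: "a < L" "b < L" and m: "\<sigma> \<in> sub_chord L c s t (a, b)" by (auto simp: cells_def)
  define x y where "x = - t * s + \<sigma> * c" and "y = t * c + \<sigma> * s"
  have m': "real a \<le> real L * x" "real L * x < real a + 1" "real b \<le> real L * y" "real L * y < real b + 1"
    using m unfolding sub_chord_def x_def y_def by auto
  have "real a + 1 \<le> real L" "real b + 1 \<le> real L" using ab by auto
  then have "0 \<le> real L * x" "real L * x < real L * 1" "0 \<le> real L * y" "real L * y < real L * 1"
    using m' by linarith+
  then have "0 \<le> x" "x < 1" "0 \<le> y" "y < 1" using L by (auto simp: zero_le_mult_iff)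
  then show "\<sigma> \<in> chord_set c s t" by (auto simp: chord_set_def x_def y_def)
qed

lemma chord_set_finite: assumes cs: "c\<^sup>2 + s\<^sup>2 = 1" shows "emeasure lborel (chord_set c s t) \<noteq> \<infinity>"
proof -
  have "chord_set c s t \<subseteq> {- (\<bar>c\<bar> + \<bar>s\<bar>) .. \<bar>c\<bar> + \<bar>s\<bar>}"
  proof
    fix \<sigma> assume a: "\<sigma> \<in> chord_set c s t"
    define x y where "x = - t * s + \<sigma> * c" and "y = t * c + \<sigma> * s"
    have xy: "\<bar>x\<bar> \<le> 1" "\<bar>y\<bar> \<le> 1" using a by (auto simp: chord_set_def x_def y_def)
    have "x * c + y * s = \<sigma> * (c\<^sup>2 + s\<^sup>2)" by (simp add: x_def y_def algebra_simps power2_eq_square)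
    then have "\<sigma> = x * c + y * s" using cs by simp
    moreover have "\<bar>x * c\<bar> \<le> 1 * \<bar>c\<bar>" "\<bar>y * s\<bar> \<le> 1 * \<bar>s\<bar>" unfolding abs_mult using xy by (intro mult_right_mono; simp)+
    ultimately show "\<sigma> \<in> {- (\<bar>c\<bar> + \<bar>s\<bar>) .. \<bar>c\<bar> + \<bar>s\<bar>}" by auto
  qed
  then have "emeasure lborel (chord_set c s t) \<le> emeasure lborel {- (\<bar>c\<bar> + \<bar>s\<bar>) .. \<bar>c\<bar> + \<bar>s\<bar>}"
    by (intro emeasure_mono) auto
  then show ?thesis by (auto simp: top_unique emeasure_lborel_Icc_eq)
qed

lemma sub_chord_finite: assumes cs: "c\<^sup>2 + s\<^sup>2 = 1" and L: "0 < L" and Q: "Q \<in> cells L"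
  shows "emeasure lborel (sub_chord L c s t Q) \<noteq> \<infinity>"
proof -
  have "emeasure lborel (sub_chord L c s t Q) \<le> emeasure lborel (chord_set c s t)"
    using Q chord_set_Union[OF L] by (intro emeasure_mono) auto
  then show ?thesis using chord_set_finite[OF cs, of t] by (auto simp: top_unique)
qed

lemma chord_self_similar:
  assumes cs: "c\<^sup>2 + s\<^sup>2 = 1" and L: "0 < L"
  shows "(\<Sum>Q\<in>cells L. chord c s (real L * t - (- s * real (fst Q) + c * real (snd Q)))) = real L * chord c s t"
proof -
  have "chord c s t = (\<Sum>Q\<in>cells L. measure lborel (sub_chord L c s t Q))"
    unfolding chord_def chord_set_Union[OF L, of c s t]
    by (rule measure_finite_Union)
       (use sub_chord_finite[OF cs L] disjoint_family_on_mono[OF subset_UNIV sub_chord_disjoint] in auto)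
  also have "\<dots> = (\<Sum>Q\<in>cells L. chord c s (real L * t - (- s * real (fst Q) + c * real (snd Q)))) / real L"
    unfolding measure_sub_chord[OF cs L] by (simp add: sum_divide_distrib)
  finally show ?thesis using L by simp
qed

text \<open>These lines leave the square through the two sides that are nearly orthogonal to them,
  so that the chord has length at least 1.\<close>

lemma chord_plateau:
  assumes cs: "c\<^sup>2 + s\<^sup>2 = 1" and l: "\<bar>s\<bar> \<le> \<bar>c\<bar>"
  obtains u where "\<And>t. u < t \<Longrightarrow> t < u + (\<bar>c\<bar> - 2 * \<bar>s\<bar>) \<Longrightarrow> 1 \<le> chord c s t"
proof -
  have base: "1 \<le> chord c s t" if cs: "c\<^sup>2 + s\<^sup>2 = 1" "\<bar>s\<bar> \<le> c" and t: "\<bar>s\<bar> < t" "t < c - \<bar>s\<bar>" for c s t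
  proof -
    note ch = major_ge_half[OF cs]
    have "slice c s t = {0..<1}"
    proof -
      have "\<bar>x * s\<bar> \<le> \<bar>s\<bar>" if "0 \<le> x" "x < 1" for x
        using that mult_right_mono[of x 1 "\<bar>s\<bar>"] by (simp add: abs_mult)
      then show ?thesis using t by (force simp: slice_def abs_le_iff)
    qed
    then show ?thesis using chord_slice[OF cs(1), of t] ch by simp
  qed
  show ?thesis
  proof (cases "0 \<le> c")
    case True
    show ?thesis
      by (rule that[of "\<bar>s\<bar>"]) (rule base, use cs l True in auto)
  next
    case False
    show ?thesis
    proof (rule that[of "\<bar>s\<bar> - \<bar>c\<bar>"])
      fix t assume t: "\<bar>s\<bar> - \<bar>c\<bar> < t" "t < \<bar>s\<bar> - \<bar>c\<bar> + (\<bar>c\<bar> - 2 * \<bar>s\<bar>)"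
      have "1 \<le> chord (- c) (- s) (- t)" by (rule base) (use cs l t False in auto)
      then show "1 \<le> chord c s t" by (simp add: chord_neg)
    qed
  qed
qed

section \<open>The recursion of a grid model\<close>

definition ch :: "real \<Rightarrow> real \<Rightarrow> real" where
  "ch \<theta> = chord (cos \<theta>) (sin \<theta>)"

definition sh :: "real \<Rightarrow> nat \<times> nat \<Rightarrow> real" where
  "sh \<theta> Q = proj \<theta> (real (fst Q), real (snd Q))"

lemma sh_eq: "sh \<theta> Q = - sin \<theta> * real (fst Q) + cos \<theta> * real (snd Q)"
  by (simp add: sh_def proj_def)

lemma cos_sin_squared: "(cos \<theta>)\<^sup>2 + (sin \<theta>)\<^sup>2 = (1::real)" by simp

sublocale uniform_grid \<subseteq> lines L X ch sh
proof (unfold_locales)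
  fix \<theta> t
  show "0 \<le> ch \<theta> t \<and> ch \<theta> t \<le> 2" unfolding ch_def using chord_nonneg chord_le2[OF cos_sin_squared] by auto
  show "ch \<theta> \<in> borel_measurable borel" unfolding ch_def by (rule chord_meas)
  show "(\<integral>\<^sup>+t. ennreal (ch \<theta> t) \<partial>lborel) = 1" unfolding ch_def by (rule chord_total[OF cos_sin_squared])
  show "(\<Sum>Q\<in>cells L. ch \<theta> (real L * t - sh \<theta> Q)) = real L * ch \<theta> t"
    unfolding ch_def sh_eq by (rule chord_self_similar[OF cos_sin_squared]) simp
qed

text \<open>For negative \<open>e\<close> the sum is read backwards, which moves the base point
  \<open>w\<close>.\<close>

lemma telescope_step:
  fixes F :: "real \<Rightarrow> real"
  shows "\<exists>w. (\<Sum>b<n. F (z + e * real b + \<bar>e\<bar>) - F (z + e * real b)) = F (w + \<bar>e\<bar> * real n) - F w"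
proof (cases "0 \<le> e")
  case True
  have "(\<Sum>b<n. F (z + e * real (Suc b)) - F (z + e * real b)) = F (z + e * real n) - F (z + e * real 0)"
    by (rule sum_lessThan_telescope)
  then show ?thesis using True by (intro exI[of _ z]) (simp add: algebra_simps)
next
  case False
  have "(\<Sum>b<n. F (z - e + e * real b) - F (z - e + e * real (Suc b))) = F (z - e + e * real 0) - F (z - e + e * real n)"
    by (rule sum_lessThan_telescope')
  then show ?thesis using False by (intro exI[of _ "z - e + e * real n"]) (simp add: algebra_simps)
qed

section \<open>Equidistribution under the iterated adjoint\<close>

context uniform_grid
begin

lemma Ms_pow_Suc: "(Ms \<theta> ^^ Suc k) g s = (\<Sum>Q\<in>G. (Ms \<theta> ^^ k) g ((s + sh \<theta> Q) / real L)) / (real L)\<^sup>2"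
  by (simp only: funpow.simps comp_apply Ms_def[of \<theta> "(Ms \<theta> ^^ k) g" s])

lemma Ms_pow_mono: "mono \<tau> \<Longrightarrow> mono ((Ms \<theta> ^^ k) \<tau>)"
proof (induction k)
  case (Suc k)
  show ?case
  proof (rule monoI)
    fix x y :: real assume "x \<le> y"
    then show "(Ms \<theta> ^^ Suc k) \<tau> x \<le> (Ms \<theta> ^^ Suc k) \<tau> y"
      unfolding Ms_pow_Suc by (intro divide_right_mono sum_mono monoD[OF Suc.IH[OF Suc.prems]]) auto
  qed
qed simp

lemma Ms_pow_dom:
  assumes "\<And>t t'. t \<le> t' \<Longrightarrow> \<bar>g t - g t'\<bar> \<le> \<tau> t' - \<tau> t"
  shows "t \<le> t' \<Longrightarrow> \<bar>(Ms \<theta> ^^ k) g t - (Ms \<theta> ^^ k) g t'\<bar> \<le> (Ms \<theta> ^^ k) \<tau> t' - (Ms \<theta> ^^ k) \<tau> t"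
proof (induction k arbitrary: t t')
  case (Suc k)
  let ?g = "(Ms \<theta> ^^ k) g" and ?t = "(Ms \<theta> ^^ k) \<tau>"
  have "\<bar>(\<Sum>Q\<in>G. ?g ((t + sh \<theta> Q) / real L)) - (\<Sum>Q\<in>G. ?g ((t' + sh \<theta> Q) / real L))\<bar>
     \<le> (\<Sum>Q\<in>G. \<bar>?g ((t + sh \<theta> Q) / real L) - ?g ((t' + sh \<theta> Q) / real L)\<bar>)"
    unfolding sum_subtractf[symmetric] by (rule sum_abs)
  also have "\<dots> \<le> (\<Sum>Q\<in>G. ?t ((t' + sh \<theta> Q) / real L) - ?t ((t + sh \<theta> Q) / real L))"
    using Suc.prems by (intro sum_mono Suc.IH divide_right_mono) auto
  finally have "\<bar>(\<Sum>Q\<in>G. ?g ((t + sh \<theta> Q) / real L)) - (\<Sum>Q\<in>G. ?g ((t' + sh \<theta> Q) / real L))\<bar> / (real L)\<^sup>2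
     \<le> (\<Sum>Q\<in>G. ?t ((t' + sh \<theta> Q) / real L) - ?t ((t + sh \<theta> Q) / real L)) / (real L)\<^sup>2"
    by (rule divide_right_mono) simp
  then show ?case by (simp add: Ms_pow_Suc sum_subtractf diff_divide_distrib[symmetric] abs_divide del: funpow.simps)
qed (use assms in simp)

text \<open>Shifting by one grid step along the direction with the larger projection telescopes,
  so each averaging step gains a factor \<open>L\<close>.\<close>
lemma Ms_pow_increment:
  assumes e: "e = cos \<theta> \<or> e = - sin \<theta>" and R: "\<And>t. 0 \<le> \<tau> t \<and> \<tau> t \<le> R"
  shows "(Ms \<theta> ^^ k) \<tau> (z + \<bar>e\<bar>) - (Ms \<theta> ^^ k) \<tau> z \<le> R / real L ^ k"
proof (induction k arbitrary: z)
  case 0 then show ?case using R[of "z + \<bar>e\<bar>"] R[of z] by simp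
next
  case (Suc k)
  let ?f = "(Ms \<theta> ^^ k) \<tau>"
  define F where "F u = ?f (u / real L)" for u
  have inner: "(\<Sum>b<L. F (y + e * real b + \<bar>e\<bar>) - F (y + e * real b)) \<le> R / real L ^ k" for y
  proof -
    obtain w where "(\<Sum>b<L. F (y + e * real b + \<bar>e\<bar>) - F (y + e * real b)) = F (w + \<bar>e\<bar> * real L) - F w"
      using telescope_step[of F y e L] by blast
    also have "\<dots> = ?f (w / real L + \<bar>e\<bar>) - ?f (w / real L)" by (simp add: F_def add_divide_distrib)
    also have "\<dots> \<le> R / real L ^ k" by (rule Suc.IH)
    finally show ?thesis .
  qed
  have "(\<Sum>Q\<in>G. F (z + \<bar>e\<bar> + sh \<theta> Q) - F (z + sh \<theta> Q)) \<le> real L * (R / real L ^ k)"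
    using e
  proof
    assume e: "e = cos \<theta>"
    have "(\<Sum>Q\<in>G. F (z + \<bar>e\<bar> + sh \<theta> Q) - F (z + sh \<theta> Q))
       = (\<Sum>a<L. \<Sum>b<L. F ((z - sin \<theta> * real a) + e * real b + \<bar>e\<bar>) - F ((z - sin \<theta> * real a) + e * real b))"
      unfolding cells_def sum.cartesian_product sh_eq e by (intro sum.cong) (auto simp: algebra_simps)
    also have "\<dots> \<le> real (card {..<L}) * (R / real L ^ k)" by (rule sum_bounded_above) (rule inner)
    finally show ?thesis by simp
  next
    assume e: "e = - sin \<theta>"
    have "(\<Sum>Q\<in>G. F (z + \<bar>e\<bar> + sh \<theta> Q) - F (z + sh \<theta> Q))
       = (\<Sum>a<L. \<Sum>b<L. F ((z + cos \<theta> * real b) + e * real a + \<bar>e\<bar>) - F ((z + cos \<theta> * real b) + e * real a))"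
      unfolding cells_def sum.cartesian_product sh_eq e by (intro sum.cong) (auto simp: algebra_simps)
    also have "\<dots> = (\<Sum>b<L. \<Sum>a<L. F ((z + cos \<theta> * real b) + e * real a + \<bar>e\<bar>) - F ((z + cos \<theta> * real b) + e * real a))"
      by (rule sum.swap)
    also have "\<dots> \<le> real (card {..<L}) * (R / real L ^ k)" by (rule sum_bounded_above) (rule inner)
    finally show ?thesis by simp
  qed
  then have "(\<Sum>Q\<in>G. F (z + \<bar>e\<bar> + sh \<theta> Q) - F (z + sh \<theta> Q)) / (real L)\<^sup>2 \<le> real L * (R / real L ^ k) / (real L)\<^sup>2"
    by (rule divide_right_mono) simp
  then show ?case by (simp add: Ms_pow_Suc F_def sum_subtractf diff_divide_distrib power2_eq_square mult.commute del: funpow.simps)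
qed

text \<open>One of the two grid steps has projection at least 1/2 in absolute value, so eight such
  steps cross the interval from -2 to 2, which contains every shadow. Monotonicity of the majorant
  fills in the points between.\<close>

lemma Ms_pow_osc:
  assumes g: "bv_dom R g" and z: "- 2 \<le> z" "z \<le> 2" "- 2 \<le> z'" "z' \<le> 2"
  shows "\<bar>(Ms \<theta> ^^ k) g z - (Ms \<theta> ^^ k) g z'\<bar> \<le> 8 * R / real L ^ k"
proof -
  from g obtain \<tau> where t: "mono \<tau>" "\<And>t. 0 \<le> \<tau> t \<and> \<tau> t \<le> R" "\<And>t t'. t \<le> t' \<Longrightarrow> \<bar>g t - g t'\<bar> \<le> \<tau> t' - \<tau> t"
    by (auto simp: bv_dom_def)
  let ?T = "(Ms \<theta> ^^ k) \<tau>"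
  have mT: "mono ?T" by (rule Ms_pow_mono[OF t(1)])
  have "\<exists>e. (e = cos \<theta> \<or> e = - sin \<theta>) \<and> 1/2 \<le> \<bar>e\<bar>"
  proof (rule ccontr)
    assume "\<not> ?thesis"
    then have "\<bar>cos \<theta>\<bar> < 1/2" "\<bar>sin \<theta>\<bar> < 1/2" by force+
    then have "(cos \<theta>)\<^sup>2 \<le> (1/2)\<^sup>2" "(sin \<theta>)\<^sup>2 \<le> (1/2)\<^sup>2" by (auto intro!: abs_le_square_iff[THEN iffD1])
    then have "(cos \<theta>)\<^sup>2 + (sin \<theta>)\<^sup>2 \<le> (1/2)\<^sup>2 + (1/2)\<^sup>2" by (intro add_mono)
    then show False by (simp add: power_divide)
  qed
  then obtain e where e: "e = cos \<theta> \<or> e = - sin \<theta>" "1/2 \<le> \<bar>e\<bar>" by blast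
  have inc: "?T (x + real i * \<bar>e\<bar>) - ?T x \<le> real i * (R / real L ^ k)" for x i
  proof (induction i)
    case (Suc i)
    have "?T (x + real i * \<bar>e\<bar> + \<bar>e\<bar>) - ?T (x + real i * \<bar>e\<bar>) \<le> R / real L ^ k"
      by (rule Ms_pow_increment[OF e(1) t(2)])
    with Suc show ?case by (simp add: algebra_simps add_divide_distrib)
  qed simp
  have "?T 2 \<le> ?T (- 2 + real 8 * \<bar>e\<bar>)" using mT e(2) by (auto simp: mono_def)
  then have osc: "?T 2 - ?T (- 2) \<le> 8 * R / real L ^ k" using inc[of "-2" 8] by simp
  have main: "\<bar>(Ms \<theta> ^^ k) g x - (Ms \<theta> ^^ k) g y\<bar> \<le> 8 * R / real L ^ k" if "- 2 \<le> x" "x \<le> y" "y \<le> 2" for x y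
  proof -
    have "\<bar>(Ms \<theta> ^^ k) g x - (Ms \<theta> ^^ k) g y\<bar> \<le> ?T y - ?T x" by (rule Ms_pow_dom[OF t(3) that(2)])
    also have "\<dots> \<le> ?T 2 - ?T (- 2)" using mT that by (intro diff_mono) (auto simp: mono_def)
    finally show ?thesis using osc by linarith
  qed
  show ?thesis using main[of z z'] main[of z' z] z by (cases "z \<le> z'") (auto simp: abs_minus_commute)
qed

lemma ch_supp: "0 < ch \<theta> t \<Longrightarrow> - 2 \<le> t \<and> t \<le> 2"
proof -
  assume "0 < ch \<theta> t"
  then have "t \<in> shadow (cos \<theta>) (sin \<theta>)" unfolding ch_def by (rule chord_shadow[OF cos_sin_squared])
  moreover have "- 1 \<le> min 0 (cos \<theta>)" "- 1 \<le> min 0 (- sin \<theta>)" "max 0 (cos \<theta>) \<le> 1" "max 0 (- sin \<theta>) \<le> 1"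
    using sin_ge_minus_one[of \<theta>] by (auto simp: minus_le_iff)
  ultimately show ?thesis unfolding shadow_def atLeastAtMost_iff by linarith
qed

lemma ig_Ms_pow: "BM g \<Longrightarrow> ig \<theta> ((Ms \<theta> ^^ k) g) = ig \<theta> g"
proof (induction k)
  case (Suc k)
  let ?g = "(Ms \<theta> ^^ k) g"
  have g: "BM ?g" using Suc.prems by (induction k) auto
  have "ig \<theta> (Ms \<theta> ?g) = ig \<theta> (\<lambda>t. Ms \<theta> ?g t * 1)" by simp
  also have "\<dots> = ig \<theta> (\<lambda>t. ?g t * PP \<theta> (\<lambda>_. 1) t)" by (rule PP_duality[OF g BM_const, symmetric])
  also have "\<dots> = ig \<theta> ?g" by (intro ig_cong BM_mult g BM_PP BM_const) (simp add: PP_const)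
  finally show ?case using Suc by simp
qed simp

text \<open>The adjoint preserves the mean, so small oscillation forces every value close to
  it.\<close>

lemma Ms_pow_ge:
  assumes g: "bv_dom R g" "BM g" and s: "0 < ch \<theta> s"
  shows "ig \<theta> g - 8 * R / real L ^ k \<le> (Ms \<theta> ^^ k) g s"
proof -
  have "BM ((Ms \<theta> ^^ k) g)" using g(2) by (induction k) auto
  then have "ig \<theta> ((Ms \<theta> ^^ k) g) \<le> ig \<theta> (\<lambda>_. (Ms \<theta> ^^ k) g s + 8 * R / real L ^ k)"
  proof (rule ig_mono[OF _ BM_const])
    fix t assume "0 < ch \<theta> t"
    then show "(Ms \<theta> ^^ k) g t \<le> (Ms \<theta> ^^ k) g s + 8 * R / real L ^ k"
      using Ms_pow_osc[OF g(1), where z=t and z'=s and \<theta>=\<theta> and k=k] ch_supp[of \<theta> t] ch_supp[OF s] by linarith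
  qed
  then show ?thesis unfolding ig_const ig_Ms_pow[OF g(2)] by simp
qed

section \<open>The variance density and its minorant of bounded variation\<close>

definition beta :: "real \<Rightarrow> real \<Rightarrow> real" where
  "beta \<theta> t = (\<Sum>Q\<in>G. \<Sum>Q'\<in>G. pair_prob X Q Q' * (ch \<theta> (real L * t - sh \<theta> Q) * ch \<theta> (real L * t - sh \<theta> Q')))"

lemma BB_beta: "BB \<theta> (\<lambda>_. 1) t = beta \<theta> t / ch \<theta> t"
  by (simp add: BB_def pairsum_def beta_def mult.assoc)

lemma beta_nonneg: "0 \<le> beta \<theta> t"
  unfolding beta_def by (intro sum_nonneg mult_nonneg_nonneg pair_prob_nonneg h_nonneg)

lemma beta_le: "beta \<theta> t \<le> real L * (ch \<theta> t)\<^sup>2"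
proof -
  have "beta \<theta> t \<le> (\<Sum>Q\<in>G. \<Sum>Q'\<in>G. (1 / real L) * (ch \<theta> (real L * t - sh \<theta> Q) * ch \<theta> (real L * t - sh \<theta> Q')))"
    unfolding beta_def by (intro sum_mono mult_right_mono pair_prob_le) auto
  also have "\<dots> = (\<Sum>Q\<in>G. ch \<theta> (real L * t - sh \<theta> Q))\<^sup>2 / real L"
    by (simp add: power2_eq_square sum_product sum_divide_distrib)
  also have "\<dots> = real L * (ch \<theta> t)\<^sup>2" unfolding h_self by (simp add: power2_eq_square)
  finally show ?thesis .
qed

lemma beta_meas[measurable]: "beta \<theta> \<in> borel_measurable borel"
  unfolding beta_def[abs_def] by measurable

lemma ch_bv: "bv_dom 4 (ch \<theta>)" unfolding ch_def by (rule chord_bv[OF cos_sin_squared])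

lemma beta_bv: "bv_dom (16 * (real L)^4) (beta \<theta>)"
proof -
  have one: "bv_dom 16 (\<lambda>t. pair_prob X Q Q' * (ch \<theta> (real L * t - sh \<theta> Q) * ch \<theta> (real L * t - sh \<theta> Q')))"
    if "Q \<in> G" "Q' \<in> G" for Q Q'
  proof -
    have b: "bv_dom 4 (\<lambda>t. ch \<theta> (real L * t - sh \<theta> Q))" for Q by (rule bv_dom_affine[OF ch_bv]) simp
    have a: "\<bar>ch \<theta> z\<bar> \<le> 2" for z using h_bounds[of \<theta> z] by simp
    have m: "bv_dom (2 * 4 + 2 * 4) (\<lambda>t. ch \<theta> (real L * t - sh \<theta> Q) * ch \<theta> (real L * t - sh \<theta> Q'))"
      by (rule bv_dom_mult[OF b b]) (rule a)+
    have "pair_prob X Q Q' \<le> 1" by (simp add: pair_prob_def)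
    then have "bv_dom (1 * (2 * 4 + 2 * 4) + 0 * 0) (\<lambda>t. pair_prob X Q Q' * (ch \<theta> (real L * t - sh \<theta> Q) * ch \<theta> (real L * t - sh \<theta> Q')))"
      using pair_prob_nonneg[of Q Q']
      by (intro bv_dom_combine[OF m bv_dom_const])
         (auto simp: abs_mult simp flip: right_diff_distrib intro!: mult_left_le_one_le)
    then show ?thesis by simp
  qed
  have "bv_dom (real (card G) * (real (card G) * 16)) (beta \<theta>)"
    unfolding beta_def[abs_def] by (intro bv_dom_sum finite_cells one)
  then show ?thesis by (simp add: power4_eq_xxxx mult.commute mult.left_commute mult.assoc)
qed

text \<open>The density is \<open>beta / ch\<close>. Replacing the denominator by
  \<open>max (ch \<theta> t) d'\<close> gives bounded variation uniformly in the direction, hence a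
  common \<open>k\<close>. Where the chord is shorter than \<open>d'\<close> the density is at most
  \<open>L * d' = \<delta> / 2\<close>, so little mean is lost; the other half of
  \<open>\<delta>\<close> is left for the oscillation.\<close>

lemma minorant:
  assumes d: "0 < \<delta>"
  shows "\<exists>k. \<forall>\<theta>. \<exists>g. BM g \<and> (\<forall>t. 0 \<le> g t \<and> g t \<le> 2 * real L) \<and>
      (\<forall>t. 0 < ch \<theta> t \<longrightarrow> g t \<le> BB \<theta> (\<lambda>_. 1) t) \<and> (\<forall>s. 0 < ch \<theta> s \<longrightarrow> Vc \<theta> - \<delta> \<le> (Ms \<theta> ^^ Suc k) g s)"
proof -
  define d' where "d' = \<delta> / (2 * real L)"
  have d': "0 < d'" using d by (simp add: d'_def)
  \<comment> \<open>The product rule for variation: each variation is multiplied by the supremum of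
    the other factor, \<open>1 / d'\<close> for the reciprocal and \<open>4 * L\<close> for
    \<open>beta\<close>.\<close>
  define R where "R = (1/d') * (16 * (real L)^4) + (4 * real L) * (4 / d'\<^sup>2)"
  have "eventually (\<lambda>k. 8 * R / real L ^ Suc k \<le> \<delta> / 2) sequentially"
  proof -
    have "(\<lambda>k. 8 * R * inverse (real L ^ Suc k)) \<longlonglongrightarrow> 8 * R * 0"
      using L2 by (intro tendsto_mult tendsto_const LIMSEQ_Suc LIMSEQ_inverse_realpow_zero) auto
    then have "eventually (\<lambda>k. 8 * R * inverse (real L ^ Suc k) < \<delta> / 2) sequentially"
      by (rule order_tendstoD) (use d in simp)
    then show ?thesis unfolding divide_inverse[of "8 * R"] by (rule eventually_mono) (rule less_imp_le)
  qed
  then obtain k where k: "8 * R / real L ^ Suc k \<le> \<delta> / 2" by (auto simp: eventually_sequentially)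
  show ?thesis
  proof (intro exI[of _ k] allI)
    fix \<theta>
    define g where "g t = beta \<theta> t * (1 / max (ch \<theta> t) d')" for t
    have mp: "0 < max (ch \<theta> t) d'" for t using d' by (simp add: less_max_iff_disj)
    have g0: "0 \<le> g t" for t unfolding g_def using beta_nonneg mp[of t] by (intro mult_nonneg_nonneg) auto
    have gle: "g t \<le> 2 * real L" for t
    proof -
      have "g t \<le> (real L * (ch \<theta> t)\<^sup>2) * (1 / max (ch \<theta> t) d')"
        unfolding g_def using mp[of t] by (intro mult_right_mono beta_le) auto
      also have "\<dots> \<le> real L * ch \<theta> t"
      proof -
        have "ch \<theta> t / max (ch \<theta> t) d' \<le> 1" using mp[of t] by (simp add: divide_le_eq)
        then have "real L * ch \<theta> t * (ch \<theta> t / max (ch \<theta> t) d') \<le> real L * ch \<theta> t * 1"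
          by (intro mult_left_mono) auto
        then show ?thesis by (simp add: power2_eq_square)
      qed
      also have "\<dots> \<le> real L * 2" using h_le2 by (intro mult_left_mono) auto
      finally show ?thesis by simp
    qed
    have gBM: "BM g"
    proof (rule BM_I[of _ "2 * real L"])
      show "g \<in> borel_measurable borel" unfolding g_def[abs_def] by measurable
    qed (use g0 gle in simp)
    have gBB: "g t \<le> BB \<theta> (\<lambda>_. 1) t" if "0 < ch \<theta> t" for t
      unfolding g_def BB_beta using that beta_nonneg mp[of t] by (simp, intro divide_left_mono mult_pos_pos) auto
    have gV: "Vc \<theta> - \<delta> / 2 \<le> ig \<theta> g"
    proof -
      have "ig \<theta> (\<lambda>t. BB \<theta> (\<lambda>_. 1) t - \<delta> / 2) \<le> ig \<theta> g"
      proof (intro ig_mono BM_diff BM_vv BM_const gBM)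
        fix t assume t: "0 < ch \<theta> t"
        show "BB \<theta> (\<lambda>_. 1) t - \<delta> / 2 \<le> g t"
        proof (cases "d' \<le> ch \<theta> t")
          case True
          then show ?thesis using d by (simp add: g_def BB_beta max_def)
        next
          case False
          have "BB \<theta> (\<lambda>_. 1) t \<le> real L * (ch \<theta> t)\<^sup>2 / ch \<theta> t"
            unfolding BB_beta using t by (intro divide_right_mono beta_le) auto
          also have "\<dots> = real L * ch \<theta> t" using t by (simp add: power2_eq_square)
          also have "\<dots> \<le> real L * d'" using False by (intro mult_left_mono) auto
          also have "\<dots> = \<delta> / 2" by (simp add: d'_def)
          finally show ?thesis using g0[of t] by linarith
        qed
      qed
      then show ?thesis by (simp add: ig_diff BM_vv Vc_def)
    qed
    have gbv: "bv_dom R g" unfolding R_def g_def[abs_def]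
    proof (rule bv_dom_mult[OF beta_bv bv_dom_inverse[OF ch_bv d']])
      fix t
      have "beta \<theta> t \<le> real L * (ch \<theta> t)\<^sup>2" by (rule beta_le)
      also have "\<dots> \<le> real L * 2\<^sup>2" using h_bounds[of \<theta> t] by (intro mult_left_mono power_mono) auto
      finally show "\<bar>beta \<theta> t\<bar> \<le> 4 * real L" using beta_nonneg[of \<theta> t] by simp
      show "\<bar>1 / max (ch \<theta> t) d'\<bar> \<le> 1 / d'" using mp[of t] d' by (auto simp: abs_of_pos intro!: divide_left_mono)
    qed
    show "\<exists>g. BM g \<and> (\<forall>t. 0 \<le> g t \<and> g t \<le> 2 * real L) \<and>
      (\<forall>t. 0 < ch \<theta> t \<longrightarrow> g t \<le> BB \<theta> (\<lambda>_. 1) t) \<and> (\<forall>s. 0 < ch \<theta> s \<longrightarrow> Vc \<theta> - \<delta> \<le> (Ms \<theta> ^^ Suc k) g s)"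
    proof (intro exI[of _ g] conjI allI impI gBM g0 gle gBB)
      fix s assume "0 < ch \<theta> s"
      then show "Vc \<theta> - \<delta> \<le> (Ms \<theta> ^^ Suc k) g s"
        using Ms_pow_ge[OF gbv gBM, where \<theta>=\<theta> and s=s and k="Suc k"] gV k by linarith
    qed
  qed
qed

section \<open>Identification of the variance\<close>

definition VarS :: "real \<Rightarrow> real \<Rightarrow> real" where
  "VarS \<theta> t = measure_pmf.variance X (\<lambda>F. \<Sum>Q\<in>F. ch \<theta> (real L * t - sh \<theta> Q))"

lemma VarS_nonneg: "0 \<le> VarS \<theta> t"
  unfolding VarS_def by (rule measure_pmf.variance_positive)

lemma VarS_eq: "VarS \<theta> t = beta \<theta> t + (\<Sum>Q\<in>G. (ch \<theta> (real L * t - sh \<theta> Q))\<^sup>2) / real L - (ch \<theta> t)\<^sup>2"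
proof -
  let ?w = "\<lambda>Q. ch \<theta> (real L * t - sh \<theta> Q)"
  have "VarS \<theta> t = EE (\<lambda>F. (sum ?w F)\<^sup>2) - (EE (\<lambda>F. sum ?w F))\<^sup>2"
    unfolding VarS_def by (rule measure_pmf.variance_eq) auto
  also have "EE (\<lambda>F. sum ?w F) = ch \<theta> t" unfolding EE_sum h_self by simp
  also have "EE (\<lambda>F. (sum ?w F)\<^sup>2) = EE (\<lambda>F. ((sum ?w F)\<^sup>2 - (\<Sum>Q\<in>F. (?w Q)\<^sup>2)) + (\<Sum>Q\<in>F. (?w Q)\<^sup>2))"
    by simp
  also have "\<dots> = EE (\<lambda>F. (sum ?w F)\<^sup>2 - (\<Sum>Q\<in>F. (?w Q)\<^sup>2)) + EE (\<lambda>F. \<Sum>Q\<in>F. (?w Q)\<^sup>2)"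
    by (rule Bochner_Integration.integral_add) auto
  finally show ?thesis unfolding EE_pair EE_sum by (simp add: beta_def mult.assoc)
qed

lemma Vc_beta: "Vc \<theta> = (\<integral>t. beta \<theta> t \<partial>lborel)"
proof -
  have "Vc \<theta> = (\<integral>t. ch \<theta> t * BB \<theta> (\<lambda>_. 1) t \<partial>lborel)"
    unfolding Vc_def by (rule ig_eq[OF BM_meas[OF BM_vv]])
  also have "\<dots> = (\<integral>t. beta \<theta> t \<partial>lborel)"
  proof (intro Bochner_Integration.integral_cong refl)
    fix t show "ch \<theta> t * BB \<theta> (\<lambda>_. 1) t = beta \<theta> t"
      using beta_le[of \<theta> t] beta_nonneg[of \<theta> t] by (cases "ch \<theta> t = 0") (auto simp: BB_beta)
  qed
  finally show ?thesis .
qed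

lemma ch_sq_integrable: "integrable lborel (\<lambda>t. (ch \<theta> t)\<^sup>2)"
  by (rule Bochner_Integration.integrable_bound[of _ "\<lambda>t. 2 * ch \<theta> t"])
     (use h_integrable h_le2 in \<open>auto simp: power2_eq_square intro!: mult_right_mono\<close>)

lemma beta_integrable: "integrable lborel (beta \<theta>)"
  by (rule Bochner_Integration.integrable_bound[of _ "\<lambda>t. real L * (ch \<theta> t)\<^sup>2"])
     (use ch_sq_integrable beta_le beta_nonneg in \<open>auto simp: abs_of_nonneg\<close>)

text \<open>The children's average of \<open>ch\<^sup>2\<close> in \<open>VarS_eq\<close> has the
  same integral as \<open>ch\<^sup>2\<close>, so only the pair term \<open>beta\<close>
  remains.\<close>

lemma VarS_integral: "integrable lborel (VarS \<theta>)" "(\<integral>t. VarS \<theta> t \<partial>lborel) = Vc \<theta>"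
proof -
  note i = integral_children[OF ch_sq_integrable, of \<theta> \<theta>]
  show "integrable lborel (VarS \<theta>)" unfolding VarS_eq[abs_def]
    using beta_integrable i(1) ch_sq_integrable by (intro Bochner_Integration.integrable_diff Bochner_Integration.integrable_add)
  show "(\<integral>t. VarS \<theta> t \<partial>lborel) = Vc \<theta>" unfolding VarS_eq
    using beta_integrable i ch_sq_integrable by (simp add: Vc_beta)
qed

text \<open>Lines near an extreme corner of the unit square meet only the corner cell, whose presence is random.\<close>
lemma Vc_ge_corner:
  assumes m: "0 < m" "m \<le> 1" "m \<le> \<bar>cos \<theta>\<bar>" "m \<le> \<bar>sin \<theta>\<bar>"
  shows "m^3 / (256 * (real L)\<^sup>2) \<le> Vc \<theta>"
proof -
  \<comment> \<open>\<open>t0\<close> is the left end of the shadow, and \<open>Qs\<close> the cell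
    at the corner of the square that projects there.\<close>
  define t0 where "t0 = min 0 (cos \<theta>) + min 0 (- sin \<theta>)"
  define Qs where "Qs = (if 0 < sin \<theta> then L - 1 else 0, if cos \<theta> < 0 then L - 1 else 0)"
  have Qs: "Qs \<in> G" by (auto simp: Qs_def cells_def)
  have apart: "sh \<theta> Qs + m \<le> sh \<theta> Q" if Q: "Q \<in> G" "Q \<noteq> Qs" for Q
  proof -
    obtain a b where ab: "Q = (a, b)" "a < L" "b < L" using Q(1) by (auto simp: cells_def)
    have L1: "real (L - Suc 0) = real L - 1" using L2 by (simp add: of_nat_diff)
    have aL: "real a \<le> real L - 1" "real b \<le> real L - 1" using ab by linarith+
    have x: "0 \<le> - sin \<theta> * real a - (- sin \<theta> * real (fst Qs)) \<and> (a \<noteq> fst Qs \<longrightarrow> m \<le> - sin \<theta> * real a - (- sin \<theta> * real (fst Qs)))"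
    proof (cases "0 < sin \<theta>")
      case True
      have e: "- sin \<theta> * real a - (- sin \<theta> * real (fst Qs)) = sin \<theta> * (real L - 1 - real a)"
        using True by (simp add: Qs_def L1 algebra_simps)
      have "m * 1 \<le> sin \<theta> * (real L - 1 - real a)" if "a \<noteq> fst Qs"
        using that True m ab by (intro mult_mono) (auto simp: Qs_def)
      then show ?thesis unfolding e using True aL by simp
    next
      case False
      have "m * 1 \<le> - sin \<theta> * real a" if "a \<noteq> fst Qs"
        using that False m ab by (intro mult_mono) (auto simp: Qs_def)
      then show ?thesis using False by (simp add: Qs_def mult_nonpos_nonneg)
    qed
    have y: "0 \<le> cos \<theta> * real b - cos \<theta> * real (snd Qs) \<and> (b \<noteq> snd Qs \<longrightarrow> m \<le> cos \<theta> * real b - cos \<theta> * real (snd Qs))"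
    proof (cases "cos \<theta> < 0")
      case True
      have e: "cos \<theta> * real b - cos \<theta> * real (snd Qs) = (- cos \<theta>) * (real L - 1 - real b)"
        using True by (simp add: Qs_def L1 algebra_simps)
      have "m * 1 \<le> (- cos \<theta>) * (real L - 1 - real b)" if "b \<noteq> snd Qs"
        using that True m ab by (intro mult_mono) (auto simp: Qs_def)
      moreover have "0 \<le> (- cos \<theta>) * (real L - 1 - real b)" using True aL by (intro mult_nonneg_nonneg) auto
      ultimately show ?thesis unfolding e by simp
    next
      case False
      have "m * 1 \<le> cos \<theta> * real b" if "b \<noteq> snd Qs"
        using that False m ab by (intro mult_mono) (auto simp: Qs_def)
      then show ?thesis using False by (simp add: Qs_def)
    qed
    have "a \<noteq> fst Qs \<or> b \<noteq> snd Qs" using Q(2) ab(1) by (auto simp: prod_eq_iff)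
    then show ?thesis using x y unfolding sh_eq ab(1) fst_conv snd_conv by linarith
  qed
  have ch_left: "ch \<theta> r = 0" if "r < t0" for r
  proof (rule ccontr)
    assume "ch \<theta> r \<noteq> 0"
    then have "0 < ch \<theta> r" by (simp add: less_le)
    then have "r \<in> shadow (cos \<theta>) (sin \<theta>)" unfolding ch_def by (rule chord_shadow[OF cos_sin_squared])
    then show False using that by (simp add: shadow_def t0_def)
  qed
  \<comment> \<open>Parameters, in the scale of the cell, for which a line meets no cell other than
    \<open>Qs\<close> and still has a substantial chord in it.\<close>
  define B where "B = {r. t0 \<le> r \<and> r < t0 + m \<and> m / 8 \<le> ch \<theta> r}"
  have Bm[measurable]: "B \<in> sets borel" unfolding B_def by measurable
  \<comment> \<open>Only \<open>Qs\<close> contributes, so the variance is at least that of a scaled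
    Bernoulli variable with parameter \<open>1 / L\<close>, and
    \<open>1 / L - 1 / L\<^sup>2 \<ge> 1 / (2 * L)\<close>.\<close>
  have var: "(m / 8)\<^sup>2 / (2 * real L) * indicator B (real L * t - sh \<theta> Qs) \<le> VarS \<theta> t" for t
  proof (cases "real L * t - sh \<theta> Qs \<in> B")
    case True
    let ?w = "\<lambda>Q. ch \<theta> (real L * t - sh \<theta> Q)"
    have z: "?w Q = 0" if "Q \<in> G - {Qs}" for Q
      by (rule ch_left) (use apart[of Q] that True in \<open>auto simp: B_def\<close>)
    have one: "sum f G = f Qs" if "\<And>Q. Q \<in> G - {Qs} \<Longrightarrow> f Q = 0" for f :: "nat \<times> nat \<Rightarrow> real"
      using that Qs by (simp add: sum.remove[of G Qs f])
    have "(\<Sum>Q\<in>G. (?w Q)\<^sup>2) = (?w Qs)\<^sup>2" by (rule one) (use z in simp)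
    moreover have "real L * ch \<theta> t = ?w Qs" unfolding h_self[symmetric] by (rule one) (use z in simp)
    moreover have "0 \<le> beta \<theta> t" by (rule beta_nonneg)
    moreover have "ch \<theta> t = ?w Qs / real L" using calculation(2) by (simp add: field_simps)
    ultimately have v: "(?w Qs)\<^sup>2 / real L - (?w Qs / real L)\<^sup>2 \<le> VarS \<theta> t" unfolding VarS_eq by simp
    have "(?w Qs / real L)\<^sup>2 = (?w Qs)\<^sup>2 / real L * (1 / real L)" by (simp add: power2_eq_square)
    also have "\<dots> \<le> (?w Qs)\<^sup>2 / real L * (1 / 2)" using L2 by (intro mult_left_mono divide_left_mono) auto
    finally have "(?w Qs)\<^sup>2 / (2 * real L) \<le> VarS \<theta> t" using v by simp
    moreover have "(m / 8)\<^sup>2 / (2 * real L) \<le> (?w Qs)\<^sup>2 / (2 * real L)"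
      using True m by (intro divide_right_mono power_mono) (auto simp: B_def)
    ultimately show ?thesis using True by simp
  qed (use VarS_nonneg in simp)
  have Bfin: "emeasure lborel B < \<infinity>"
  proof -
    have "emeasure lborel B \<le> emeasure lborel {t0..t0 + m}" by (intro emeasure_mono) (auto simp: B_def)
    also have "\<dots> < \<infinity>" using m by simp
    finally show ?thesis .
  qed
  \<comment> \<open>By \<open>chord_tip\<close> with \<open>m / 8\<close>, at most half of an
    interval of length \<open>m\<close> is lost.\<close>
  have Bbig: "m / 2 \<le> measure lborel B"
  proof -
    let ?T = "{t \<in> shadow (cos \<theta>) (sin \<theta>). chord (cos \<theta>) (sin \<theta>) t < m / 8}"
    have Tm: "?T \<in> sets lborel" by (simp add: shadow_def)
    have tip: "emeasure lborel ?T \<le> ennreal (4 * (m / 8))" by (rule chord_tip[OF cos_sin_squared]) (use m in auto)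
    have "t0 + m \<le> max 0 (cos \<theta>) + max 0 (- sin \<theta>)" using m unfolding t0_def by (auto simp: min_def max_def)
    then have "{t0..<t0 + m} \<subseteq> B \<union> ?T" by (auto simp: B_def shadow_def t0_def ch_def)
    then have "emeasure lborel {t0..<t0 + m} \<le> emeasure lborel (B \<union> ?T)" using Tm by (intro emeasure_mono) auto
    also have "\<dots> \<le> emeasure lborel B + emeasure lborel ?T" using Tm by (intro emeasure_subadditive) auto
    also have "\<dots> \<le> ennreal (measure lborel B) + ennreal (4 * (m / 8))"
      using tip Bfin by (intro add_mono) (auto simp: emeasure_eq_ennreal_measure)
    also have "\<dots> = ennreal (measure lborel B + 4 * (m / 8))" using m by (intro ennreal_plus[symmetric]) auto
    also have "emeasure lborel {t0..<t0 + m} = ennreal m" using m by simp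
    finally have "m \<le> measure lborel B + 4 * (m / 8)" using m by (subst (asm) ennreal_le_iff) auto
    then show ?thesis by simp
  qed
  have ind_int: "integrable lborel (indicator B :: real \<Rightarrow> real)" using Bfin by (simp add: less_top)
  have "(m / 8)\<^sup>2 / (2 * real L) * ((m / 2) / real L) \<le> (m / 8)\<^sup>2 / (2 * real L) * (measure lborel B / real L)"
    using Bbig by (intro mult_left_mono divide_right_mono) auto
  also have "\<dots> = (\<integral>t. (m / 8)\<^sup>2 / (2 * real L) * indicator B (real L * t - sh \<theta> Qs) \<partial>lborel)"
    by (simp add: integral_affine[of "indicator B"])
  also have "\<dots> \<le> (\<integral>t. VarS \<theta> t \<partial>lborel)"
    by (intro integral_mono var VarS_integral(1) integrable_mult_right integrable_affine ind_int)
  also have "\<dots> = Vc \<theta>" by (rule VarS_integral(2))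
  finally have "(m / 8)\<^sup>2 / (2 * real L) * ((m / 2) / real L) \<le> Vc \<theta>" .
  moreover have "(m / 8)\<^sup>2 / (2 * real L) * ((m / 2) / real L) = m^3 / (256 * (real L)\<^sup>2)"
    by (simp add: power2_eq_square power3_eq_cube)
  ultimately show ?thesis by simp
qed

text \<open>The plateaus of the two cells overlap in an interval of scaled parameters of length 1/4.
  There both chords are at least 1, so \<open>beta\<close> is at least the probability of the pair;
  scaling back contributes \<open>1 / L\<close>.\<close>

lemma Vc_ge_pair:
  assumes Q: "Q \<in> G" "Q' \<in> G" and J: "\<And>r. u < r \<Longrightarrow> r < u + l \<Longrightarrow> 1 \<le> ch \<theta> r"
    and d: "\<bar>sh \<theta> Q - sh \<theta> Q'\<bar> \<le> l - 1/4"
  shows "pair_prob X Q Q' / (4 * real L) \<le> Vc \<theta>"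
proof -
  define a where "a = max (u + sh \<theta> Q) (u + sh \<theta> Q')"
  let ?I = "{a<..<a + 1/4}"
  have low: "pair_prob X Q Q' * indicator ?I (real L * t - 0) \<le> beta \<theta> t" for t
  proof (cases "real L * t \<in> ?I")
    case True
    have l: "u < real L * t - sh \<theta> Q" "real L * t - sh \<theta> Q < u + l" "u < real L * t - sh \<theta> Q'" "real L * t - sh \<theta> Q' < u + l"
      using True d unfolding a_def max_def by (auto split: if_splits)
    have "pair_prob X Q Q' * (1 * 1) \<le> pair_prob X Q Q' * (ch \<theta> (real L * t - sh \<theta> Q) * ch \<theta> (real L * t - sh \<theta> Q'))"
      using J[OF l(1,2)] J[OF l(3,4)] pair_prob_nonneg by (intro mult_left_mono mult_mono) auto
    also have "\<dots> \<le> (\<Sum>Q'\<in>G. pair_prob X Q Q' * (ch \<theta> (real L * t - sh \<theta> Q) * ch \<theta> (real L * t - sh \<theta> Q')))"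
      using Q pair_prob_nonneg by (intro member_le_sum) auto
    also have "\<dots> \<le> beta \<theta> t" unfolding beta_def
      using Q pair_prob_nonneg by (intro member_le_sum[where f="\<lambda>Q. \<Sum>Q'\<in>G. pair_prob X Q Q' * (ch \<theta> (real L * t - sh \<theta> Q) * ch \<theta> (real L * t - sh \<theta> Q'))"] sum_nonneg) auto
    finally show ?thesis using True by simp
  qed (use beta_nonneg in simp)
  have "pair_prob X Q Q' / (4 * real L) = (\<integral>t. pair_prob X Q Q' * indicator ?I (real L * t - 0) \<partial>lborel)"
    unfolding integral_mult_right_zero integral_affine by simp
  also have "\<dots> \<le> (\<integral>t. beta \<theta> t \<partial>lborel)"
    by (intro integral_mono low beta_integrable integrable_mult_right integrable_affine) simp
  finally show ?thesis by (simp only: Vc_beta)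
qed

text \<open>Closed and half-open cells differ on a line in finitely many points unless the line runs
  along a grid line. Such lines are axis-parallel with \<open>t\<close> of the excluded form;
  excluding these values for every direction gives one countable exceptional set.\<close>

lemma line_len_eq:
  assumes F: "F \<subseteq> G" and t: "\<And>k. t \<noteq> real k / real L \<and> t \<noteq> - (real k / real L)"
  shows "real L * line_len \<theta> t (\<Union> (grid_square L 1 ` F)) = (\<Sum>Q\<in>F. ch \<theta> (real L * t - sh \<theta> Q))"
proof -
  define c s where "c = cos \<theta>" and "s = sin \<theta>"
  have cs: "c\<^sup>2 + s\<^sup>2 = 1" by (simp add: c_def s_def)
  have c_cases: "s = 1 \<or> s = - 1" if "c = 0" using cs that by (simp add: power2_eq_1_iff)
  have s_cases: "c = 1 \<or> c = - 1" if "s = 0" using cs that by (simp add: power2_eq_1_iff)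
  define x y where "x \<sigma> = - t * s + \<sigma> * c" and "y \<sigma> = t * c + \<sigma> * s" for \<sigma>
  define Nx Ny where "Nx k = {\<sigma>. real L * x \<sigma> = real k}" and "Ny k = {\<sigma>. real L * y \<sigma> = real k}" for k :: nat
  have Nx: "finite (Nx k)" for k
  proof (cases "c = 0")
    case True
    have "Nx k = {}"
    proof -
      have "real L * (- t * s) \<noteq> real k" using c_cases[OF True] t[of k] by (auto simp: field_simps)
      then show ?thesis by (auto simp: Nx_def x_def True)
    qed
    then show ?thesis by simp
  next
    case False
    then have "Nx k \<subseteq> {(real k / real L + t * s) / c}" by (auto simp: Nx_def x_def field_simps)
    then show ?thesis by (rule finite_subset) simp
  qed
  have Ny: "finite (Ny k)" for k
  proof (cases "s = 0")
    case True
    have "Ny k = {}"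
    proof -
      have "real L * (t * c) \<noteq> real k" using s_cases[OF True] t[of k] by (auto simp: field_simps)
      then show ?thesis by (auto simp: Ny_def y_def True)
    qed
    then show ?thesis by simp
  next
    case False
    then have "Ny k \<subseteq> {(real k / real L - t * c) / s}" by (auto simp: Ny_def y_def field_simps)
    then show ?thesis by (rule finite_subset) simp
  qed
  define N where "N = (\<Union>k\<le>L. Nx k \<union> Ny k)"
  have N: "finite N" using Nx Ny by (auto simp: N_def)
  have finF: "finite F" using F finite_subset by fastforce
  define A B where "A = {\<sigma>. (x \<sigma>, y \<sigma>) \<in> \<Union> (grid_square L 1 ` F)}" and "B = (\<Union>Q\<in>F. sub_chord L c s t Q)"
  have sq: "(x \<sigma>, y \<sigma>) \<in> grid_square L 1 Q \<longleftrightarrow> real (fst Q) \<le> real L * x \<sigma> \<and> real L * x \<sigma> \<le> real (fst Q) + 1 \<and>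
      real (snd Q) \<le> real L * y \<sigma> \<and> real L * y \<sigma> \<le> real (snd Q) + 1" for \<sigma> Q
    by (auto simp: grid_square_def field_simps)
  have BA: "B \<subseteq> A" unfolding A_def B_def using sq by (fastforce simp: sub_chord_def x_def y_def)
  have AB: "A \<subseteq> B \<union> N"
  proof
    fix \<sigma> assume "\<sigma> \<in> A"
    then obtain Q where Q: "Q \<in> F" "(x \<sigma>, y \<sigma>) \<in> grid_square L 1 Q" by (auto simp: A_def)
    have lt: "Suc (fst Q) \<le> L" "Suc (snd Q) \<le> L" using F Q(1) by (auto simp: cells_def)
    show "\<sigma> \<in> B \<union> N"
    proof (cases "real L * x \<sigma> = real (Suc (fst Q)) \<or> real L * y \<sigma> = real (Suc (snd Q))")
      case True
      then have "\<sigma> \<in> Nx (Suc (fst Q)) \<or> \<sigma> \<in> Ny (Suc (snd Q))" by (auto simp: Nx_def Ny_def)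
      then show ?thesis using lt by (auto simp: N_def)
    next
      case False
      then have "\<sigma> \<in> sub_chord L c s t Q" using Q(2) unfolding sq by (auto simp: sub_chord_def x_def y_def)
      then show ?thesis using Q(1) by (auto simp: B_def)
    qed
  qed
  have Bm: "B \<in> sets borel" unfolding B_def using finF by auto
  have AN: "A = B \<union> (A \<inter> N)" using AB BA by auto
  have finAN: "finite (A \<inter> N)" using N by simp
  have "line_len \<theta> t (\<Union> (grid_square L 1 ` F)) = measure lebesgue A"
    by (simp add: line_len_def A_def x_def y_def c_def s_def)
  also have "\<dots> = measure lebesgue B"
  proof -
    have "A \<inter> N \<in> null_sets lebesgue" using finAN by (intro finite_imp_null_set_lborel[THEN null_sets_completionI])
    then have "emeasure lebesgue (B \<union> (A \<inter> N)) = emeasure lebesgue B"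
      using Bm by (intro emeasure_Un_null_set) auto
    then show ?thesis using AN by (simp add: measure_def)
  qed
  also have "\<dots> = measure lborel B" using Bm by (simp add: measure_completion)
  also have "\<dots> = (\<Sum>Q\<in>F. measure lborel (sub_chord L c s t Q))" unfolding B_def
  proof (rule measure_finite_Union[OF finF])
    show "sub_chord L c s t ` F \<subseteq> sets lborel" by auto
    show "disjoint_family_on (sub_chord L c s t) F" by (rule disjoint_family_on_mono[OF subset_UNIV sub_chord_disjoint])
    show "emeasure lborel (sub_chord L c s t Q) \<noteq> \<infinity>" if "Q \<in> F" for Q
      using that F by (intro sub_chord_finite[OF cs L_pos(1)]) auto
  qed
  also have "\<dots> = (\<Sum>Q\<in>F. ch \<theta> (real L * t - sh \<theta> Q)) / real L"
    unfolding measure_sub_chord[OF cs L_pos(1)] by (simp add: ch_def sh_eq c_def s_def sum_divide_distrib)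
  finally show ?thesis by simp
qed

lemma Vfun_eq: "Vfun L X \<theta> = Vc \<theta>"
proof -
  define E where "E = range (\<lambda>k. real k / real L) \<union> range (\<lambda>k. - (real k / real L))"
  have "countable E" by (auto simp: E_def)
  then have "E \<in> null_sets lebesgue" by (intro null_sets_completionI countable_imp_null_set_lborel)
  then have E: "negligible E" by (simp add: negligible_iff_null_sets)
  have "Vfun L X \<theta> = integral UNIV (VarS \<theta>)"
    unfolding Vfun_def
  proof (rule integral_spike[OF E])
    fix t assume "t \<in> UNIV - E"
    then have t: "\<And>k. t \<noteq> real k / real L \<and> t \<noteq> - (real k / real L)" by (auto simp: E_def)
    have eq: "real L * line_len \<theta> t (\<Union> (grid_square L 1 ` F)) = (\<Sum>Q\<in>F. ch \<theta> (real L * t - sh \<theta> Q))" if "F \<in> set_pmf X" for F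
      using support_sub[OF that] t by (rule line_len_eq)
    have 1: "EE (\<lambda>F. real L * line_len \<theta> t (\<Union> (grid_square L 1 ` F))) = EE (\<lambda>F. \<Sum>Q\<in>F. ch \<theta> (real L * t - sh \<theta> Q))"
      by (rule EE_cong) (rule eq)
    show "VarS \<theta> t = measure_pmf.variance X (\<lambda>F. real L * line_len \<theta> t (\<Union> (grid_square L 1 ` F)))"
      unfolding VarS_def 1 by (rule EE_cong) (simp only: eq)
  qed
  also have "\<dots> = (\<integral>t. VarS \<theta> t \<partial>lborel)"
    by (rule integral_unique[OF has_integral_integral_lborel[OF VarS_integral(1)]])
  finally show ?thesis by (simp add: VarS_integral(2))
qed

end

section \<open>Positivity of the variance\<close>

locale nondegenerate_grid = uniform_grid +
  assumes nd: "non_degenerate L X"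
begin

text \<open>If no two cells of any \<open>A b\<close> occurred together, each count would be at most
  1. Its mean is 1 by uniformity, so it would be 1 almost surely, contrary to
  \<open>nc\<close>.\<close>

lemma pair_from_counts:
  assumes A: "\<And>b. b < L \<Longrightarrow> A b \<subseteq> G \<and> card (A b) = L"
    and nc: "\<not> (\<forall>F\<in>set_pmf X. \<forall>b<L. card (F \<inter> A b) = 1)"
  shows "\<exists>b<L. \<exists>Q\<in>A b. \<exists>Q'\<in>A b. 0 < pair_prob X Q Q'"
proof (rule ccontr)
  assume c: "\<not> ?thesis"
  have le1: "card (F \<inter> A b) \<le> 1" if F: "F \<in> set_pmf X" and b: "b < L" for F b
  proof (rule ccontr)
    assume "\<not> card (F \<inter> A b) \<le> 1"
    then have "1 < card (F \<inter> A b)" by simp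
    moreover have fin: "finite (F \<inter> A b)" using finite_supp_elem[OF F] by simp
    ultimately obtain Q Q' where Q: "Q \<in> F \<inter> A b" "Q' \<in> F \<inter> A b" "Q \<noteq> Q'"
      by (metis card_le_Suc0_iff_eq One_nat_def not_le)
    have "0 < pmf X F" using F by (simp add: set_pmf_iff pmf_pos)
    also have "pmf X F \<le> measure_pmf.prob X {F. Q \<in> F \<and> Q' \<in> F}"
      using Q by (subst measure_pmf_single[symmetric]) (intro measure_pmf.finite_measure_mono, auto)
    finally have "0 < pair_prob X Q Q'" using Q(3) by (simp add: pair_prob_def)
    with c Q b show False by blast
  qed
  have "card (F \<inter> A b) = 1" if F: "F \<in> set_pmf X" and b: "b < L" for F b
  proof (rule ccontr)
    assume ne: "card (F \<inter> A b) \<noteq> 1"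
    have ex: "EE (\<lambda>F. real (card (F \<inter> A b))) = 1"
    proof -
      have "EE (\<lambda>F. real (card (F \<inter> A b))) = EE (\<lambda>F. sum (\<lambda>Q. if Q \<in> A b then 1 else 0) F)"
        by (rule EE_cong) (use finite_supp_elem in \<open>simp add: sum.If_cases\<close>)
      also have "\<dots> = (\<Sum>Q\<in>G. if Q \<in> A b then 1 else 0) / real L" by (rule EE_sum)
      also have "(\<Sum>Q\<in>G. if Q \<in> A b then 1 else (0::real)) = real (card (A b))"
        using A[OF b] by (simp add: sum.If_cases Int_absorb1)
      finally show ?thesis using A[OF b] by simp
    qed
    have "EE (\<lambda>F. 1 - real (card (F \<inter> A b))) = 0" using ex by simp
    then have "AE F in measure_pmf X. 1 - real (card (F \<inter> A b)) = 0"
      by (subst (asm) integral_nonneg_eq_0_iff_AE) (use le1 b in \<open>auto simp: AE_measure_pmf_iff\<close>)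
    then have "real (card (F \<inter> A b)) = 1" using F by (simp add: AE_measure_pmf_iff)
    then show False using ne by simp
  qed
  with nc show False by blast
qed

lemma row_pair: "\<exists>b<L. \<exists>a a'. (a, b) \<in> G \<and> (a', b) \<in> G \<and> 0 < pair_prob X (a, b) (a', b)"
proof -
  define A where "A b = {..<L} \<times> {b}" for b :: nat
  have "card (F \<inter> A b) = card {a. (a, b) \<in> F}" if "F \<in> set_pmf X" for F b
  proof -
    have "F \<inter> A b = (\<lambda>a. (a, b)) ` {a. (a, b) \<in> F}" using support_sub[OF that] by (auto simp: A_def cells_def)
    then show ?thesis by (simp add: card_image inj_on_def)
  qed
  then have "\<not> (\<forall>F\<in>set_pmf X. \<forall>b<L. card (F \<inter> A b) = 1)" using nd by (auto simp: non_degenerate_def)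
  then have "\<exists>b<L. \<exists>Q\<in>A b. \<exists>Q'\<in>A b. 0 < pair_prob X Q Q'"
    by (rule pair_from_counts[rotated]) (auto simp: A_def cells_def card_cartesian_product)
  then show ?thesis by (fastforce simp: A_def cells_def)
qed

lemma column_pair: "\<exists>a<L. \<exists>b b'. (a, b) \<in> G \<and> (a, b') \<in> G \<and> 0 < pair_prob X (a, b) (a, b')"
proof -
  define A where "A a = {a} \<times> {..<L}" for a :: nat
  have "card (F \<inter> A a) = card {b. (a, b) \<in> F}" if "F \<in> set_pmf X" for F a
  proof -
    have "F \<inter> A a = (\<lambda>b. (a, b)) ` {b. (a, b) \<in> F}" using support_sub[OF that] by (auto simp: A_def cells_def)
    then show ?thesis by (simp add: card_image inj_on_def)
  qed
  then have "\<not> (\<forall>F\<in>set_pmf X. \<forall>b<L. card (F \<inter> A b) = 1)" using nd by (auto simp: non_degenerate_def)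
  then have "\<exists>b<L. \<exists>Q\<in>A b. \<exists>Q'\<in>A b. 0 < pair_prob X Q Q'"
    by (rule pair_from_counts[rotated]) (auto simp: A_def cells_def card_cartesian_product)
  then show ?thesis by (fastforce simp: A_def cells_def)
qed

text \<open>Oblique directions are covered by the corner estimate. It degenerates for lines close to
  an axis; nearly horizontal ones use two cells of one row, nearly vertical ones two cells of one
  column, and these are the pairs that non-degeneracy supplies.\<close>

lemma Vc_bounded_below: "\<exists>V0>0. \<forall>\<theta>. V0 \<le> Vc \<theta>"
proof -
  obtain b a a' where r: "(a, b) \<in> G" "(a', b) \<in> G" "0 < pair_prob X (a, b) (a', b)" using row_pair by blast
  obtain x y y' where c: "(x, y) \<in> G" "(x, y') \<in> G" "0 < pair_prob X (x, y) (x, y')" using column_pair by blast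
  \<comment> \<open>With this threshold two cells of one row, or of one column, have projections at
    distance at most 1/8, which the plateau accommodates.\<close>
  define m where "m = 1 / (8 * real L)"
  have m: "0 < m" "m \<le> 1/16" using L2 by (auto simp: m_def field_simps)
  define V0 where "V0 = min (m^3 / (256 * (real L)\<^sup>2)) (min (pair_prob X (a, b) (a', b) / (4 * real L)) (pair_prob X (x, y) (x, y') / (4 * real L)))"
  have bound: "\<bar>e * real i - e * real j\<bar> \<le> \<bar>f\<bar> - 2 * \<bar>e\<bar> - 1/4"
    if ef: "f\<^sup>2 + e\<^sup>2 = 1" "\<bar>e\<bar> \<le> m" and ij: "i < L" "j < L" for e f :: real and i j
  proof -
    have "\<bar>e * real i - e * real j\<bar> = \<bar>e\<bar> * \<bar>real i - real j\<bar>" by (simp flip: right_diff_distrib abs_mult)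
    also have "\<dots> \<le> m * real L" using ef ij by (intro mult_mono) auto
    also have "\<dots> = 1/8" by (simp add: m_def)
    finally have 1: "\<bar>e * real i - e * real j\<bar> \<le> 1/8" .
    have "\<bar>e\<bar> \<le> 1/16" using ef m by simp
    then have "e\<^sup>2 \<le> (1/16)\<^sup>2" by (intro abs_le_square_iff[THEN iffD1]) auto
    then have "(3/4)\<^sup>2 \<le> \<bar>f\<bar>\<^sup>2" using ef(1) by (simp add: power2_eq_square)
    then have "3/4 \<le> \<bar>f\<bar>" by (rule power2_le_imp_le) simp
    then show ?thesis using 1 \<open>\<bar>e\<bar> \<le> 1/16\<close> by linarith
  qed
  show ?thesis
  proof (intro exI[of _ V0] conjI allI)
    show "0 < V0" using m r c by (auto simp: V0_def intro!: divide_pos_pos)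
    fix \<theta>
    consider "m \<le> \<bar>cos \<theta>\<bar>" "m \<le> \<bar>sin \<theta>\<bar>" | "\<bar>sin \<theta>\<bar> \<le> m" | "\<bar>cos \<theta>\<bar> \<le> m" by linarith
    then show "V0 \<le> Vc \<theta>"
    proof cases
      case 1
      then have "m^3 / (256 * (real L)\<^sup>2) \<le> Vc \<theta>" using m by (intro Vc_ge_corner) auto
      then show ?thesis unfolding V0_def by linarith
    next
      case 2
      note bd = bound[OF cos_sin_squared 2]
      have "\<bar>sin \<theta>\<bar> \<le> \<bar>cos \<theta>\<bar>" using bd[of 0 0] by simp
      then obtain u where u: "\<And>t. u < t \<Longrightarrow> t < u + (\<bar>cos \<theta>\<bar> - 2 * \<bar>sin \<theta>\<bar>) \<Longrightarrow> 1 \<le> chord (cos \<theta>) (sin \<theta>) t"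
        using chord_plateau[OF cos_sin_squared] by blast
      have "pair_prob X (a, b) (a', b) / (4 * real L) \<le> Vc \<theta>"
      proof (rule Vc_ge_pair[OF r(1,2)])
        show "1 \<le> ch \<theta> t" if "u < t" "t < u + (\<bar>cos \<theta>\<bar> - 2 * \<bar>sin \<theta>\<bar>)" for t
          unfolding ch_def by (rule u[OF that])
        show "\<bar>sh \<theta> (a, b) - sh \<theta> (a', b)\<bar> \<le> \<bar>cos \<theta>\<bar> - 2 * \<bar>sin \<theta>\<bar> - 1/4"
          using bd[of a' a] r by (simp add: sh_eq cells_def)
      qed
      then show ?thesis unfolding V0_def by linarith
    next
      case 3
      have sc1: "(sin \<theta>)\<^sup>2 + (cos \<theta>)\<^sup>2 = 1" by simp
      note bd = bound[OF sc1 3]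
      have "\<bar>cos \<theta>\<bar> \<le> \<bar>sin \<theta>\<bar>" using bd[of 0 0] by simp
      then obtain u where u: "\<And>t. u < t \<Longrightarrow> t < u + (\<bar>sin \<theta>\<bar> - 2 * \<bar>cos \<theta>\<bar>) \<Longrightarrow> 1 \<le> chord (sin \<theta>) (cos \<theta>) t"
        using chord_plateau[OF sc1] by blast
      have "pair_prob X (x, y) (x, y') / (4 * real L) \<le> Vc \<theta>"
      proof (rule Vc_ge_pair[OF c(1,2)])
        \<comment> \<open>Exchanging the coordinates reverses the sign of \<open>t\<close>, so the
          plateau is reflected.\<close>
        show "1 \<le> ch \<theta> t" if "- (u + (\<bar>sin \<theta>\<bar> - 2 * \<bar>cos \<theta>\<bar>)) < t" "t < - (u + (\<bar>sin \<theta>\<bar> - 2 * \<bar>cos \<theta>\<bar>)) + (\<bar>sin \<theta>\<bar> - 2 * \<bar>cos \<theta>\<bar>)" for t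
          using u[of "- t"] that unfolding ch_def chord_swap by simp
        show "\<bar>sh \<theta> (x, y) - sh \<theta> (x, y')\<bar> \<le> \<bar>sin \<theta>\<bar> - 2 * \<bar>cos \<theta>\<bar> - 1/4"
          using bd[of y y'] c by (simp add: sh_eq cells_def)
      qed
      then show ?thesis unfolding V0_def by linarith
    qed
  qed
qed

lemma crit_shadow_ex: "\<exists>V0. crit_shadow L X ch sh V0 (\<lambda>\<theta>. shadow (cos \<theta>) (sin \<theta>))"
proof -
  obtain V0 where V0: "0 < V0" "\<And>\<theta>. V0 \<le> Vc \<theta>" using Vc_bounded_below by blast
  have "crit_shadow L X ch sh V0 (\<lambda>\<theta>. shadow (cos \<theta>) (sin \<theta>))"
  proof (unfold_locales)
    show "0 < V0" "\<And>\<theta>. V0 \<le> Vc \<theta>" by (rule V0)+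
    show "shadow (cos \<theta>) (sin \<theta>) \<in> sets borel" for \<theta> by (simp add: shadow_def)
    show "emeasure lborel (shadow (cos \<theta>) (sin \<theta>)) < \<infinity>" for \<theta> by (simp add: shadow_def emeasure_lborel_Icc_eq)
    show "t \<in> shadow (cos \<theta>) (sin \<theta>)" if "0 < ch \<theta> t" for \<theta> t
      using that unfolding ch_def by (rule chord_shadow[OF cos_sin_squared])
    show "emeasure lborel {t \<in> shadow (cos \<theta>) (sin \<theta>). ch \<theta> t < \<delta>} \<le> ennreal (4 * \<delta>)" if "0 < \<delta>" "\<delta> \<le> 1" for \<delta> \<theta>
      unfolding ch_def by (rule chord_tip[OF cos_sin_squared that])
  qed (rule minorant)
  then show ?thesis by blast
qed

end

section \<open>Branching structure of the random sets\<close>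

text \<open>Embeds the index tree of a fresh copy as the tree of descendants of the square
  \<open>Q\<close> of generation \<open>k\<close>; composing a sample with it restricts the
  randomness to that subtree.\<close>

definition shift_index :: "nat \<Rightarrow> nat \<Rightarrow> nat \<times> nat \<Rightarrow> nat \<times> nat \<times> nat \<Rightarrow> nat \<times> nat \<times> nat" where
  "shift_index L k Q x = (k + fst x, L ^ fst x * fst Q + fst (snd x), L ^ fst x * snd Q + snd (snd x))"

definition glue :: "nat \<Rightarrow> nat \<Rightarrow> nat \<times> nat \<Rightarrow> nat \<times> nat \<Rightarrow> nat \<times> nat" where
  "glue L n Q R = (L ^ n * fst Q + fst R, L ^ n * snd Q + snd R)"

lemma Sq_Suc_iff:
  "R \<in> Sq L \<omega> (Suc n) \<longleftrightarrow> (\<exists>Q\<in>Sq L \<omega> n. \<exists>P\<in>\<omega> (n, Q). R = glue L 1 Q P)"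
  by (simp add: glue_def image_iff)

declare Sq.simps(2)[simp del]

lemma Sq_split: "Sq L \<omega> (k + n) = (\<Union>Q\<in>Sq L \<omega> k. glue L n Q ` Sq L (\<omega> \<circ> shift_index L k Q) n)"
proof (induction n)
  case 0
  then show ?case by (auto simp: glue_def)
next
  case (Suc n)
  have g: "glue L 1 (glue L n Q R) P = glue L (Suc n) Q (glue L 1 R P)" for Q R P
    by (simp add: glue_def algebra_simps)
  have s: "(\<omega> \<circ> shift_index L k Q) (n, R) = \<omega> (k + n, glue L n Q R)" for Q R
    by (simp add: shift_index_def glue_def)
  show ?case
  proof (intro set_eqI)
    fix x
    have "x \<in> Sq L \<omega> (k + Suc n) \<longleftrightarrow> (\<exists>R\<in>Sq L \<omega> (k + n). \<exists>P\<in>\<omega> (k + n, R). x = glue L 1 R P)"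
      by (simp only: add_Suc_right Sq_Suc_iff)
    also have "\<dots> \<longleftrightarrow> (\<exists>Q\<in>Sq L \<omega> k. \<exists>R\<in>Sq L (\<omega> \<circ> shift_index L k Q) n. \<exists>P\<in>\<omega> (k + n, glue L n Q R). x = glue L 1 (glue L n Q R) P)"
      unfolding Suc by blast
    also have "\<dots> \<longleftrightarrow> (\<exists>Q\<in>Sq L \<omega> k. \<exists>T\<in>Sq L (\<omega> \<circ> shift_index L k Q) (Suc n). x = glue L (Suc n) Q T)"
      unfolding Bex_def Sq_Suc_iff g s by blast
    finally show "x \<in> Sq L \<omega> (k + Suc n) \<longleftrightarrow> x \<in> (\<Union>Q\<in>Sq L \<omega> k. glue L (Suc n) Q ` Sq L (\<omega> \<circ> shift_index L k Q) (Suc n))"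
      by blast
  qed
qed

lemma glue_inj: "R \<in> cells (L ^ n) \<Longrightarrow> R' \<in> cells (L ^ n) \<Longrightarrow> glue L n Q R = glue L n Q' R' \<longleftrightarrow> Q = Q' \<and> R = R'"
proof -
  have "a = a' \<and> i = i'" if "a < l" "a' < l" "l * i + a = l * i' + a'" for a a' i i' l :: nat
  proof -
    have "(l * i + a) div l = i" "(l * i + a) mod l = a" "(l * i' + a') div l = i'" "(l * i' + a') mod l = a'"
      using that(1,2) by auto
    then show ?thesis using that(3) by metis
  qed
  note aux = this
  assume R: "R \<in> cells (L ^ n)" "R' \<in> cells (L ^ n)"
  show ?thesis
  proof
    assume e: "glue L n Q R = glue L n Q' R'"
    have "fst R = fst R' \<and> fst Q = fst Q'" "snd R = snd R' \<and> snd Q = snd Q'"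
      by (rule aux[where l="L ^ n"]; use R e in \<open>auto simp: glue_def cells_def\<close>)+
    then show "Q = Q' \<and> R = R'" by (simp add: prod_eq_iff)
  qed simp
qed

lemma glue_cells: "0 < L \<Longrightarrow> Q \<in> cells (L ^ k) \<Longrightarrow> R \<in> cells (L ^ n) \<Longrightarrow> glue L n Q R \<in> cells (L ^ (k + n))"
proof -
  have "l * i + a < l * m" if "i < m" "a < l" for l i a m :: nat
  proof -
    have "l * i + a < l * (i + 1)" using that by simp
    also have "\<dots> \<le> l * m" using that by (intro mult_le_mono2) simp
    finally show ?thesis .
  qed
  then show "0 < L \<Longrightarrow> Q \<in> cells (L ^ k) \<Longrightarrow> R \<in> cells (L ^ n) \<Longrightarrow> ?thesis"
    by (auto simp: glue_def cells_def power_add mult.commute)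
qed

text \<open>Only levels below \<open>n\<close>: the samples attached to the potential squares of
  earlier generations determine generation \<open>n\<close>.\<close>

definition coords :: "nat \<Rightarrow> nat \<Rightarrow> (nat \<times> nat \<times> nat) set" where
  "coords L n = (SIGMA m:{..<n}. cells (L ^ m))"

lemma finite_coords[simp]: "finite (coords L n)" by (simp add: coords_def)

lemma Sq_cells: assumes L: "0 < L" and \<omega>: "\<And>x. \<omega> x \<subseteq> cells L" shows "Sq L \<omega> n \<subseteq> cells (L ^ n)"
proof (induction n)
  case (Suc n)
  show ?case
  proof
    fix R assume "R \<in> Sq L \<omega> (Suc n)"
    then obtain Q P where "Q \<in> Sq L \<omega> n" "P \<in> \<omega> (n, Q)" "R = glue L 1 Q P" by (auto simp: Sq_Suc_iff)
    moreover from this have "Q \<in> cells (L ^ n)" "P \<in> cells (L ^ 1)" using Suc \<omega>[of "(n, Q)"] by auto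
    ultimately show "R \<in> cells (L ^ Suc n)" using glue_cells[OF L, of Q n P 1] by simp
  qed
qed (auto simp: cells_def)

lemma Sq_cong:
  assumes L: "0 < L" and \<omega>: "\<And>x. \<omega> x \<subseteq> cells L" and eq: "\<And>x. x \<in> coords L n \<Longrightarrow> \<omega> x = \<omega>' x"
  shows "Sq L \<omega> n = Sq L \<omega>' n"
  using eq
proof (induction n)
  case (Suc n)
  have 1: "Sq L \<omega> n = Sq L \<omega>' n" by (rule Suc.IH) (use Suc.prems in \<open>auto simp: coords_def\<close>)
  have sub: "Sq L \<omega> n \<subseteq> cells (L ^ n)" by (rule Sq_cells[OF L \<omega>])
  have 2: "\<omega> (n, Q) = \<omega>' (n, Q)" if "Q \<in> Sq L \<omega> n" for Q
    by (rule Suc.prems) (use that sub in \<open>auto simp: coords_def\<close>)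
  show ?case
  proof (rule set_eqI)
    fix R
    show "R \<in> Sq L \<omega> (Suc n) \<longleftrightarrow> R \<in> Sq L \<omega>' (Suc n)"
      unfolding Sq_Suc_iff 1[symmetric] by (intro bex_cong refl) (simp add: 2)
  qed
qed simp

section \<open>Measurability and independence\<close>

context uniform_grid
begin

abbreviation "\<Omega> \<equiv> sample_space X"

sublocale \<Omega>: prob_space "\<Omega>"
  unfolding sample_space_def by (rule prob_space_PiM) (rule prob_space_measure_pmf)

lemma space_\<Omega>[simp]: "space \<Omega> = UNIV"
  by (simp add: sample_space_def space_PiM)

text \<open>Replacing samples outside the support by the empty set changes \<open>Sq\<close> on a null set only, and makes the
  generations finite and measurable everywhere.\<close>
definition RT :: "(nat \<times> nat \<times> nat) set \<Rightarrow> omega \<Rightarrow> omega" where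
  "RT K \<omega> x = (if x \<in> K \<and> \<omega> x \<in> set_pmf X then \<omega> x else {})"

lemma RT_cells: "RT K \<omega> x \<subseteq> G"
  using support_sub by (auto simp: RT_def)

definition S :: "nat \<Rightarrow> omega \<Rightarrow> (nat \<times> nat) set" where
  "S n \<omega> = Sq L (RT UNIV \<omega>) n"

lemma S_cells: "S n \<omega> \<subseteq> cells (L ^ n)"
  unfolding S_def by (rule Sq_cells[OF L_pos(1) RT_cells])

lemma finite_S[simp]: "finite (S n \<omega>)"
  by (rule finite_subset[OF S_cells finite_cells])

lemma S_RT: "S n \<omega> = Sq L (RT (coords L n) \<omega>) n"
  unfolding S_def by (rule Sq_cong[OF L_pos(1) RT_cells]) (simp add: RT_def)

lemma AE_supp: "AE \<omega> in \<Omega>. \<forall>x. \<omega> x \<in> set_pmf X"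
  unfolding sample_space_def
proof (subst AE_all_countable, rule allI)
  fix x
  have "AE F in measure_pmf X. F \<in> set_pmf X" by (simp add: AE_measure_pmf_iff)
  then show "AE \<omega> in PiM UNIV (\<lambda>_. measure_pmf X). \<omega> x \<in> set_pmf X"
    by (intro AE_PiM_component[where P="\<lambda>F. F \<in> set_pmf X"] prob_space_measure_pmf) auto
qed

lemma AE_S: "AE \<omega> in \<Omega>. \<forall>n. Sq L \<omega> n = S n \<omega>"
  using AE_supp
proof eventually_elim
  case (elim \<omega>)
  then have "RT UNIV \<omega> = \<omega>" by (auto simp: RT_def fun_eq_iff)
  then show ?case by (simp add: S_def)
qed

text \<open>The support of the model is finite, so with finite \<open>K\<close> the regularised
  sample takes finitely many values and every function of it is measurable.\<close>

lemma RT_measurable: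
  assumes K: "finite K" "K \<subseteq> K'"
  shows "(\<lambda>x. g (RT K x)) \<in> measurable (PiM K' (\<lambda>_. measure_pmf X)) (count_space UNIV)"
proof -
  define D where "D = insert {} (set_pmf X)"
  define tr where "tr F = (if F \<in> set_pmf X then F else {})" for F
  define ext where "ext y = (\<lambda>x. if x \<in> K then y x else {})" for y :: omega
  have 1: "(\<lambda>x. \<lambda>i\<in>K. tr (x i)) \<in> measurable (PiM K' (\<lambda>_. measure_pmf X)) (PiM K (\<lambda>_. count_space D))"
  proof (rule measurable_restrict)
    fix i assume "i \<in> K"
    then have "(\<lambda>x. x i) \<in> measurable (PiM K' (\<lambda>_. measure_pmf X)) (measure_pmf X)"
      using K by (intro measurable_component_singleton) auto
    moreover have "tr \<in> measurable (measure_pmf X) (count_space D)" by (auto simp: tr_def D_def)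
    ultimately show "(\<lambda>x. tr (x i)) \<in> measurable (PiM K' (\<lambda>_. measure_pmf X)) (count_space D)"
      by (rule measurable_compose)
  qed
  have 2: "PiM K (\<lambda>_. count_space D) = count_space (PiE K (\<lambda>_. D))"
    by (rule count_space_PiM_finite) (auto simp: K D_def intro: countable_finite)
  have 3: "(\<lambda>y. g (ext y)) \<in> measurable (count_space (PiE K (\<lambda>_. D))) (count_space UNIV)" by simp
  have "(\<lambda>x. g (ext (\<lambda>i\<in>K. tr (x i)))) \<in> measurable (PiM K' (\<lambda>_. measure_pmf X)) (count_space UNIV)"
    using measurable_compose[OF 1[unfolded 2] 3] .
  moreover have "ext (\<lambda>i\<in>K. tr (x i)) = RT K x" for x by (auto simp: ext_def tr_def RT_def fun_eq_iff)
  ultimately show ?thesis by simp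
qed

lemma S_measurable[measurable]: "S n \<in> measurable \<Omega> (count_space UNIV)"
  unfolding S_RT[abs_def] sample_space_def by (rule RT_measurable[where g="\<lambda>y. Sq L y n"]) auto

lemma fS_measurable[measurable]: "(\<lambda>\<omega>. f (S n \<omega>) :: real) \<in> borel_measurable \<Omega>"
  by (rule measurable_compose[OF S_measurable]) simp

lemma fS_bounded: "\<exists>B. \<forall>\<omega>. \<bar>f (S n \<omega>) :: real\<bar> \<le> B"
proof -
  have "\<bar>f (S n \<omega>)\<bar> \<le> (\<Sum>A\<in>Pow (cells (L ^ n)). \<bar>f A\<bar>)" for \<omega>
    by (rule member_le_sum) (use S_cells in auto)
  then show ?thesis by blast
qed

lemma shift_index_inj: "inj (shift_index L k Q)"
proof (rule injI)
  fix x y assume e: "shift_index L k Q x = shift_index L k Q y"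
  then have "fst x = fst y" by (simp add: shift_index_def)
  with e show "x = y" by (auto simp: shift_index_def prod_eq_iff)
qed

lemma shift_index_distr: "distr \<Omega> \<Omega> (\<lambda>\<omega>. \<omega> \<circ> shift_index L k Q) = \<Omega>"
proof -
  have "distr (PiM UNIV (\<lambda>_. measure_pmf X)) (PiM UNIV (\<lambda>_. measure_pmf X)) (\<lambda>\<omega>. \<lambda>n\<in>UNIV. \<omega> (shift_index L k Q n))
     = PiM UNIV (\<lambda>_. measure_pmf X)"
    by (rule distr_PiM_reindex[of UNIV "\<lambda>_. measure_pmf X" "shift_index L k Q" UNIV])
       (auto simp: shift_index_inj prob_space_measure_pmf)
  then show ?thesis by (simp only: restrict_UNIV sample_space_def comp_def)
qed

lemma shift_index_measurable[measurable]: "(\<lambda>\<omega>. \<omega> \<circ> shift_index L k Q) \<in> measurable \<Omega> \<Omega>"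
proof -
  have "(\<lambda>\<omega>. \<lambda>n\<in>UNIV. \<omega> (shift_index L k Q n)) \<in> measurable (PiM UNIV (\<lambda>_. measure_pmf X)) (PiM UNIV (\<lambda>_. measure_pmf X))"
    by (intro measurable_restrict measurable_component_singleton) auto
  then show ?thesis by (simp only: restrict_UNIV sample_space_def comp_def)
qed

lemma integral_sft: "(\<integral>\<omega>. f (S n (\<omega> \<circ> shift_index L k Q)) \<partial>\<Omega>) = (\<integral>\<omega>. f (S n \<omega>) \<partial>\<Omega> :: real)"
proof -
  have "(\<integral>\<omega>. f (S n \<omega>) \<partial>\<Omega>) = (\<integral>\<omega>. f (S n \<omega>) \<partial>distr \<Omega> \<Omega> (\<lambda>\<omega>. \<omega> \<circ> shift_index L k Q))"
    by (simp add: shift_index_distr)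
  also have "\<dots> = (\<integral>\<omega>. f (S n (\<omega> \<circ> shift_index L k Q)) \<partial>\<Omega>)"
    by (rule integral_distr) measurable
  finally show ?thesis by simp
qed

lemma indep_coords: "\<Omega>.indep_vars (\<lambda>_. measure_pmf X) (\<lambda>x \<omega>. \<omega> x) UNIV"
proof (subst \<Omega>.indep_vars_iff_distr_eq_PiM)
  have rv: "(\<lambda>\<omega>. \<omega> x) \<in> measurable \<Omega> (measure_pmf X)" for x
    unfolding sample_space_def by (rule measurable_component_singleton) simp
  show "\<And>i. (\<lambda>\<omega>. \<omega> i) \<in> measurable \<Omega> (measure_pmf X)" by (rule rv)
  have "distr \<Omega> (measure_pmf X) (\<lambda>\<omega>. \<omega> i) = measure_pmf X" for i
    unfolding sample_space_def by (rule distr_PiM_component) (auto simp: prob_space_measure_pmf)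
  moreover have "distr \<Omega> (PiM UNIV (\<lambda>_. measure_pmf X)) (\<lambda>x. \<lambda>i\<in>UNIV. x i) = \<Omega>"
    unfolding restrict_UNIV by (simp add: sample_space_def distr_id)
  ultimately show "distr \<Omega> (PiM UNIV (\<lambda>_. measure_pmf X)) (\<lambda>x. \<lambda>i\<in>UNIV. x i)
      = PiM UNIV (\<lambda>i. distr \<Omega> (measure_pmf X) (\<lambda>\<omega>. \<omega> i))"
    by (simp add: sample_space_def)
qed simp

lemma coords_sft_disjoint:
  assumes "Q \<noteq> Q'" shows "shift_index L k Q ` coords L n \<inter> shift_index L k Q' ` coords L n = {}"
proof (rule ccontr)
  assume "\<not> ?thesis"
  then obtain m R m' R' where m: "R \<in> cells (L ^ m)" "R' \<in> cells (L ^ m')" "shift_index L k Q (m, R) = shift_index L k Q' (m', R')"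
    by (fastforce simp: coords_def)
  then have "m = m'" "glue L m Q R = glue L m Q' R'" by (auto simp: shift_index_def glue_def)
  then have "Q = Q'" using glue_inj m by blast
  with assms show False by simp
qed

text \<open>The branching property: given generation \<open>k\<close>, the subtrees at its squares
  are independent copies of the whole tree. Stating it on the event \<open>S k \<omega> = A\<close>
  also covers values of probability 0.\<close>

lemma branch:
  fixes f :: "nat \<times> nat \<Rightarrow> (nat \<times> nat) set \<Rightarrow> real"
  assumes A: "finite A"
  shows "(\<integral>\<omega>. indicator {\<omega>. S k \<omega> = A} \<omega> * (\<Prod>Q\<in>A. f Q (S n (\<omega> \<circ> shift_index L k Q))) \<partial>\<Omega>)
     = \<Omega>.prob {\<omega>. S k \<omega> = A} * (\<Prod>Q\<in>A. \<integral>\<omega>. f Q (S n \<omega>) \<partial>\<Omega>)"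
proof -
  \<comment> \<open>\<open>None\<close> stands for generation \<open>k\<close> and
    \<open>Some Q\<close> for the subtree at \<open>Q\<close>; the sets \<open>K j\<close> of
    coordinates involved are pairwise disjoint.\<close>
  define I where "I = insert None (Some ` A)"
  define K where "K j = (case j of None \<Rightarrow> coords L k | Some Q \<Rightarrow> shift_index L k Q ` coords L n)" for j
  define Y where "Y j x = (case j of None \<Rightarrow> indicator {A} (Sq L (RT (coords L k) x) k)
     | Some Q \<Rightarrow> f Q (Sq L (RT (shift_index L k Q ` coords L n) x \<circ> shift_index L k Q) n))" for j x
  have fK: "finite (K j)" for j by (auto simp: K_def split: option.split)
  have disj: "disjoint_family_on K I"
    unfolding disjoint_family_on_def
  proof (intro ballI impI)
    fix i j :: "(nat \<times> nat) option" assume ij: "i \<noteq> j"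
    have *: "coords L k \<inter> shift_index L k Q ` coords L n = {}" for Q by (auto simp: coords_def shift_index_def)
    show "K i \<inter> K j = {}"
      using ij * coords_sft_disjoint by (cases i; cases j) (auto simp: K_def Int_commute)
  qed
  have ind: "\<Omega>.indep_vars (\<lambda>j. PiM (K j) (\<lambda>_. measure_pmf X)) (\<lambda>j \<omega>. restrict (\<lambda>x. \<omega> x) (K j)) I"
    by (rule \<Omega>.indep_vars_restrict[OF indep_coords _ disj]) simp
  have "\<Omega>.indep_vars (\<lambda>_. borel) (\<lambda>j \<omega>. Y j (restrict (\<lambda>x. \<omega> x) (K j))) I"
  proof (rule \<Omega>.indep_vars_compose2[OF ind])
    fix j
    have "(\<lambda>x. (case j of None \<Rightarrow> indicator {A} (Sq L y k) | Some Q \<Rightarrow> f Q (Sq L (y \<circ> shift_index L k Q) n))) \<in> borel_measurable M" for y M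
      by simp
    have "Y j = (\<lambda>x. (\<lambda>y. case j of None \<Rightarrow> indicator {A} (Sq L y k) | Some Q \<Rightarrow> f Q (Sq L (y \<circ> shift_index L k Q) n)) (RT (K j) x))"
      by (auto simp: Y_def K_def fun_eq_iff split: option.split)
    moreover have "(\<lambda>x. (\<lambda>y. case j of None \<Rightarrow> indicator {A} (Sq L y k) | Some Q \<Rightarrow> f Q (Sq L (y \<circ> shift_index L k Q) n)) (RT (K j) x))
       \<in> measurable (PiM (K j) (\<lambda>_. measure_pmf X)) (count_space UNIV)"
      by (rule RT_measurable[OF fK order_refl])
    ultimately have "Y j \<in> measurable (PiM (K j) (\<lambda>_. measure_pmf X)) (count_space UNIV)" by simp
    then show "Y j \<in> borel_measurable (PiM (K j) (\<lambda>_. measure_pmf X))"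
      by (rule measurable_compose[where g="\<lambda>x. x"]) simp
  qed
  moreover have YN: "Y None (restrict (\<lambda>x. \<omega> x) (K None)) = indicator {\<omega>. S k \<omega> = A} \<omega>" for \<omega>
  proof -
    have "RT (coords L k) (restrict (\<lambda>x. \<omega> x) (coords L k)) = RT (coords L k) \<omega>" by (auto simp: RT_def fun_eq_iff)
    then show ?thesis by (simp add: Y_def K_def S_RT indicator_def)
  qed
  moreover have YS: "Y (Some Q) (restrict (\<lambda>x. \<omega> x) (K (Some Q))) = f Q (S n (\<omega> \<circ> shift_index L k Q))" for \<omega> Q
  proof -
    have "RT (shift_index L k Q ` coords L n) (restrict (\<lambda>x. \<omega> x) (shift_index L k Q ` coords L n)) \<circ> shift_index L k Q = RT (coords L n) (\<omega> \<circ> shift_index L k Q)"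
      using shift_index_inj by (auto simp: RT_def fun_eq_iff inj_image_mem_iff)
    then show ?thesis by (simp add: Y_def K_def S_RT)
  qed
  moreover have int: "integrable \<Omega> (\<lambda>\<omega>. Y j (restrict (\<lambda>x. \<omega> x) (K j)))" for j
  proof (cases j)
    case None
    then show ?thesis unfolding None YN
      by (intro \<Omega>.integrable_const_bound[of _ 1]) (auto simp: indicator_def)
  next
    case (Some Q)
    obtain B where B: "\<And>\<omega>. \<bar>f Q (S n \<omega>)\<bar> \<le> B" using fS_bounded by blast
    show ?thesis unfolding Some YS
      by (intro \<Omega>.integrable_const_bound[of _ B]) (auto simp: B)
  qed
  ultimately have "(\<integral>\<omega>. (\<Prod>j\<in>I. Y j (restrict (\<lambda>x. \<omega> x) (K j))) \<partial>\<Omega>) = (\<Prod>j\<in>I. \<integral>\<omega>. Y j (restrict (\<lambda>x. \<omega> x) (K j)) \<partial>\<Omega>)"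
    using A by (intro \<Omega>.indep_vars_lebesgue_integral) (auto simp: I_def)
  note prods = this
  have prodI: "(\<Prod>j\<in>I. Z j) = Z None * (\<Prod>Q\<in>A. Z (Some Q))" for Z :: "(nat \<times> nat) option \<Rightarrow> real"
    unfolding I_def using A by (subst prod.insert) (auto simp: prod.reindex)
  show ?thesis
    using prods unfolding prodI YN YS integral_sft by simp
qed

end

section \<open>Projections and moments\<close>

lemma segment_param:
  fixes z :: real
  assumes "min 0 z \<le> a" "a \<le> max 0 z"
  obtains w where "0 \<le> w" "w \<le> 1" "a = w * z"
proof (cases "z = 0")
  case True
  then show ?thesis using assms that[of 0] by auto
next
  case False
  show ?thesis
  proof (rule that[of "a / z"])
    show "0 \<le> a / z" "a / z \<le> 1" using assms False
      by (cases "0 < z"; auto simp: min_def max_def divide_le_eq zero_le_divide_iff split: if_splits)+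
  qed (use False in simp)
qed

lemma segment_param_bounds:
  fixes z :: real
  assumes "0 \<le> w" "w \<le> 1"
  shows "min 0 z \<le> w * z \<and> w * z \<le> max 0 z"
proof (cases "0 \<le> z")
  case True
  then show ?thesis using assms mult_right_mono[of w 1 z] by simp
next
  case False
  then show ?thesis using assms mult_right_mono_neg[of w 1 z] by (simp add: mult_nonneg_nonpos)
qed

lemma shadow_iff: "r \<in> shadow c s \<longleftrightarrow> (\<exists>x y. 0 \<le> x \<and> x \<le> 1 \<and> 0 \<le> y \<and> y \<le> 1 \<and> r = - s * x + c * y)"
proof
  assume r: "r \<in> shadow c s"
  define a where "a = max (min 0 c) (r - max 0 (- s))"
  have "min 0 c \<le> a" "a \<le> max 0 c" using r by (auto simp: a_def shadow_def)
  then obtain y where y: "0 \<le> y" "y \<le> 1" "a = y * c" by (rule segment_param)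
  have "min 0 (- s) \<le> r - a" "r - a \<le> max 0 (- s)" using r by (auto simp: a_def shadow_def)
  then obtain x where x: "0 \<le> x" "x \<le> 1" "r - a = x * (- s)" by (rule segment_param)
  have "r = - s * x + c * y" using x(3) y(3) by (simp add: algebra_simps)
  then show "\<exists>x y. 0 \<le> x \<and> x \<le> 1 \<and> 0 \<le> y \<and> y \<le> 1 \<and> r = - s * x + c * y" using x y by blast
next
  assume "\<exists>x y. 0 \<le> x \<and> x \<le> 1 \<and> 0 \<le> y \<and> y \<le> 1 \<and> r = - s * x + c * y"
  then obtain x y where xy: "0 \<le> x" "x \<le> 1" "0 \<le> y" "y \<le> 1" and r: "r = - s * x + c * y" by blast
  have "r = x * (- s) + y * c" using r by (simp add: algebra_simps)
  then show "r \<in> shadow c s"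
    using segment_param_bounds[OF xy(1,2), of "- s"] segment_param_bounds[OF xy(3,4), of c] by (auto simp: shadow_def)
qed

lemma proj_grid_square:
  assumes L: "0 < L"
  shows "t \<in> proj \<theta> ` grid_square L n Q \<longleftrightarrow> real L ^ n * t - sh \<theta> Q \<in> shadow (cos \<theta>) (sin \<theta>)"
proof
  have P: "0 < real L ^ n" using L by simp
  {
    assume "t \<in> proj \<theta> ` grid_square L n Q"
    then obtain u v where uv: "real (fst Q) / real L ^ n \<le> u" "u \<le> (real (fst Q) + 1) / real L ^ n"
      "real (snd Q) / real L ^ n \<le> v" "v \<le> (real (snd Q) + 1) / real L ^ n" and t: "t = - sin \<theta> * u + cos \<theta> * v"
      by (auto simp: grid_square_def proj_def)
    have "real L ^ n * t - sh \<theta> Q = - sin \<theta> * (real L ^ n * u - real (fst Q)) + cos \<theta> * (real L ^ n * v - real (snd Q))"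
      by (simp add: t sh_eq algebra_simps)
    moreover have "0 \<le> real L ^ n * u - real (fst Q)" "real L ^ n * u - real (fst Q) \<le> 1"
      "0 \<le> real L ^ n * v - real (snd Q)" "real L ^ n * v - real (snd Q) \<le> 1"
      using uv P by (auto simp: divide_le_eq le_divide_eq mult.commute)
    ultimately show "real L ^ n * t - sh \<theta> Q \<in> shadow (cos \<theta>) (sin \<theta>)" unfolding shadow_iff by blast
  next
    assume "real L ^ n * t - sh \<theta> Q \<in> shadow (cos \<theta>) (sin \<theta>)"
    then obtain x y where xy: "0 \<le> x" "x \<le> 1" "0 \<le> y" "y \<le> 1"
      and r: "real L ^ n * t - sh \<theta> Q = - sin \<theta> * x + cos \<theta> * y" unfolding shadow_iff by blast
    define u v where "u = (real (fst Q) + x) / real L ^ n" and "v = (real (snd Q) + y) / real L ^ n"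
    have uv: "real L ^ n * u = real (fst Q) + x" "real L ^ n * v = real (snd Q) + y"
      using P by (simp_all add: u_def v_def)
    have "real L ^ n * proj \<theta> (u, v) = - sin \<theta> * (real L ^ n * u) + cos \<theta> * (real L ^ n * v)"
      by (simp add: proj_def algebra_simps)
    also have "\<dots> = real L ^ n * t" using r unfolding uv by (simp add: sh_eq proj_def algebra_simps)
    finally have "real L ^ n * t = real L ^ n * proj \<theta> (u, v)" ..
    then have "t = proj \<theta> (u, v)" using P by (metis less_irrefl mult_left_cancel)
    moreover have "(u, v) \<in> grid_square L n Q"
      using xy P by (auto simp: grid_square_def u_def v_def intro!: divide_right_mono)
    ultimately show "t \<in> proj \<theta> ` grid_square L n Q" by blast
  }
qed

lemma AE_summable_of_summable_integrals:
  fixes f :: "nat \<Rightarrow> 'a \<Rightarrow> real"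
  assumes f: "\<And>k. integrable M (f k)" and s: "summable (\<lambda>k. \<integral>x. \<bar>f k x\<bar> \<partial>M)"
  shows "AE x in M. summable (\<lambda>k. \<bar>f k x\<bar>)"
proof -
  have [measurable]: "f k \<in> borel_measurable M" for k using f by simp
  have "(\<integral>\<^sup>+x. (\<Sum>k. ennreal \<bar>f k x\<bar>) \<partial>M) = (\<Sum>k. \<integral>\<^sup>+x. ennreal \<bar>f k x\<bar> \<partial>M)"
    by (rule nn_integral_suminf) measurable
  also have "\<dots> = (\<Sum>k. ennreal (\<integral>x. \<bar>f k x\<bar> \<partial>M))"
    using f by (intro suminf_cong nn_integral_eq_integral) auto
  also have "\<dots> = ennreal (\<Sum>k. \<integral>x. \<bar>f k x\<bar> \<partial>M)"
    by (rule suminf_ennreal2[OF _ s]) simp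
  finally have "(\<integral>\<^sup>+x. (\<Sum>k. ennreal \<bar>f k x\<bar>) \<partial>M) \<noteq> \<infinity>" by simp
  then have "AE x in M. (\<Sum>k. ennreal \<bar>f k x\<bar>) \<noteq> \<infinity>"
    by (intro nn_integral_PInf_AE) measurable
  then show ?thesis
    by eventually_elim (intro summable_suminf_not_top, auto)
qed

context uniform_grid
begin

definition PR :: "real \<Rightarrow> nat \<Rightarrow> (nat \<times> nat) set \<Rightarrow> real set" where
  "PR \<theta> n A = {t. \<exists>Q\<in>A. real L ^ n * t - sh \<theta> Q \<in> shadow (cos \<theta>) (sin \<theta>)}"

lemma PR_Sset: "proj \<theta> ` Sset L \<omega> n = PR \<theta> n (Sq L \<omega> n)"
proof -
  have "t \<in> proj \<theta> ` Sset L \<omega> n \<longleftrightarrow> (\<exists>Q\<in>Sq L \<omega> n. t \<in> proj \<theta> ` grid_square L n Q)" for t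
    unfolding Sset_def by blast
  then show ?thesis unfolding proj_grid_square[OF L_pos(1)] PR_def by blast
qed

lemma PR_bounded: assumes A: "A \<subseteq> cells (L ^ n)" and t: "t \<in> PR \<theta> n A" shows "- 2 \<le> t \<and> t \<le> 2"
proof -
  from t obtain Q where Q: "Q \<in> A" "t \<in> proj \<theta> ` grid_square L n Q"
    unfolding PR_def proj_grid_square[OF L_pos(1), symmetric] by blast
  then obtain u v where uv: "real (fst Q) / real L ^ n \<le> u" "u \<le> (real (fst Q) + 1) / real L ^ n"
      "real (snd Q) / real L ^ n \<le> v" "v \<le> (real (snd Q) + 1) / real L ^ n" and te: "t = - sin \<theta> * u + cos \<theta> * v"
    by (auto simp: grid_square_def proj_def)
  have "fst Q + 1 \<le> L ^ n" "snd Q + 1 \<le> L ^ n" using Q(1) A by (auto simp: cells_def)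
  then have "real (fst Q) + 1 \<le> real L ^ n" "real (snd Q) + 1 \<le> real L ^ n"
    by (metis of_nat_1 of_nat_add of_nat_le_iff of_nat_power)+
  then have "(real (fst Q) + 1) / real L ^ n \<le> 1" "(real (snd Q) + 1) / real L ^ n \<le> 1" by auto
  moreover have "0 \<le> real (fst Q) / real L ^ n" "0 \<le> real (snd Q) / real L ^ n" by auto
  ultimately have "\<bar>u\<bar> \<le> 1" "\<bar>v\<bar> \<le> 1" using uv by linarith+
  then have "\<bar>sin \<theta>\<bar> * \<bar>u\<bar> \<le> 1 * 1" "\<bar>cos \<theta>\<bar> * \<bar>v\<bar> \<le> 1 * 1" by (intro mult_mono; simp)+
  then have "\<bar>- sin \<theta> * u\<bar> \<le> 1" "\<bar>cos \<theta> * v\<bar> \<le> 1" by (simp_all add: abs_mult)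
  then show ?thesis unfolding te by linarith
qed

lemma PR_borel[measurable]: "PR \<theta> n A \<in> sets borel"
proof -
  have "PR \<theta> n A = (\<Union>Q\<in>A. {t. real L ^ n * t - sh \<theta> Q \<in> shadow (cos \<theta>) (sin \<theta>)})" by (auto simp: PR_def)
  moreover have "{t. real L ^ n * t - sh \<theta> Q \<in> shadow (cos \<theta>) (sin \<theta>)} \<in> sets borel" for Q
    unfolding shadow_def atLeastAtMost_iff by measurable
  ultimately show ?thesis by (auto intro!: sets.countable_UN'' countableI_type)
qed

lemma PR_glue:
  "t \<in> PR \<theta> (k + n) (\<Union>Q\<in>A. glue L n Q ` B Q) \<longleftrightarrow> (\<exists>Q\<in>A. real L ^ k * t - sh \<theta> Q \<in> PR \<theta> n (B Q))"
proof -
  have "real L ^ (k + n) * t - sh \<theta> (glue L n Q R) = real L ^ n * (real L ^ k * t - sh \<theta> Q) - sh \<theta> R" for Q R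
    by (simp add: sh_eq glue_def power_add algebra_simps)
  then show ?thesis unfolding PR_def by auto
qed

lemma S_split: "S (k + n) \<omega> = (\<Union>Q\<in>S k \<omega>. glue L n Q ` S n (\<omega> \<circ> shift_index L k Q))"
proof -
  have "RT UNIV \<omega> \<circ> shift_index L k Q = RT UNIV (\<omega> \<circ> shift_index L k Q)" for Q by (auto simp: RT_def fun_eq_iff)
  then show ?thesis unfolding S_def Sq_split by simp
qed

lemma S_0: "S 0 \<omega> = {(0, 0)}" by (simp add: S_def)

lemma S_1: "S 1 \<omega> = RT UNIV \<omega> (0, 0, 0)"
  by (auto simp: S_def Sq.simps(2))

lemma prob_UNIV[simp]: "\<Omega>.prob UNIV = 1"
  using \<Omega>.prob_space by simp

lemma S_event[measurable]: "{\<omega>. S k \<omega> = A} \<in> sets \<Omega>"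
proof -
  have "S k -` {A} \<inter> space \<Omega> \<in> sets \<Omega>" by (rule measurable_sets[OF S_measurable]) simp
  then show ?thesis by (simp add: vimage_def)
qed

lemma integrable_fS[simp]: "integrable \<Omega> (\<lambda>\<omega>. f (S n \<omega>) :: real)"
proof -
  obtain B where "\<And>\<omega>. \<bar>f (S n \<omega>)\<bar> \<le> B" using fS_bounded by blast
  then show ?thesis by (intro \<Omega>.integrable_const_bound[of _ B]) auto
qed

section \<open>Moments of sums over a generation\<close>

lemma integrable_shift_prod:
  "integrable \<Omega> (\<lambda>\<omega>. indicator {\<omega>. S k \<omega> = A} \<omega> * (\<Prod>Q\<in>A. f Q (S n (\<omega> \<circ> shift_index L k Q))) :: real)"
proof -
  have "\<exists>B. \<forall>\<omega>. \<bar>f Q (S n \<omega>)\<bar> \<le> B" for Q by (rule fS_bounded)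
  then obtain B where B: "\<And>Q \<omega>. \<bar>f Q (S n \<omega>)\<bar> \<le> B Q" by metis
  show ?thesis
  proof (rule \<Omega>.integrable_const_bound[of _ "\<Prod>Q\<in>A. B Q"])
    have "\<bar>indicator {\<omega>. S k \<omega> = A} \<omega> * (\<Prod>Q\<in>A. f Q (S n (\<omega> \<circ> shift_index L k Q)))\<bar> \<le> 1 * (\<Prod>Q\<in>A. B Q)" for \<omega>
      unfolding abs_mult abs_prod using B by (intro mult_mono prod_mono prod_nonneg) (auto simp: indicator_def intro: order_trans[OF abs_ge_zero B])
    then show "AE \<omega> in \<Omega>. norm (indicator {\<omega>. S k \<omega> = A} \<omega> * (\<Prod>Q\<in>A. f Q (S n (\<omega> \<circ> shift_index L k Q)))) \<le> (\<Prod>Q\<in>A. B Q)"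
      by simp
  qed measurable
qed

text \<open>Conditioning on generation \<open>n\<close> becomes a finite sum over its possible
  values.\<close>

lemma S_sum_split: "f (S n \<omega>) \<omega> = (\<Sum>A\<in>Pow (cells (L ^ n)). indicator {\<omega>. S n \<omega> = A} \<omega> * (f A \<omega> :: real))"
proof -
  have "(\<Sum>A\<in>Pow (cells (L ^ n)). indicator {\<omega>. S n \<omega> = A} \<omega> * f A \<omega>) = (\<Sum>A\<in>{S n \<omega>}. indicator {\<omega>. S n \<omega> = A} \<omega> * f A \<omega>)"
    by (rule sum.mono_neutral_right) (use S_cells in \<open>auto simp: indicator_def\<close>)
  then show ?thesis by simp
qed

lemma integral_S: "(\<integral>\<omega>. f (S n \<omega>) \<partial>\<Omega>) = (\<Sum>A\<in>Pow (cells (L ^ n)). \<Omega>.prob {\<omega>. S n \<omega> = A} * (f A :: real))"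
  unfolding S_sum_split[of "\<lambda>A _. f A"]
  by (subst Bochner_Integration.integral_sum) (auto intro!: integrable_real_mult_indicator \<Omega>.integrable_const simp: \<Omega>.emeasure_eq_measure)

lemma integral_S1: "(\<integral>\<omega>. f (S 1 \<omega>) \<partial>\<Omega>) = EE (f :: _ \<Rightarrow> real)"
proof -
  define tr where "tr F = (if F \<in> set_pmf X then F else {})" for F
  have rv: "(\<lambda>\<omega>. \<omega> (0, 0, 0)) \<in> measurable \<Omega> (measure_pmf X)"
    unfolding sample_space_def by (rule measurable_component_singleton) simp
  have "distr \<Omega> (measure_pmf X) (\<lambda>\<omega>. \<omega> (0, 0, 0)) = measure_pmf X"
    unfolding sample_space_def by (rule distr_PiM_component) (auto simp: prob_space_measure_pmf)
  then have "EE (\<lambda>F. f (tr F)) = (\<integral>F. f (tr F) \<partial>distr \<Omega> (measure_pmf X) (\<lambda>\<omega>. \<omega> (0, 0, 0)))" by simp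
  also have "\<dots> = (\<integral>\<omega>. f (tr (\<omega> (0, 0, 0))) \<partial>\<Omega>)" by (rule integral_distr[OF rv]) simp
  also have "\<dots> = (\<integral>\<omega>. f (S 1 \<omega>) \<partial>\<Omega>)" by (simp only: S_1 RT_def tr_def UNIV_I simp_thms)
  also have "EE (\<lambda>F. f (tr F)) = EE f" by (rule EE_cong) (simp add: tr_def)
  finally show ?thesis by simp
qed

lemma branch_prod:
  "(\<integral>\<omega>. (\<Prod>Q\<in>S k \<omega>. f Q (S n (\<omega> \<circ> shift_index L k Q))) \<partial>\<Omega>) = (\<integral>\<omega>. (\<Prod>Q\<in>S k \<omega>. \<integral>\<omega>. f Q (S n \<omega>) \<partial>\<Omega> :: real) \<partial>\<Omega>)"
proof -
  have fin: "finite A" if "A \<in> Pow (cells (L ^ k))" for A using that finite_subset finite_cells by blast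
  have "(\<integral>\<omega>. (\<Prod>Q\<in>S k \<omega>. f Q (S n (\<omega> \<circ> shift_index L k Q))) \<partial>\<Omega>)
     = (\<Sum>A\<in>Pow (cells (L ^ k)). \<Omega>.prob {\<omega>. S k \<omega> = A} * (\<Prod>Q\<in>A. \<integral>\<omega>. f Q (S n \<omega>) \<partial>\<Omega>))"
    unfolding S_sum_split[of "\<lambda>A \<omega>. \<Prod>Q\<in>A. f Q (S n (\<omega> \<circ> shift_index L k Q))" k]
    by (subst Bochner_Integration.integral_sum) (auto intro!: integrable_shift_prod sum.cong branch fin)
  then show ?thesis unfolding integral_S[of "\<lambda>A. \<Prod>Q\<in>A. \<integral>\<omega>. f Q (S n \<omega>) \<partial>\<Omega>"] .
qed

lemma prod_pick: "finite A \<Longrightarrow> P \<in> A \<Longrightarrow> (\<Prod>Q\<in>A. if Q = P then f Q else 1) = (f P :: real)"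
  by (simp add: prod.delta)

lemma prod_pick2:
  assumes "finite A" "P \<in> A" "P' \<in> A" "P \<noteq> P'"
  shows "(\<Prod>Q\<in>A. if Q = P \<or> Q = P' then f Q else 1) = (f P * f P' :: real)"
proof -
  have "(\<Prod>Q\<in>A. if Q = P \<or> Q = P' then f Q else 1) = (\<Prod>Q\<in>{P, P'}. f Q)"
    by (rule prod.mono_neutral_cong_right) (use assms in auto)
  then show ?thesis using assms by simp
qed

lemma branch_one:
  fixes g :: "(nat \<times> nat) set \<Rightarrow> real"
  assumes A: "finite A" "P \<in> A"
  shows "(\<integral>\<omega>. indicator {\<omega>. S k \<omega> = A} \<omega> * g (S n (\<omega> \<circ> shift_index L k P)) \<partial>\<Omega>) = \<Omega>.prob {\<omega>. S k \<omega> = A} * (\<integral>\<omega>. g (S n \<omega>) \<partial>\<Omega>)"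
    and "integrable \<Omega> (\<lambda>\<omega>. indicator {\<omega>. S k \<omega> = A} \<omega> * g (S n (\<omega> \<circ> shift_index L k P)))"
proof -
  define f where "f Q B = (if Q = P then g B else 1)" for Q :: "nat \<times> nat" and B
  have 1: "(\<Prod>Q\<in>A. f Q (S n (\<omega> \<circ> shift_index L k Q))) = g (S n (\<omega> \<circ> shift_index L k P))" for \<omega>
    unfolding f_def by (rule prod_pick[OF A])
  have "(\<Prod>Q\<in>A. \<integral>\<omega>. f Q (S n \<omega>) \<partial>\<Omega>) = (\<Prod>Q\<in>A. if Q = P then \<integral>\<omega>. g (S n \<omega>) \<partial>\<Omega> else 1)"
    by (rule prod.cong) (auto simp: f_def \<Omega>.prob_space)
  then have 2: "(\<Prod>Q\<in>A. \<integral>\<omega>. f Q (S n \<omega>) \<partial>\<Omega>) = (\<integral>\<omega>. g (S n \<omega>) \<partial>\<Omega>)" using prod_pick[OF A] by simp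
  show "(\<integral>\<omega>. indicator {\<omega>. S k \<omega> = A} \<omega> * g (S n (\<omega> \<circ> shift_index L k P)) \<partial>\<Omega>) = \<Omega>.prob {\<omega>. S k \<omega> = A} * (\<integral>\<omega>. g (S n \<omega>) \<partial>\<Omega>)"
    using branch[OF A(1), of k f n] unfolding 1 2 .
  show "integrable \<Omega> (\<lambda>\<omega>. indicator {\<omega>. S k \<omega> = A} \<omega> * g (S n (\<omega> \<circ> shift_index L k P)))"
    using integrable_shift_prod[of k A f n] unfolding 1 .
qed

lemma branch_two:
  fixes g :: "(nat \<times> nat) set \<Rightarrow> real"
  assumes A: "finite A" "P \<in> A" "P' \<in> A" "P \<noteq> P'"
  shows "(\<integral>\<omega>. indicator {\<omega>. S k \<omega> = A} \<omega> * (g (S n (\<omega> \<circ> shift_index L k P)) * g (S n (\<omega> \<circ> shift_index L k P'))) \<partial>\<Omega>)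
       = \<Omega>.prob {\<omega>. S k \<omega> = A} * (\<integral>\<omega>. g (S n \<omega>) \<partial>\<Omega>)\<^sup>2"
    and "integrable \<Omega> (\<lambda>\<omega>. indicator {\<omega>. S k \<omega> = A} \<omega> * (g (S n (\<omega> \<circ> shift_index L k P)) * g (S n (\<omega> \<circ> shift_index L k P'))))"
proof -
  define f where "f Q B = (if Q = P \<or> Q = P' then g B else 1)" for Q :: "nat \<times> nat" and B
  have 1: "(\<Prod>Q\<in>A. f Q (S n (\<omega> \<circ> shift_index L k Q))) = g (S n (\<omega> \<circ> shift_index L k P)) * g (S n (\<omega> \<circ> shift_index L k P'))" for \<omega>
    unfolding f_def by (rule prod_pick2[OF A])
  have "(\<Prod>Q\<in>A. \<integral>\<omega>. f Q (S n \<omega>) \<partial>\<Omega>) = (\<Prod>Q\<in>A. if Q = P \<or> Q = P' then \<integral>\<omega>. g (S n \<omega>) \<partial>\<Omega> else 1)"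
    by (rule prod.cong) (auto simp: f_def \<Omega>.prob_space)
  then have 2: "(\<Prod>Q\<in>A. \<integral>\<omega>. f Q (S n \<omega>) \<partial>\<Omega>) = (\<integral>\<omega>. g (S n \<omega>) \<partial>\<Omega>)\<^sup>2"
    using prod_pick2[OF A] by (simp add: power2_eq_square)
  show "(\<integral>\<omega>. indicator {\<omega>. S k \<omega> = A} \<omega> * (g (S n (\<omega> \<circ> shift_index L k P)) * g (S n (\<omega> \<circ> shift_index L k P'))) \<partial>\<Omega>)
       = \<Omega>.prob {\<omega>. S k \<omega> = A} * (\<integral>\<omega>. g (S n \<omega>) \<partial>\<Omega>)\<^sup>2"
    using branch[OF A(1), of k f n] unfolding 1 2 .
  show "integrable \<Omega> (\<lambda>\<omega>. indicator {\<omega>. S k \<omega> = A} \<omega> * (g (S n (\<omega> \<circ> shift_index L k P)) * g (S n (\<omega> \<circ> shift_index L k P'))))"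
    using integrable_shift_prod[of k A f n] unfolding 1 .
qed

lemma first_moment:
  fixes g :: "(nat \<times> nat) set \<Rightarrow> real"
  shows "(\<integral>\<omega>. (\<Sum>Q\<in>S k \<omega>. g (S n (\<omega> \<circ> shift_index L k Q))) \<partial>\<Omega>) = (\<integral>\<omega>. real (card (S k \<omega>)) \<partial>\<Omega>) * (\<integral>\<omega>. g (S n \<omega>) \<partial>\<Omega>)"
    and "integrable \<Omega> (\<lambda>\<omega>. \<Sum>Q\<in>S k \<omega>. g (S n (\<omega> \<circ> shift_index L k Q)))"
proof -
  let ?P = "Pow (cells (L ^ k))"
  have fin: "finite A" if "A \<in> ?P" for A using that finite_subset finite_cells by blast
  have eq: "(\<Sum>Q\<in>S k \<omega>. g (S n (\<omega> \<circ> shift_index L k Q)))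
     = (\<Sum>A\<in>?P. \<Sum>Q\<in>A. indicator {\<omega>. S k \<omega> = A} \<omega> * g (S n (\<omega> \<circ> shift_index L k Q)))" for \<omega>
    unfolding S_sum_split[of "\<lambda>A \<omega>. \<Sum>Q\<in>A. g (S n (\<omega> \<circ> shift_index L k Q))" k] by (simp add: sum_distrib_left)
  show i: "integrable \<Omega> (\<lambda>\<omega>. \<Sum>Q\<in>S k \<omega>. g (S n (\<omega> \<circ> shift_index L k Q)))"
    unfolding eq by (intro Bochner_Integration.integrable_sum branch_one(2) fin)
  have "(\<integral>\<omega>. (\<Sum>Q\<in>S k \<omega>. g (S n (\<omega> \<circ> shift_index L k Q))) \<partial>\<Omega>)
     = (\<Sum>A\<in>?P. \<Sum>Q\<in>A. \<integral>\<omega>. indicator {\<omega>. S k \<omega> = A} \<omega> * g (S n (\<omega> \<circ> shift_index L k Q)) \<partial>\<Omega>)"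
    unfolding eq
    by (subst Bochner_Integration.integral_sum, (intro Bochner_Integration.integrable_sum branch_one(2) fin; assumption),
        intro sum.cong refl Bochner_Integration.integral_sum branch_one(2) fin)
  also have "\<dots> = (\<Sum>A\<in>?P. \<Sum>Q\<in>A. \<Omega>.prob {\<omega>. S k \<omega> = A} * (\<integral>\<omega>. g (S n \<omega>) \<partial>\<Omega>))"
    by (intro sum.cong refl branch_one(1) fin)
  also have "\<dots> = (\<Sum>A\<in>?P. \<Omega>.prob {\<omega>. S k \<omega> = A} * real (card A)) * (\<integral>\<omega>. g (S n \<omega>) \<partial>\<Omega>)"
    unfolding sum_distrib_right by (intro sum.cong refl) simp
  finally show "(\<integral>\<omega>. (\<Sum>Q\<in>S k \<omega>. g (S n (\<omega> \<circ> shift_index L k Q))) \<partial>\<Omega>) = (\<integral>\<omega>. real (card (S k \<omega>)) \<partial>\<Omega>) * (\<integral>\<omega>. g (S n \<omega>) \<partial>\<Omega>)"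
    unfolding integral_S[of "\<lambda>A. real (card A)"] .
qed

text \<open>The function is centred, so independence of distinct subtrees kills the mixed
  terms.\<close>

lemma second_moment:
  fixes g :: "(nat \<times> nat) set \<Rightarrow> real"
  assumes g: "(\<integral>\<omega>. g (S n \<omega>) \<partial>\<Omega>) = 0"
  shows "(\<integral>\<omega>. (\<Sum>Q\<in>S k \<omega>. g (S n (\<omega> \<circ> shift_index L k Q)))\<^sup>2 \<partial>\<Omega>) = (\<integral>\<omega>. real (card (S k \<omega>)) \<partial>\<Omega>) * (\<integral>\<omega>. (g (S n \<omega>))\<^sup>2 \<partial>\<Omega>)"
    and "integrable \<Omega> (\<lambda>\<omega>. (\<Sum>Q\<in>S k \<omega>. g (S n (\<omega> \<circ> shift_index L k Q)))\<^sup>2)"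
proof -
  let ?P = "Pow (cells (L ^ k))" and ?g = "\<lambda>Q \<omega>. g (S n (\<omega> \<circ> shift_index L k Q))"
  have fin: "finite A" if "A \<in> ?P" for A using that finite_subset finite_cells by blast
  have eq: "(\<Sum>Q\<in>S k \<omega>. ?g Q \<omega>)\<^sup>2
     = (\<Sum>A\<in>?P. \<Sum>Q\<in>A. \<Sum>Q'\<in>A. indicator {\<omega>. S k \<omega> = A} \<omega> * (?g Q \<omega> * ?g Q' \<omega>))" for \<omega>
  proof -
    have "(\<Sum>Q\<in>S k \<omega>. ?g Q \<omega>)\<^sup>2 = (\<Sum>A\<in>?P. indicator {\<omega>. S k \<omega> = A} \<omega> * (\<Sum>Q\<in>A. ?g Q \<omega>)\<^sup>2)"
      by (rule S_sum_split[of "\<lambda>A \<omega>. (\<Sum>Q\<in>A. ?g Q \<omega>)\<^sup>2" k])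
    also have "\<dots> = (\<Sum>A\<in>?P. \<Sum>Q\<in>A. \<Sum>Q'\<in>A. indicator {\<omega>. S k \<omega> = A} \<omega> * (?g Q \<omega> * ?g Q' \<omega>))"
      unfolding power2_eq_square unfolding sum_product unfolding sum_distrib_left ..
    finally show ?thesis .
  qed
  have int: "integrable \<Omega> (\<lambda>\<omega>. indicator {\<omega>. S k \<omega> = A} \<omega> * (?g Q \<omega> * ?g Q' \<omega>))"
    and val: "(\<integral>\<omega>. indicator {\<omega>. S k \<omega> = A} \<omega> * (?g Q \<omega> * ?g Q' \<omega>) \<partial>\<Omega>)
       = (if Q' = Q then \<Omega>.prob {\<omega>. S k \<omega> = A} * (\<integral>\<omega>. (g (S n \<omega>))\<^sup>2 \<partial>\<Omega>) else 0)"
    if "A \<in> ?P" "Q \<in> A" "Q' \<in> A" for A Q Q'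
  proof -
    note fA = fin[OF that(1)]
    show "integrable \<Omega> (\<lambda>\<omega>. indicator {\<omega>. S k \<omega> = A} \<omega> * (?g Q \<omega> * ?g Q' \<omega>))"
      using branch_one(2)[OF fA that(2), of k "\<lambda>B. (g B)\<^sup>2" n] branch_two(2)[OF fA that(2,3), of k g n]
      by (cases "Q = Q'") (auto simp: power2_eq_square)
    show "(\<integral>\<omega>. indicator {\<omega>. S k \<omega> = A} \<omega> * (?g Q \<omega> * ?g Q' \<omega>) \<partial>\<Omega>)
       = (if Q' = Q then \<Omega>.prob {\<omega>. S k \<omega> = A} * (\<integral>\<omega>. (g (S n \<omega>))\<^sup>2 \<partial>\<Omega>) else 0)"
      using branch_one(1)[OF fA that(2), of k "\<lambda>B. (g B)\<^sup>2" n] branch_two(1)[OF fA that(2,3), of k g n] g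
      by (cases "Q' = Q") (auto simp: power2_eq_square)
  qed
  show i: "integrable \<Omega> (\<lambda>\<omega>. (\<Sum>Q\<in>S k \<omega>. ?g Q \<omega>)\<^sup>2)"
    unfolding eq by (intro Bochner_Integration.integrable_sum int)
  have "(\<integral>\<omega>. (\<Sum>Q\<in>S k \<omega>. ?g Q \<omega>)\<^sup>2 \<partial>\<Omega>)
     = (\<Sum>A\<in>?P. \<Sum>Q\<in>A. \<Sum>Q'\<in>A. \<integral>\<omega>. indicator {\<omega>. S k \<omega> = A} \<omega> * (?g Q \<omega> * ?g Q' \<omega>) \<partial>\<Omega>)"
    unfolding eq
    by (subst Bochner_Integration.integral_sum, (intro Bochner_Integration.integrable_sum int; assumption), intro sum.cong refl,
        subst Bochner_Integration.integral_sum, (intro Bochner_Integration.integrable_sum int; assumption), intro sum.cong refl Bochner_Integration.integral_sum int)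
  also have "\<dots> = (\<Sum>A\<in>?P. \<Sum>Q\<in>A. \<Sum>Q'\<in>A. (if Q' = Q then \<Omega>.prob {\<omega>. S k \<omega> = A} * (\<integral>\<omega>. (g (S n \<omega>))\<^sup>2 \<partial>\<Omega>) else 0))"
    by (intro sum.cong refl val)
  also have "\<dots> = (\<Sum>A\<in>?P. \<Sum>Q\<in>A. \<Omega>.prob {\<omega>. S k \<omega> = A} * (\<integral>\<omega>. (g (S n \<omega>))\<^sup>2 \<partial>\<Omega>))"
    using fin by (intro sum.cong refl) (simp add: sum.delta)
  also have "\<dots> = (\<Sum>A\<in>?P. \<Omega>.prob {\<omega>. S k \<omega> = A} * real (card A)) * (\<integral>\<omega>. (g (S n \<omega>))\<^sup>2 \<partial>\<Omega>)"
    unfolding sum_distrib_right by (intro sum.cong refl) simp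
  finally show "(\<integral>\<omega>. (\<Sum>Q\<in>S k \<omega>. ?g Q \<omega>)\<^sup>2 \<partial>\<Omega>) = (\<integral>\<omega>. real (card (S k \<omega>)) \<partial>\<Omega>) * (\<integral>\<omega>. (g (S n \<omega>))\<^sup>2 \<partial>\<Omega>)"
    unfolding integral_S[of "\<lambda>A. real (card A)"] .
qed

lemma card_S_split: "card (S (k + n) \<omega>) = (\<Sum>Q\<in>S k \<omega>. card (S n (\<omega> \<circ> shift_index L k Q)))"
proof -
  have "card (S (k + n) \<omega>) = (\<Sum>Q\<in>S k \<omega>. card (glue L n Q ` S n (\<omega> \<circ> shift_index L k Q)))"
    unfolding S_split
  proof (rule card_UN_disjoint)
    show "\<forall>Q\<in>S k \<omega>. \<forall>Q'\<in>S k \<omega>. Q \<noteq> Q' \<longrightarrow> glue L n Q ` S n (\<omega> \<circ> shift_index L k Q) \<inter> glue L n Q' ` S n (\<omega> \<circ> shift_index L k Q') = {}"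
      using glue_inj S_cells by blast
  qed auto
  also have "\<dots> = (\<Sum>Q\<in>S k \<omega>. card (S n (\<omega> \<circ> shift_index L k Q)))"
    by (intro sum.cong refl card_image inj_onI) (use glue_inj S_cells in blast)
  finally show ?thesis .
qed

lemma expected_card_1: "(\<integral>\<omega>. real (card (S 1 \<omega>)) \<partial>\<Omega>) = real L"
proof -
  have "(\<integral>\<omega>. real (card (S 1 \<omega>)) \<partial>\<Omega>) = EE (\<lambda>F. real (card F))" by (rule integral_S1)
  also have "\<dots> = EE (\<lambda>F. sum (\<lambda>_. 1) F)" by simp
  also have "\<dots> = real L" unfolding EE_sum by simp
  finally show ?thesis .
qed

lemma expected_card: "(\<integral>\<omega>. real (card (S k \<omega>)) \<partial>\<Omega>) = real L ^ k"
proof (induction k)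
  case 0
  then show ?case by (simp add: S_0 \<Omega>.prob_space)
next
  case (Suc k)
  have "(\<integral>\<omega>. real (card (S (k + 1) \<omega>)) \<partial>\<Omega>) = (\<integral>\<omega>. (\<Sum>Q\<in>S k \<omega>. real (card (S 1 (\<omega> \<circ> shift_index L k Q)))) \<partial>\<Omega>)"
    unfolding card_S_split of_nat_sum ..
  also have "\<dots> = real L ^ k * real L" unfolding first_moment(1)[of "\<lambda>A. real (card A)"] Suc expected_card_1 ..
  finally show ?case by simp
qed

definition Zt :: "nat \<Rightarrow> omega \<Rightarrow> real" where
  "Zt k \<omega> = real (card (S k \<omega>)) / real L ^ k"

text \<open>\<open>2 \<bar>y\<bar> \<le> r y\<^sup>2 + 1/r\<close> with \<open>r\<close> the square root of \<open>L ^ k\<close>.\<close>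
lemma abs_le_second_moment:
  assumes "integrable \<Omega> (f :: omega \<Rightarrow> real)" "integrable \<Omega> (\<lambda>\<omega>. (f \<omega>)\<^sup>2)"
    and b: "(\<integral>\<omega>. (f \<omega>)\<^sup>2 \<partial>\<Omega>) \<le> C / real L ^ k"
  shows "(\<integral>\<omega>. \<bar>f \<omega>\<bar> \<partial>\<Omega>) \<le> (C + 1) * (1 / sqrt (real L)) ^ k"
proof -
  define r where "r = sqrt (real L) ^ k"
  have r: "0 < r" "r * r = real L ^ k" by (simp_all add: r_def flip: power_mult_distrib)
  have "0 \<le> (\<integral>\<omega>. (f \<omega>)\<^sup>2 \<partial>\<Omega>)" by (intro Bochner_Integration.integral_nonneg) simp
  then have "0 \<le> C / real L ^ k" using b by linarith
  then have C: "0 \<le> C" using L_pos zero_less_power[OF L_pos(2), of k] by (auto simp: zero_le_divide_iff)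
  have "(\<integral>\<omega>. \<bar>f \<omega>\<bar> \<partial>\<Omega>) \<le> (\<integral>\<omega>. r * (f \<omega>)\<^sup>2 + 1 / r \<partial>\<Omega>)"
  proof (rule integral_mono)
    fix \<omega>
    define y where "y = \<bar>f \<omega>\<bar>"
    have "0 \<le> (r * y - 1)\<^sup>2 / r" using r by simp
    also have "\<dots> = r * y\<^sup>2 + 1 / r - 2 * y" using r by (simp add: power2_eq_square field_simps)
    finally have "y \<le> r * y\<^sup>2 + 1 / r" using abs_ge_zero[of "f \<omega>"] unfolding y_def by linarith
    then show "\<bar>f \<omega>\<bar> \<le> r * (f \<omega>)\<^sup>2 + 1 / r" by (simp add: y_def)
  qed (use assms in auto)
  also have "\<dots> = r * (\<integral>\<omega>. (f \<omega>)\<^sup>2 \<partial>\<Omega>) + 1 / r" using assms by (simp add: \<Omega>.prob_space)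
  also have "\<dots> \<le> r * (C / (r * r)) + 1 / r" using b r by (intro add_right_mono mult_left_mono) auto
  also have "\<dots> = (C + 1) / r" using r(1) by (simp add: add_divide_distrib)
  also have "\<dots> = (C + 1) * (1 / sqrt (real L)) ^ k" by (simp add: r_def power_divide)
  finally show ?thesis .
qed

lemma root_lt_1: "1 / sqrt (real L) < 1" "0 < 1 / sqrt (real L)"
proof -
  have "1 < sqrt (real L)" using L2 by simp
  then show "1 / sqrt (real L) < 1" by simp
qed simp

text \<open>The increments are normalised sums of centred offspring numbers. Their second moments
  are of order \<open>L ^ (-k)\<close>, so their absolute values are summable in mean and hence
  almost surely.\<close>

lemma Zt_converges: "AE \<omega> in \<Omega>. convergent (\<lambda>k. Zt k \<omega>)"
proof -
  define d where "d k \<omega> = Zt (Suc k) \<omega> - Zt k \<omega>" for k \<omega>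
  define g where "g A = real (card A) - real L" for A :: "(nat \<times> nat) set"
  have g0: "(\<integral>\<omega>. g (S 1 \<omega>) \<partial>\<Omega>) = 0"
    unfolding g_def using expected_card_1 integrable_fS[of "\<lambda>A. real (card A)" 1] by (simp add: \<Omega>.prob_space)
  have dg: "d k \<omega> = (\<Sum>Q\<in>S k \<omega>. g (S 1 (\<omega> \<circ> shift_index L k Q))) / real L ^ Suc k" for k \<omega>
  proof -
    have "real (card (S (k + 1) \<omega>)) - real L * real (card (S k \<omega>)) = (\<Sum>Q\<in>S k \<omega>. g (S 1 (\<omega> \<circ> shift_index L k Q)))"
      unfolding card_S_split by (simp add: g_def sum_subtractf)
    then show ?thesis by (simp add: d_def Zt_def field_simps)
  qed
  have g2: "(\<integral>\<omega>. (g (S 1 \<omega>))\<^sup>2 \<partial>\<Omega>) \<le> real L ^ 4"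
  proof -
    have "(g A)\<^sup>2 \<le> (real L * real L)\<^sup>2" if "A \<subseteq> cells (L ^ 1)" for A
    proof -
      have "card A \<le> card (cells (L ^ 1))" using that by (intro card_mono) auto
      then have "real (card A) \<le> real L * real L" by (simp flip: of_nat_mult)
      moreover have "real L \<le> real L * real L" using L2 by simp
      moreover have "0 \<le> real (card A)" by simp
      ultimately have "\<bar>g A\<bar> \<le> real L * real L" unfolding g_def abs_le_iff using L_pos(2) by linarith
      then have "\<bar>g A\<bar>\<^sup>2 \<le> (real L * real L)\<^sup>2" by (intro power_mono) auto
      then show ?thesis by simp
    qed
    from this[OF S_cells] have "(\<integral>\<omega>. (g (S 1 \<omega>))\<^sup>2 \<partial>\<Omega>) \<le> (\<integral>\<omega>. (real L * real L)\<^sup>2 \<partial>\<Omega>)"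
      using integrable_fS[of "\<lambda>A. (g A)\<^sup>2"] by (intro integral_mono) auto
    then show ?thesis by (simp add: \<Omega>.prob_space power2_eq_square power4_eq_xxxx)
  qed
  have int: "integrable \<Omega> (d k)" "integrable \<Omega> (\<lambda>\<omega>. (d k \<omega>)\<^sup>2)" for k
    unfolding dg[abs_def] power_divide using first_moment(2)[where k=k and g=g and n=1] second_moment(2)[OF g0, where k=k] by auto
  have "(\<integral>\<omega>. \<bar>d k \<omega>\<bar> \<partial>\<Omega>) \<le> (real L ^ 4 + 1) * (1 / sqrt (real L)) ^ k" for k
  proof (rule abs_le_second_moment[OF int])
    have "(\<integral>\<omega>. (d k \<omega>)\<^sup>2 \<partial>\<Omega>) = real L ^ k * (\<integral>\<omega>. (g (S 1 \<omega>))\<^sup>2 \<partial>\<Omega>) / (real L ^ Suc k)\<^sup>2"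
      unfolding dg power_divide using second_moment(1)[OF g0, where k=k] by (simp add: expected_card)
    also have "\<dots> \<le> real L ^ k * real L ^ 4 / (real L ^ k)\<^sup>2"
      using g2 L2 by (intro frac_le mult_left_mono power_mono power_increasing) auto
    also have "\<dots> = real L ^ 4 / real L ^ k" by (simp add: power2_eq_square)
    finally show "(\<integral>\<omega>. (d k \<omega>)\<^sup>2 \<partial>\<Omega>) \<le> real L ^ 4 / real L ^ k" .
  qed
  then have "summable (\<lambda>k. \<integral>\<omega>. \<bar>d k \<omega>\<bar> \<partial>\<Omega>)"
    using root_lt_1 by (intro summable_comparison_test'[OF summable_mult[OF summable_geometric]]) auto
  then have "AE \<omega> in \<Omega>. summable (\<lambda>k. \<bar>d k \<omega>\<bar>)" by (intro AE_summable_of_summable_integrals int)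
  then show ?thesis
  proof eventually_elim
    case (elim \<omega>)
    then have "summable (\<lambda>k. d k \<omega>)" by (rule summable_rabs_cancel)
    then have "convergent (\<lambda>n. \<Sum>k<n. d k \<omega>)" by (simp add: summable_iff_convergent)
    moreover have "(\<Sum>k<n. d k \<omega>) = Zt n \<omega> - Zt 0 \<omega>" for n
      unfolding d_def by (rule sum_lessThan_telescope)
    ultimately have "convergent (\<lambda>n. Zt n \<omega> - Zt 0 \<omega>)" by simp
    then show ?case by (subst (asm) convergent_diff_const_right_iff)
  qed
qed

text \<open>The bridge between the random sets and the recursion: the indicator of missing the next
  generation is the product of the indicators of missing each copy, and \<open>branch_prod\<close>
  takes the expectation factorwise.\<close>

lemma integral_PR: "(\<integral>\<omega>. indicator (PR \<theta> n (S n \<omega>)) t \<partial>\<Omega>) = (hit \<theta> ^^ n) (indicator (shadow (cos \<theta>) (sin \<theta>))) t"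
proof (induction n arbitrary: t)
  case 0
  have "PR \<theta> 0 (S 0 \<omega>) = shadow (cos \<theta>) (sin \<theta>)" for \<omega> by (auto simp: PR_def S_0 sh_eq)
  then show ?case by (simp add: \<Omega>.prob_space)
next
  case (Suc n)
  let ?i = "\<lambda>A t. indicator (PR \<theta> n A) t :: real"
  have "indicator (PR \<theta> (1 + n) (S (1 + n) \<omega>)) t = 1 - (\<Prod>Q\<in>S 1 \<omega>. 1 - ?i (S n (\<omega> \<circ> shift_index L 1 Q)) (real L * t - sh \<theta> Q))" for \<omega>
  proof (cases "t \<in> PR \<theta> (1 + n) (S (1 + n) \<omega>)")
    case True
    then obtain Q where "Q \<in> S 1 \<omega>" "real L * t - sh \<theta> Q \<in> PR \<theta> n (S n (\<omega> \<circ> shift_index L 1 Q))"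
      unfolding S_split PR_glue by auto
    then have "(\<Prod>Q\<in>S 1 \<omega>. 1 - ?i (S n (\<omega> \<circ> shift_index L 1 Q)) (real L * t - sh \<theta> Q)) = 0"
      by (intro prod_zero bexI[of _ Q]) auto
    then show ?thesis using True by simp
  next
    case False
    then have "\<forall>Q\<in>S 1 \<omega>. real L * t - sh \<theta> Q \<notin> PR \<theta> n (S n (\<omega> \<circ> shift_index L 1 Q))"
      unfolding S_split PR_glue by auto
    then have "(\<Prod>Q\<in>S 1 \<omega>. 1 - ?i (S n (\<omega> \<circ> shift_index L 1 Q)) (real L * t - sh \<theta> Q)) = 1"
      by (intro prod.neutral) auto
    then show ?thesis using False by simp
  qed
  then have e: "indicator (PR \<theta> (Suc n) (S (Suc n) \<omega>)) t = 1 - (\<Prod>Q\<in>S 1 \<omega>. 1 - ?i (S n (\<omega> \<circ> shift_index L 1 Q)) (real L * t - sh \<theta> Q))" for \<omega>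
    by simp
  have int: "integrable \<Omega> (\<lambda>\<omega>. \<Prod>Q\<in>S 1 \<omega>. 1 - ?i (S n (\<omega> \<circ> shift_index L 1 Q)) (real L * t - sh \<theta> Q))"
  proof -
    have "integrable \<Omega> (\<lambda>\<omega>. 1 - indicator (PR \<theta> (Suc n) (S (Suc n) \<omega>)) t :: real)"
      using integrable_fS[of "\<lambda>A. indicator (PR \<theta> (Suc n) A) t" "Suc n"] by simp
    then show ?thesis unfolding e by simp
  qed
  have "(\<integral>\<omega>. indicator (PR \<theta> (Suc n) (S (Suc n) \<omega>)) t \<partial>\<Omega>)
     = 1 - (\<integral>\<omega>. (\<Prod>Q\<in>S 1 \<omega>. 1 - ?i (S n (\<omega> \<circ> shift_index L 1 Q)) (real L * t - sh \<theta> Q)) \<partial>\<Omega>)"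
    unfolding e using int by (simp add: \<Omega>.prob_space)
  also have "(\<integral>\<omega>. (\<Prod>Q\<in>S 1 \<omega>. 1 - ?i (S n (\<omega> \<circ> shift_index L 1 Q)) (real L * t - sh \<theta> Q)) \<partial>\<Omega>)
     = (\<integral>\<omega>. (\<Prod>Q\<in>S 1 \<omega>. \<integral>\<omega>. 1 - ?i (S n \<omega>) (real L * t - sh \<theta> Q) \<partial>\<Omega>) \<partial>\<Omega>)"
    by (rule branch_prod[where f="\<lambda>Q B. 1 - ?i B (real L * t - sh \<theta> Q)"])
  also have "\<dots> = EE (\<lambda>F. \<Prod>Q\<in>F. \<integral>\<omega>. 1 - ?i (S n \<omega>) (real L * t - sh \<theta> Q) \<partial>\<Omega>)"
    by (rule integral_S1)
  also have "(\<lambda>Q. \<integral>\<omega>. 1 - ?i (S n \<omega>) (real L * t - sh \<theta> Q) \<partial>\<Omega>)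
     = (\<lambda>Q. 1 - (hit \<theta> ^^ n) (indicator (shadow (cos \<theta>) (sin \<theta>))) (real L * t - sh \<theta> Q))"
  proof
    fix Q
    show "(\<integral>\<omega>. 1 - ?i (S n \<omega>) (real L * t - sh \<theta> Q) \<partial>\<Omega>) = 1 - (hit \<theta> ^^ n) (indicator (shadow (cos \<theta>) (sin \<theta>))) (real L * t - sh \<theta> Q)"
      unfolding Suc[symmetric] using integrable_fS[of "\<lambda>A. ?i A (real L * t - sh \<theta> Q)" n] by (simp add: \<Omega>.prob_space)
  qed
  finally show ?case by (simp add: hit_def[of \<theta> "(hit \<theta> ^^ n) (indicator (shadow (cos \<theta>) (sin \<theta>)))"] hit_prob_def)
qed

end

section \<open>Expected Favard length\<close>

text \<open>Both sides are \<open>0\<close> if \<open>g\<close> is not integrable.\<close>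
lemma integral_eq_lborel:
  fixes g :: "real \<Rightarrow> real"
  assumes g[measurable]: "g \<in> borel_measurable borel" and nn: "\<And>x. 0 \<le> g x"
  shows "integral {a..b} g = (\<integral>x. indicator {a..b} x * g x \<partial>lborel)"
proof (cases "integrable lborel (\<lambda>x. indicator {a..b} x * g x)")
  case True
  then have "set_integrable lborel {a..b} g" by (simp add: set_integrable_def)
  from set_borel_integral_eq_integral(2)[OF this] show ?thesis by (simp add: set_lebesgue_integral_def)
next
  case False
  have "\<not> g integrable_on {a..b}"
  proof
    assume "g integrable_on {a..b}"
    then have "g absolutely_integrable_on {a..b}" by (rule nonnegative_absolutely_integrable_1) (rule nn)
    then have "integrable lebesgue (\<lambda>x. indicator {a..b} x * g x)" by (simp add: set_integrable_def)
    then have "integrable lborel (\<lambda>x. indicator {a..b} x * g x)" by (subst (asm) integrable_completion) auto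
    with False show False by simp
  qed
  then show ?thesis using False by (simp add: not_integrable_integral not_integrable_integral_eq)
qed

lemma integrable_on_bounded_borel:
  fixes g :: "real \<Rightarrow> real"
  assumes g[measurable]: "g \<in> borel_measurable borel" and B: "\<And>x. \<bar>g x\<bar> \<le> B"
  shows "g integrable_on {a..b}"
proof -
  have "integrable lborel (\<lambda>x. indicator {a..b} x *\<^sub>R g x)"
  proof (rule Bochner_Integration.integrable_bound)
    show "integrable lborel (\<lambda>x. B * indicator {a..b} x)"
      by (intro Bochner_Integration.integrable_mult_right integrable_real_indicator) (auto simp: emeasure_lborel_Icc_eq)
    show "AE x in lborel. norm (indicator {a..b} x *\<^sub>R g x) \<le> norm (B * indicator {a..b} x :: real)"
      using order_trans[OF B abs_ge_self] by (auto simp: indicator_def)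
  qed measurable
  then have "set_integrable lborel {a..b} g" by (simp add: set_integrable_def)
  then show ?thesis by (rule set_borel_integral_eq_integral(1))
qed

lemma tendsto_integral_uniform_limit:
  fixes f :: "nat \<Rightarrow> real \<Rightarrow> real"
  assumes int: "\<And>n. f n integrable_on {a..b}" and u: "uniform_limit {a..b} f g sequentially" and ab: "a < b"
  shows "(\<lambda>n. integral {a..b} (f n)) \<longlonglongrightarrow> integral {a..b} g"
proof -
  have ev: "\<forall>\<^sub>F n in sequentially. \<forall>x\<in>{a..b}. \<bar>f n x - g x\<bar> < e" if "0 < e" for e
    using uniform_limitD[OF u that] by (simp add: dist_real_def)
  have gi: "g integrable_on {a..b}"
    unfolding interval_cbox
  proof (rule integrable_uniform_limit)
    fix e :: real assume "0 < e"
    from ev[OF this] obtain n where "\<forall>x\<in>{a..b}. \<bar>f n x - g x\<bar> < e" by (auto simp: eventually_sequentially)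
    then show "\<exists>h. (\<forall>x\<in>cbox a b. norm (g x - h x) \<le> e) \<and> h integrable_on cbox a b"
      using int[of n] by (intro exI[of _ "f n"]) (auto simp: abs_minus_commute intro: less_imp_le)
  qed
  show ?thesis
  proof (rule tendstoI)
    fix e :: real assume e: "0 < e"
    define d where "d = e / (2 * (b - a))"
    have d: "0 < d" "d * (b - a) < e" using e ab by (simp_all add: d_def field_simps)
    show "\<forall>\<^sub>F n in sequentially. dist (integral {a..b} (f n)) (integral {a..b} g) < e"
      using ev[OF d(1)]
    proof eventually_elim
      case (elim n)
      have "\<bar>integral {a..b} (f n) - integral {a..b} g\<bar> = norm (integral {a..b} (\<lambda>x. f n x - g x))"
        by (simp add: Henstock_Kurzweil_Integration.integral_diff[OF int gi])
      also have "\<dots> \<le> integral {a..b} (\<lambda>x. d)"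
        using elim by (intro integral_norm_bound_integral Henstock_Kurzweil_Integration.integrable_diff int gi) (auto intro: less_imp_le)
      also have "\<dots> = d * (b - a)" using ab by simp
      finally show ?case using d by (simp add: dist_real_def)
    qed
  qed
qed

text \<open>\<open>r n\<close> below is the integer part of the fourth root of \<open>n\<close>.
  Monotonicity sandwiches \<open>f n\<close> between its values at the neighbouring fourth powers,
  whose ratio tends to 1.\<close>

lemma tendsto_along_fourth_powers:
  fixes f :: "nat \<Rightarrow> real"
  assumes nn: "\<And>n. 0 \<le> f n" and dec: "\<And>n. f (Suc n) \<le> f n" and l: "(\<lambda>m. real m ^ 4 * f (m ^ 4)) \<longlonglongrightarrow> l"
  shows "(\<lambda>n. real n * f n) \<longlonglongrightarrow> l"
proof -
  have mono: "f b \<le> f a" if "a \<le> b" for a b using lift_Suc_antimono_le[of f, OF dec that] .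
  have "\<exists>m. m ^ 4 \<le> n \<and> n < (Suc m) ^ 4" for n :: nat
  proof (induction n)
    case 0
    show ?case by (rule exI[of _ 0]) simp
  next
    case (Suc n)
    then obtain m where m: "m ^ 4 \<le> n" "n < Suc m ^ 4" by blast
    show ?case
    proof (cases "Suc n < Suc m ^ 4")
      case True
      with m show ?thesis by (intro exI[of _ m]) auto
    next
      case False
      then have "Suc n = Suc m ^ 4" using m by simp
      moreover have "Suc m ^ 4 < Suc (Suc m) ^ 4" by (intro power_strict_mono) auto
      ultimately show ?thesis by (intro exI[of _ "Suc m"]) auto
    qed
  qed
  then obtain r where r: "\<And>n. r n ^ 4 \<le> n" "\<And>n. n < Suc (r n) ^ 4" by metis
  have rt: "filterlim r at_top sequentially"
    unfolding filterlim_at_top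
  proof
    fix Z
    show "\<forall>\<^sub>F n in sequentially. Z \<le> r n"
      using eventually_ge_at_top[of "Z ^ 4"]
    proof eventually_elim
      case (elim n)
      then have "Z ^ 4 < Suc (r n) ^ 4" using r(2)[of n] by simp
      then have "Z < Suc (r n)" by (rule power_less_imp_less_base) simp
      then show ?case by simp
    qed
  qed
  have q1: "(\<lambda>m::nat. (real (Suc m) / real m) ^ 4) \<longlonglongrightarrow> 1" by real_asymp
  have q2: "(\<lambda>m::nat. (real m / real (Suc m)) ^ 4) \<longlonglongrightarrow> 1" by real_asymp
  have l': "(\<lambda>m. real (Suc m) ^ 4 * f (Suc m ^ 4)) \<longlonglongrightarrow> l"
    using LIMSEQ_Suc[OF l] .
  have up: "(\<lambda>n. (real (Suc (r n)) / real (r n)) ^ 4 * (real (r n) ^ 4 * f (r n ^ 4))) \<longlonglongrightarrow> 1 * l"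
    by (intro tendsto_mult filterlim_compose[OF q1 rt] filterlim_compose[OF l rt])
  have lo: "(\<lambda>n. (real (r n) / real (Suc (r n))) ^ 4 * (real (Suc (r n)) ^ 4 * f (Suc (r n) ^ 4))) \<longlonglongrightarrow> 1 * l"
    by (intro tendsto_mult filterlim_compose[OF q2 rt] filterlim_compose[OF l' rt])
  have rpos: "\<forall>\<^sub>F n in sequentially. 1 \<le> r n" using rt unfolding filterlim_at_top by blast
  have pw: "real k ^ 4 = real (k ^ 4)" for k by simp
  show ?thesis
  proof (rule tendsto_sandwich)
    show "\<forall>\<^sub>F n in sequentially. real n * f n \<le> (real (Suc (r n)) / real (r n)) ^ 4 * (real (r n) ^ 4 * f (r n ^ 4))"
      using rpos
    proof eventually_elim
      case (elim n)
      have "real n * f n \<le> real (Suc (r n) ^ 4) * f (r n ^ 4)"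
        using r[of n] nn by (intro mult_mono mono) (simp_all only: of_nat_le_iff less_imp_le of_nat_0_le_iff)
      also have "\<dots> = (real (Suc (r n)) / real (r n)) ^ 4 * (real (r n) ^ 4 * f (r n ^ 4))"
        using elim by (simp add: power_divide)
      finally show ?case .
    qed
    show "\<forall>\<^sub>F n in sequentially. (real (r n) / real (Suc (r n))) ^ 4 * (real (Suc (r n)) ^ 4 * f (Suc (r n) ^ 4)) \<le> real n * f n"
    proof (rule always_eventually, rule allI)
      fix n
      have "(real (r n) / real (Suc (r n))) ^ 4 * (real (Suc (r n)) ^ 4 * f (Suc (r n) ^ 4)) = real (r n ^ 4) * f (Suc (r n) ^ 4)"
        by (simp add: power_divide del: of_nat_Suc)
      also have "\<dots> \<le> real n * f n"
        using r[of n] nn by (intro mult_mono mono) (simp_all only: of_nat_le_iff less_imp_le of_nat_0_le_iff)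
      finally show "(real (r n) / real (Suc (r n))) ^ 4 * (real (Suc (r n)) ^ 4 * f (Suc (r n) ^ 4)) \<le> real n * f n" .
    qed
  qed (use up lo in auto)
qed

lemma shadow_zoom_out:
  assumes L: "0 < L" and Q: "Q \<in> cells L" and t: "real L * t - sh \<theta> Q \<in> shadow (cos \<theta>) (sin \<theta>)"
  shows "t \<in> shadow (cos \<theta>) (sin \<theta>)"
proof -
  have L0: "0 < real L" using L by simp
  obtain x y where xy: "0 \<le> x" "x \<le> 1" "0 \<le> y" "y \<le> 1"
    and r: "real L * t - sh \<theta> Q = - sin \<theta> * x + cos \<theta> * y" using t unfolding shadow_iff by blast
  define u where "u = (real (fst Q) + x) / real L"
  define v where "v = (real (snd Q) + y) / real L"
  have uv: "real L * u = real (fst Q) + x" "real L * v = real (snd Q) + y" using L0 by (simp_all add: u_def v_def)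
  have "real L * (- sin \<theta> * u + cos \<theta> * v) = - sin \<theta> * (real L * u) + cos \<theta> * (real L * v)"
    by (simp add: algebra_simps)
  also have "\<dots> = real L * t" using r unfolding uv by (simp add: sh_eq proj_def algebra_simps)
  finally have te: "t = - sin \<theta> * u + cos \<theta> * v" using L0 by simp
  have "fst Q + 1 \<le> L" "snd Q + 1 \<le> L" using Q by (auto simp: cells_def)
  then have "real (fst Q) + 1 \<le> real L" "real (snd Q) + 1 \<le> real L" by (metis of_nat_1 of_nat_add of_nat_le_iff)+
  then have "0 \<le> u" "u \<le> 1" "0 \<le> v" "v \<le> 1" using xy L0 by (auto simp: u_def v_def)
  then show ?thesis unfolding shadow_iff using te by blast
qed

context uniform_grid
begin

section \<open>Measurability and means of projection lengths\<close>

definition pm :: "real \<Rightarrow> nat \<Rightarrow> (nat \<times> nat) set \<Rightarrow> real" where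
  "pm \<theta> n A = measure lborel (PR \<theta> n A)"

lemma measure_proj: "measure lebesgue (proj \<theta> ` Sset L \<omega> n) = pm \<theta> n (Sq L \<omega> n)"
  unfolding PR_Sset pm_def by (rule measure_completion) simp

text \<open>The theorem speaks of \<open>Sq\<close> itself, which outside a null set may be any set
  of indices, so measurability has to come from the events \<open>Q \<in> A x\<close>. Jointness in
  the direction makes the Favard length measurable in the sample.\<close>

lemma pm_measurable_pair:
  assumes A: "\<And>Q. {x \<in> space N. Q \<in> A x} \<in> sets N"
  shows "(\<lambda>(x, \<theta>). pm \<theta> n (A x)) \<in> borel_measurable (N \<Otimes>\<^sub>M borel)"
proof -
  let ?M = "(N \<Otimes>\<^sub>M (borel :: real measure)) \<Otimes>\<^sub>M (lborel :: real measure)"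
  have "Measurable.pred N (\<lambda>x. Q \<in> A x)" for Q using A unfolding pred_def .
  from measurable_compose[OF measurable_compose[OF measurable_fst measurable_fst] this]
  have 1[measurable]: "Measurable.pred ?M (\<lambda>z. Q \<in> A (fst (fst z)))" for Q .
  have 2[measurable]: "(\<lambda>z. snd (fst z)) \<in> borel_measurable ?M" "snd \<in> borel_measurable ?M" by measurable
  have 3[measurable]: "(\<lambda>z. real L ^ n * snd z - sh (snd (fst z)) Q) \<in> borel_measurable ?M" for Q
    unfolding sh_eq proj_def by measurable
  have 4[measurable]: "Measurable.pred ?M (\<lambda>z. real L ^ n * snd z - sh (snd (fst z)) Q \<in> shadow (cos (snd (fst z))) (sin (snd (fst z))))" for Q
  proof -
    have a: "(\<lambda>z. cos (snd (fst z))) \<in> borel_measurable ?M" "(\<lambda>z. - sin (snd (fst z))) \<in> borel_measurable ?M"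
      by measurable
    have b: "(\<lambda>z. min 0 (cos (snd (fst z))) + min 0 (- sin (snd (fst z)))) \<in> borel_measurable ?M"
      "(\<lambda>z. max 0 (cos (snd (fst z))) + max 0 (- sin (snd (fst z)))) \<in> borel_measurable ?M"
      by (intro borel_measurable_add borel_measurable_min borel_measurable_max borel_measurable_const a)+
    show ?thesis unfolding shadow_def atLeastAtMost_iff
      by (intro pred_intros_logic; unfold pred_def; intro borel_measurable_le b 3)
  qed
  have 5: "Measurable.pred ?M (\<lambda>z. Q \<in> A (fst (fst z)) \<and>
      real L ^ n * snd z - sh (snd (fst z)) Q \<in> shadow (cos (snd (fst z))) (sin (snd (fst z))))" for Q
    using sets.sets_Collect_conj[OF 4[of Q, unfolded pred_def] 1[of Q, unfolded pred_def]] unfolding pred_def .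
  have "Measurable.pred ?M (\<lambda>z. \<exists>Q. Q \<in> A (fst (fst z)) \<and>
      real L ^ n * snd z - sh (snd (fst z)) Q \<in> shadow (cos (snd (fst z))) (sin (snd (fst z))))" (is "Measurable.pred _ ?P")
    by (rule pred_intros_countable(2)) (rule 5)
  then have "{z \<in> space ?M. ?P z} \<in> sets ?M" (is "?E \<in> _") unfolding pred_def .
  then have "(\<lambda>x. emeasure lborel (Pair x -` ?E)) \<in> borel_measurable (N \<Otimes>\<^sub>M borel)"
    by (rule lborel.measurable_emeasure_Pair)
  then have "(\<lambda>x. enn2real (emeasure lborel (Pair x -` ?E))) \<in> borel_measurable (N \<Otimes>\<^sub>M borel)" by measurable
  moreover have "enn2real (emeasure lborel (Pair x -` ?E)) = (\<lambda>(x, \<theta>). pm \<theta> n (A x)) x" if "x \<in> space (N \<Otimes>\<^sub>M borel)" for x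
  proof -
    obtain y \<theta> where x: "x = (y, \<theta>)" by (cases x)
    have "Pair x -` ?E = PR \<theta> n (A y)" using that by (auto simp: x PR_def space_pair_measure)
    then show ?thesis by (simp add: x pm_def measure_def)
  qed
  ultimately show ?thesis by (rule iffD1[OF measurable_cong, rotated])
qed

lemma pm_measurable[measurable]: "(\<lambda>\<theta>. pm \<theta> n A) \<in> borel_measurable borel"
proof -
  have "(\<lambda>(x :: unit, \<theta>). pm \<theta> n A) \<in> borel_measurable (count_space UNIV \<Otimes>\<^sub>M borel)"
    by (rule pm_measurable_pair) simp
  from measurable_compose[OF measurable_Pair1' this, of "()"] show ?thesis by simp
qed

lemma PR_fmeasurable: assumes "A \<subseteq> cells (L ^ n)" shows "PR \<theta> n A \<in> fmeasurable lborel"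
proof (rule fmeasurableI2)
  show "{- 2..2 :: real} \<in> fmeasurable lborel" by (rule fmeasurableI) (auto simp: emeasure_lborel_Icc_eq)
  show "PR \<theta> n A \<subseteq> {- 2..2}" using PR_bounded[OF assms] by auto
qed simp

lemma pm_nonneg: "0 \<le> pm \<theta> n A" by (simp add: pm_def)

lemma pm_le: assumes "A \<subseteq> cells (L ^ n)" shows "pm \<theta> n A \<le> 4"
proof -
  have "pm \<theta> n A \<le> measure lborel {- 2..2 :: real}" unfolding pm_def
    by (rule measure_mono_fmeasurable) (use PR_bounded[OF assms] in \<open>auto intro!: fmeasurableI simp: emeasure_lborel_Icc_eq\<close>)
  then show ?thesis by simp
qed

definition AP :: "real \<Rightarrow> nat \<Rightarrow> real" where
  "AP \<theta> n = (\<integral>\<omega>. pm \<theta> n (S n \<omega>) \<partial>\<Omega>)"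

lemma AP_eq: "AP \<theta> n = (\<integral>t. (hit \<theta> ^^ n) (indicator (shadow (cos \<theta>) (sin \<theta>))) t \<partial>lborel)"
proof -
  let ?P = "Pow (cells (L ^ n))"
  have int: "integrable lborel (\<lambda>t. indicator (PR \<theta> n A) t :: real)" if "A \<in> ?P" for A
    using PR_fmeasurable[of A n \<theta>] that by (intro integrable_real_indicator) (auto simp: fmeasurable_def)
  have "(\<integral>t. (hit \<theta> ^^ n) (indicator (shadow (cos \<theta>) (sin \<theta>))) t \<partial>lborel)
     = (\<integral>t. (\<Sum>A\<in>?P. \<Omega>.prob {\<omega>. S n \<omega> = A} * indicator (PR \<theta> n A) t) \<partial>lborel)"
    unfolding integral_PR[symmetric] integral_S[of "\<lambda>A. indicator (PR \<theta> n A) _"] ..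
  also have "\<dots> = (\<Sum>A\<in>?P. \<Omega>.prob {\<omega>. S n \<omega> = A} * pm \<theta> n A)"
    using int by (subst Bochner_Integration.integral_sum) (auto simp: pm_def)
  finally show ?thesis unfolding AP_def integral_S[of "\<lambda>A. pm \<theta> n A"] ..
qed

definition FavS :: "nat \<Rightarrow> (nat \<times> nat) set \<Rightarrow> real" where
  "FavS n A = integral {0..pi} (\<lambda>\<theta>. pm \<theta> n A)"

lemma Fav_Sset: "Fav (Sset L \<omega> n) = FavS n (Sq L \<omega> n)"
  by (simp add: Fav_def FavS_def measure_proj)

lemma pm_integrable: assumes "A \<subseteq> cells (L ^ n)" shows "(\<lambda>\<theta>. pm \<theta> n A) integrable_on {0..pi}"
  using pm_le[OF assms] by (intro integrable_on_bounded_borel[where B=4]) (auto simp: pm_nonneg)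

lemma integral_nonneg':
  fixes g :: "real \<Rightarrow> real"
  assumes "\<And>x. 0 \<le> g x" shows "0 \<le> integral {a..b} g"
proof (cases "g integrable_on {a..b}")
  case True
  then show ?thesis by (rule Henstock_Kurzweil_Integration.integral_nonneg) (rule assms)
qed (simp add: not_integrable_integral)

lemma FavS_nonneg: "0 \<le> FavS n A"
  unfolding FavS_def by (rule integral_nonneg'; simp add: pm_nonneg)

lemma FavS_le: assumes "A \<subseteq> cells (L ^ n)" shows "FavS n A \<le> 4 * pi"
proof -
  have "FavS n A \<le> integral {0..pi} (\<lambda>\<theta>. 4 :: real)" unfolding FavS_def
    using pm_le[OF assms] by (intro integral_le pm_integrable[OF assms]) auto
  then show ?thesis by simp
qed

definition FA :: "nat \<Rightarrow> real" where
  "FA n = (\<integral>\<omega>. FavS n (S n \<omega>) \<partial>\<Omega>)"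

lemma FA_bounds: "0 \<le> FA n" "FA n \<le> 4 * pi"
proof -
  show "0 \<le> FA n" unfolding FA_def by (intro Bochner_Integration.integral_nonneg FavS_nonneg)
  have "FA n \<le> (\<integral>\<omega>. 4 * pi \<partial>\<Omega>)" unfolding FA_def by (intro integral_mono FavS_le S_cells integrable_fS \<Omega>.integrable_const)
  then show "FA n \<le> 4 * pi" by simp
qed


lemma AP_sum: "AP \<theta> n = (\<Sum>A\<in>Pow (cells (L ^ n)). \<Omega>.prob {\<omega>. S n \<omega> = A} * pm \<theta> n A)"
  unfolding AP_def by (rule integral_S[of "\<lambda>A. pm \<theta> n A"])

lemma AP_integrable: "(\<lambda>\<theta>. AP \<theta> n) integrable_on {0..pi}"
  unfolding AP_sum by (intro Henstock_Kurzweil_Integration.integrable_sum integrable_on_mult_right pm_integrable) auto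

lemma FA_eq: "FA n = integral {0..pi} (\<lambda>\<theta>. AP \<theta> n)"
  unfolding FA_def integral_S[of "FavS n"] unfolding AP_sum FavS_def
  by (subst Henstock_Kurzweil_Integration.integral_sum) (auto intro!: integrable_on_mult_right pm_integrable)

lemma Sq_event: "{\<omega> \<in> space \<Omega>. Q \<in> Sq L \<omega> n} \<in> sets \<Omega>"
proof (induction n arbitrary: Q)
  case 0
  then show ?case by (cases "Q = (0, 0)") (auto simp flip: space_\<Omega>)
next
  case (Suc n)
  have rv: "{\<omega> \<in> space \<Omega>. P \<in> \<omega> x} \<in> sets \<Omega>" for P x
  proof -
    have "(\<lambda>\<omega>. \<omega> x) \<in> measurable \<Omega> (measure_pmf X)"
      unfolding sample_space_def by (rule measurable_component_singleton) simp
    from measurable_sets[OF this, of "{F. P \<in> F}"] show ?thesis by (simp add: vimage_def)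
  qed
  have "{\<omega> \<in> space \<Omega>. Q \<in> Sq L \<omega> (Suc n)}
     = (\<Union>R. \<Union>P\<in>{P. Q = glue L 1 R P}. {\<omega> \<in> space \<Omega>. R \<in> Sq L \<omega> n} \<inter> {\<omega> \<in> space \<Omega>. P \<in> \<omega> (n, R)})"
    by (auto simp: Sq_Suc_iff)
  also have "\<dots> \<in> sets \<Omega>"
    by (intro sets.countable_UN'' countableI_type sets.Int Suc rv)
  finally show ?case .
qed

lemma pm_Sq_measurable: "(\<lambda>\<omega>. pm \<theta> n (Sq L \<omega> n)) \<in> borel_measurable \<Omega>"
proof -
  have "(\<lambda>\<omega>. (\<omega>, \<theta>)) \<in> measurable \<Omega> (\<Omega> \<Otimes>\<^sub>M borel)" by measurable
  from measurable_compose[OF this pm_measurable_pair[OF Sq_event]] show ?thesis by simp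
qed

lemma FavS_Sq_measurable: "(\<lambda>\<omega>. FavS n (Sq L \<omega> n)) \<in> borel_measurable \<Omega>"
proof -
  have sb: "sets (\<Omega> \<Otimes>\<^sub>M (lborel :: real measure)) = sets (\<Omega> \<Otimes>\<^sub>M borel)" by (rule sets_pair_measure_cong) auto
  have "(\<lambda>z. pm (snd z) n (Sq L (fst z) n)) \<in> borel_measurable (\<Omega> \<Otimes>\<^sub>M (lborel :: real measure))"
    using pm_measurable_pair[OF Sq_event, where n=n] unfolding case_prod_beta measurable_cong_sets[OF sb refl] .
  moreover have "(\<lambda>z. indicator {0..pi} (snd z) :: real) \<in> borel_measurable (\<Omega> \<Otimes>\<^sub>M (lborel :: real measure))"
    by measurable
  ultimately have "(\<lambda>z. indicator {0..pi} (snd z) * pm (snd z) n (Sq L (fst z) n)) \<in> borel_measurable (\<Omega> \<Otimes>\<^sub>M (lborel :: real measure))"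
    by (rule borel_measurable_times[rotated])
  then have "(\<lambda>(\<omega>, \<theta>). indicator {0..pi} \<theta> * pm \<theta> n (Sq L \<omega> n)) \<in> borel_measurable (\<Omega> \<Otimes>\<^sub>M lborel)"
    unfolding case_prod_beta .
  then have "(\<lambda>\<omega>. \<integral>\<theta>. indicator {0..pi} \<theta> * pm \<theta> n (Sq L \<omega> n) \<partial>lborel) \<in> borel_measurable \<Omega>"
    by (rule lborel.borel_measurable_lebesgue_integral)
  then show ?thesis unfolding FavS_def by (subst integral_eq_lborel) (auto simp: pm_nonneg)
qed

lemma expected_proj: "(\<integral>\<omega>. measure lebesgue (proj \<theta> ` Sset L \<omega> n) \<partial>\<Omega>) = AP \<theta> n"
  unfolding measure_proj AP_def
  by (rule integral_cong_AE[OF pm_Sq_measurable fS_measurable]) (use AE_S in eventually_elim, simp)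

lemma expected_Fav: "(\<integral>\<omega>. Fav (Sset L \<omega> n) \<partial>\<Omega>) = FA n"
  unfolding Fav_Sset FA_def
  by (rule integral_cong_AE[OF FavS_Sq_measurable fS_measurable]) (use AE_S in eventually_elim, simp)

end

section \<open>Almost sure convergence\<close>

lemma measure_affine_vimage:
  fixes c d :: real
  assumes c: "0 < c"
  shows "measure lborel {t. c * t - d \<in> M} = measure lborel M / c"
proof -
  have "measure lborel M = (\<integral>t. indicator M t \<partial>lborel)" by simp
  also have "\<dots> = \<bar>c\<bar> *\<^sub>R (\<integral>t. indicator M (- d + c * t) \<partial>lborel)"
    by (rule lborel_integral_real_affine) (use c in simp)
  also have "(\<lambda>t. indicator M (- d + c * t)) = (indicator {t. c * t - d \<in> M} :: real \<Rightarrow> real)"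
    by (auto simp: indicator_def fun_eq_iff algebra_simps)
  finally show ?thesis using c by simp
qed

lemma telescope_drop:
  fixes f :: "nat \<Rightarrow> real"
  assumes drop: "\<And>n. N \<le> n \<Longrightarrow> 0 < n \<Longrightarrow> f n - f (Suc n) \<le> C / (real n)\<^sup>2" and C: "0 \<le> C" and a: "N \<le> a" "0 < a"
  shows "f a - f (a + m) \<le> real m * (C / (real a)\<^sup>2)"
proof (induction m)
  case (Suc m)
  have "f (a + m) - f (Suc (a + m)) \<le> C / (real (a + m))\<^sup>2" using drop[of "a + m"] a by simp
  also have "\<dots> \<le> C / (real a)\<^sup>2" using a C by (intro divide_left_mono power_mono mult_pos_pos) auto
  finally show ?case using Suc by (simp add: distrib_right add_divide_distrib)
qed simp

context uniform_grid
begin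

lemma pm_glue:
  assumes A: "finite A"
  shows "pm \<theta> (k + n) (\<Union>Q\<in>A. glue L n Q ` B Q) \<le> (\<Sum>Q\<in>A. pm \<theta> n (B Q)) / real L ^ k"
proof -
  have "PR \<theta> (k + n) (\<Union>Q\<in>A. glue L n Q ` B Q) = (\<Union>Q\<in>A. {t. real L ^ k * t - sh \<theta> Q \<in> PR \<theta> n (B Q)})"
    using PR_glue by blast
  then have "pm \<theta> (k + n) (\<Union>Q\<in>A. glue L n Q ` B Q) = measure lborel (\<Union>Q\<in>A. {t. real L ^ k * t - sh \<theta> Q \<in> PR \<theta> n (B Q)})"
    by (simp add: pm_def)
  also have "\<dots> \<le> (\<Sum>Q\<in>A. measure lborel {t. real L ^ k * t - sh \<theta> Q \<in> PR \<theta> n (B Q)})"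
  proof (rule measure_UNION_le[OF A])
    fix Q
    have "(\<lambda>t. real L ^ k * t - sh \<theta> Q) -` PR \<theta> n (B Q) \<inter> space borel \<in> sets borel"
      by (rule measurable_sets[OF _ PR_borel]) measurable
    then show "{t. real L ^ k * t - sh \<theta> Q \<in> PR \<theta> n (B Q)} \<in> sets lborel" by (simp add: vimage_def)
  qed
  also have "\<dots> = (\<Sum>Q\<in>A. pm \<theta> n (B Q) / real L ^ k)"
    by (simp add: measure_affine_vimage pm_def)
  finally show ?thesis by (simp add: sum_divide_distrib)
qed

lemma FavS_split: "FavS (k + n) (S (k + n) \<omega>) \<le> (\<Sum>Q\<in>S k \<omega>. FavS n (S n (\<omega> \<circ> shift_index L k Q))) / real L ^ k"
proof -
  have int: "(\<lambda>\<theta>. \<Sum>Q\<in>S k \<omega>. pm \<theta> n (S n (\<omega> \<circ> shift_index L k Q))) integrable_on {0..pi}"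
    by (intro Henstock_Kurzweil_Integration.integrable_sum pm_integrable S_cells finite_S)
  have "FavS (k + n) (S (k + n) \<omega>) \<le> integral {0..pi} (\<lambda>\<theta>. (\<Sum>Q\<in>S k \<omega>. pm \<theta> n (S n (\<omega> \<circ> shift_index L k Q))) / real L ^ k)"
    unfolding FavS_def
  proof (rule integral_le)
    show "(\<lambda>\<theta>. pm \<theta> (k + n) (S (k + n) \<omega>)) integrable_on {0..pi}" by (rule pm_integrable[OF S_cells])
    show "(\<lambda>\<theta>. (\<Sum>Q\<in>S k \<omega>. pm \<theta> n (S n (\<omega> \<circ> shift_index L k Q))) / real L ^ k) integrable_on {0..pi}"
      by (rule integrable_on_divide[OF int])
    show "pm \<theta> (k + n) (S (k + n) \<omega>) \<le> (\<Sum>Q\<in>S k \<omega>. pm \<theta> n (S n (\<omega> \<circ> shift_index L k Q))) / real L ^ k" for \<theta>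
      unfolding S_split by (rule pm_glue) simp
  qed
  also have "\<dots> = (\<Sum>Q\<in>S k \<omega>. FavS n (S n (\<omega> \<circ> shift_index L k Q))) / real L ^ k"
    unfolding FavS_def Henstock_Kurzweil_Integration.integral_divide
    by (subst Henstock_Kurzweil_Integration.integral_sum) (auto intro!: pm_integrable[OF S_cells])
  finally show ?thesis .
qed

lemma FavS_S_Suc_le: "FavS (Suc n) (S (Suc n) \<omega>) \<le> FavS n (S n \<omega>)"
proof -
  have "pm \<theta> (n + 1) (S (n + 1) \<omega>) \<le> pm \<theta> n (S n \<omega>)" for \<theta>
    unfolding pm_def
  proof (rule measure_mono_fmeasurable)
    show "PR \<theta> (n + 1) (S (n + 1) \<omega>) \<subseteq> PR \<theta> n (S n \<omega>)"
    proof
      fix t assume "t \<in> PR \<theta> (n + 1) (S (n + 1) \<omega>)"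
      then obtain Q where Q: "Q \<in> S n \<omega>" "real L ^ n * t - sh \<theta> Q \<in> PR \<theta> 1 (S 1 (\<omega> \<circ> shift_index L n Q))"
        unfolding S_split PR_glue by blast
      then obtain P where P: "P \<in> S 1 (\<omega> \<circ> shift_index L n Q)"
        "real L ^ 1 * (real L ^ n * t - sh \<theta> Q) - sh \<theta> P \<in> shadow (cos \<theta>) (sin \<theta>)" unfolding PR_def by blast
      have "real L ^ n * t - sh \<theta> Q \<in> shadow (cos \<theta>) (sin \<theta>)"
        by (rule shadow_zoom_out[OF L_pos(1), where Q=P]) (use P S_cells[of 1] in auto)
      then show "t \<in> PR \<theta> n (S n \<omega>)" using Q(1) unfolding PR_def by blast
    qed
  qed (use PR_fmeasurable[OF S_cells] in auto)
  then show ?thesis unfolding FavS_def by (intro integral_le pm_integrable S_cells) auto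
qed

text \<open>\<open>U\<close>, the total Favard length of the copies, dominates that of their union.
  The overlap is thus nonnegative, and its norm in the mean is simply the difference of the
  expectations \<open>FA n\<close> and \<open>FA (k + n)\<close>. The remaining term
  \<open>f\<close> is a centred sum over generation \<open>k\<close>.\<close>

lemma Fav_concentration:
  "(\<integral>\<omega>. \<bar>FavS (k + n) (S (k + n) \<omega>) - Zt k \<omega> * FA n\<bar> \<partial>\<Omega>) \<le> FA n - FA (k + n) + ((4 * pi)\<^sup>2 + 1) * (1 / sqrt (real L)) ^ k"
proof -
  define g where "g A = FavS n A - FA n" for A
  define U where "U \<omega> = (\<Sum>Q\<in>S k \<omega>. FavS n (S n (\<omega> \<circ> shift_index L k Q))) / real L ^ k" for \<omega>
  define f where "f \<omega> = (\<Sum>Q\<in>S k \<omega>. g (S n (\<omega> \<circ> shift_index L k Q))) / real L ^ k" for \<omega>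
  have g0: "(\<integral>\<omega>. g (S n \<omega>) \<partial>\<Omega>) = 0"
    unfolding g_def using integrable_fS[of "FavS n" n] by (simp add: FA_def)
  have Uf: "U \<omega> - Zt k \<omega> * FA n = f \<omega>" for \<omega>
    by (simp add: U_def f_def g_def Zt_def sum_subtractf diff_divide_distrib)
  have "\<bar>g (S n \<omega>)\<bar> \<le> 4 * pi" for \<omega>
    using FavS_nonneg[of n "S n \<omega>"] FavS_le[OF S_cells, of n \<omega>] FA_bounds[of n] unfolding g_def by linarith
  then have "\<bar>g (S n \<omega>)\<bar>\<^sup>2 \<le> (4 * pi)\<^sup>2" for \<omega> by (intro power_mono) auto
  then have "(\<integral>\<omega>. (g (S n \<omega>))\<^sup>2 \<partial>\<Omega>) \<le> (\<integral>\<omega>. (4 * pi)\<^sup>2 \<partial>\<Omega>)"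
    using integrable_fS[of "\<lambda>A. (g A)\<^sup>2" n] by (intro integral_mono) auto
  then have g2: "(\<integral>\<omega>. (g (S n \<omega>))\<^sup>2 \<partial>\<Omega>) \<le> (4 * pi)\<^sup>2" by simp
  have fi: "integrable \<Omega> f" "integrable \<Omega> (\<lambda>\<omega>. (f \<omega>)\<^sup>2)"
    unfolding f_def power_divide using first_moment(2)[where g=g and k=k and n=n] second_moment(2)[OF g0, where k=k] by auto
  have "(\<integral>\<omega>. (f \<omega>)\<^sup>2 \<partial>\<Omega>) = real L ^ k * (\<integral>\<omega>. (g (S n \<omega>))\<^sup>2 \<partial>\<Omega>) / (real L ^ k)\<^sup>2"
    unfolding f_def power_divide using second_moment(1)[OF g0, where k=k] by (simp add: expected_card)
  also have "\<dots> \<le> real L ^ k * (4 * pi)\<^sup>2 / (real L ^ k)\<^sup>2"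
    using g2 by (intro divide_right_mono mult_left_mono) auto
  also have "\<dots> = (4 * pi)\<^sup>2 / real L ^ k" by (simp add: power2_eq_square)
  finally have f1: "(\<integral>\<omega>. \<bar>f \<omega>\<bar> \<partial>\<Omega>) \<le> ((4 * pi)\<^sup>2 + 1) * (1 / sqrt (real L)) ^ k"
    by (rule abs_le_second_moment[OF fi])
  have Ui: "integrable \<Omega> U" unfolding U_def using first_moment(2)[where g="FavS n" and k=k and n=n] by auto
  have UE: "(\<integral>\<omega>. U \<omega> \<partial>\<Omega>) = FA n"
    unfolding U_def using first_moment(1)[where g="FavS n" and k=k and n=n] by (simp add: expected_card FA_def)
  have Fi: "integrable \<Omega> (\<lambda>\<omega>. FavS (k + n) (S (k + n) \<omega>))" by (rule integrable_fS)
  have Zi: "integrable \<Omega> (\<lambda>\<omega>. Zt k \<omega> * FA n)" unfolding Zt_def using integrable_fS[of "\<lambda>A. real (card A)" k] by auto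
  have "(\<integral>\<omega>. \<bar>FavS (k + n) (S (k + n) \<omega>) - Zt k \<omega> * FA n\<bar> \<partial>\<Omega>) \<le> (\<integral>\<omega>. (U \<omega> - FavS (k + n) (S (k + n) \<omega>)) + \<bar>f \<omega>\<bar> \<partial>\<Omega>)"
  proof (rule integral_mono)
    show "\<bar>FavS (k + n) (S (k + n) \<omega>) - Zt k \<omega> * FA n\<bar> \<le> (U \<omega> - FavS (k + n) (S (k + n) \<omega>)) + \<bar>f \<omega>\<bar>" for \<omega>
      using FavS_split[of k n \<omega>] Uf[of \<omega>] unfolding U_def[symmetric] by linarith
  qed (use Fi Zi Ui fi in auto)
  also have "\<dots> = FA n - FA (k + n) + (\<integral>\<omega>. \<bar>f \<omega>\<bar> \<partial>\<Omega>)"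
    using Fi Ui fi by (simp add: UE) (simp add: FA_def)
  finally show ?thesis using f1 by linarith
qed

text \<open>Multiplied by \<open>m ^ 4\<close>, the overlap over \<open>m\<close> generations is of
  order \<open>m ^ 4 * m / (m ^ 4)\<^sup>2 = 1 / m ^ 3\<close>, while the concentration error decays
  exponentially, so the errors are summable in mean. The shift from \<open>m ^ 4\<close> to
  \<open>a m = m ^ 4 - m\<close> does not affect the limit of the means.\<close>

lemma Fav_AE_limit:
  assumes C: "0 < C" and drop: "\<And>n. N \<le> n \<Longrightarrow> 0 < n \<Longrightarrow> FA n - FA (Suc n) \<le> C / (real n)\<^sup>2"
    and c: "(\<lambda>n. real n * FA n) \<longlonglongrightarrow> c"
  shows "AE \<omega> in \<Omega>. \<exists>z. (\<lambda>k. Zt k \<omega>) \<longlonglongrightarrow> z \<and> (\<lambda>n. real n * FavS n (S n \<omega>)) \<longlonglongrightarrow> z * c"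
proof -
  define a where "a m = m ^ 4 - m" for m :: nat
  define D where "D m \<omega> = real m ^ 4 * (FavS (m ^ 4) (S (m ^ 4) \<omega>) - Zt m \<omega> * FA (a m))" for m \<omega>
  define q where "q = 1 / sqrt (real L)"
  have q: "0 < q" "q < 1" using root_lt_1 by (auto simp: q_def)
  have ma: "m + a m = m ^ 4" for m using self_le_power[of m 4] by (cases "m = 0") (simp_all add: a_def)
  have a_half: "real m ^ 4 / 2 \<le> real (a m)" "m \<le> a m" if "2 \<le> m" for m
  proof -
    have "2 * m \<le> m ^ 3 * m" using that self_le_power[of m 3] by (intro mult_right_mono) auto
    also have "\<dots> = m + a m" by (simp add: ma power_Suc2[symmetric] numeral_eq_Suc)
    finally show 1: "m \<le> a m" by simp
    have "real m ^ 4 = real (m + a m)" by (simp add: ma)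
    then show "real m ^ 4 / 2 \<le> real (a m)" using 1 by simp
  qed
  have Di: "integrable \<Omega> (D m)" for m
    unfolding D_def Zt_def using integrable_fS[of "FavS (m ^ 4)" "m ^ 4"] integrable_fS[of "\<lambda>A. real (card A)" m] by auto
  have qm: "\<forall>\<^sub>F m in sequentially. real m ^ 4 * q ^ m \<le> 1 / real m ^ 2"
    using q by real_asymp
  define K where "K = 4 * C + ((4 * pi)\<^sup>2 + 1)"
  have bound: "\<forall>\<^sub>F m in sequentially. norm (\<integral>\<omega>. \<bar>D m \<omega>\<bar> \<partial>\<Omega>) \<le> K * (1 / real m ^ 2)"
    using qm eventually_ge_at_top[of "max 2 N"]
  proof eventually_elim
    case (elim m)
    then have m: "2 \<le> m" "N \<le> a m" "0 < a m" "0 < real m" using a_half(2)[of m] by auto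
    have "FA (a m) - FA (a m + m) \<le> real m * (C / (real (a m))\<^sup>2)"
      by (rule telescope_drop[OF drop]) (use C m in auto)
    also have "\<dots> \<le> real m * (C / (real m ^ 4 / 2)\<^sup>2)"
      using a_half(1)[OF m(1)] m C by (intro mult_left_mono divide_left_mono power_mono mult_pos_pos) auto
    also have "\<dots> = 4 * C / real m ^ 7" using m(4) by (simp add: power2_eq_square field_simps flip: power_Suc power_add)
    finally have t: "FA (a m) - FA (m ^ 4) \<le> 4 * C / real m ^ 7" by (simp add: ma add.commute[of "a m"])
    have "norm (\<integral>\<omega>. \<bar>D m \<omega>\<bar> \<partial>\<Omega>) = real m ^ 4 * (\<integral>\<omega>. \<bar>FavS (m ^ 4) (S (m ^ 4) \<omega>) - Zt m \<omega> * FA (a m)\<bar> \<partial>\<Omega>)"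
      by (simp add: D_def abs_mult)
    also have "\<dots> \<le> real m ^ 4 * (FA (a m) - FA (m ^ 4) + ((4 * pi)\<^sup>2 + 1) * q ^ m)"
      using Fav_concentration[of m "a m"] unfolding ma q_def by (intro mult_left_mono) auto
    also have "\<dots> \<le> real m ^ 4 * (4 * C / real m ^ 7 + ((4 * pi)\<^sup>2 + 1) * q ^ m)"
      using t by (intro mult_left_mono) auto
    also have "\<dots> = 4 * C / real m ^ 3 + ((4 * pi)\<^sup>2 + 1) * (real m ^ 4 * q ^ m)"
      using m(4) by (simp add: field_simps flip: power_add)
    also have "\<dots> \<le> 4 * C / real m ^ 2 + ((4 * pi)\<^sup>2 + 1) * (1 / real m ^ 2)"
      using elim(1) m C by (intro add_mono mult_left_mono divide_left_mono power_increasing mult_pos_pos) auto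
    also have "\<dots> = K * (1 / real m ^ 2)" by (simp add: K_def add_divide_distrib)
    finally show ?case .
  qed
  have "summable (\<lambda>m. K * (1 / real m ^ 2))"
    using inverse_power_summable[of 2, where 'a=real] by (intro summable_mult) (simp add: inverse_eq_divide)
  then have "summable (\<lambda>m. \<integral>\<omega>. \<bar>D m \<omega>\<bar> \<partial>\<Omega>)" by (rule summable_comparison_test_ev[OF bound])
  then have AE_D: "AE \<omega> in \<Omega>. summable (\<lambda>m. \<bar>D m \<omega>\<bar>)" by (rule AE_summable_of_summable_integrals[OF Di])
  have cm: "(\<lambda>m. real m ^ 4 * FA (a m)) \<longlonglongrightarrow> c"
  proof -
    have at: "filterlim a at_top sequentially"
      by (rule filterlim_at_top_mono[OF filterlim_ident]) (rule eventually_mono[OF eventually_ge_at_top a_half(2)])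
    have "(\<lambda>m::nat. real m ^ 4 / (real m ^ 4 - real m)) \<longlonglongrightarrow> 1" by real_asymp
    from tendsto_mult[OF this filterlim_compose[OF c at]]
    have "(\<lambda>m. real m ^ 4 / (real m ^ 4 - real m) * (real (a m) * FA (a m))) \<longlonglongrightarrow> c" by simp
    moreover have "\<forall>\<^sub>F m in sequentially. real m ^ 4 / (real m ^ 4 - real m) * (real (a m) * FA (a m)) = real m ^ 4 * FA (a m)"
      using eventually_ge_at_top[of 2]
    proof eventually_elim
      case (elim m)
      have "real m ^ 4 - real m = real (a m)" using arg_cong[OF ma[of m], of real] by simp
      moreover have "0 < a m" using a_half(2)[OF elim] elim by simp
      ultimately show ?case by simp
    qed
    ultimately show ?thesis by (rule Lim_transform_eventually)
  qed
  from Zt_converges AE_D show ?thesis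
  proof eventually_elim
    case (elim \<omega>)
    then obtain z where z: "(\<lambda>k. Zt k \<omega>) \<longlonglongrightarrow> z" by (auto simp: convergent_def)
    have "(\<lambda>m. D m \<omega>) \<longlonglongrightarrow> 0" using summable_LIMSEQ_zero[OF elim(2)] by (simp add: tendsto_rabs_zero_iff)
    from tendsto_add[OF this tendsto_mult[OF z cm]]
    have "(\<lambda>m. D m \<omega> + Zt m \<omega> * (real m ^ 4 * FA (a m))) \<longlonglongrightarrow> z * c" by simp
    moreover have "D m \<omega> + Zt m \<omega> * (real m ^ 4 * FA (a m)) = real m ^ 4 * FavS (m ^ 4) (S (m ^ 4) \<omega>)" for m
      by (simp add: D_def algebra_simps)
    ultimately have "(\<lambda>m. real m ^ 4 * FavS (m ^ 4) (S (m ^ 4) \<omega>)) \<longlonglongrightarrow> z * c" by simp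
    then have "(\<lambda>n. real n * FavS n (S n \<omega>)) \<longlonglongrightarrow> z * c"
      by (rule tendsto_along_fourth_powers[rotated 2]) (rule FavS_nonneg FavS_S_Suc_le)+
    with z show ?case by blast
  qed
qed

end

theorem theorem5p1:
  fixes L :: nat and X :: "(nat \<times> nat) set pmf"
  assumes "L \<ge> 2"
    and "grid_model L X"
    and "uniform_grid_model L X"
    and "non_degenerate L X"
  shows "uniform_limit {0..pi}
           (\<lambda>n \<theta>. real n * (\<integral>\<omega>. measure lebesgue (proj \<theta> ` Sset L \<omega> n) \<partial>sample_space X))
           (\<lambda>\<theta>. 2 / Vfun L X \<theta>) sequentially \<and>
         (\<lambda>n. real n * (\<integral>\<omega>. Fav (Sset L \<omega> n) \<partial>sample_space X))
           \<longlonglongrightarrow> integral {0..pi} (\<lambda>\<theta>. 2 / Vfun L X \<theta>) \<and>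
         (AE \<omega> in sample_space X. \<exists>z. (\<lambda>n. Zn L \<omega> n) \<longlonglongrightarrow> z \<and>
           (\<lambda>n. real n * Fav (Sset L \<omega> n)) \<longlonglongrightarrow> z * integral {0..pi} (\<lambda>\<theta>. 2 / Vfun L X \<theta>))"
proof -
  interpret nondegenerate_grid L X by unfold_locales (use assms in auto)
  obtain V0 where "crit_shadow L X ch sh V0 (\<lambda>\<theta>. shadow (cos \<theta>) (sin \<theta>))" using crit_shadow_ex by blast
  then interpret cs: crit_shadow L X ch sh V0 "\<lambda>\<theta>. shadow (cos \<theta>) (sin \<theta>)" .
  have AA: "cs.AA \<theta> n = AP \<theta> n" for \<theta> n unfolding cs.AA_def AP_eq ..
  let ?c = "integral {0..pi} (\<lambda>\<theta>. 2 / Vfun L X \<theta>)"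
  have u: "uniform_limit {0..pi} (\<lambda>n \<theta>. real n * AP \<theta> n) (\<lambda>\<theta>. 2 / Vfun L X \<theta>) sequentially"
  proof (rule uniform_limitI)
    fix e :: real assume e: "0 < e"
    then have "\<forall>\<^sub>F n in sequentially. \<forall>\<theta>. \<bar>real n * cs.AA \<theta> n - 2 / Vc \<theta>\<bar> \<le> e / 2" by (intro cs.AA_limit) simp
    then show "\<forall>\<^sub>F n in sequentially. \<forall>\<theta>\<in>{0..pi}. dist (real n * AP \<theta> n) (2 / Vfun L X \<theta>) < e"
    proof eventually_elim
      case (elim n)
      show ?case
      proof
        fix \<theta>
        have "\<bar>real n * AP \<theta> n - 2 / Vfun L X \<theta>\<bar> \<le> e / 2" using elim unfolding AA Vfun_eq by blast
        then show "dist (real n * AP \<theta> n) (2 / Vfun L X \<theta>) < e" using e by (simp add: dist_real_def)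
      qed
    qed
  qed
  have "(\<lambda>n. integral {0..pi} (\<lambda>\<theta>. real n * AP \<theta> n)) \<longlonglongrightarrow> ?c"
    by (rule tendsto_integral_uniform_limit[OF integrable_on_mult_right[OF AP_integrable] u]) simp
  then have c: "(\<lambda>n. real n * FA n) \<longlonglongrightarrow> ?c" by (simp add: FA_eq)
  obtain C N where C: "0 < C" and drop: "\<And>\<theta> n. N \<le> n \<Longrightarrow> 0 < n \<Longrightarrow> cs.AA \<theta> n - cs.AA \<theta> (Suc n) \<le> C / (real n)\<^sup>2"
    by (rule cs.AA_drop) blast
  have FA_drop: "FA n - FA (Suc n) \<le> (C * pi) / (real n)\<^sup>2" if "N \<le> n" "0 < n" for n
  proof -
    have "FA n - FA (Suc n) = integral {0..pi} (\<lambda>\<theta>. AP \<theta> n - AP \<theta> (Suc n))"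
      unfolding FA_eq by (rule Henstock_Kurzweil_Integration.integral_diff[OF AP_integrable AP_integrable, symmetric])
    also have "\<dots> \<le> integral {0..pi} (\<lambda>\<theta>. C / (real n)\<^sup>2)"
      using drop[OF that] unfolding AA by (intro integral_le Henstock_Kurzweil_Integration.integrable_diff AP_integrable) auto
    finally show ?thesis by (simp add: mult.commute)
  qed
  have "AE \<omega> in \<Omega>. \<exists>z. (\<lambda>k. Zt k \<omega>) \<longlonglongrightarrow> z \<and> (\<lambda>n. real n * FavS n (S n \<omega>)) \<longlonglongrightarrow> z * ?c"
    by (rule Fav_AE_limit[OF _ FA_drop c]) (use C in auto)
  with AE_S have "AE \<omega> in \<Omega>. \<exists>z. (\<lambda>n. Zn L \<omega> n) \<longlonglongrightarrow> z \<and> (\<lambda>n. real n * Fav (Sset L \<omega> n)) \<longlonglongrightarrow> z * ?c"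
    by eventually_elim (simp add: Zn_def Zt_def Fav_Sset)
  with u c show ?thesis unfolding expected_proj expected_Fav by blast
qed

end
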